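(* Let $x_0\in\mathbb{R}^n$ and let $\Omega\in L_s(S^{n-1})$, $1<s\le\infty$, be $A_t$-homogeneous of degree zero. Let $0<\alpha<\gamma$ and let $T_{\Omega,\alpha}^P$ be a parabolic linear operator satisfying, for every $f\in L_1(\mathbb{R}^n)$ with compact support and every $x\notin\operatorname{supp}f$, the size condition $$|T_{\Omega,\alpha}^P f(x)|\le c_0\int_{\mathbb{R}^n}\frac{|\Omega(x-y)|}{\rho(x-y)^{\gamma-\alpha}}\,|f(y)|\,dy,$$ with $c_0$ independent of $f$ and $x$. Let $1<q,q_1,p_1,\dots,p_m,p<\frac\gamma\alpha$ with $\frac1q=\sum_{i=1}^m\frac1{p_i}+\frac1p$ and $\frac1{q_1}=\frac1q-\frac\alpha\gamma$, and let $\overrightarrow{b}=(b_1,\dots,b_m)$ with $b_i\in LC^{\{x_0\}}_{p_i,\lambda_i,P}(\mathbb{R}^n)$, $0\le\lambda_i<\frac1\gamma$, $i=1,\dots,m$. Let $\varphi_1,\varphi_2$ be positive measurable functions on $\mathbb{R}^n\times(0,\infty)$, and suppose that either (i) $s'\le q$ and, for all $r>0$, $$\int_r^\infty\Big(1+\ln\frac tr\Big)^m\frac{\operatorname*{ess\,inf}_{t<\tau<\infty}\varphi_1(x_0,\tau)\tau^{\gamma/p}}{t^{\gamma\left(\frac1{q_1}-\left(\sum_{i=1}^m\lambda_i+\sum_{i=1}^m\frac1{p_i}\right)\right)+1}}\,dt\le C\,\varphi_2(x_0,r),$$ or (ii) $q_1<s$ and, for all $r>0$, $$\int_r^\infty\Big(1+\ln\frac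 tr\Big)^m\frac{\operatorname*{ess\,inf}_{t<\tau<\infty}\varphi_1(x_0,\tau)\tau^{\gamma/p}}{t^{\gamma\left(\frac1{q_1}-\left(\frac1s+\sum_{i=1}^m\lambda_i+\sum_{i=1}^m\frac1{p_i}\right)\right)+1}}\,dt\le C\,\varphi_2(x_0,r)\,r^{\gamma/s},$$ where $C$ does not depend on $r$. Then the operators $[\overrightarrow b,T_{\Omega,\alpha}^P]$ and $M^P_{\Omega,\overrightarrow b,\alpha}$ are bounded from $LM^{\{x_0\}}_{p,\varphi_1,P}$ to $LM^{\{x_0\}}_{q_1,\varphi_2,P}$. Moreover, $$\big\|[\overrightarrow b,T_{\Omega,\alpha}^P]f\big\|_{LM^{\{x_0\}}_{q_1,\varphi_2,P}}\lesssim\prod_{i=1}^m\|b_i\|_{LC^{\{x_0\}}_{p_i,\lambda_i,P}}\,\|f\|_{LM^{\{x_0\}}_{p,\varphi_1,P}},$$ $$\big\|M^P_{\Omega,\overrightarrow b,\alpha}f\big\|_{LM^{\{x_0\}}_{q_1,\varphi_2,P}}\lesssim\prod_{i=1}^m\|b_i\|_{LC^{\{x_0\}}_{p_i,\lambda_i,P}}\,\|f\|_{LM^{\{x_0\}}_{p,\varphi_1,P}}.$$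
   Context: Setting. $n\ge2$; $P$ is a real $n\times n$ matrix all of whose eigenvalues have positive real part; $A_t=t^P$ for $t>0$; $\gamma=\operatorname{tr}P$. $\rho$ is a quasi-distance associated with $P$: $\rho(A_tx)=t\rho(x)$ for $t>0$; $\rho(0)=0$; $\rho(x-y)=\rho(y-x)\ge0$; $\rho(x-y)\le k(\rho(x-z)+\rho(y-z))$ for a constant $k$; and $dx=\rho^{\gamma-1}d\sigma(w)\,d\rho$ with $\rho=\rho(x)$, $w=A_{\rho^{-1}}x$, $d\sigma$ a measure on the unit ellipsoid $\{w:\rho(w)=1\}$. (Model case: $P=\operatorname{diag}[\alpha_1,\dots,\alpha_n]$, $1\le\alpha_1\le\cdots\le\alpha_n$, and for $x\neq 0$, $\rho(x)$ is the unique $\rho>0$ with $\sum_i x_i^2\rho^{-2\alpha_i}=1$, so that the unit ellipsoid is $S^{n-1}$.) Ellipsoids: $E(x,r)=\{y:\rho(x-y)<r\}$, with Lebesgue measure $|E(x,r)|=\upsilon_\rho r^\gamma$, where $\upsilon_\rho$ is the volume of the unit ellipsoid. $S^{n-1}$ is the Euclidean unit sphere with normalized surface measure. $\Omega$ is a real-valued measurable function on $\mathbb{R}^n$; $\Omega\in L_s(S^{n-1})$ refers to its restriction to $S^{n-1}$; $A_t$-homogeneous of degree zero means $\Omega(A_tx)=\Omega(x)$ for all $t>0$, $x\in\mathbb{R}^n$. $s'=s/(s-1)$. Operators. The model operator is $T_{\Omega,\alpha}^Pf(x)=\int_{\mathbb{R}^n}\frac{\Omega(x-y)}{\rho(x-y)^{\gamma-\alpha}}f(y)\,dy$.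 For $\overrightarrow b=(b_1,\dots,b_m)$ locally integrable and $0<\alpha<\gamma$, $$[\overrightarrow b,T_{\Omega,\alpha}^P]f(x)=\int_{\mathbb{R}^n}\prod_{i=1}^m[b_i(x)-b_i(y)]\frac{\Omega(x-y)}{\rho(x-y)^{\gamma-\alpha}}f(y)\,dy,$$ $$M^P_{\Omega,\overrightarrow b,\alpha}f(x)=\sup_{t>0}|E(x,t)|^{-1+\frac\alpha\gamma}\int_{E(x,t)}\prod_{i=1}^m|b_i(x)-b_i(y)|\,|\Omega(x-y)|\,|f(y)|\,dy.$$ Spaces. For $1\le p<\infty$ and $\varphi$ positive measurable on $\mathbb{R}^n\times(0,\infty)$, $LM^{\{x_0\}}_{p,\varphi,P}$ (parabolic generalized local Morrey space) is the set of $f\in L_p^{loc}(\mathbb{R}^n)$ with $$\|f\|_{LM^{\{x_0\}}_{p,\varphi,P}}=\sup_{r>0}\varphi(x_0,r)^{-1}|E(x_0,r)|^{-1/p}\|f\|_{L_p(E(x_0,r))}<\infty.$$ For $1\le p<\infty$, $0\le\lambda<1/\gamma$, $LC^{\{x_0\}}_{p,\lambda,P}$ (parabolic local Campanato space) is the set of $b\in L_p^{loc}(\mathbb{R}^n)$ with $$\|b\|_{LC^{\{x_0\}}_{p,\lambda,P}}=\sup_{r>0}\Big(\frac1{|E(x_0,r)|^{1+\lambda p}}\int_{E(x_0,r)}|b(y)-b_{E(x_0,r)}|^p\,dy\Big)^{1/p}<\infty,$$ where $b_{E(x_0,r)}=|E(x_0,r)|^{-1}\int_{E(x_0,r)}b(y)\,dy$.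 $A\lesssim B$ means $A\le CB$ with a constant $C>0$ independent of appropriate quantities (here of $f$ and $\overrightarrow b$). *)

theory Defs
  imports "HOL-Analysis.Analysis"
begin

section \<open>Parabolic dilations and quasi-distances\<close>

definition eigenvalues_pos_Re :: "real^'n^'n \<Rightarrow> bool" where
  "eigenvalues_pos_Re P \<longleftrightarrow>
     (\<forall>(z::complex) (v::complex^'n). v \<noteq> 0 \<and> map_matrix complex_of_real P *v v = z *s v \<longrightarrow> 0 < Re z)"

text \<open>The product of the type class \<open>times\<close> on \<^typ>\<open>real^'n^'n\<close> is entrywise, so neither the power nor
  the exponential function of the library is the one for matrices.\<close>

definition matrix_power :: "real^'n^'n \<Rightarrow> nat \<Rightarrow> real^'n^'n" where
  "matrix_power P k = ((\<lambda>Q. P ** Q) ^^ k) (mat 1)"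

definition matrix_exp :: "real^'n^'n \<Rightarrow> real^'n^'n" where
  "matrix_exp P = (\<Sum>k. (1 / fact k) *\<^sub>R matrix_power P k)"

text \<open>\<open>dilation P t\<close> is \<open>A\<^sub>t = t\<^sup>P = exp (ln t P)\<close>, for \<open>t > 0\<close>.\<close>

definition dilation :: "real^'n^'n \<Rightarrow> real \<Rightarrow> real^'n \<Rightarrow> real^'n" where
  "dilation P t x = matrix_exp (ln t *\<^sub>R P) *v x"

text \<open>The formula \<open>dx = \<rho>\<^bsup>\<gamma>-1\<^esup> d\<sigma>(w) d\<rho>\<close>. It includes Borel measurability of \<open>\<rho>\<close>; \<open>\<sigma>\<close> has to be finite because
  \<open>\<sigma>\<close> has total mass \<open>\<gamma>\<close> times the volume of the unit ellipsoid.\<close>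

definition polar_decomposition :: "real^'n^'n \<Rightarrow> (real^'n \<Rightarrow> real) \<Rightarrow> (real^'n) measure \<Rightarrow> bool" where
  "polar_decomposition P \<rho> \<sigma> \<longleftrightarrow>
     \<rho> \<in> borel_measurable borel \<and>
     sets \<sigma> = sets (restrict_space borel {w. \<rho> w = 1}) \<and> finite_measure \<sigma> \<and>
     (\<forall>h :: real^'n \<Rightarrow> ennreal. h \<in> borel_measurable borel \<longrightarrow>
        (\<integral>\<^sup>+x. h x \<partial>lborel) =
        (\<integral>\<^sup>+r\<in>{0<..}. (\<integral>\<^sup>+w. h (dilation P r w) * ennreal (r powr (trace P - 1)) \<partial>\<sigma>) \<partial>lborel))"

definition parabolic_quasi_distance :: "real^'n^'n \<Rightarrow> (real^'n \<Rightarrow> real) \<Rightarrow> bool" where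
  "parabolic_quasi_distance P \<rho> \<longleftrightarrow>
     (\<forall>t>0. \<forall>x. \<rho> (dilation P t x) = t * \<rho> x) \<and>
     \<rho> 0 = 0 \<and>
     (\<forall>x y. \<rho> (x - y) = \<rho> (y - x) \<and> 0 \<le> \<rho> (x - y)) \<and>
     (\<exists>k. \<forall>x y z. \<rho> (x - y) \<le> k * (\<rho> (x - z) + \<rho> (y - z))) \<and>
     (\<exists>\<sigma>. polar_decomposition P \<rho> \<sigma>)"

definition ellipsoid :: "(real^'n \<Rightarrow> real) \<Rightarrow> real^'n \<Rightarrow> real \<Rightarrow> (real^'n) set" where
  "ellipsoid \<rho> x r = {y. \<rho> (x - y) < r}"

section \<open>Lebesgue spaces\<close>

text \<open>Powers of extended nonnegative numbers, only used with exponents \<open>a > 0\<close>.\<close>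

definition ennreal_powr :: "ennreal \<Rightarrow> real \<Rightarrow> ennreal" where
  "ennreal_powr x a = (if x = \<infinity> then \<infinity> else ennreal (enn2real x powr a))"

definition in_Lp :: "'a measure \<Rightarrow> ennreal \<Rightarrow> ('a \<Rightarrow> real) \<Rightarrow> bool" where
  "in_Lp M s f \<longleftrightarrow> f \<in> borel_measurable M \<and>
     (if s = \<infinity> then \<exists>B. AE x in M. \<bar>f x\<bar> \<le> B
      else (\<integral>\<^sup>+x. ennreal (\<bar>f x\<bar> powr enn2real s) \<partial>M) < \<infinity>)"

definition Lp_loc :: "real \<Rightarrow> ('a::euclidean_space \<Rightarrow> real) set" where
  "Lp_loc p = {f. f \<in> borel_measurable lebesgue \<and>
     (\<forall>K. compact K \<longrightarrow> (\<integral>\<^sup>+x\<in>K. ennreal (\<bar>f x\<bar> powr p) \<partial>lebesgue) < \<infinity>)}"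

definition Lp_norm_on :: "real \<Rightarrow> 'a::euclidean_space set \<Rightarrow> ('a \<Rightarrow> real) \<Rightarrow> ennreal" where
  "Lp_norm_on p A f = ennreal_powr (\<integral>\<^sup>+x\<in>A. ennreal (\<bar>f x\<bar> powr p) \<partial>lebesgue) (1 / p)"

definition conj_exponent :: "ennreal \<Rightarrow> real" where
  "conj_exponent s = (if s = \<infinity> then 1 else enn2real s / (enn2real s - 1))"

definition ess_inf :: "'a measure \<Rightarrow> ('a \<Rightarrow> ennreal) \<Rightarrow> ennreal" where
  "ess_inf M g = Sup {z. AE x in M. z \<le> g x}"

text \<open>The normalized surface measure: a Borel set \<open>A\<close> of unit vectors has mass \<open>|{x \<in> B. x / |x| \<in> A}| / |B|\<close>,
  where \<open>B\<close> is the unit ball.\<close>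

definition sphere_measure :: "'a::euclidean_space measure" where
  "sphere_measure = restrict_space (distr (uniform_measure lborel (ball 0 1)) borel sgn) (sphere 0 1)"

section \<open>Local Morrey and local Campanato spaces\<close>

definition LM_norm ::
  "(real^'n \<Rightarrow> real) \<Rightarrow> real^'n \<Rightarrow> real \<Rightarrow> (real^'n \<Rightarrow> real \<Rightarrow> real) \<Rightarrow> (real^'n \<Rightarrow> real) \<Rightarrow> ennreal" where
  "LM_norm \<rho> x0 p \<phi> f =
     (SUP r\<in>{0<..}. ennreal (inverse (\<phi> x0 r) * measure lebesgue (ellipsoid \<rho> x0 r) powr (- 1 / p))
        * Lp_norm_on p (ellipsoid \<rho> x0 r) f)"

definition LM ::
  "(real^'n \<Rightarrow> real) \<Rightarrow> real^'n \<Rightarrow> real \<Rightarrow> (real^'n \<Rightarrow> real \<Rightarrow> real) \<Rightarrow> (real^'n \<Rightarrow> real) set" where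
  "LM \<rho> x0 p \<phi> = {f \<in> Lp_loc p. LM_norm \<rho> x0 p \<phi> f < \<infinity>}"

definition average :: "'a::euclidean_space set \<Rightarrow> ('a \<Rightarrow> real) \<Rightarrow> real" where
  "average A b = (LINT y:A|lebesgue. b y) / measure lebesgue A"

definition LC_norm :: "(real^'n \<Rightarrow> real) \<Rightarrow> real^'n \<Rightarrow> real \<Rightarrow> real \<Rightarrow> (real^'n \<Rightarrow> real) \<Rightarrow> ennreal" where
  "LC_norm \<rho> x0 p l b =
     (SUP r\<in>{0<..}. ennreal_powr
        (ennreal (1 / measure lebesgue (ellipsoid \<rho> x0 r) powr (1 + l * p)) *
         (\<integral>\<^sup>+y\<in>ellipsoid \<rho> x0 r. ennreal (\<bar>b y - average (ellipsoid \<rho> x0 r) b\<bar> powr p) \<partial>lebesgue))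
        (1 / p))"

definition LC :: "(real^'n \<Rightarrow> real) \<Rightarrow> real^'n \<Rightarrow> real \<Rightarrow> real \<Rightarrow> (real^'n \<Rightarrow> real) set" where
  "LC \<rho> x0 p l = {b \<in> Lp_loc p. LC_norm \<rho> x0 p l b < \<infinity>}"

definition positive_weight :: "(real^'n \<Rightarrow> real \<Rightarrow> real) \<Rightarrow> bool" where
  "positive_weight \<phi> \<longleftrightarrow>
     (\<lambda>(x, r). \<phi> x r) \<in> borel_measurable (lebesgue_on (UNIV \<times> {0<..})) \<and> (\<forall>x. \<forall>r>0. 0 < \<phi> x r)"

section \<open>Operators\<close>

definition kernel :: "real^'n^'n \<Rightarrow> (real^'n \<Rightarrow> real) \<Rightarrow> (real^'n \<Rightarrow> real) \<Rightarrow> real \<Rightarrow> real^'n \<Rightarrow> real" where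
  "kernel P \<rho> \<Omega> \<alpha> z = \<Omega> z / \<rho> z powr (trace P - \<alpha>)"

definition integrable_compact_support :: "(real^'n \<Rightarrow> real) set" where
  "integrable_compact_support = {f. integrable lebesgue f \<and> compact (closure {x. f x \<noteq> 0})}"

text \<open>Linearity is understood in the space of functions modulo equality almost everywhere, since the model operator
  \<open>f \<mapsto> \<integral> \<Omega>(x - y) \<rho>(x - y)\<^bsup>\<alpha>-\<gamma>\<^esup> f(y) dy\<close> is only defined almost everywhere.\<close>

definition linear_operator :: "((real^'n \<Rightarrow> real) \<Rightarrow> real^'n \<Rightarrow> real) \<Rightarrow> bool" where
  "linear_operator T \<longleftrightarrow>
     (\<forall>f\<in>integrable_compact_support. \<forall>g\<in>integrable_compact_support. \<forall>c d.
        AE x in lebesgue. T (\<lambda>y. c * f y + d * g y) x = c * T f x + d * T g x)"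

definition size_condition ::
  "real^'n^'n \<Rightarrow> (real^'n \<Rightarrow> real) \<Rightarrow> (real^'n \<Rightarrow> real) \<Rightarrow> real \<Rightarrow> ((real^'n \<Rightarrow> real) \<Rightarrow> real^'n \<Rightarrow> real) \<Rightarrow> bool" where
  "size_condition P \<rho> \<Omega> \<alpha> T \<longleftrightarrow>
     (\<exists>c0::real. \<forall>f\<in>integrable_compact_support. \<forall>x. x \<notin> closure {x. f x \<noteq> 0} \<longrightarrow>
        ennreal \<bar>T f x\<bar> \<le>
          ennreal c0 * (\<integral>\<^sup>+y. ennreal (\<bar>kernel P \<rho> \<Omega> \<alpha> (x - y)\<bar> * \<bar>f y\<bar>) \<partial>lebesgue))"

definition commutator_integrand ::
  "real^'n^'n \<Rightarrow> (real^'n \<Rightarrow> real) \<Rightarrow> (real^'n \<Rightarrow> real) \<Rightarrow> real \<Rightarrow> nat \<Rightarrow> (nat \<Rightarrow> real^'n \<Rightarrow> real)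
    \<Rightarrow> (real^'n \<Rightarrow> real) \<Rightarrow> real^'n \<Rightarrow> real^'n \<Rightarrow> real" where
  "commutator_integrand P \<rho> \<Omega> \<alpha> m b f x y =
     (\<Prod>i\<in>{1..m}. b i x - b i y) * kernel P \<rho> \<Omega> \<alpha> (x - y) * f y"

definition commutator ::
  "real^'n^'n \<Rightarrow> (real^'n \<Rightarrow> real) \<Rightarrow> (real^'n \<Rightarrow> real) \<Rightarrow> real \<Rightarrow> nat \<Rightarrow> (nat \<Rightarrow> real^'n \<Rightarrow> real)
    \<Rightarrow> (real^'n \<Rightarrow> real) \<Rightarrow> real^'n \<Rightarrow> real" where
  "commutator P \<rho> \<Omega> \<alpha> m b f x = (LINT y|lebesgue. commutator_integrand P \<rho> \<Omega> \<alpha> m b f x y)"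

definition maximal_commutator ::
  "real^'n^'n \<Rightarrow> (real^'n \<Rightarrow> real) \<Rightarrow> (real^'n \<Rightarrow> real) \<Rightarrow> real \<Rightarrow> nat \<Rightarrow> (nat \<Rightarrow> real^'n \<Rightarrow> real)
    \<Rightarrow> (real^'n \<Rightarrow> real) \<Rightarrow> real^'n \<Rightarrow> ennreal" where
  "maximal_commutator P \<rho> \<Omega> \<alpha> m b f x =
     (SUP t\<in>{0<..}. ennreal (measure lebesgue (ellipsoid \<rho> x t) powr (- 1 + \<alpha> / trace P)) *
        (\<integral>\<^sup>+y\<in>ellipsoid \<rho> x t.
           ennreal ((\<Prod>i\<in>{1..m}. \<bar>b i x - b i y\<bar>) * \<bar>\<Omega> (x - y)\<bar> * \<bar>f y\<bar>) \<partial>lebesgue))"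

text \<open>The integral occurring in the hypotheses on the pair of weights; \<open>e\<close> is the exponent of \<open>t\<close> in the denominator.\<close>

definition weight_integral ::
  "real^'n^'n \<Rightarrow> real^'n \<Rightarrow> nat \<Rightarrow> real \<Rightarrow> (real^'n \<Rightarrow> real \<Rightarrow> real) \<Rightarrow> real \<Rightarrow> real \<Rightarrow> ennreal" where
  "weight_integral P x0 m p \<phi> e r =
     (\<integral>\<^sup>+t\<in>{r<..}. ennreal ((1 + ln (t / r)) ^ m) *
        (ess_inf (lebesgue_on {t<..}) (\<lambda>\<tau>. ennreal (\<phi> x0 \<tau> * \<tau> powr (trace P / p))) / ennreal (t powr e))
      \<partial>lebesgue)"

end

theory Submission
  imports Defs
begin

text \<open>Both operators are dominated pointwise by
  \<open>G(x) = \<integral> \<Prod>\<^sub>i |b\<^sub>i(x) - b\<^sub>i(y)| |\<Omega>(x - y)| \<rho>(x - y)\<^bsup>\<alpha>-\<gamma>\<^esup> |f(y)| dy\<close>, so only the local norms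
  of \<open>G\<close> have to be estimated.

  Each of the two hypotheses provides a finite exponent \<open>\<sigma> \<le> s\<close> with \<open>\<sigma> > \<gamma> / (\<gamma> - \<alpha>)\<close>. By homogeneity, \<open>\<Omega>\<close> then has an
  \<open>L\<^sub>\<sigma>\<close>-norm over \<open>{\<rho> < t}\<close> of order \<open>t\<^bsup>\<gamma>/\<sigma>\<^esup>\<close>, so the kernel \<open>|\<Omega>| \<rho>\<^bsup>\<alpha>-\<gamma>\<^esup>\<close> lies in weak \<open>L\<^bsub>\<gamma>/(\<gamma>-\<alpha>)\<^esub>\<close>, and the weak Young inequality
  gives the \<open>L\<^sub>u \<rightarrow> L\<^sub>v\<close> bound of Hardy, Littlewood and Sobolev.

  For \<open>x \<in> E(x\<^sub>0, r)\<close> the part of \<open>f\<close> near \<open>E(x\<^sub>0, r)\<close> is treated by this bound, and the part on the shell \<open>\<rho>(x\<^sub>0 - y) \<approx> 2\<^sup>j r\<close> by Hoelder's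
  inequality. Writing \<open>b\<^sub>i(x) - b\<^sub>i(y)\<close> as the difference of the deviations of \<open>b\<^sub>i\<close> from its average over \<open>E(x\<^sub>0, r)\<close> reduces the product to
  norms of such deviations; telescoping the averages over dyadic ellipsoids makes the Campanato norm grow by a factor \<open>1 + j\<close> on
  the \<open>j\<close>-th shell. The sum over \<open>j\<close> is comparable with the integral in the hypothesis on the weights, since the essential infimum
  is increasing in \<open>t\<close>.\<close>

section \<open>Powers and Lebesgue norms of extended nonnegative functions\<close>

text \<open>The data constrain the objects only indirectly. The L_s condition on \<Omega> lives on
  the Euclidean sphere, a null set for the volume, whereas the estimates integrate \<Omega> over
  {\<rho> < t}; homogeneity must carry the one into the other. Of \<rho> neither continuity nor
  definiteness is given; what topology is needed is extracted from the volumes of {\<rho> < t},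
  which the polar formula supplies. The weight hypotheses (i) and (ii) are merged by a pair
  (\<sigma>, \<theta>), namely (q', 0) or, for finite s, (s, 1/s). In the first case \<Omega>(x - y)
  is averaged in y by Hoelder's inequality; in the second it is averaged in x by Minkowski's, which
  costs a factor (2^j)^(\<gamma>/s) that the factor r^(\<gamma>/s) in (ii) accounts for. Estimates
  run in \<open>ennreal\<close>, so that Fubini, Hoelder and Minkowski ask for no integrability;
  that the commutator integral exists almost everywhere is read off at the end from the finite local
  norms of G. Since \<Omega>(x - y) must be measurable in the pair (x, y), \<Omega>, b and f are
  replaced by Borel versions.\<close>

lemma ennreal_powr_ennreal: "0 \<le> x \<Longrightarrow> ennreal_powr (ennreal x) a = ennreal (x powr a)"
  by (simp add: ennreal_powr_def)

lemma ennreal_powr_0 [simp]: "ennreal_powr 0 a = 0"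
  by (simp add: ennreal_powr_def)

lemma ennreal_powr_top [simp]: "ennreal_powr top a = top"
  by (simp add: ennreal_powr_def)

lemma ennreal_powr_one_left [simp]: "ennreal_powr 1 a = 1"
  by (simp add: ennreal_powr_def)

lemma ennreal_powr_one [simp]: "ennreal_powr x 1 = x"
  by (cases x) (auto simp: ennreal_powr_ennreal)

lemma ennreal_powr_eq_0_iff [simp]: "ennreal_powr x a = 0 \<longleftrightarrow> x = 0"
  by (cases x) (auto simp: ennreal_powr_ennreal ennreal_eq_0_iff less_eq_real_def)

lemma ennreal_powr_eq_top_iff [simp]: "ennreal_powr x a = top \<longleftrightarrow> x = top"
  by (cases x) (auto simp: ennreal_powr_ennreal)

lemma ennreal_powr_mono: "x \<le> y \<Longrightarrow> 0 < a \<Longrightarrow> ennreal_powr x a \<le> ennreal_powr y a"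
  by (cases x; cases y) (auto simp: ennreal_powr_ennreal top_unique intro!: ennreal_leI powr_mono2)

text \<open>The values 0 and \<open>top\<close> are fixed by every exponent, negative ones and 0
  included. This convention lets the laws for products, iterated powers and sums of exponents hold
  without side conditions; negative exponents do occur, in the proof of Minkowski's
  inequality.\<close>

lemma ennreal_powr_mult:
  "ennreal_powr (x * y) a = ennreal_powr x a * ennreal_powr y a"
proof (cases "x = 0 \<or> y = 0")
  case False
  then show ?thesis
    by (cases x; cases y)
      (auto simp: ennreal_powr_ennreal powr_mult ennreal_mult_top ennreal_top_mult
            simp flip: ennreal_mult)
qed auto

lemma ennreal_powr_powr: "ennreal_powr (ennreal_powr x a) b = ennreal_powr x (a * b)"
  by (cases x) (auto simp: ennreal_powr_ennreal powr_powr)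

lemma ennreal_powr_add: "ennreal_powr x a * ennreal_powr x b = ennreal_powr x (a + b)"
  by (cases x) (auto simp: ennreal_powr_ennreal powr_add ennreal_mult)

lemma measurable_ennreal_powr [measurable]:
  assumes [measurable]: "f \<in> borel_measurable M"
  shows "(\<lambda>x. ennreal_powr (f x) a) \<in> borel_measurable M"
  unfolding ennreal_powr_def by measurable

section \<open>Hoelder and Minkowski inequalities for functions with values in
  \<open>ennreal\<close>\<close>

lemma weighted_am_gm_ennreal:
  assumes "0 < a" "0 < b" "a + b = 1"
  shows "ennreal_powr x a * ennreal_powr y b \<le> ennreal a * x + ennreal b * y"
proof (cases "x = top \<or> y = top")
  case True
  then show ?thesis using assms by (auto simp: ennreal_mult_top)
next
  case False
  then obtain u v where uv: "x = ennreal u" "y = ennreal v" "0 \<le> u" "0 \<le> v"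
    by (metis ennreal_cases)
  have "u powr a * v powr b \<le> a * u + b * v"
    using Youngs_inequality_0[of a b u v] assms uv by (cases "u = 0 \<or> v = 0") auto
  then show ?thesis
    using uv assms by (simp add: ennreal_powr_ennreal ennreal_leI flip: ennreal_mult ennreal_plus)
qed

text \<open>Scale both integrals to 1 and integrate the weighted inequality of the means. With
  exponents a + b = 1 on F and G themselves, the three-exponent form 1 / r = 1 / p + 1 / q is the
  instance a = r / p, b = r / q.\<close>

theorem nn_integral_Holder:
  assumes [measurable]: "F \<in> borel_measurable M" "G \<in> borel_measurable M"
    and ab: "0 < a" "0 < b" "a + b = 1"
  shows "(\<integral>\<^sup>+x. ennreal_powr (F x) a * ennreal_powr (G x) b \<partial>M)
         \<le> ennreal_powr (\<integral>\<^sup>+x. F x \<partial>M) a * ennreal_powr (\<integral>\<^sup>+x. G x \<partial>M) b"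
    (is "?L \<le> ennreal_powr ?A a * ennreal_powr ?B b")
proof -
  \<comment> \<open>A vanishing integral comes before an infinite one: 0 * \<open>top\<close> is 0,
    so the bound is trivial only after both factors are known to be nonzero.\<close>
  consider "?A = 0" | "?B = 0" | "?A \<noteq> 0" "?B \<noteq> 0" "?A = top \<or> ?B = top"
    | "?A \<noteq> 0" "?B \<noteq> 0" "?A \<noteq> top" "?B \<noteq> top" by blast
  then show ?thesis
  proof cases
    case 1
    then have "AE x in M. F x = 0" by (subst (asm) nn_integral_0_iff_AE) auto
    then have "?L = (\<integral>\<^sup>+x. 0 \<partial>M)" by (intro nn_integral_cong_AE) auto
    then show ?thesis by simp
  next
    case 2
    then have "AE x in M. G x = 0" by (subst (asm) nn_integral_0_iff_AE) auto
    then have "?L = (\<integral>\<^sup>+x. 0 \<partial>M)" by (intro nn_integral_cong_AE) auto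
    then show ?thesis by simp
  next
    case 3
    then have "ennreal_powr ?A a * ennreal_powr ?B b = top"
      by (auto simp: ennreal_mult_eq_top_iff)
    then show ?thesis by simp
  next
    case 4
    then obtain u v where u: "?A = ennreal u" "0 < u" and v: "?B = ennreal v" "0 < v"
      by (metis ennreal_cases ennreal_0 less_eq_real_def)
    have "?L = (\<integral>\<^sup>+x. (ennreal_powr ?A a * ennreal_powr ?B b) *
       (ennreal_powr (ennreal (1/u) * F x) a * ennreal_powr (ennreal (1/v) * G x) b) \<partial>M)"
    proof (intro nn_integral_cong)
      fix x
      have "ennreal_powr (F x) a = ennreal_powr ?A a * ennreal_powr (ennreal (1/u) * F x) a"
        using u by (simp add: mult.assoc[symmetric] flip: ennreal_mult ennreal_powr_mult)
      moreover have "ennreal_powr (G x) b = ennreal_powr ?B b * ennreal_powr (ennreal (1/v) * G x) b"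
        using v by (simp add: mult.assoc[symmetric] flip: ennreal_mult ennreal_powr_mult)
      ultimately show "ennreal_powr (F x) a * ennreal_powr (G x) b = (ennreal_powr ?A a * ennreal_powr ?B b) *
         (ennreal_powr (ennreal (1/u) * F x) a * ennreal_powr (ennreal (1/v) * G x) b)"
        by (simp only: mult_ac)
    qed
    also have "\<dots> = (ennreal_powr ?A a * ennreal_powr ?B b) * (\<integral>\<^sup>+x. ennreal_powr (ennreal (1/u) * F x) a * ennreal_powr (ennreal (1/v) * G x) b \<partial>M)"
      by (rule nn_integral_cmult) measurable
    also have "(\<integral>\<^sup>+x. ennreal_powr (ennreal (1/u) * F x) a * ennreal_powr (ennreal (1/v) * G x) b \<partial>M)
       \<le> (\<integral>\<^sup>+x. ennreal a * (ennreal (1/u) * F x) + ennreal b * (ennreal (1/v) * G x) \<partial>M)"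
      by (intro nn_integral_mono weighted_am_gm_ennreal ab)
    also have "\<dots> = ennreal a * (ennreal (1/u) * ?A) + ennreal b * (ennreal (1/v) * ?B)"
      by (simp add: nn_integral_add nn_integral_cmult)
    also have "\<dots> = 1"
      using u v ab by (simp flip: ennreal_mult ennreal_plus)
    finally show ?thesis by (simp add: mult_left_mono)
  qed
qed

text \<open>Values in \<open>ennreal\<close> admit suprema, series and inner integrals as arguments
  without any finiteness check. Norms over a set are written with an indicator inside F, so that one
  measure serves all ellipsoids.\<close>

definition enn_Lp_norm :: "real \<Rightarrow> 'a measure \<Rightarrow> ('a \<Rightarrow> ennreal) \<Rightarrow> ennreal" where
  "enn_Lp_norm p M F = ennreal_powr (\<integral>\<^sup>+x. ennreal_powr (F x) p \<partial>M) (1 / p)"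

lemma enn_Lp_norm_powr: "0 < p \<Longrightarrow> ennreal_powr (enn_Lp_norm p M F) p = (\<integral>\<^sup>+x. ennreal_powr (F x) p \<partial>M)"
  by (simp add: enn_Lp_norm_def ennreal_powr_powr)

lemma enn_Lp_norm_mono:
  assumes "\<And>x. x \<in> space M \<Longrightarrow> F x \<le> G x" "0 < p"
  shows "enn_Lp_norm p M F \<le> enn_Lp_norm p M G"
  unfolding enn_Lp_norm_def using assms
  by (intro ennreal_powr_mono nn_integral_mono) auto

lemma enn_Lp_norm_mono_AE:
  assumes "AE x in M. F x \<le> G x" "0 < p"
  shows "enn_Lp_norm p M F \<le> enn_Lp_norm p M G"
  unfolding enn_Lp_norm_def
proof (intro ennreal_powr_mono nn_integral_mono_AE)
  show "AE x in M. ennreal_powr (F x) p \<le> ennreal_powr (G x) p"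
    using assms by (auto intro: ennreal_powr_mono)
qed (use assms in auto)

lemma enn_Lp_norm_cmult:
  assumes [measurable]: "F \<in> borel_measurable M" and "0 < p"
  shows "enn_Lp_norm p M (\<lambda>x. c * F x) = c * enn_Lp_norm p M F"
  using assms(2) by (simp add: enn_Lp_norm_def ennreal_powr_mult nn_integral_cmult ennreal_powr_powr)

lemma enn_Lp_norm_leI:
  assumes "(\<integral>\<^sup>+x. ennreal_powr (F x) p \<partial>M) \<le> ennreal_powr c p" "0 < p"
  shows "enn_Lp_norm p M F \<le> c"
proof -
  have "enn_Lp_norm p M F \<le> ennreal_powr (ennreal_powr c p) (1 / p)"
    unfolding enn_Lp_norm_def using assms by (intro ennreal_powr_mono) auto
  then show ?thesis using assms by (simp add: ennreal_powr_powr)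
qed

lemma enn_Lp_norm_Holder2:
  assumes [measurable]: "F \<in> borel_measurable M" "G \<in> borel_measurable M"
    and pq: "0 < p" "0 < q" "0 < r" "1 / r = 1 / p + 1 / q"
  shows "enn_Lp_norm r M (\<lambda>x. F x * G x) \<le> enn_Lp_norm p M F * enn_Lp_norm q M G"
proof (rule enn_Lp_norm_leI)
  have "r * (1 / p + 1 / q) = 1" using pq(3) unfolding pq(4)[symmetric] by simp
  then have *: "r / p + r / q = 1" by (simp add: distrib_left)
  have "(\<integral>\<^sup>+x. ennreal_powr (F x * G x) r \<partial>M) =
     (\<integral>\<^sup>+x. ennreal_powr (ennreal_powr (F x) p) (r/p) * ennreal_powr (ennreal_powr (G x) q) (r/q) \<partial>M)"
    using pq by (simp add: ennreal_powr_powr ennreal_powr_mult)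
  also have "\<dots> \<le> ennreal_powr (\<integral>\<^sup>+x. ennreal_powr (F x) p \<partial>M) (r/p) * ennreal_powr (\<integral>\<^sup>+x. ennreal_powr (G x) q \<partial>M) (r/q)"
    using pq * by (intro nn_integral_Holder) auto
  also have "\<dots> = ennreal_powr (enn_Lp_norm p M F * enn_Lp_norm q M G) r"
    by (simp add: enn_Lp_norm_def ennreal_powr_mult ennreal_powr_powr)
  finally show "(\<integral>\<^sup>+x. ennreal_powr (F x * G x) r \<partial>M) \<le> ennreal_powr (enn_Lp_norm p M F * enn_Lp_norm q M G) r" .
qed (use pq in auto)

text \<open>Induction that splits off one factor at a time. The distinguished factor F keeps its own
  exponent p, so the exponent of the remaining product stays positive even when S is empty.\<close>

lemma enn_Lp_norm_Holder_prod:
  assumes "finite S" and [measurable]: "F \<in> borel_measurable M" "\<And>i. i \<in> S \<Longrightarrow> G i \<in> borel_measurable M"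
    and p: "0 < p" "\<And>i. i \<in> S \<Longrightarrow> 0 < ps i" and r: "0 < r" "1 / r = (\<Sum>i\<in>S. 1 / ps i) + 1 / p"
  shows "enn_Lp_norm r M (\<lambda>x. (\<Prod>i\<in>S. G i x) * F x) \<le> (\<Prod>i\<in>S. enn_Lp_norm (ps i) M (G i)) * enn_Lp_norm p M F"
  using assms
proof (induction S arbitrary: r rule: finite_induct)
  case empty
  then show ?case by simp
next
  case (insert j S)
  have [measurable]: "G i \<in> borel_measurable M" if "i \<in> insert j S" for i using insert.prems that by blast
  define t where "t = 1 / ((\<Sum>i\<in>S. 1 / ps i) + 1 / p)"
  have "0 \<le> (\<Sum>i\<in>S. 1 / ps i)" using insert.prems by (intro sum_nonneg) (auto intro: less_imp_le)
  then have t: "0 < t" "1 / t = (\<Sum>i\<in>S. 1 / ps i) + 1 / p" using insert.prems by (auto simp: t_def add_nonneg_pos)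
  have "enn_Lp_norm r M (\<lambda>x. (\<Prod>i\<in>insert j S. G i x) * F x) = enn_Lp_norm r M (\<lambda>x. G j x * ((\<Prod>i\<in>S. G i x) * F x))"
    using insert.hyps by (simp add: mult_ac)
  also have "\<dots> \<le> enn_Lp_norm (ps j) M (G j) * enn_Lp_norm t M (\<lambda>x. (\<Prod>i\<in>S. G i x) * F x)"
    using insert.prems insert.hyps t by (intro enn_Lp_norm_Holder2) auto
  also have "\<dots> \<le> enn_Lp_norm (ps j) M (G j) * ((\<Prod>i\<in>S. enn_Lp_norm (ps i) M (G i)) * enn_Lp_norm p M F)"
    using insert.prems t by (intro mult_left_mono insert.IH) auto
  finally show ?case using insert.hyps by (simp add: mult_ac)
qed

lemma enn_Lp_norm_indicator:
  assumes [measurable]: "A \<in> sets M" and "0 < p"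
  shows "enn_Lp_norm p M (indicator A) = ennreal_powr (emeasure M A) (1 / p)"
proof -
  have "ennreal_powr (indicator A x) p = indicator A x" for x by (auto simp: indicator_def)
  then show ?thesis by (simp add: enn_Lp_norm_def)
qed

text \<open>Hoelder's inequality against the indicator of A, whose exponent w satisfies 1 / w = 1 /
  q - 1 / p. For equal exponents there is no such w; the last factor is then a power with exponent
  0, which is 1 because the measure of A is neither 0 nor \<open>top\<close>.\<close>

lemma enn_Lp_norm_exponent_mono:
  assumes [measurable]: "A \<in> sets M" "F \<in> borel_measurable M" and A: "emeasure M A \<noteq> 0" "emeasure M A \<noteq> top"
    and pq: "0 < q" "q \<le> p"
  shows "enn_Lp_norm q M (\<lambda>x. F x * indicator A x) \<le> enn_Lp_norm p M (\<lambda>x. F x * indicator A x) * ennreal_powr (emeasure M A) (1 / q - 1 / p)"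
proof (cases "q = p")
  case True
  obtain a where a: "emeasure M A = ennreal a" "0 < a" using A by (metis ennreal_cases ennreal_0 less_eq_real_def)
  show ?thesis using True a by (simp add: ennreal_powr_ennreal)
next
  case False
  then have lt: "q < p" using pq by simp
  define w where "w = 1 / (1 / q - 1 / p)"
  have w: "0 < w" "1 / w = 1 / q - 1 / p" using lt pq by (auto simp: w_def frac_less2)
  have "enn_Lp_norm q M (\<lambda>x. F x * indicator A x) = enn_Lp_norm q M (\<lambda>x. (F x * indicator A x) * indicator A x)"
    by (intro arg_cong[where f="enn_Lp_norm q M"] ext) (auto simp: indicator_def)
  also have "\<dots> \<le> enn_Lp_norm p M (\<lambda>x. F x * indicator A x) * enn_Lp_norm w M (indicator A)"
    using w pq by (intro enn_Lp_norm_Holder2) auto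
  finally show ?thesis using w by (simp add: enn_Lp_norm_indicator)
qed

lemma nn_integral_Holder_norm:
  assumes [measurable]: "F \<in> borel_measurable M" "G \<in> borel_measurable M" and p: "1 < p" "1 / p + 1 / q = 1"
  shows "(\<integral>\<^sup>+x. F x * G x \<partial>M) \<le> enn_Lp_norm p M F * enn_Lp_norm q M G"
proof -
  have "1 / p < 1" using p by simp
  then have "0 < 1 / q" using p by linarith
  then have "0 < q" by (simp add: zero_less_divide_iff)
  then have "enn_Lp_norm 1 M (\<lambda>x. F x * G x) \<le> enn_Lp_norm p M F * enn_Lp_norm q M G"
    using p by (intro enn_Lp_norm_Holder2) auto
  then show ?thesis by (simp add: enn_Lp_norm_def)
qed

text \<open>With n(y) the norm of F(., y) and I the integral of n, write F = n^((q-1)/q) (n^(1-q)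
  F^q)^(1/q). Hoelder in y bounds the q-th power of the inner integral by I^(q-1) times the integral
  of n^(1-q) F^q in y, and Tonelli turns the integral of this in x into I^(q-1) times the integral
  of n^(1-q) n^q = n, that is I^q.\<close>

theorem enn_Lp_norm_Minkowski:
  assumes "sigma_finite_measure M" "sigma_finite_measure N"
    and F[measurable]: "case_prod F \<in> borel_measurable (M \<Otimes>\<^sub>M N)" and q: "1 \<le> q"
  shows "enn_Lp_norm q M (\<lambda>x. \<integral>\<^sup>+y. F x y \<partial>N) \<le> (\<integral>\<^sup>+y. enn_Lp_norm q M (\<lambda>x. F x y) \<partial>N)"
proof -
  interpret M: sigma_finite_measure M by fact
  interpret N: sigma_finite_measure N by fact
  interpret pair_sigma_finite M N ..
  have F'[measurable]: "(\<lambda>(y, x). F x y) \<in> borel_measurable (N \<Otimes>\<^sub>M M)"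
    by (subst measurable_pair_swap_iff) simp
  show ?thesis
  proof (cases "q = 1")
    case True
    have "(\<integral>\<^sup>+x. (\<integral>\<^sup>+y. F x y \<partial>N) \<partial>M) = (\<integral>\<^sup>+y. (\<integral>\<^sup>+x. F x y \<partial>M) \<partial>N)"
      by (rule Fubini'[symmetric]) simp
    then show ?thesis using True by (simp add: enn_Lp_norm_def)
  next
    case False
    then have q1: "1 < q" using q by simp
    define n where "n y = enn_Lp_norm q M (\<lambda>x. F x y)" for y
    have n[measurable]: "n \<in> borel_measurable N" unfolding n_def enn_Lp_norm_def by measurable
    define I where "I = (\<integral>\<^sup>+y. n y \<partial>N)"
    show ?thesis
    proof (cases "I = top")
      case True then show ?thesis by (simp add: I_def n_def)
    next
      case fin: False
      then have nfin: "AE y in N. n y \<noteq> top"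
        unfolding I_def using nn_integral_PInf_AE[of n N] n by (auto simp: infinity_ennreal_def)
      have np: "ennreal_powr (n y) q = (\<integral>\<^sup>+x. ennreal_powr (F x y) q \<partial>M)" for y
        unfolding n_def using q1 by (simp add: enn_Lp_norm_powr)
      \<comment> \<open>The factorization breaks where n y = 0, because there
        \<open>ennreal_powr (n y) (1 - q)\<close> is 0. Tonelli on this set shows that F vanishes
        there for almost every x and y, which repairs it.\<close>
      let ?Z = "\<lambda>y. (indicator {0} (n y) :: ennreal)"
      have "(\<integral>\<^sup>+x. (\<integral>\<^sup>+y. ?Z y * ennreal_powr (F x y) q \<partial>N) \<partial>M) = (\<integral>\<^sup>+y. (\<integral>\<^sup>+x. ?Z y * ennreal_powr (F x y) q \<partial>M) \<partial>N)"
        by (rule Fubini'[symmetric]) measurable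
      also have "\<dots> = (\<integral>\<^sup>+y. ?Z y * ennreal_powr (n y) q \<partial>N)"
      proof (intro nn_integral_cong)
        fix y assume "y \<in> space N"
        then have [measurable]: "(\<lambda>x. F x y) \<in> borel_measurable M" using measurable_Pair1[OF F] by simp
        show "(\<integral>\<^sup>+x. ?Z y * ennreal_powr (F x y) q \<partial>M) = ?Z y * ennreal_powr (n y) q"
          by (subst nn_integral_cmult) (auto simp: np)
      qed
      also have "\<dots> = (\<integral>\<^sup>+y. 0 \<partial>N)" by (intro nn_integral_cong) (auto simp: indicator_def)
      also have "\<dots> = 0" by simp
      finally have "AE x in M. (\<integral>\<^sup>+y. ?Z y * ennreal_powr (F x y) q \<partial>N) = 0"
        by (subst (asm) nn_integral_0_iff_AE) auto
      moreover have "AE y in N. n y = 0 \<longrightarrow> F x y = 0"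
        if "(\<integral>\<^sup>+y. ?Z y * ennreal_powr (F x y) q \<partial>N) = 0" "x \<in> space M" for x
      proof -
        have [measurable]: "F x \<in> borel_measurable N" using measurable_Pair2[OF F that(2)] by simp
        have "AE y in N. ?Z y * ennreal_powr (F x y) q = 0"
          using that by (subst (asm) nn_integral_0_iff_AE) auto
        then show ?thesis by eventually_elim (auto simp: indicator_def split: if_splits)
      qed
      ultimately have Z: "AE x in M. AE y in N. n y = 0 \<longrightarrow> F x y = 0"
        using AE_space by (auto elim!: AE_mp)
      let ?a = "(q - 1) / q" and ?b = "1 / q"
      have ab: "0 < ?a" "0 < ?b" "?a + ?b = 1" using q1 by (auto simp: field_simps)
      let ?G = "\<lambda>x y. ennreal_powr (n y) (1 - q) * ennreal_powr (F x y) q"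
      have main: "(\<integral>\<^sup>+y. F x y \<partial>N) \<le> ennreal_powr I ?a * ennreal_powr (\<integral>\<^sup>+y. ?G x y \<partial>N) ?b"
        if x: "x \<in> space M" "AE y in N. n y = 0 \<longrightarrow> F x y = 0" for x
      proof -
        have [measurable]: "F x \<in> borel_measurable N" using measurable_Pair2[OF F x(1)] by simp
        have "(\<integral>\<^sup>+y. F x y \<partial>N) = (\<integral>\<^sup>+y. ennreal_powr (n y) ?a * ennreal_powr (?G x y) ?b \<partial>N)"
        proof (intro nn_integral_cong_AE)
          show "AE y in N. F x y = ennreal_powr (n y) ?a * ennreal_powr (?G x y) ?b"
            using x(2) nfin
          proof eventually_elim
            case (elim y)
            show ?case
            proof (cases "n y = 0")
              case False
              then obtain c where c: "n y = ennreal c" "0 < c"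
                using elim by (metis ennreal_cases ennreal_0 less_eq_real_def)
              have "c powr ((1 - q) / q) * c powr ((q - 1) / q) = 1"
                using c by (simp add: diff_divide_distrib flip: powr_add)
              then have "ennreal_powr (n y) ((q-1)/q) * ennreal_powr (n y) ((1-q)/q) = 1"
                using c by (simp add: ennreal_powr_ennreal mult.commute flip: ennreal_mult)
              then show ?thesis using q1
                by (simp add: ennreal_powr_mult ennreal_powr_powr mult.assoc[symmetric])
            qed (use elim in auto)
          qed
        qed
        also have "\<dots> \<le> ennreal_powr I ?a * ennreal_powr (\<integral>\<^sup>+y. ?G x y \<partial>N) ?b"
          unfolding I_def by (intro nn_integral_Holder ab) measurable
        finally show ?thesis .
      qed
      have "(\<integral>\<^sup>+x. ennreal_powr (\<integral>\<^sup>+y. F x y \<partial>N) q \<partial>M) \<le> (\<integral>\<^sup>+x. ennreal_powr I (q-1) * (\<integral>\<^sup>+y. ?G x y \<partial>N) \<partial>M)"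
      proof (intro nn_integral_mono_AE)
        show "AE x in M. ennreal_powr (\<integral>\<^sup>+y. F x y \<partial>N) q \<le> ennreal_powr I (q-1) * (\<integral>\<^sup>+y. ?G x y \<partial>N)"
          using Z AE_space
        proof eventually_elim
          case (elim x)
          have "ennreal_powr (\<integral>\<^sup>+y. F x y \<partial>N) q \<le> ennreal_powr (ennreal_powr I ?a * ennreal_powr (\<integral>\<^sup>+y. ?G x y \<partial>N) ?b) q"
            using main[of x] elim q1 by (intro ennreal_powr_mono) auto
          then show ?case using q1 by (simp add: ennreal_powr_mult ennreal_powr_powr)
        qed
      qed
      also have "\<dots> = ennreal_powr I (q-1) * (\<integral>\<^sup>+x. (\<integral>\<^sup>+y. ?G x y \<partial>N) \<partial>M)"
        by (rule nn_integral_cmult) measurable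
      also have "(\<integral>\<^sup>+x. (\<integral>\<^sup>+y. ?G x y \<partial>N) \<partial>M) = (\<integral>\<^sup>+y. (\<integral>\<^sup>+x. ?G x y \<partial>M) \<partial>N)"
        by (rule Fubini'[symmetric]) measurable
      also have "\<dots> = (\<integral>\<^sup>+y. ennreal_powr (n y) (1 - q) * ennreal_powr (n y) q \<partial>N)"
      proof (intro nn_integral_cong)
        fix y assume "y \<in> space N"
        then have [measurable]: "(\<lambda>x. F x y) \<in> borel_measurable M" using measurable_Pair1[OF F] by simp
        show "(\<integral>\<^sup>+x. ?G x y \<partial>M) = ennreal_powr (n y) (1 - q) * ennreal_powr (n y) q"
          by (subst nn_integral_cmult) (auto simp: np)
      qed
      also have "\<dots> = I" unfolding I_def using q1 by (simp add: ennreal_powr_add)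
      also have "ennreal_powr I (q-1) * I = ennreal_powr I q"
        using ennreal_powr_add[of I "q-1" 1] by simp
      finally show ?thesis
        using q1 unfolding I_def n_def by (intro enn_Lp_norm_leI) auto
    qed
  qed
qed

text \<open>Minkowski's inequality for the counting measure on the natural numbers.\<close>

lemma enn_Lp_norm_suminf:
  assumes "sigma_finite_measure M" and [measurable]: "\<And>j::nat. F j \<in> borel_measurable M" and "1 \<le> q"
  shows "enn_Lp_norm q M (\<lambda>x. \<Sum>j. F j x) \<le> (\<Sum>j. enn_Lp_norm q M (F j))"
proof -
  have "enn_Lp_norm q M (\<lambda>x. \<integral>\<^sup>+j. F j x \<partial>count_space UNIV) \<le> (\<integral>\<^sup>+j. enn_Lp_norm q M (F j) \<partial>count_space UNIV)"
    using assms
    by (intro enn_Lp_norm_Minkowski[where F="\<lambda>x j. F j x"] sigma_finite_measure_count_space) measurable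
  then show ?thesis by (simp add: nn_integral_count_space_nat)
qed

text \<open>The index type is arbitrary, so the finite family is enumerated and padded with zeros to
  a series.\<close>

lemma enn_Lp_norm_sum:
  assumes "sigma_finite_measure M" "finite S" and [measurable]: "\<And>i. i \<in> S \<Longrightarrow> F i \<in> borel_measurable M" and "1 \<le> q"
  shows "enn_Lp_norm q M (\<lambda>x. \<Sum>j\<in>S. F j x) \<le> (\<Sum>j\<in>S. enn_Lp_norm q M (F j))"
proof -
  obtain g :: "nat \<Rightarrow> 'b" where g: "bij_betw g {..<card S} S"
    using assms(2) by (metis bij_betw_from_nat_into_finite)
  define H where "H j = (\<lambda>x. if j < card S then F (g j) x else 0)" for j
  have [measurable]: "H j \<in> borel_measurable M" for j
    using bij_betwE[OF g] by (cases "j < card S") (auto simp: H_def)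
  have s: "(\<Sum>j\<in>S. f j) = (\<Sum>j. if j < card S then f (g j) else 0)" for f :: "'b \<Rightarrow> ennreal"
  proof -
    have "(\<Sum>j\<in>S. f j) = (\<Sum>j<card S. f (g j))" using sum.reindex_bij_betw[OF g] by metis
    also have "\<dots> = (\<Sum>j. if j < card S then f (g j) else 0)"
      by (subst suminf_finite[where N="{..<card S}"]) auto
    finally show ?thesis .
  qed
  have "enn_Lp_norm q M (\<lambda>x. \<Sum>j. H j x) \<le> (\<Sum>j. enn_Lp_norm q M (H j))"
    by (intro enn_Lp_norm_suminf assms) simp
  also have "(\<lambda>x. \<Sum>j. H j x) = (\<lambda>x. \<Sum>j\<in>S. F j x)" by (rule ext) (simp add: s H_def)
  also have "(\<Sum>j. enn_Lp_norm q M (H j)) = (\<Sum>j\<in>S. enn_Lp_norm q M (F j))"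
    unfolding s by (rule arg_cong[where f=suminf], rule ext) (auto simp: H_def enn_Lp_norm_def)
  finally show ?thesis .
qed

section \<open>The weak Young inequality\<close>

lemma ex_dyadic_interval:
  assumes "1 \<le> (x::real)"
  shows "\<exists>j::nat. 2 ^ j \<le> x \<and> x < 2 * 2 ^ j"
proof -
  obtain n :: nat where n: "x < 2 ^ n" using real_arch_pow[of 2 x] by auto
  define N where "N = (LEAST n::nat. x < 2 ^ n)"
  have N: "x < 2 ^ N" unfolding N_def using n by (rule LeastI)
  then obtain j where j: "N = Suc j" using assms by (cases N) auto
  have "\<not> x < 2 ^ j" using j not_less_Least[of j "\<lambda>n. x < 2 ^ n"] by (simp add: N_def[symmetric])
  then show ?thesis using N j by (intro exI[of _ j]) auto
qed

lemma suminf_ennreal_geometric: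
  assumes "0 \<le> c" "0 \<le> q" "q < (1::real)"
  shows "(\<Sum>j. ennreal (c * q ^ j)) = ennreal (c / (1 - q))"
proof (rule suminf_ennreal_eq)
  show "(\<lambda>j. c * q ^ j) sums (c / (1 - q))"
    using sums_mult[OF geometric_sums[of q], of c] assms by simp
qed (use assms in auto)

lemma power_powr_swap: "(2 ^ j :: real) powr a = (2 powr a) ^ j"
  by (simp add: powr_realpow[symmetric] powr_powr mult.commute)

text \<open>Cut {R \<le> X} into the pieces 2^j R \<le> X < 2^(j+1) R. On each, X^(-a) is at most
  (2^j R)^(-a) and the mass of W is at most A (2^(j+1) R)^\<delta>; the products form a geometric
  series of ratio 2^(\<delta>-a) < 1.\<close>

lemma nn_integral_dyadic_above:
  fixes X :: "'a \<Rightarrow> real"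
  assumes [measurable]: "X \<in> borel_measurable M" "W \<in> borel_measurable M"
    and A: "0 \<le> A" "0 \<le> a" "\<delta> < a"
    and le: "\<And>t. 0 < t \<Longrightarrow> (\<integral>\<^sup>+x. W x * indicator {x. X x < t} x \<partial>M) \<le> ennreal (A * t powr \<delta>)"
    and R: "0 < R"
  shows "(\<integral>\<^sup>+x. W x * ennreal (X x powr - a) * indicator {x. R \<le> X x} x \<partial>M)
    \<le> ennreal (A * 2 powr \<delta> / (1 - 2 powr (\<delta> - a)) * R powr (\<delta> - a))"
proof -
  have "(\<integral>\<^sup>+x. W x * ennreal (X x powr - a) * indicator {x. R \<le> X x} x \<partial>M)
     \<le> (\<integral>\<^sup>+x. (\<Sum>j. ennreal ((2 ^ j * R) powr - a) * (W x * indicator {x. X x < 2 * 2 ^ j * R} x)) \<partial>M)"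
  proof (intro nn_integral_mono)
    fix x
    show "W x * ennreal (X x powr - a) * indicator {x. R \<le> X x} x
      \<le> (\<Sum>j. ennreal ((2 ^ j * R) powr - a) * (W x * indicator {x. X x < 2 * 2 ^ j * R} x))" (is "_ \<le> suminf ?f")
    proof (cases "R \<le> X x")
      case True
      then obtain j :: nat where j: "2 ^ j \<le> X x / R" "X x / R < 2 * 2 ^ j"
        using ex_dyadic_interval[of "X x / R"] R by auto
      then have j': "2 ^ j * R \<le> X x" "X x < 2 * 2 ^ j * R" using R by (auto simp: field_simps)
      have "X x powr - a \<le> (2 ^ j * R) powr - a" using j' A R by (intro powr_mono2') auto
      then have "W x * ennreal (X x powr - a) * indicator {x. R \<le> X x} x \<le> ?f j"
        using True j' by (auto simp: mult.commute intro!: mult_left_mono ennreal_leI)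
      also have "?f j \<le> suminf ?f" using sum_le_suminf[of ?f "{j}"] by auto
      finally show ?thesis .
    qed auto
  qed
  also have "\<dots> = (\<Sum>j. ennreal ((2 ^ j * R) powr - a) * (\<integral>\<^sup>+x. W x * indicator {x. X x < 2 * 2 ^ j * R} x \<partial>M))"
    by (subst nn_integral_suminf) (auto simp: nn_integral_cmult)
  also have "\<dots> \<le> (\<Sum>j. ennreal ((2 ^ j * R) powr - a) * ennreal (A * (2 * 2 ^ j * R) powr \<delta>))"
    using R by (intro suminf_le mult_left_mono le) auto
  also have "\<dots> = (\<Sum>j. ennreal ((A * 2 powr \<delta> * R powr (\<delta> - a)) * (2 powr (\<delta> - a)) ^ j))"
  proof (intro arg_cong[where f=suminf] ext)
    fix j :: nat
    have "(2 ^ j * R) powr - a * (A * (2 * 2 ^ j * R) powr \<delta>) = A * 2 powr \<delta> * (R powr \<delta> * R powr - a) * ((2 ^ j) powr \<delta> * (2 ^ j) powr - a)"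
      using R by (simp add: powr_mult)
    also have "\<dots> = (A * 2 powr \<delta> * R powr (\<delta> - a)) * (2 powr (\<delta> - a)) ^ j"
      using R by (simp flip: powr_add power_powr_swap)
    finally show "ennreal ((2 ^ j * R) powr - a) * ennreal (A * (2 * 2 ^ j * R) powr \<delta>) = ennreal ((A * 2 powr \<delta> * R powr (\<delta> - a)) * (2 powr (\<delta> - a)) ^ j)"
      using A by (simp flip: ennreal_mult)
  qed
  also have "\<dots> = ennreal (A * 2 powr \<delta> * R powr (\<delta> - a) / (1 - 2 powr (\<delta> - a)))"
    using A powr_less_mono[of "\<delta> - a" 0 2] by (intro suminf_ennreal_geometric) auto
  finally show ?thesis by simp
qed

text \<open>The mirror image: the pieces shrink towards 0, and now a < \<delta> makes the ratio
  2^(a-\<delta>) less than 1. Points with X = 0 are left out, where \<open>powr\<close> would return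
  0 rather than infinity.\<close>

lemma nn_integral_dyadic_below:
  fixes X :: "'a \<Rightarrow> real"
  assumes [measurable]: "X \<in> borel_measurable M" "W \<in> borel_measurable M"
    and A: "0 \<le> A" "0 \<le> a" "a < \<delta>"
    and le: "\<And>t. 0 < t \<Longrightarrow> (\<integral>\<^sup>+x. W x * indicator {x. X x < t} x \<partial>M) \<le> ennreal (A * t powr \<delta>)"
    and R: "0 < R"
  shows "(\<integral>\<^sup>+x. W x * ennreal (X x powr - a) * indicator {x. 0 < X x \<and> X x < R} x \<partial>M)
    \<le> ennreal (A * 2 powr \<delta> / (1 - 2 powr (a - \<delta>)) * R powr (\<delta> - a))"
proof -
  have "(\<integral>\<^sup>+x. W x * ennreal (X x powr - a) * indicator {x. 0 < X x \<and> X x < R} x \<partial>M)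
     \<le> (\<integral>\<^sup>+x. (\<Sum>j. ennreal ((R / 2 ^ j) powr - a) * (W x * indicator {x. X x < 2 * R / 2 ^ j} x)) \<partial>M)"
  proof (intro nn_integral_mono)
    fix x
    show "W x * ennreal (X x powr - a) * indicator {x. 0 < X x \<and> X x < R} x
      \<le> (\<Sum>j. ennreal ((R / 2 ^ j) powr - a) * (W x * indicator {x. X x < 2 * R / 2 ^ j} x))" (is "_ \<le> suminf ?f")
    proof (cases "0 < X x \<and> X x < R")
      case True
      then obtain i :: nat where i: "2 ^ i \<le> R / X x" "R / X x < 2 * 2 ^ i"
        using ex_dyadic_interval[of "R / X x"] R by auto
      \<comment> \<open>\<open>ex_dyadic_interval\<close> for R / X gives pieces closed above, while
        the series uses pieces closed below; the index therefore moves by one unless X is exactly R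
        / 2^i.\<close>
      have "\<exists>j. R / 2 ^ j \<le> X x \<and> X x < 2 * R / 2 ^ j"
      proof (cases "X x = R / 2 ^ i")
        case True then show ?thesis by (intro exI[of _ i]) (use R in \<open>auto simp: field_simps\<close>)
      next
        case False then show ?thesis using R i True by (intro exI[of _ "Suc i"]) (auto simp: field_simps less_eq_real_def)
      qed
      then obtain j where j': "R / 2 ^ j \<le> X x" "X x < 2 * R / 2 ^ j" by blast
      have "X x powr - a \<le> (R / 2 ^ j) powr - a" using j' A R by (intro powr_mono2') auto
      moreover have "indicator {x. 0 < X x \<and> X x < R} x = (1 :: ennreal)" "indicator {x. X x < 2 * R / 2 ^ j} x = (1 :: ennreal)"
        using True j' by auto
      ultimately have "W x * ennreal (X x powr - a) * indicator {x. 0 < X x \<and> X x < R} x \<le> ?f j"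
        by (simp only: mult_1_right mult.commute[of "ennreal _" "W x"]) (intro mult_left_mono ennreal_leI, auto)
      also have "?f j \<le> suminf ?f" using sum_le_suminf[of ?f "{j}"] by auto
      finally show ?thesis .
    qed auto
  qed
  also have "\<dots> = (\<Sum>j. ennreal ((R / 2 ^ j) powr - a) * (\<integral>\<^sup>+x. W x * indicator {x. X x < 2 * R / 2 ^ j} x \<partial>M))"
    by (subst nn_integral_suminf) (auto simp: nn_integral_cmult)
  also have "\<dots> \<le> (\<Sum>j. ennreal ((R / 2 ^ j) powr - a) * ennreal (A * (2 * R / 2 ^ j) powr \<delta>))"
    using R by (intro suminf_le mult_left_mono le) auto
  also have "\<dots> = (\<Sum>j. ennreal ((A * 2 powr \<delta> * R powr (\<delta> - a)) * (2 powr (a - \<delta>)) ^ j))"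
  proof (intro arg_cong[where f=suminf] ext)
    fix j :: nat
    have "(R / 2 ^ j) powr - a * (A * (2 * R / 2 ^ j) powr \<delta>) = A * 2 powr \<delta> * (R powr \<delta> * R powr - a) * ((2 ^ j) powr a * (2 ^ j) powr - \<delta>)"
      using R by (simp add: powr_mult powr_divide powr_minus field_simps)
    also have "\<dots> = (A * 2 powr \<delta> * R powr (\<delta> - a)) * (2 powr (a - \<delta>)) ^ j"
      using R by (simp flip: powr_add power_powr_swap)
    finally show "ennreal ((R / 2 ^ j) powr - a) * ennreal (A * (2 * R / 2 ^ j) powr \<delta>) = ennreal ((A * 2 powr \<delta> * R powr (\<delta> - a)) * (2 powr (a - \<delta>)) ^ j)"
      using A by (simp flip: ennreal_mult)
  qed
  also have "\<dots> = ennreal (A * 2 powr \<delta> * R powr (\<delta> - a) / (1 - 2 powr (a - \<delta>)))"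
    using A powr_less_mono[of "a - \<delta>" 0 2] by (intro suminf_ennreal_geometric) auto
  finally show ?thesis by simp
qed

text \<open>For fixed y cut the kernel at a level \<mu> depending on f(y). Where k > \<mu>, the
  restriction h^w \<le> f^v replaces h by f(y)^(v/w), and the first moment of the large part of k
  remains; where k \<le> \<mu>, Hoelder with exponents w and w' is applied. Each part is at most a
  constant times f(y)^(v-1), so the integral against f is controlled by that of f^v. The
  complementary region is this lemma with the two functions exchanged.\<close>

lemma weak_type_bilinear_half:
  fixes f :: "'b \<Rightarrow> real" and h :: "'a \<Rightarrow> real" and k :: "'a \<Rightarrow> 'b \<Rightarrow> real"
  assumes [measurable]: "f \<in> borel_measurable N" "h \<in> borel_measurable M"
    and k: "case_prod k \<in> borel_measurable (M \<Otimes>\<^sub>M N)"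
    and "sigma_finite_measure M"
    and nonneg: "\<And>y. 0 \<le> f y" "\<And>x. 0 \<le> h x" "\<And>x y. 0 \<le> k x y"
    and ex: "1 < v" "1 < w" "1 < \<kappa>" "1 / v + 1 / w + 1 / \<kappa> = 2" "1 / w + 1 / w' = 1"
    and C: "0 \<le> C"
    and large: "\<And>y \<mu>. y \<in> space N \<Longrightarrow> 0 < \<mu> \<Longrightarrow>
      (\<integral>\<^sup>+x. ennreal (k x y) * indicator {x. \<mu> < k x y} x \<partial>M) \<le> ennreal (C * \<mu> powr (1 - \<kappa>))"
    and small: "\<And>y \<mu>. y \<in> space N \<Longrightarrow> 0 < \<mu> \<Longrightarrow>
      (\<integral>\<^sup>+x. ennreal (k x y powr w') * indicator {x. k x y \<le> \<mu>} x \<partial>M) \<le> ennreal (C * \<mu> powr (w' - \<kappa>))"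
    and f1: "(\<integral>\<^sup>+y. ennreal (f y powr v) \<partial>N) \<le> 1" and h1: "(\<integral>\<^sup>+x. ennreal (h x powr w) \<partial>M) \<le> 1"
  shows "(\<integral>\<^sup>+y. ennreal (f y) * (\<integral>\<^sup>+x. indicator {x. h x powr w \<le> f y powr v} x * (ennreal (h x) * ennreal (k x y)) \<partial>M) \<partial>N)
    \<le> ennreal (C + C powr (1 / w'))"
proof -
  have w': "0 < w'"
  proof -
    have "1 / w < 1" using ex by simp
    then have "0 < 1 / w'" using ex by linarith
    then show ?thesis by (simp add: zero_less_divide_iff)
  qed
  have hw: "enn_Lp_norm w M (\<lambda>x. ennreal (h x)) \<le> 1"
    using h1 ex nonneg by (intro enn_Lp_norm_leI) (auto simp: ennreal_powr_ennreal)
  have inner: "(\<integral>\<^sup>+x. indicator {x. h x powr w \<le> f y powr v} x * (ennreal (h x) * ennreal (k x y)) \<partial>M)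
      \<le> ennreal ((C + C powr (1 / w')) * f y powr (v - 1))"
    if y: "y \<in> space N" and fy: "0 < f y" for y
  proof -
    have [measurable]: "(\<lambda>x. k x y) \<in> borel_measurable M" using measurable_Pair1[OF k y] by simp
    \<comment> \<open>The level equalizes both parts: v/w + (v/\<kappa>)(1 - \<kappa>) and
      (v/\<kappa>)(w' - \<kappa>)/w' are both v - 1, by 1/v + 1/w + 1/\<kappa> = 2 and 1/w + 1/w' =
      1.\<close>
    define \<mu> where "\<mu> = f y powr (v / \<kappa>)"
    have \<mu>: "0 < \<mu>" using fy by (simp add: \<mu>_def)
    let ?K1 = "\<lambda>x. ennreal (k x y) * indicator {x. \<mu> < k x y} x"
    let ?K2 = "\<lambda>x. ennreal (k x y) * indicator {x. k x y \<le> \<mu>} x"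
    have "(\<integral>\<^sup>+x. indicator {x. h x powr w \<le> f y powr v} x * (ennreal (h x) * ennreal (k x y)) \<partial>M)
       \<le> (\<integral>\<^sup>+x. ennreal (f y powr (v / w)) * ?K1 x + ennreal (h x) * ?K2 x \<partial>M)"
    proof (intro nn_integral_mono)
      fix x
      have "h x \<le> f y powr (v / w)" if "h x powr w \<le> f y powr v"
      proof -
        have "(h x powr w) powr (1 / w) \<le> (f y powr v) powr (1 / w)"
          using that ex by (intro powr_mono2) auto
        then show ?thesis using ex nonneg by (simp add: powr_powr)
      qed
      then show "indicator {x. h x powr w \<le> f y powr v} x * (ennreal (h x) * ennreal (k x y))
         \<le> ennreal (f y powr (v / w)) * ?K1 x + ennreal (h x) * ?K2 x"
        by (auto simp: indicator_def intro!: mult_right_mono ennreal_leI)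
    qed
    also have "\<dots> = ennreal (f y powr (v / w)) * (\<integral>\<^sup>+x. ?K1 x \<partial>M) + (\<integral>\<^sup>+x. ennreal (h x) * ?K2 x \<partial>M)"
      by (subst nn_integral_add) (auto simp: nn_integral_cmult)
    also have "\<dots> \<le> ennreal (f y powr (v / w)) * ennreal (C * \<mu> powr (1 - \<kappa>)) + enn_Lp_norm w M (\<lambda>x. ennreal (h x)) * enn_Lp_norm w' M ?K2"
      using large[OF y \<mu>] ex by (intro add_mono mult_left_mono nn_integral_Holder_norm) auto
    also have "enn_Lp_norm w M (\<lambda>x. ennreal (h x)) * enn_Lp_norm w' M ?K2 \<le> 1 * ennreal ((C * \<mu> powr (w' - \<kappa>)) powr (1 / w'))"
    proof (intro mult_mono hw)
      show "enn_Lp_norm w' M ?K2 \<le> ennreal ((C * \<mu> powr (w' - \<kappa>)) powr (1 / w'))"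
      proof (rule enn_Lp_norm_leI)
        have "(\<integral>\<^sup>+x. ennreal_powr (?K2 x) w' \<partial>M) = (\<integral>\<^sup>+x. ennreal (k x y powr w') * indicator {x. k x y \<le> \<mu>} x \<partial>M)"
          using nonneg w' by (intro nn_integral_cong) (auto simp: indicator_def ennreal_powr_ennreal)
        then show "(\<integral>\<^sup>+x. ennreal_powr (?K2 x) w' \<partial>M) \<le> ennreal_powr (ennreal ((C * \<mu> powr (w' - \<kappa>)) powr (1 / w'))) w'"
          using small[OF y \<mu>] C w' by (simp add: ennreal_powr_ennreal powr_powr)
      qed (use w' in auto)
    qed auto
    also have "ennreal (f y powr (v / w)) * ennreal (C * \<mu> powr (1 - \<kappa>)) = ennreal (C * f y powr (v - 1))"
    proof -
      have "v / w + v / \<kappa> * (1 - \<kappa>) = v * (1 / v + 1 / w + 1 / \<kappa>) - v - 1"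
        using ex by (simp add: field_simps)
      also have "\<dots> = v - 1" unfolding ex(4) by simp
      finally have e: "v / w + v / \<kappa> * (1 - \<kappa>) = v - 1" .
      have "f y powr (v / w) * (C * \<mu> powr (1 - \<kappa>)) = C * f y powr (v / w + v / \<kappa> * (1 - \<kappa>))"
        by (simp add: \<mu>_def powr_powr powr_add)
      then show ?thesis using C unfolding e by (simp flip: ennreal_mult)
    qed
    also have "(C * \<mu> powr (w' - \<kappa>)) powr (1 / w') = C powr (1 / w') * f y powr (v - 1)"
    proof -
      have "v / \<kappa> * (w' - \<kappa>) * (1 / w') = v / \<kappa> - v / w'"
        using ex w' by (simp add: field_simps)
      also have "\<dots> = v * (1 / v + 1 / w + 1 / \<kappa>) - v * (1 / w + 1 / w') - 1"
        using ex(1) by (simp add: distrib_left)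
      also have "\<dots> = v - 1" unfolding ex(4) ex(5) by simp
      finally have e: "v / \<kappa> * (w' - \<kappa>) * (1 / w') = v - 1" .
      show ?thesis using C unfolding e[symmetric] by (simp add: \<mu>_def powr_powr powr_mult)
    qed
    finally show ?thesis using C by (simp add: distrib_right flip: ennreal_plus)
  qed
  have "(\<integral>\<^sup>+y. ennreal (f y) * (\<integral>\<^sup>+x. indicator {x. h x powr w \<le> f y powr v} x * (ennreal (h x) * ennreal (k x y)) \<partial>M) \<partial>N)
    \<le> (\<integral>\<^sup>+y. ennreal (C + C powr (1 / w')) * ennreal (f y powr v) \<partial>N)"
  proof (intro nn_integral_mono)
    fix y assume y: "y \<in> space N"
    show "ennreal (f y) * (\<integral>\<^sup>+x. indicator {x. h x powr w \<le> f y powr v} x * (ennreal (h x) * ennreal (k x y)) \<partial>M)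
       \<le> ennreal (C + C powr (1 / w')) * ennreal (f y powr v)"
    proof (cases "f y = 0")
      case False
      then have fy: "0 < f y" using nonneg(1)[of y] by simp
      have "ennreal (f y) * (\<integral>\<^sup>+x. indicator {x. h x powr w \<le> f y powr v} x * (ennreal (h x) * ennreal (k x y)) \<partial>M)
        \<le> ennreal (f y) * ennreal ((C + C powr (1 / w')) * f y powr (v - 1))"
        by (intro mult_left_mono inner y fy) auto
      also have "\<dots> = ennreal ((C + C powr (1 / w')) * (f y powr 1 * f y powr (v - 1)))"
        using fy C by (simp add: mult_ac flip: ennreal_mult)
      also have "\<dots> = ennreal (C + C powr (1 / w')) * ennreal (f y powr v)"
        using C unfolding powr_add[symmetric] by (simp add: ennreal_mult)
      finally show ?thesis .
    qed simp
  qed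
  also have "\<dots> = ennreal (C + C powr (1 / w')) * (\<integral>\<^sup>+y. ennreal (f y powr v) \<partial>N)"
    by (rule nn_integral_cmult) measurable
  also have "\<dots> \<le> ennreal (C + C powr (1 / w')) * 1"
    by (intro mult_left_mono f1) auto
  finally show ?thesis by simp
qed

section \<open>Convolution with kernels of weak type\<close>

lemma nn_integral_lborel_diff:
  fixes g :: "'a::euclidean_space \<Rightarrow> ennreal"
  assumes [measurable]: "g \<in> borel_measurable borel"
  shows "(\<integral>\<^sup>+x. g (x - y) \<partial>lborel) = (\<integral>\<^sup>+x. g x \<partial>lborel)"
    and "(\<integral>\<^sup>+y. g (x - y) \<partial>lborel) = (\<integral>\<^sup>+y. g y \<partial>lborel)"
proof -
  have tr: "(\<integral>\<^sup>+x. f (y + x) \<partial>lborel) = (\<integral>\<^sup>+x. f x \<partial>lborel)"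
    if [measurable]: "f \<in> borel_measurable borel" for f :: "'a \<Rightarrow> ennreal" and y
    by (subst (2) lborel_distr_plus[of y, symmetric], subst nn_integral_distr) auto
  have um: "distr lborel borel (uminus :: 'a \<Rightarrow> 'a) = lborel"
    by (subst (2) lborel_affine[of "-1" "0::'a"]) (simp_all add: density_1 one_ennreal_def[symmetric])
  have rf: "(\<integral>\<^sup>+x. f (- x) \<partial>lborel) = (\<integral>\<^sup>+x. f x \<partial>lborel)"
    if [measurable]: "f \<in> borel_measurable borel" for f :: "'a \<Rightarrow> ennreal"
    by (subst (2) um[symmetric], subst nn_integral_distr) auto
  show "(\<integral>\<^sup>+x. g (x - y) \<partial>lborel) = (\<integral>\<^sup>+x. g x \<partial>lborel)"
    using tr[of g "- y"] by simp
  show "(\<integral>\<^sup>+y. g (x - y) \<partial>lborel) = (\<integral>\<^sup>+y. g y \<partial>lborel)"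
    using tr[of g x] rf[of "\<lambda>z. g (x + z)"] by simp
qed

text \<open>Pass to X = 1 / K: the weak-type bound says that {X < t} has mass at most B t^\<kappa>,
  and the two moments of K become integrals of X^(-1) near 0 and of X^(-a) away from 0, to which the
  dyadic lemmas apply.\<close>

lemma weak_type_kernel_bounds:
  fixes K :: "'a \<Rightarrow> real"
  assumes [measurable]: "K \<in> borel_measurable M" and nn: "\<And>x. 0 \<le> K x" and B: "0 \<le> B" and \<kappa>: "1 < \<kappa>"
    and weak: "\<And>\<mu>. 0 < \<mu> \<Longrightarrow> emeasure M {x \<in> space M. \<mu> < K x} \<le> ennreal (B * \<mu> powr - \<kappa>)"
  shows "\<exists>C\<ge>0. \<forall>\<mu>>0. (\<integral>\<^sup>+x. ennreal (K x) * indicator {x. \<mu> < K x} x \<partial>M) \<le> ennreal (C * \<mu> powr (1 - \<kappa>))"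
    and "\<kappa> < a \<Longrightarrow> \<exists>C\<ge>0. \<forall>\<mu>>0. (\<integral>\<^sup>+x. ennreal (K x powr a) * indicator {x. K x \<le> \<mu>} x \<partial>M) \<le> ennreal (C * \<mu> powr (a - \<kappa>))"
proof -
  define X where "X x = 1 / K x" for x
  \<comment> \<open>Where K = 0, division gives X = 0, which would wrongly count as a large kernel
    value; W removes these points.\<close>
  define W where "W x = (indicator {x. 0 < K x} x :: ennreal)" for x
  have [measurable]: "X \<in> borel_measurable M" "W \<in> borel_measurable M" by (simp_all add: X_def[abs_def] W_def[abs_def])
  have le: "(\<integral>\<^sup>+x. W x * indicator {x. X x < t} x \<partial>M) \<le> ennreal (B * t powr \<kappa>)" if "0 < t" for t
  proof -
    have "(\<integral>\<^sup>+x. W x * indicator {x. X x < t} x \<partial>M) \<le> (\<integral>\<^sup>+x. indicator {x \<in> space M. 1 / t < K x} x \<partial>M)"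
      using that by (intro nn_integral_mono) (auto simp: W_def X_def indicator_def field_simps)
    also have "\<dots> \<le> ennreal (B * (1 / t) powr - \<kappa>)" using weak[of "1/t"] that by simp
    also have "(1 / t) powr - \<kappa> = t powr \<kappa>" using that by (simp add: powr_divide powr_minus_divide)
    finally show ?thesis .
  qed
  show "\<exists>C\<ge>0. \<forall>\<mu>>0. (\<integral>\<^sup>+x. ennreal (K x) * indicator {x. \<mu> < K x} x \<partial>M) \<le> ennreal (C * \<mu> powr (1 - \<kappa>))"
  proof (intro exI[of _ "B * 2 powr \<kappa> / (1 - 2 powr (1 - \<kappa>))"] conjI allI impI)
    show "0 \<le> B * 2 powr \<kappa> / (1 - 2 powr (1 - \<kappa>))"
      using B powr_less_mono[of "1 - \<kappa>" 0 2] \<kappa> by auto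
    fix \<mu> :: real assume \<mu>: "0 < \<mu>"
    have "(\<integral>\<^sup>+x. ennreal (K x) * indicator {x. \<mu> < K x} x \<partial>M) = (\<integral>\<^sup>+x. W x * ennreal (X x powr - 1) * indicator {x. 0 < X x \<and> X x < 1 / \<mu>} x \<partial>M)"
      using \<mu> nn by (intro nn_integral_cong) (auto simp: indicator_def W_def X_def field_simps powr_minus)
    also have "\<dots> \<le> ennreal (B * 2 powr \<kappa> / (1 - 2 powr (1 - \<kappa>)) * (1 / \<mu>) powr (\<kappa> - 1))"
      by (rule nn_integral_dyadic_below) (use le B \<kappa> \<mu> in auto)
    also have "(1 / \<mu>) powr (\<kappa> - 1) = \<mu> powr (1 - \<kappa>)"
      using \<mu> powr_minus_divide[of \<mu> "\<kappa> - 1"] by (simp add: powr_divide)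
    finally show "(\<integral>\<^sup>+x. ennreal (K x) * indicator {x. \<mu> < K x} x \<partial>M) \<le> ennreal (B * 2 powr \<kappa> / (1 - 2 powr (1 - \<kappa>)) * \<mu> powr (1 - \<kappa>))" .
  qed
  show "\<exists>C\<ge>0. \<forall>\<mu>>0. (\<integral>\<^sup>+x. ennreal (K x powr a) * indicator {x. K x \<le> \<mu>} x \<partial>M) \<le> ennreal (C * \<mu> powr (a - \<kappa>))" if a: "\<kappa> < a"
  proof (intro exI[of _ "B * 2 powr \<kappa> / (1 - 2 powr (\<kappa> - a))"] conjI allI impI)
    show "0 \<le> B * 2 powr \<kappa> / (1 - 2 powr (\<kappa> - a))"
      using B powr_less_mono[of "\<kappa> - a" 0 2] a by auto
    fix \<mu> :: real assume \<mu>: "0 < \<mu>"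
    have "(\<integral>\<^sup>+x. ennreal (K x powr a) * indicator {x. K x \<le> \<mu>} x \<partial>M) = (\<integral>\<^sup>+x. W x * ennreal (X x powr - a) * indicator {x. 1 / \<mu> \<le> X x} x \<partial>M)"
    proof (intro nn_integral_cong)
      fix x
      show "ennreal (K x powr a) * indicator {x. K x \<le> \<mu>} x = W x * ennreal (X x powr - a) * indicator {x. 1 / \<mu> \<le> X x} x"
        using \<mu> nn[of x] by (cases "K x = 0") (auto simp: indicator_def W_def X_def field_simps powr_minus powr_divide)
    qed
    also have "\<dots> \<le> ennreal (B * 2 powr \<kappa> / (1 - 2 powr (\<kappa> - a)) * (1 / \<mu>) powr (\<kappa> - a))"
      by (rule nn_integral_dyadic_above) (use le B \<kappa> \<mu> a in auto)
    also have "(1 / \<mu>) powr (\<kappa> - a) = \<mu> powr (a - \<kappa>)"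
      using \<mu> powr_minus_divide[of \<mu> "\<kappa> - a"] by (simp add: powr_divide)
    finally show "(\<integral>\<^sup>+x. ennreal (K x powr a) * indicator {x. K x \<le> \<mu>} x \<partial>M) \<le> ennreal (B * 2 powr \<kappa> / (1 - 2 powr (\<kappa> - a)) * \<mu> powr (a - \<kappa>))" .
  qed
qed

text \<open>The bilinear form that pairs h with the convolution of K and f is split according to
  whether h^w \<le> f^v or the reverse, with w conjugate to u. Homogeneity removes the normalization
  of f and h, and testing with a power of a truncation of the convolution converts the bilinear
  bound into the L_u bound.\<close>

theorem weak_Young:
  fixes K :: "'a::euclidean_space \<Rightarrow> real"
  assumes [measurable]: "K \<in> borel_measurable borel" and nn: "\<And>x. 0 \<le> K x" and B: "0 \<le> B" and \<kappa>: "1 < \<kappa>"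
    and weak: "\<And>\<mu>. 0 < \<mu> \<Longrightarrow> emeasure lborel {x. \<mu> < K x} \<le> ennreal (B * \<mu> powr - \<kappa>)"
    and v: "1 < v" and u: "0 < u" "1 / u = 1 / v + 1 / \<kappa> - 1"
  shows "\<exists>C>0. \<forall>f\<in>borel_measurable borel. (\<forall>y. 0 \<le> f y) \<longrightarrow>
    enn_Lp_norm u lborel (\<lambda>x. \<integral>\<^sup>+y. ennreal (K (x - y)) * ennreal (f y) \<partial>lborel)
      \<le> ennreal C * enn_Lp_norm v lborel (\<lambda>y. ennreal (f y))"
proof -
  define w where "w = u / (u - 1)"
  define v' where "v' = v / (v - 1)"
  have "1 / v < 1" using v by simp
  then have \<kappa>u: "1 / u < 1 / \<kappa>" using u by linarith
  then have "\<kappa> < u" using u(1) \<kappa> by (simp add: field_simps)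
  then have u1: "1 < u" using \<kappa> by simp
  have w: "1 < w" "1 / u + 1 / w = 1" "1 / w + 1 / u = 1" using u1 by (auto simp: w_def field_simps)
  have v': "1 / v + 1 / v' = 1" "0 < v'" using v by (auto simp: v'_def field_simps)
  have "0 < 1 / u" using u(1) by simp
  then have "1 / v' < 1 / \<kappa>" using u(2) v' by linarith
  then have \<kappa>v': "\<kappa> < v'" using v'(2) \<kappa> by (simp add: field_simps)
  have sum2: "1 / v + 1 / w + 1 / \<kappa> = 2" "1 / w + 1 / v + 1 / \<kappa> = 2" using w u by linarith+
  have weak': "\<And>\<mu>. 0 < \<mu> \<Longrightarrow> emeasure lborel {x \<in> space lborel. \<mu> < K x} \<le> ennreal (B * \<mu> powr - \<kappa>)"
    using weak by simp
  obtain C1 where C1: "0 \<le> C1" "\<And>\<mu>. \<mu> > 0 \<Longrightarrow> (\<integral>\<^sup>+x. ennreal (K x) * indicator {x. \<mu> < K x} x \<partial>lborel) \<le> ennreal (C1 * \<mu> powr (1 - \<kappa>))"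
    using weak_type_kernel_bounds(1)[of K lborel B \<kappa>] nn B \<kappa> weak' by auto
  obtain C2 where C2: "0 \<le> C2" "\<And>\<mu>. \<mu> > 0 \<Longrightarrow> (\<integral>\<^sup>+x. ennreal (K x powr u) * indicator {x. K x \<le> \<mu>} x \<partial>lborel) \<le> ennreal (C2 * \<mu> powr (u - \<kappa>))"
    using weak_type_kernel_bounds(2)[of K lborel B \<kappa> u] nn B \<kappa> \<open>\<kappa> < u\<close> weak' by auto
  obtain C3 where C3: "0 \<le> C3" "\<And>\<mu>. \<mu> > 0 \<Longrightarrow> (\<integral>\<^sup>+x. ennreal (K x powr v') * indicator {x. K x \<le> \<mu>} x \<partial>lborel) \<le> ennreal (C3 * \<mu> powr (v' - \<kappa>))"
    using weak_type_kernel_bounds(2)[of K lborel B \<kappa> v'] nn B \<kappa> \<kappa>v' weak' by auto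
  define C where "C = C1 + C2 + C3"
  have C: "0 \<le> C" "C1 \<le> C" "C2 \<le> C" "C3 \<le> C" using C1 C2 C3 by (auto simp: C_def)
  have Cle: "ennreal (Ci * \<mu> powr t) \<le> ennreal (C * \<mu> powr t)" if "Ci \<le> C" for Ci \<mu> t
    using that by (intro ennreal_leI mult_right_mono) auto
  \<comment> \<open>The summand 1 makes the constant positive when C = 0.\<close>
  define D where "D = (C + C powr (1 / u)) + (C + C powr (1 / v')) + 1"
  have D: "0 < D" using C by (simp add: D_def add_nonneg_pos)
  have unit: "(\<integral>\<^sup>+x. ennreal (h x) * (\<integral>\<^sup>+y. ennreal (K (x - y)) * ennreal (f y) \<partial>lborel) \<partial>lborel) \<le> ennreal D"
    if [measurable]: "f \<in> borel_measurable borel" "h \<in> borel_measurable borel"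
      and fh: "\<And>y. 0 \<le> f y" "\<And>x. 0 \<le> h x" "(\<integral>\<^sup>+y. ennreal (f y powr v) \<partial>lborel) \<le> 1" "(\<integral>\<^sup>+x. ennreal (h x powr w) \<partial>lborel) \<le> 1"
    for f h :: "'a \<Rightarrow> real"
  proof -
    let ?A = "\<lambda>x y. indicator {x. h x powr w \<le> f y powr v} x * (ennreal (h x) * ennreal (K (x - y))) :: ennreal"
    let ?B = "\<lambda>x y. indicator {y. f y powr v \<le> h x powr w} y * (ennreal (f y) * ennreal (K (x - y))) :: ennreal"
    have "(\<integral>\<^sup>+x. ennreal (h x) * (\<integral>\<^sup>+y. ennreal (K (x - y)) * ennreal (f y) \<partial>lborel) \<partial>lborel)
      = (\<integral>\<^sup>+x. (\<integral>\<^sup>+y. ennreal (h x) * (ennreal (K (x - y)) * ennreal (f y)) \<partial>lborel) \<partial>lborel)"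
      by (simp add: nn_integral_cmult)
    also have "\<dots> \<le> (\<integral>\<^sup>+x. (\<integral>\<^sup>+y. ennreal (f y) * ?A x y + ennreal (h x) * ?B x y \<partial>lborel) \<partial>lborel)"
      by (intro nn_integral_mono) (auto simp: indicator_def mult_ac)
    also have "\<dots> = (\<integral>\<^sup>+x. (\<integral>\<^sup>+y. ennreal (f y) * ?A x y \<partial>lborel) \<partial>lborel) + (\<integral>\<^sup>+x. ennreal (h x) * (\<integral>\<^sup>+y. ?B x y \<partial>lborel) \<partial>lborel)"
      by (simp add: nn_integral_add nn_integral_cmult)
    also have "(\<integral>\<^sup>+x. (\<integral>\<^sup>+y. ennreal (f y) * ?A x y \<partial>lborel) \<partial>lborel) = (\<integral>\<^sup>+y. (\<integral>\<^sup>+x. ennreal (f y) * ?A x y \<partial>lborel) \<partial>lborel)"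
      by (rule lborel_pair.Fubini'[symmetric]) measurable
    also have "\<dots> = (\<integral>\<^sup>+y. ennreal (f y) * (\<integral>\<^sup>+x. ?A x y \<partial>lborel) \<partial>lborel)"
      by (simp add: nn_integral_cmult)
    also have "\<dots> \<le> ennreal (C + C powr (1 / u))"
    proof (rule weak_type_bilinear_half[where k="\<lambda>x y. K (x - y)" and \<kappa>=\<kappa>])
      fix y :: 'a and \<mu> :: real assume \<mu>: "0 < \<mu>"
      show "(\<integral>\<^sup>+x. ennreal (K (x - y)) * indicator {x. \<mu> < K (x - y)} x \<partial>lborel) \<le> ennreal (C * \<mu> powr (1 - \<kappa>))"
        using nn_integral_lborel_diff(1)[of "\<lambda>x. ennreal (K x) * indicator {x. \<mu> < K x} x" y] order_trans[OF C1(2)[OF \<mu>] Cle[OF C(2)]]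
        by (simp add: indicator_def)
      show "(\<integral>\<^sup>+x. ennreal (K (x - y) powr u) * indicator {x. K (x - y) \<le> \<mu>} x \<partial>lborel) \<le> ennreal (C * \<mu> powr (u - \<kappa>))"
        using nn_integral_lborel_diff(1)[of "\<lambda>x. ennreal (K x powr u) * indicator {x. K x \<le> \<mu>} x" y] order_trans[OF C2(2)[OF \<mu>] Cle[OF C(3)]]
        by (simp add: indicator_def)
    qed (use fh nn v w \<kappa> sum2 C in \<open>auto intro: sigma_finite_lborel\<close>)
    also have "(\<integral>\<^sup>+x. ennreal (h x) * (\<integral>\<^sup>+y. ?B x y \<partial>lborel) \<partial>lborel) \<le> ennreal (C + C powr (1 / v'))"
    proof (rule weak_type_bilinear_half[where k="\<lambda>y x. K (x - y)" and \<kappa>=\<kappa>])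
      fix x :: 'a and \<mu> :: real assume \<mu>: "0 < \<mu>"
      show "(\<integral>\<^sup>+y. ennreal (K (x - y)) * indicator {y. \<mu> < K (x - y)} y \<partial>lborel) \<le> ennreal (C * \<mu> powr (1 - \<kappa>))"
        using nn_integral_lborel_diff(2)[of "\<lambda>x. ennreal (K x) * indicator {x. \<mu> < K x} x" x] order_trans[OF C1(2)[OF \<mu>] Cle[OF C(2)]]
        by (simp add: indicator_def)
      show "(\<integral>\<^sup>+y. ennreal (K (x - y) powr v') * indicator {y. K (x - y) \<le> \<mu>} y \<partial>lborel) \<le> ennreal (C * \<mu> powr (v' - \<kappa>))"
        using nn_integral_lborel_diff(2)[of "\<lambda>x. ennreal (K x powr v') * indicator {x. K x \<le> \<mu>} x" x] order_trans[OF C3(2)[OF \<mu>] Cle[OF C(4)]]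
        by (simp add: indicator_def)
    qed (use fh nn v w v' \<kappa> sum2 C in \<open>auto intro: sigma_finite_lborel\<close>)
    also have "ennreal (C + C powr (1 / u)) + ennreal (C + C powr (1 / v')) = ennreal ((C + C powr (1 / u)) + (C + C powr (1 / v')))"
      using C by (simp flip: ennreal_plus)
    also have "\<dots> \<le> ennreal D" by (intro ennreal_leI) (simp add: D_def)
    finally show ?thesis by (simp add: add_mono)
  qed
  have scaled: "(\<integral>\<^sup>+x. ennreal (h x) * (\<integral>\<^sup>+y. ennreal (K (x - y)) * ennreal (f y) \<partial>lborel) \<partial>lborel) \<le> ennreal (D * a * b)"
    if [measurable]: "f \<in> borel_measurable borel" "h \<in> borel_measurable borel"
      and fh: "\<And>y. 0 \<le> f y" "\<And>x. 0 \<le> h x"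
      and ab: "0 < a" "(\<integral>\<^sup>+y. ennreal (f y powr v) \<partial>lborel) \<le> ennreal (a powr v)" "0 < b" "(\<integral>\<^sup>+x. ennreal (h x powr w) \<partial>lborel) \<le> ennreal (b powr w)"
    for f h :: "'a \<Rightarrow> real" and a b
  proof -
    have n: "(\<integral>\<^sup>+y. ennreal ((g y / c) powr t) \<partial>lborel) \<le> 1"
      if [measurable]: "g \<in> borel_measurable borel" and "\<And>y. 0 \<le> g y" "0 < c" "(\<integral>\<^sup>+y. ennreal (g y powr t) \<partial>lborel) \<le> ennreal (c powr t)"
      for g :: "'a \<Rightarrow> real" and c t
    proof -
      have "(\<integral>\<^sup>+y. ennreal ((g y / c) powr t) \<partial>lborel) = (\<integral>\<^sup>+y. ennreal (1 / c powr t) * ennreal (g y powr t) \<partial>lborel)"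
        using that by (intro nn_integral_cong) (simp add: powr_divide flip: ennreal_mult)
      also have "\<dots> = ennreal (1 / c powr t) * (\<integral>\<^sup>+y. ennreal (g y powr t) \<partial>lborel)" by (rule nn_integral_cmult) measurable
      also have "\<dots> \<le> ennreal (1 / c powr t) * ennreal (c powr t)" by (intro mult_left_mono that) auto
      also have "\<dots> = 1" using that by (simp flip: ennreal_mult)
      finally show ?thesis .
    qed
    have "(\<integral>\<^sup>+x. ennreal (h x) * (\<integral>\<^sup>+y. ennreal (K (x - y)) * ennreal (f y) \<partial>lborel) \<partial>lborel)
       = (\<integral>\<^sup>+x. ennreal (a * b) * (ennreal (h x / b) * (\<integral>\<^sup>+y. ennreal (K (x - y)) * ennreal (f y / a) \<partial>lborel)) \<partial>lborel)"
    proof (intro nn_integral_cong)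
      fix x
      have "(\<integral>\<^sup>+y. ennreal (K (x - y)) * ennreal (f y) \<partial>lborel) = (\<integral>\<^sup>+y. ennreal a * (ennreal (K (x - y)) * ennreal (f y / a)) \<partial>lborel)"
        using ab nn fh by (intro nn_integral_cong) (simp flip: ennreal_mult)
      also have "\<dots> = ennreal a * (\<integral>\<^sup>+y. ennreal (K (x - y)) * ennreal (f y / a) \<partial>lborel)" by (rule nn_integral_cmult) measurable
      finally have e: "(\<integral>\<^sup>+y. ennreal (K (x - y)) * ennreal (f y) \<partial>lborel) = ennreal a * (\<integral>\<^sup>+y. ennreal (K (x - y)) * ennreal (f y / a) \<partial>lborel)" .
      have "ennreal (h x) = ennreal b * ennreal (h x / b)" using ab fh by (simp flip: ennreal_mult)
      then show "ennreal (h x) * (\<integral>\<^sup>+y. ennreal (K (x - y)) * ennreal (f y) \<partial>lborel) =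
         ennreal (a * b) * (ennreal (h x / b) * (\<integral>\<^sup>+y. ennreal (K (x - y)) * ennreal (f y / a) \<partial>lborel))"
        unfolding e using ab by (simp add: ennreal_mult mult_ac)
    qed
    also have "\<dots> = ennreal (a * b) * (\<integral>\<^sup>+x. (ennreal (h x / b) * (\<integral>\<^sup>+y. ennreal (K (x - y)) * ennreal (f y / a) \<partial>lborel)) \<partial>lborel)"
      by (rule nn_integral_cmult) measurable
    also have "\<dots> \<le> ennreal (a * b) * ennreal D"
      using ab fh by (intro mult_left_mono unit n) auto
    also have "\<dots> = ennreal (D * a * b)" using ab D by (simp add: mult_ac flip: ennreal_mult)
    finally show ?thesis .
  qed
  show ?thesis
  proof (intro exI[of _ D] conjI ballI impI D)
    fix f :: "'a \<Rightarrow> real" assume f[measurable]: "f \<in> borel_measurable borel" and f0: "\<forall>y. 0 \<le> f y"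
    define Tf where "Tf x = (\<integral>\<^sup>+y. ennreal (K (x - y)) * ennreal (f y) \<partial>lborel)" for x
    have [measurable]: "Tf \<in> borel_measurable borel" unfolding Tf_def by measurable
    define n where "n = enn_Lp_norm v lborel (\<lambda>y. ennreal (f y))"
    have nv: "ennreal_powr n v = (\<integral>\<^sup>+y. ennreal (f y powr v) \<partial>lborel)"
      unfolding n_def using v f0 by (simp add: enn_Lp_norm_powr ennreal_powr_ennreal)
    have "enn_Lp_norm u lborel Tf \<le> ennreal D * n"
    proof -
      consider "n = top" | "n = 0" | a where "n = ennreal a" "0 < a"
        by (cases n) (auto simp: less_eq_real_def)
      then show ?thesis
      proof cases
        case 1 then show ?thesis using D by (simp add: ennreal_mult_top)
      next
        case 2
        then have "(\<integral>\<^sup>+y. ennreal (f y powr v) \<partial>lborel) = 0" using nv by simp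
        then have "AE y in lborel. f y = 0" by (subst (asm) nn_integral_0_iff_AE) (auto simp: ennreal_eq_0_iff powr_def split: if_splits)
        then have "Tf x = (\<integral>\<^sup>+(y::'a). 0 \<partial>lborel)" for x unfolding Tf_def by - (rule nn_integral_cong_AE, auto)
        then show ?thesis by (simp add: enn_Lp_norm_def)
      next
        case 3
        have fa: "(\<integral>\<^sup>+y. ennreal (f y powr v) \<partial>lborel) \<le> ennreal (a powr v)"
          using nv 3 by (simp add: ennreal_powr_ennreal)
        \<comment> \<open>The test function must have a finite u-norm beforehand, so that a power of
          this norm can be divided out below; cutting the convolution in height and in support
          ensures this.\<close>
        define g where "g N x = enn2real (min (Tf x) (of_nat N)) * indicator (ball 0 (real N)) x" for N :: nat and x
        have [measurable]: "ball (0::'a) r \<in> sets borel" for r by simp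
        have [measurable]: "g N \<in> borel_measurable borel" for N
          unfolding g_def by (intro borel_measurable_times borel_measurable_indicator) measurable
        have g0: "0 \<le> g N x" for N x by (simp add: g_def)
        have mfin: "min (Tf x) (of_nat N) < top" for x and N :: nat
          by (rule le_less_trans[OF min.cobounded2]) (simp add: ennreal_of_nat_eq_real_of_nat)
        have gT: "ennreal (g N x) \<le> Tf x" for N x
        proof -
          have "ennreal (g N x) \<le> ennreal (enn2real (min (Tf x) (of_nat N)))"
            by (simp add: g_def indicator_def)
          also have "\<dots> = min (Tf x) (of_nat N)" using mfin by (rule ennreal_enn2real)
          also have "\<dots> \<le> Tf x" by (rule min.cobounded1)
          finally show ?thesis .
        qed
        have gN: "g N x \<le> real N * indicator (ball 0 (real N)) x" for N x
        proof -
          have "enn2real (min (Tf x) (of_nat N)) \<le> enn2real (of_nat N)"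
            by (intro enn2real_mono) (auto simp: ennreal_of_nat_eq_real_of_nat)
          then show ?thesis by (auto simp: g_def indicator_def ennreal_of_nat_eq_real_of_nat)
        qed
        have bd: "(\<integral>\<^sup>+x. ennreal (g N x powr u) \<partial>lborel) \<le> ennreal ((D * a) powr u)" for N
        proof -
          define I where "I = (\<integral>\<^sup>+x. ennreal (g N x powr u) \<partial>lborel)"
          have "I \<le> (\<integral>\<^sup>+(x::'a). ennreal (real N powr u) * indicator (ball 0 (real N)) x \<partial>lborel)"
            unfolding I_def
          proof (intro nn_integral_mono)
            fix x :: 'a show "ennreal (g N x powr u) \<le> ennreal (real N powr u) * indicator (ball 0 (real N)) x"
              using gN[of N x] g0[of N x] u1 by (auto simp: indicator_def intro!: ennreal_leI powr_mono2 split: if_splits)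
          qed
          also have "\<dots> < top"
            using emeasure_lborel_ball_finite[of "0::'a" "real N"] by (simp add: nn_integral_cmult ennreal_mult_less_top)
          finally have "I < top" .
          then obtain i where i: "I = ennreal i" "0 \<le> i" by (cases I) auto
          show ?thesis
          proof (cases "i = 0")
            case True then show ?thesis using i by (simp add: I_def)
          next
            case False
            then have ip: "0 < i" using i by simp
            \<comment> \<open>Since g \<le> Tf, the integral i of g^u is at most that of g^(u-1) Tf.
              The w-norm of g^(u-1) is i^(1/w), so the bilinear bound reads i \<le> D a i^(1/w),
              that is, i^(1/u) \<le> D a.\<close>
            have "I \<le> (\<integral>\<^sup>+x. ennreal (g N x powr (u - 1)) * Tf x \<partial>lborel)"
              unfolding I_def
            proof (intro nn_integral_mono)
              fix x
              have "ennreal (g N x powr u) = ennreal (g N x powr (u - 1)) * ennreal (g N x)"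
              proof (cases "g N x = 0")
                case False
                have "g N x powr u = g N x powr (u - 1) * g N x"
                  using powr_mult_base[of "g N x" "u - 1"] g0[of N x] by (simp add: mult.commute)
                then show ?thesis using g0[of N x] by (simp add: ennreal_mult)
              qed auto
              then show "ennreal (g N x powr u) \<le> ennreal (g N x powr (u - 1)) * Tf x"
                using gT by (simp add: mult_left_mono)
            qed
            also have "\<dots> \<le> ennreal (D * a * i powr (1 / w))"
              unfolding Tf_def
            proof (rule scaled)
              have "(u - 1) * w = u" using u1 by (simp add: w_def)
              then show "(\<integral>\<^sup>+x. ennreal ((g N x powr (u - 1)) powr w) \<partial>lborel) \<le> ennreal ((i powr (1 / w)) powr w)"
                using i w by (simp add: powr_powr I_def)
            qed (use f0 fa 3 ip in auto)
            finally have le: "i \<le> D * a * i powr (1 / w)" using D 3 i by (simp add: ennreal_le_iff)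
            have "i = i powr (1 / u + 1 / w)" using ip unfolding w(2) by simp
            then have "i = i powr (1 / u) * i powr (1 / w)" by (simp only: powr_add)
            then have "i powr (1 / u) * i powr (1 / w) \<le> (D * a) * i powr (1 / w)" using le by simp
            then have "i powr (1 / u) \<le> D * a" using ip by simp
            then have "(i powr (1 / u)) powr u \<le> (D * a) powr u" using u by (intro powr_mono2) auto
            then have "i \<le> (D * a) powr u" using u(1) ip by (simp add: powr_powr)
            then show ?thesis using i by (simp add: I_def[symmetric] ennreal_leI)
          qed
        qed
        \<comment> \<open>Prepares Fatou's lemma: the truncations recover Tf at every point,
          infinite values included.\<close>
        have lim: "ennreal_powr (Tf x) u \<le> liminf (\<lambda>N. ennreal (g N x powr u))" for x
        proof -
          have "eventually (\<lambda>N. norm x < real N) sequentially" using filterlim_real_sequentially by (simp add: filterlim_at_top_dense)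
          then have ev: "eventually (\<lambda>N. g N x = enn2real (min (Tf x) (of_nat N))) sequentially"
            by eventually_elim (simp add: g_def)
          show ?thesis
          proof (cases "Tf x")
            case (real t)
            have "eventually (\<lambda>N. t < real N) sequentially" using filterlim_real_sequentially by (simp add: filterlim_at_top_dense)
            with ev have "eventually (\<lambda>N. ennreal_powr (Tf x) u \<le> ennreal (g N x powr u)) sequentially"
            proof eventually_elim
              case (elim N)
              then have "min (Tf x) (of_nat N) = ennreal t"
                using real by (simp add: ennreal_of_nat_eq_real_of_nat min_def)
              then show ?case using elim real by (simp add: ennreal_powr_ennreal)
            qed
            then show ?thesis by (rule Liminf_bounded)
          next
            case top
            have "c \<le> liminf (\<lambda>N. ennreal (g N x powr u))" if "c < top" for c
            proof -
              obtain d where d: "c = ennreal d" "0 \<le> d" using \<open>c < top\<close> by (cases c) auto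
              have "eventually (\<lambda>N. d powr (1 / u) \<le> real N) sequentially" using filterlim_real_sequentially by (simp add: filterlim_at_top)
              with ev have "eventually (\<lambda>N. c \<le> ennreal (g N x powr u)) sequentially"
              proof eventually_elim
                case (elim N)
                then have "g N x = real N" using top by (simp add: ennreal_of_nat_eq_real_of_nat)
                moreover have "(d powr (1 / u)) powr u \<le> real N powr u" using elim u by (intro powr_mono2) auto
                ultimately show ?case using d u(1) by (simp add: powr_powr ennreal_leI)
              qed
              then show ?thesis by (rule Liminf_bounded)
            qed
            then show ?thesis using top by (metis dense_le top_greatest ennreal_powr_top)
          qed
        qed
        have "(\<integral>\<^sup>+x. ennreal_powr (Tf x) u \<partial>lborel) \<le> (\<integral>\<^sup>+x. liminf (\<lambda>N. ennreal (g N x powr u)) \<partial>lborel)"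
          by (intro nn_integral_mono lim)
        also have "\<dots> \<le> liminf (\<lambda>N. \<integral>\<^sup>+x. ennreal (g N x powr u) \<partial>lborel)"
          by (rule nn_integral_liminf) measurable
        also have "\<dots> \<le> ennreal ((D * a) powr u)"
          by (rule Liminf_le) (use bd in auto)
        finally have "enn_Lp_norm u lborel Tf \<le> ennreal (D * a)"
          using u D 3 by (intro enn_Lp_norm_leI) (auto simp: ennreal_powr_ennreal)
        then show ?thesis using 3 D by (simp add: ennreal_mult)
      qed
    qed
    then show "enn_Lp_norm u lborel (\<lambda>x. \<integral>\<^sup>+y. ennreal (K (x - y)) * ennreal (f y) \<partial>lborel)
      \<le> ennreal D * enn_Lp_norm v lborel (\<lambda>y. ennreal (f y))"
      by (simp add: Tf_def[abs_def] n_def)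
  qed
qed

section \<open>Matrix exponentials and dilations\<close>

lemma matrix_power_0: "matrix_power P 0 = mat 1"
  by (simp add: matrix_power_def)

lemma matrix_power_Suc: "matrix_power P (Suc k) = P ** matrix_power P k"
  by (simp add: matrix_power_def)

lemma matrix_power_Suc2: "matrix_power P (Suc k) = matrix_power P k ** P"
  proof (induction k)
  case (Suc k)
  have "matrix_power P (Suc (Suc k)) = P ** (matrix_power P k ** P)" using Suc by (simp add: matrix_power_Suc)
  then show ?case by (simp add: matrix_power_Suc matrix_mul_assoc)
qed (simp add: matrix_power_0 matrix_power_Suc)

lemma matrix_power_scaleR: "matrix_power (s *\<^sub>R P) k = s ^ k *\<^sub>R matrix_power P k"
  by (induction k) (simp_all add: matrix_power_0 matrix_power_Suc vec_eq_iff matrix_matrix_mult_def sum_distrib_left mult_ac)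

text \<open>Each multiplication costs a factor of the dimension times the norm of P. The bound is
  crude, but it dominates the entries of the exponential by a scalar exponential series.\<close>

lemma matrix_power_nth_le:
  fixes P :: "real^'n^'n"
  shows "\<bar>matrix_power P k $ i $ j\<bar> \<le> (real CARD('n) * norm P) ^ k"
proof (induction k arbitrary: i j)
  case 0
  show ?case by (simp add: matrix_power_0 mat_def)
next
  case (Suc k)
  have "\<bar>matrix_power P (Suc k) $ i $ j\<bar> \<le> (\<Sum>l\<in>UNIV. \<bar>P $ i $ l * matrix_power P k $ l $ j\<bar>)"
    by (simp add: matrix_power_Suc matrix_matrix_mult_def sum_abs)
  also have "\<dots> \<le> (\<Sum>l\<in>(UNIV::'n set). norm P * (real CARD('n) * norm P) ^ k)"
  proof (rule sum_mono)
    fix l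
    have "\<bar>P $ i $ l\<bar> \<le> norm P" using component_le_norm_cart[of "P $ i" l] Finite_Cartesian_Product.norm_nth_le[of P i] by simp
    then show "\<bar>P $ i $ l * matrix_power P k $ l $ j\<bar> \<le> norm P * (real CARD('n) * norm P) ^ k"
      using Suc by (simp add: abs_mult mult_mono)
  qed
  finally show ?case by (simp add: mult_ac)
qed

lemma summable_matrix_exp_nth:
  fixes P :: "real^'n^'n"
  shows "summable (\<lambda>k. matrix_power P k $ i $ j / fact k * s ^ k)"
proof (rule summable_comparison_test')
  show "summable (\<lambda>k. inverse (fact k) * (real CARD('n) * norm P * \<bar>s\<bar>) ^ k)"
    by (rule summable_exp)
  show "norm (matrix_power P k $ i $ j / fact k * s ^ k) \<le> inverse (fact k) * (real CARD('n) * norm P * \<bar>s\<bar>) ^ k" for k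
    using mult_right_mono[OF matrix_power_nth_le[of P k i j], of "\<bar>s\<bar> ^ k / fact k"]
    by (simp add: abs_mult power_abs power_mult_distrib field_simps)
qed

text \<open>Read entrywise, the exponential along the line s P is a scalar power series in s, so
  that termwise differentiation applies.\<close>

lemma matrix_exp_nth:
  fixes P :: "real^'n^'n"
  shows "matrix_exp (s *\<^sub>R P) $ i $ j = (\<Sum>k. matrix_power P k $ i $ j / fact k * s ^ k)"
proof -
  have "(\<lambda>k. (1 / fact k) *\<^sub>R matrix_power (s *\<^sub>R P) k) sums (\<chi> i j. \<Sum>k. matrix_power P k $ i $ j / fact k * s ^ k)"
    unfolding sums_def
  proof (intro vec_tendstoI)
    fix i j
    have "(\<lambda>k. matrix_power P k $ i $ j / fact k * s ^ k) sums (\<Sum>k. matrix_power P k $ i $ j / fact k * s ^ k)"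
      by (rule summable_sums[OF summable_matrix_exp_nth])
    then show "(\<lambda>n. (\<Sum>k<n. (1 / fact k) *\<^sub>R matrix_power (s *\<^sub>R P) k) $ i $ j) \<longlonglongrightarrow> (\<chi> i j. \<Sum>k. matrix_power P k $ i $ j / fact k * s ^ k) $ i $ j"
      by (simp add: sums_def matrix_power_scaleR mult_ac)
  qed
  then show ?thesis by (simp add: matrix_exp_def sums_iff)
qed

lemma matrix_exp_has_field_derivative_aux:
  fixes P :: "real^'n^'n"
  shows "((\<lambda>s. matrix_exp (s *\<^sub>R P) $ i $ j) has_field_derivative (\<Sum>k. matrix_power P (Suc k) $ i $ j / fact k * s ^ k)) (at s)"
proof -
  let ?c = "\<lambda>k. matrix_power P k $ i $ j / fact k"
  have "diffs ?c k = matrix_power P (Suc k) $ i $ j / fact k" for k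
    by (simp add: diffs_def field_simps del: of_nat_Suc)
  then show ?thesis
    unfolding matrix_exp_nth
    using termdiffs_strong_converges_everywhere[of ?c s, OF summable_matrix_exp_nth] by simp
qed

text \<open>Both orders of the product are recorded: the cancellation in
  \<open>matrix_exp_minus_add\<close> has P on the right of one exponential and on the left of the
  other.\<close>

lemma matrix_exp_has_field_derivative:
  fixes P :: "real^'n^'n"
  shows "((\<lambda>s. matrix_exp (s *\<^sub>R P) $ i $ j) has_field_derivative (P ** matrix_exp (s *\<^sub>R P)) $ i $ j) (at s)"
    and "((\<lambda>s. matrix_exp (s *\<^sub>R P) $ i $ j) has_field_derivative (matrix_exp (s *\<^sub>R P) ** P) $ i $ j) (at s)"
proof -
  have "(P ** matrix_exp (s *\<^sub>R P)) $ i $ j = (\<Sum>l\<in>UNIV. (\<Sum>k. P $ i $ l * (matrix_power P k $ l $ j / fact k * s ^ k)))"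
    by (simp only: matrix_matrix_mult_def vec_lambda_beta matrix_exp_nth suminf_mult[OF summable_matrix_exp_nth])
  also have "\<dots> = (\<Sum>k. \<Sum>l\<in>UNIV. P $ i $ l * (matrix_power P k $ l $ j / fact k * s ^ k))"
    by (rule suminf_sum[symmetric]) (intro summable_mult summable_matrix_exp_nth)
  also have "\<dots> = (\<Sum>k. matrix_power P (Suc k) $ i $ j / fact k * s ^ k)"
    by (simp add: matrix_power_Suc matrix_matrix_mult_def sum_divide_distrib sum_distrib_right sum_distrib_left mult_ac)
  finally show "((\<lambda>s. matrix_exp (s *\<^sub>R P) $ i $ j) has_field_derivative (P ** matrix_exp (s *\<^sub>R P)) $ i $ j) (at s)"
    using matrix_exp_has_field_derivative_aux[of P i j s] by simp
  have "(matrix_exp (s *\<^sub>R P) ** P) $ i $ j = (\<Sum>l\<in>UNIV. (\<Sum>k. P $ l $ j * (matrix_power P k $ i $ l / fact k * s ^ k)))"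
    by (simp only: matrix_matrix_mult_def vec_lambda_beta matrix_exp_nth suminf_mult[OF summable_matrix_exp_nth] mult.commute[of _ "P $ _ $ j"])
  also have "\<dots> = (\<Sum>k. \<Sum>l\<in>UNIV. P $ l $ j * (matrix_power P k $ i $ l / fact k * s ^ k))"
    by (rule suminf_sum[symmetric]) (intro summable_mult summable_matrix_exp_nth)
  also have "\<dots> = (\<Sum>k. matrix_power P (Suc k) $ i $ j / fact k * s ^ k)"
    by (simp add: matrix_power_Suc2 matrix_matrix_mult_def sum_divide_distrib sum_distrib_right sum_distrib_left mult_ac)
  finally show "((\<lambda>s. matrix_exp (s *\<^sub>R P) $ i $ j) has_field_derivative (matrix_exp (s *\<^sub>R P) ** P) $ i $ j) (at s)"
    using matrix_exp_has_field_derivative_aux[of P i j s] by simp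
qed

lemma matrix_exp_0 [simp]: "matrix_exp (0 :: real^'n^'n) = mat 1"
proof -
  have "matrix_exp (0 *\<^sub>R (0 :: real^'n^'n)) $ i $ j = mat 1 $ i $ j" for i j
    unfolding matrix_exp_nth using powser_zero[of "\<lambda>k. matrix_power (0 :: real^'n^'n) k $ i $ j / fact k"]
    by (simp add: matrix_power_0)
  then show ?thesis by (simp add: vec_eq_iff)
qed

text \<open>The derivative in s is - exp(- s P) P exp((s + t) P) + exp(- s P) P exp((s + t) P) = 0,
  so the product keeps its value at s = 0. This single identity contains both the inverse (t = 0)
  and the group law.\<close>

lemma matrix_exp_minus_add:
  fixes P :: "real^'n^'n"
  shows "matrix_exp (- s *\<^sub>R P) ** matrix_exp ((s + t) *\<^sub>R P) = matrix_exp (t *\<^sub>R P)"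
proof -
  have "(matrix_exp (- s *\<^sub>R P) ** matrix_exp ((s + t) *\<^sub>R P)) $ i $ j = (matrix_exp (- 0 *\<^sub>R P) ** matrix_exp ((0 + t) *\<^sub>R P)) $ i $ j" for i j
  proof (rule DERIV_isconst_all[where f="\<lambda>s. (matrix_exp (- s *\<^sub>R P) ** matrix_exp ((s + t) *\<^sub>R P)) $ i $ j"], rule allI)
    fix s
    let ?A = "matrix_exp (- s *\<^sub>R P)" and ?B = "matrix_exp ((s + t) *\<^sub>R P)"
    have A: "((\<lambda>s. matrix_exp (- s *\<^sub>R P) $ i $ l) has_field_derivative (- (?A ** P) $ i $ l)) (at s)" for l
      by (rule DERIV_cong[OF DERIV_chain2[OF matrix_exp_has_field_derivative(2)]]) (auto intro!: derivative_eq_intros)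
    have B: "((\<lambda>s. matrix_exp ((s + t) *\<^sub>R P) $ l $ j) has_field_derivative ((P ** ?B) $ l $ j)) (at s)" for l
      by (rule DERIV_cong[OF DERIV_chain2[OF matrix_exp_has_field_derivative(1)]]) (auto intro!: derivative_eq_intros)
    have nth: "(M ** N) $ i $ j = (\<Sum>l\<in>UNIV. M $ i $ l * N $ l $ j)" for M N :: "real^'n^'n"
      by (simp add: matrix_matrix_mult_def)
    have "((\<lambda>s. \<Sum>l\<in>UNIV. matrix_exp (- s *\<^sub>R P) $ i $ l * matrix_exp ((s + t) *\<^sub>R P) $ l $ j) has_field_derivative
       (\<Sum>l\<in>UNIV. - (?A ** P) $ i $ l * ?B $ l $ j + (P ** ?B) $ l $ j * ?A $ i $ l)) (at s)"
      by (intro DERIV_sum DERIV_mult A B)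
    then have "((\<lambda>s. (matrix_exp (- s *\<^sub>R P) ** matrix_exp ((s + t) *\<^sub>R P)) $ i $ j) has_field_derivative
       (\<Sum>l\<in>UNIV. - (?A ** P) $ i $ l * ?B $ l $ j + (P ** ?B) $ l $ j * ?A $ i $ l)) (at s)"
      by (simp only: nth)
    moreover have "(\<Sum>l\<in>UNIV. - (?A ** P) $ i $ l * ?B $ l $ j + (P ** ?B) $ l $ j * ?A $ i $ l) = - ((?A ** P) ** ?B) $ i $ j + (?A ** (P ** ?B)) $ i $ j"
      unfolding nth[of "?A ** P"] nth[of ?A "P ** ?B"] by (simp add: sum_subtractf mult.commute)
    moreover have "\<dots> = 0" by (simp add: matrix_mul_assoc)
    ultimately show "((\<lambda>s. (matrix_exp (- s *\<^sub>R P) ** matrix_exp ((s + t) *\<^sub>R P)) $ i $ j) has_field_derivative 0) (at s)"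
      by simp
  qed
  then show ?thesis by (simp add: vec_eq_iff)
qed

lemma matrix_exp_add:
  fixes P :: "real^'n^'n"
  shows "matrix_exp ((s + t) *\<^sub>R P) = matrix_exp (s *\<^sub>R P) ** matrix_exp (t *\<^sub>R P)"
proof -
  have "matrix_exp (s *\<^sub>R P) ** matrix_exp (- s *\<^sub>R P) = mat 1"
    using matrix_exp_minus_add[of "- s" P 0] by simp
  then have "matrix_exp ((s + t) *\<^sub>R P) = (matrix_exp (s *\<^sub>R P) ** matrix_exp (- s *\<^sub>R P)) ** matrix_exp ((s + t) *\<^sub>R P)"
    by simp
  then show ?thesis by (simp only: matrix_mul_assoc[symmetric] matrix_exp_minus_add)
qed

lemma dilation_mult:
  "0 < s \<Longrightarrow> 0 < t \<Longrightarrow> dilation P s (dilation P t x) = dilation P (s * t) x"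
  by (simp add: dilation_def ln_mult matrix_exp_add matrix_vector_mul_assoc)

lemma dilation_1 [simp]: "dilation P 1 x = x"
  by (simp add: dilation_def)

lemma dilation_inverse:
  "0 < t \<Longrightarrow> dilation P t (dilation P (1 / t) x) = x" "0 < t \<Longrightarrow> dilation P (1 / t) (dilation P t x) = x"
  by (simp_all add: dilation_mult)

lemma continuous_on_dilation: "continuous_on {0<..} (\<lambda>t. dilation P t x)"
proof -
  have "continuous_on UNIV (\<lambda>s. matrix_exp (s *\<^sub>R P) $ i $ j)" for i j
    by (rule DERIV_continuous_on) (rule has_field_derivative_at_within[OF matrix_exp_has_field_derivative(1)])
  then have "continuous_on {0<..} (\<lambda>t. matrix_exp (ln t *\<^sub>R P) $ i $ j)" for i j
    by (rule continuous_on_compose2) (auto intro!: continuous_intros)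
  then show ?thesis
    unfolding dilation_def matrix_vector_mult_def
    by (intro continuous_on_vec_lambda continuous_on_sum continuous_on_mult continuous_on_const) auto
qed

text \<open>For t in a compact interval away from 0 the entries of exp(ln t P) are bounded by B,
  those of their derivatives in ln t by D, and \<open>ln\<close> has Lipschitz constant 1 / a. The
  increment of t is weighted by the norm of y because the difference of the two matrices acts on
  y.\<close>

lemma dilation_Lipschitz:
  fixes P :: "real^'n^'n"
  assumes "0 < a"
  shows "\<exists>L\<ge>0. \<forall>s\<in>{a..b}. \<forall>t\<in>{a..b}. \<forall>x y. norm (dilation P s x - dilation P t y) \<le> L * (norm (x - y) + \<bar>s - t\<bar> * norm y)"
proof -
  let ?M = "\<lambda>s. matrix_exp (s *\<^sub>R P)"
  have cont: "continuous_on UNIV (\<lambda>s. ?M s $ i $ j)" for i j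
    by (rule DERIV_continuous_on) (rule has_field_derivative_at_within[OF matrix_exp_has_field_derivative(1)])
  have bound: "\<exists>D\<ge>0. \<forall>i j. \<forall>s\<in>{ln a..ln b}. \<bar>g i j s\<bar> \<le> D"
    if g: "\<And>i j. continuous_on UNIV (g i j)" for g :: "'n \<Rightarrow> 'n \<Rightarrow> real \<Rightarrow> real"
  proof -
    have "\<exists>B. \<forall>s\<in>{ln a..ln b}. norm (g i j s) \<le> B" for i j
      using compact_continuous_image[OF continuous_on_subset[OF g[of i j]], of "{ln a..ln b}"] compact_imp_bounded bounded_iff by (metis compact_Icc imageI subset_UNIV)
    then obtain B' where B': "\<And>i j s. s \<in> {ln a..ln b} \<Longrightarrow> norm (g i j s) \<le> B' i j" by metis
    define D where "D = (\<Sum>i\<in>UNIV. \<Sum>j\<in>UNIV. \<bar>B' i j\<bar>)"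
    have D: "\<bar>B' i j\<bar> \<le> D" for i j
    proof -
      have "\<bar>B' i j\<bar> \<le> (\<Sum>j\<in>UNIV. \<bar>B' i j\<bar>)" by (rule member_le_sum) auto
      also have "\<dots> \<le> D" unfolding D_def by (rule member_le_sum[where f="\<lambda>i. \<Sum>j\<in>UNIV. \<bar>B' i j\<bar>"]) (auto intro: sum_nonneg)
      finally show ?thesis .
    qed
    have "\<bar>g i j s\<bar> \<le> D" if "s \<in> {ln a..ln b}" for i j s using B'[OF that, of i j] D[of i j] by simp
    moreover have "0 \<le> D" by (simp add: D_def sum_nonneg)
    ultimately show ?thesis by blast
  qed
  have cont': "continuous_on UNIV (\<lambda>s. (P ** ?M s) $ i $ j)" for i j
    by (simp only: matrix_matrix_mult_def vec_lambda_beta) (intro continuous_on_sum continuous_on_mult continuous_on_const cont)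
  obtain B where B: "\<And>i j s. s \<in> {ln a..ln b} \<Longrightarrow> \<bar>?M s $ i $ j\<bar> \<le> B" and B0: "0 \<le> B"
    using bound[of "\<lambda>i j s. ?M s $ i $ j", OF cont] by blast
  obtain D where D: "\<And>i j s. s \<in> {ln a..ln b} \<Longrightarrow> \<bar>(P ** ?M s) $ i $ j\<bar> \<le> D" and D0: "0 \<le> D"
    using bound[of "\<lambda>i j s. (P ** ?M s) $ i $ j", OF cont'] by blast
  let ?n = "real CARD('n)"
  have lip: "\<bar>(?M s - ?M t) $ i $ j\<bar> \<le> D * \<bar>s - t\<bar>" if "s \<in> {ln a..ln b}" "t \<in> {ln a..ln b}" for s t i j
  proof -
    have "norm (?M s $ i $ j - ?M t $ i $ j) \<le> D * norm (s - t)"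
    proof (rule field_differentiable_bound[of "{ln a..ln b}"])
      fix z assume z: "z \<in> {ln a..ln b}"
      show "((\<lambda>s. ?M s $ i $ j) has_field_derivative (P ** ?M z) $ i $ j) (at z within {ln a..ln b})"
        by (rule has_field_derivative_at_within[OF matrix_exp_has_field_derivative(1)])
      show "norm ((P ** ?M z) $ i $ j) \<le> D" using D[OF z, of i j] by simp
    qed (use that in auto)
    then show ?thesis by simp
  qed
  have mv: "norm (A *v x) \<le> ?n * ?n * c * norm x" if "\<And>i j. \<bar>A $ i $ j\<bar> \<le> c" for A :: "real^'n^'n" and x c
  proof -
    \<comment> \<open>Any one index shows that the bound on absolute values of entries is
      nonnegative.\<close>
    have c: "0 \<le> c" using that[of undefined undefined] by linarith
    have "norm (A *v x) \<le> (\<Sum>i\<in>UNIV. \<bar>(A *v x) $ i\<bar>)" by (rule norm_le_l1_cart)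
    also have "\<dots> \<le> (\<Sum>i\<in>(UNIV::'n set). \<Sum>j\<in>(UNIV::'n set). c * norm x)"
    proof (rule sum_mono)
      fix i
      have "\<bar>(A *v x) $ i\<bar> \<le> (\<Sum>j\<in>UNIV. \<bar>A $ i $ j * x $ j\<bar>)"
        unfolding matrix_vector_mult_def by (simp add: sum_abs)
      also have "\<dots> \<le> (\<Sum>j\<in>(UNIV::'n set). c * norm x)"
        using that component_le_norm_cart c by (intro sum_mono) (auto simp: abs_mult intro!: mult_mono)
      finally show "\<bar>(A *v x) $ i\<bar> \<le> (\<Sum>j\<in>(UNIV::'n set). c * norm x)" .
    qed
    finally show ?thesis by (simp add: mult_ac)
  qed
  define L where "L = ?n * ?n * B + ?n * ?n * D / a"
  show ?thesis
  proof (intro exI[of _ L] conjI ballI allI)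
    show "0 \<le> L" using B0 D0 assms by (simp add: L_def)
    fix s t and x y :: "real^'n" assume st: "s \<in> {a..b}" "t \<in> {a..b}"
    then have l: "ln s \<in> {ln a..ln b}" "ln t \<in> {ln a..ln b}" using assms by auto
    have lnlip: "\<bar>ln s - ln t\<bar> \<le> \<bar>s - t\<bar> / a"
    proof -
      have *: "ln q - ln r \<le> (q - r) / a" if "a \<le> r" "r \<le> q" for q r
      proof -
        have "ln q - ln r \<le> (q - r) / r" using that assms ln_diff_le[of q r] by simp
        also have "\<dots> \<le> (q - r) / a" using that assms by (intro divide_left_mono) auto
        finally show ?thesis .
      qed
      show ?thesis
        using *[of s t] *[of t s] st assms ln_le_cancel_iff[of s t] ln_le_cancel_iff[of t s] by (cases "s \<le> t") (auto simp: abs_if)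
    qed
    have "dilation P s x - dilation P t y = ?M (ln s) *v (x - y) + (?M (ln s) - ?M (ln t)) *v y"
      by (simp add: dilation_def matrix_vector_mult_diff_distrib matrix_vector_mult_diff_rdistrib)
    then have "norm (dilation P s x - dilation P t y) \<le> norm (?M (ln s) *v (x - y)) + norm ((?M (ln s) - ?M (ln t)) *v y)"
      by (simp add: norm_triangle_ineq)
    also have "\<dots> \<le> ?n * ?n * B * norm (x - y) + ?n * ?n * (D * (\<bar>s - t\<bar> / a)) * norm y"
    proof (intro add_mono mv)
      fix i j
      show "\<bar>?M (ln s) $ i $ j\<bar> \<le> B"
        using B[OF l(1)] by simp
      show "\<bar>(?M (ln s) - ?M (ln t)) $ i $ j\<bar> \<le> D * (\<bar>s - t\<bar> / a)"
        using lip[OF l, of i j] mult_left_mono[OF lnlip D0] by linarith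
    qed
    also have "\<dots> \<le> L * (norm (x - y) + \<bar>s - t\<bar> * norm y)"
      using B0 D0 assms by (simp add: L_def algebra_simps)
    finally show "norm (dilation P s x - dilation P t y) \<le> L * (norm (x - y) + \<bar>s - t\<bar> * norm y)" .
  qed
qed

section \<open>Homogeneous quasi-norms\<close>

text \<open>Cover S by nonoverlapping cubes inside an open set U of almost the same measure. The
  part of S in a cube of side l has its image within a cube of side 2 L n l, where n is the
  dimension, and summation gives the constant. Coverings are used because \<phi> may fail to be
  injective; a measurable F inside the image is measured because the image itself may fail to be
  measurable.\<close>

lemma emeasure_subset_Lipschitz_image:
  fixes \<phi> :: "'a::euclidean_space \<Rightarrow> 'b::euclidean_space"
  assumes dim: "DIM('b) = DIM('a)" and S: "S \<in> sets lebesgue" "bounded S"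
    and L: "0 \<le> L" "\<And>x y. x \<in> S \<Longrightarrow> y \<in> S \<Longrightarrow> norm (\<phi> x - \<phi> y) \<le> L * norm (x - y)"
    and F: "F \<in> sets lebesgue" "F \<subseteq> \<phi> ` S"
  shows "emeasure lebesgue F \<le> ennreal ((2 * L * DIM('a)) ^ DIM('a)) * emeasure lebesgue S"
proof -
  let ?C = "(2 * L * DIM('a)) ^ DIM('a)"
  have C0: "0 \<le> ?C" using L by simp
  have eps: "emeasure lebesgue F \<le> ennreal ?C * (emeasure lebesgue S + ennreal e)" if e: "0 < e" for e :: real
  proof -
    obtain U where U: "open U" "S \<subseteq> U" "U - S \<in> lmeasurable" "emeasure lebesgue (U - S) < ennreal e"
      using sets_lebesgue_outer_open[OF S(1) e] by blast
    have Usets: "U \<in> sets lebesgue" using U(1) by simp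
    obtain R where R: "0 < R" "\<And>x. x \<in> S \<Longrightarrow> norm x \<le> R" using S(2) by (meson bounded_pos)
    let ?a = "- (R *\<^sub>R One) :: 'a" and ?b = "R *\<^sub>R One :: 'a"
    have "S \<subseteq> cbox ?a ?b"
    proof
      fix x assume "x \<in> S"
      then have "\<bar>x \<bullet> i\<bar> \<le> R" if "i \<in> Basis" for i using Basis_le_norm[OF that, of x] R(2) by fastforce
      then show "x \<in> cbox ?a ?b" by (auto simp: mem_box abs_le_iff) (smt (verit))+
    qed
    moreover have "box ?a ?b \<noteq> {}" using R by (auto simp: box_ne_empty)
    \<comment> \<open>The gauge is U on the points of U, so each cube of the covering, tagged by a
      point of S, lies in U.\<close>
    moreover have "gauge (\<lambda>x. if x \<in> U then U else UNIV)" using U(1) by (auto simp: gauge_def)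
    ultimately obtain D where D: "countable D" "\<And>K. K \<in> D \<Longrightarrow> interior K \<noteq> {} \<and> (\<exists>c d. K = cbox c d)"
      "pairwise (\<lambda>A B. interior A \<inter> interior B = {}) D"
      "\<And>K. K \<in> D \<Longrightarrow> \<exists>x \<in> S \<inter> K. K \<subseteq> (if x \<in> U then U else UNIV)"
      "\<And>u v. cbox u v \<in> D \<Longrightarrow> \<exists>n. \<forall>i \<in> Basis. v \<bullet> i - u \<bullet> i = (?b \<bullet> i - ?a \<bullet> i) / 2^n"
      "S \<subseteq> \<Union>D"
      by (rule covering_lemma) blast
    have KU: "K \<subseteq> U" if "K \<in> D" for K using D(4)[OF that] U(2) by fastforce
    have "\<exists>Q. Q \<in> sets lborel \<and> \<phi> ` (S \<inter> K) \<subseteq> Q \<and> emeasure lborel Q \<le> ennreal ?C * emeasure lborel (interior K)" if K: "K \<in> D" for K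
    proof -
      obtain c d where cd: "K = cbox c d" using D(2)[OF K] by blast
      obtain n where n: "\<forall>i \<in> Basis. d \<bullet> i - c \<bullet> i = (?b \<bullet> i - ?a \<bullet> i) / 2^n" using D(5) K cd by blast
      define l where "l = 2 * R / 2 ^ n"
      have l: "0 < l" "\<And>i. i \<in> Basis \<Longrightarrow> d \<bullet> i - c \<bullet> i = l" using R n by (auto simp: l_def)
      obtain x where x: "x \<in> S" "x \<in> K" using D(4)[OF K] by blast
      \<comment> \<open>The Euclidean norm is at most the sum of the absolute coordinates, each at
        most l in the cube; hence the factor of the dimension.\<close>
      define r where "r = L * (DIM('a) * l)"
      have r: "0 \<le> r" using L l by (simp add: r_def)
      have near: "norm (\<phi> y - \<phi> x) \<le> r" if "y \<in> S" "y \<in> K" for y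
      proof -
        have "norm (y - x) \<le> (\<Sum>i\<in>Basis. \<bar>(y - x) \<bullet> i\<bar>)" by (rule norm_le_l1)
        also have "\<dots> \<le> (\<Sum>i\<in>(Basis::'a set). l)"
        proof (rule sum_mono)
          fix i :: 'a assume i: "i \<in> Basis"
          then have "c \<bullet> i \<le> y \<bullet> i" "y \<bullet> i \<le> d \<bullet> i" "c \<bullet> i \<le> x \<bullet> i" "x \<bullet> i \<le> d \<bullet> i"
            using that x cd by (auto simp: mem_box)
          then show "\<bar>(y - x) \<bullet> i\<bar> \<le> l" using l(2)[OF i] by (auto simp: inner_diff_left)
        qed
        finally have "L * norm (y - x) \<le> r" unfolding r_def using L by (intro mult_left_mono) auto
        then show ?thesis using L(2)[OF that(1) x(1)] by linarith
      qed
      let ?u = "\<phi> x - r *\<^sub>R One" and ?v = "\<phi> x + r *\<^sub>R One"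
      have "\<phi> ` (S \<inter> K) \<subseteq> cbox ?u ?v"
      proof (rule image_subsetI)
        fix y assume "y \<in> S \<inter> K"
        then have "\<bar>(\<phi> y - \<phi> x) \<bullet> i\<bar> \<le> r" if "i \<in> Basis" for i using near[of y] Basis_le_norm[OF that, of "\<phi> y - \<phi> x"] by auto
        then show "\<phi> y \<in> cbox ?u ?v"
          by (auto simp: mem_box inner_diff_left inner_add_left abs_le_iff) (smt (verit))+
      qed
      moreover have "emeasure lborel (cbox ?u ?v) = ennreal ((2 * r) ^ DIM('a))"
        using r dim by (simp add: emeasure_lborel_cbox_eq inner_diff_left inner_add_left flip: dim)
      moreover have "emeasure lborel (interior K) = ennreal (l ^ DIM('a))"
      proof -
        have "\<forall>b\<in>Basis. c \<bullet> b \<le> d \<bullet> b" using l by (smt (verit))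
        then show ?thesis using l by (simp add: cd interior_cbox emeasure_lborel_box_eq inner_diff_left)
      qed
      moreover have "(2 * r) ^ DIM('a) = ?C * l ^ DIM('a)" by (simp add: r_def power_mult_distrib[symmetric] mult_ac)
      ultimately show ?thesis
        using C0 l by (intro exI[of _ "cbox ?u ?v"]) (auto simp: ennreal_mult)
    qed
    then obtain Q where Q: "\<And>K. K \<in> D \<Longrightarrow> Q K \<in> sets lborel" "\<And>K. K \<in> D \<Longrightarrow> \<phi> ` (S \<inter> K) \<subseteq> Q K"
      "\<And>K. K \<in> D \<Longrightarrow> emeasure lborel (Q K) \<le> ennreal ?C * emeasure lborel (interior K)" by metis
    \<comment> \<open>D is countable but may be finite; indices outside I get the empty set, so that
      the sums below run over all natural numbers.\<close>
    define I where "I = to_nat_on D ` D"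
    define A where "A n = (if n \<in> I then from_nat_into D n else {})" for n
    define B where "B n = (if n \<in> I then Q (A n) else {})" for n
    have AD: "A n \<in> D" if "n \<in> I" for n using that D(1) by (auto simp: A_def I_def)
    have surj: "\<exists>n\<in>I. A n = K" if "K \<in> D" for K using that D(1) by (auto simp: A_def I_def)
    have inj: "A n \<noteq> A m" if "n \<in> I" "m \<in> I" "n \<noteq> m" for n m using that D(1) by (auto simp: A_def I_def)
    have disj: "disjoint_family (\<lambda>n. interior (A n))"
      unfolding disjoint_family_on_def
    proof (intro ballI impI)
      fix m n :: nat assume "m \<noteq> n"
      show "interior (A m) \<inter> interior (A n) = {}"
      proof (cases "m \<in> I \<and> n \<in> I")
        case True
        then show ?thesis using D(3) AD inj[of m n] \<open>m \<noteq> n\<close> by (auto simp: pairwise_def)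
      qed (auto simp: A_def)
    qed
    have "F \<subseteq> (\<Union>n. B n)"
    proof
      fix z assume "z \<in> F"
      then obtain x where x: "x \<in> S" "z = \<phi> x" using F(2) by blast
      then obtain K where K: "K \<in> D" "x \<in> K" using D(6) by blast
      obtain n where "n \<in> I" "A n = K" using surj[OF K(1)] by blast
      then show "z \<in> (\<Union>n. B n)" using Q(2)[OF K(1)] x K by (auto simp: B_def)
    qed
    moreover have Bs: "B n \<in> sets lborel" for n using Q(1)[OF AD] by (auto simp: B_def)
    ultimately have "emeasure lebesgue F \<le> emeasure lebesgue (\<Union>n. B n)"
      by (intro emeasure_mono sets_completionI_sets sets.countable_UN) auto
    also have "\<dots> = emeasure lborel (\<Union>n. B n)"
    proof -
      have "(\<Union>n. B n) \<in> sets lborel" using Bs by (intro sets.countable_UN) auto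
      then show ?thesis by simp
    qed
    also have "\<dots> \<le> (\<Sum>n. emeasure lborel (B n))" using Bs by (intro emeasure_subadditive_countably) auto
    also have "\<dots> \<le> (\<Sum>n. ennreal ?C * emeasure lborel (interior (A n)))"
      using Q(3)[OF AD] by (intro suminf_le) (auto simp: B_def A_def)
    also have "\<dots> = ennreal ?C * emeasure lborel (\<Union>n. interior (A n))"
      using disj by (subst suminf_emeasure[symmetric]) auto
    also have "emeasure lborel (\<Union>n. interior (A n)) \<le> emeasure lborel U"
    proof (rule emeasure_mono)
      show "(\<Union>n. interior (A n)) \<subseteq> U"
      proof (rule UN_least)
        fix n show "interior (A n) \<subseteq> U"
          using KU[OF AD, of n] interior_subset[of "A n"] by (cases "n \<in> I") (auto simp: A_def)
      qed
    qed (use U(1) in auto)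
    also have "emeasure lborel U = emeasure lebesgue U" using U(1) by simp
    also have "\<dots> = emeasure lebesgue S + emeasure lebesgue (U - S)"
      using U(2) S(1) Usets by (subst plus_emeasure) (auto simp: Un_absorb1 fmeasurableD)
    also have "\<dots> \<le> emeasure lebesgue S + ennreal e" using U(4) by (intro add_left_mono) auto
    finally show ?thesis by (simp add: mult_left_mono)
  qed
  show ?thesis
  proof (rule ennreal_le_epsilon)
    fix e :: real assume e: "0 < e"
    define e' where "e' = e / (?C + 1)"
    have e': "0 < e'" "?C * e' \<le> e" using C0 e by (auto simp: e'_def field_simps add_pos_nonneg)
    have "emeasure lebesgue F \<le> ennreal ?C * (emeasure lebesgue S + ennreal e')" by (rule eps) fact
    also have "\<dots> = ennreal ?C * emeasure lebesgue S + ennreal (?C * e')" using C0 e' by (simp add: distrib_left ennreal_mult)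
    also have "\<dots> \<le> ennreal ?C * emeasure lebesgue S + ennreal e" using e' by (intro add_left_mono ennreal_leI)
    finally show "emeasure lebesgue F \<le> ennreal ?C * emeasure lebesgue S + ennreal e" .
  qed
qed

text \<open>Layer cake: an integral is the integral over t \<ge> 0 of the measures of the superlevel
  sets, so an inequality between these passes to the integrals, even for functions on different
  spaces.\<close>

lemma nn_integral_le_of_distribution_le:
  fixes f :: "'a \<Rightarrow> real" and g :: "'b \<Rightarrow> real"
  assumes "sigma_finite_measure M" "sigma_finite_measure N"
    and [measurable]: "f \<in> borel_measurable M" "g \<in> borel_measurable N"
    and nonneg: "\<And>x. 0 \<le> f x" "\<And>x. 0 \<le> g x"
    and le: "\<And>t. 0 \<le> t \<Longrightarrow> emeasure M {x \<in> space M. t < f x} \<le> C * emeasure N {x \<in> space N. t < g x}"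
  shows "(\<integral>\<^sup>+x. ennreal (f x) \<partial>M) \<le> C * (\<integral>\<^sup>+x. ennreal (g x) \<partial>N)"
proof -
  have layer: "(\<integral>\<^sup>+x. ennreal (f x) \<partial>M) = (\<integral>\<^sup>+t. indicator {0..} t * emeasure M {x \<in> space M. t < f x} \<partial>lborel)"
    if "sigma_finite_measure M" and [measurable]: "f \<in> borel_measurable M" and nonneg: "\<And>x. 0 \<le> f x"
    for M :: "'c measure" and f :: "'c \<Rightarrow> real"
  proof -
    interpret M: sigma_finite_measure M by fact
    interpret pair_sigma_finite M lborel ..
    have "(\<integral>\<^sup>+x. ennreal (f x) \<partial>M) = (\<integral>\<^sup>+x. (\<integral>\<^sup>+t. indicator {t. 0 \<le> t \<and> t < f x} t \<partial>lborel) \<partial>M)"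
    proof (intro nn_integral_cong)
      fix x
      have "{t. 0 \<le> t \<and> t < f x} = {0..<f x}" by auto
      then show "ennreal (f x) = (\<integral>\<^sup>+t. indicator {t. 0 \<le> t \<and> t < f x} t \<partial>lborel)"
        using nonneg[of x] by simp
    qed
    also have "\<dots> = (\<integral>\<^sup>+t. (\<integral>\<^sup>+x. indicator {t. 0 \<le> t \<and> t < f x} t \<partial>M) \<partial>lborel)"
      by (rule Fubini'[symmetric]) measurable
    also have "\<dots> = (\<integral>\<^sup>+t. indicator {0..} t * emeasure M {x \<in> space M. t < f x} \<partial>lborel)"
    proof (intro nn_integral_cong)
      fix t :: real
      have "(\<integral>\<^sup>+x. indicator {t. 0 \<le> t \<and> t < f x} t \<partial>M) = (\<integral>\<^sup>+x. indicator {0..} t * indicator {x \<in> space M. t < f x} x \<partial>M)"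
        by (intro nn_integral_cong) (auto simp: indicator_def)
      also have "\<dots> = indicator {0..} t * emeasure M {x \<in> space M. t < f x}"
        by (subst nn_integral_cmult) auto
      finally show "(\<integral>\<^sup>+x. indicator {t. 0 \<le> t \<and> t < f x} t \<partial>M) = indicator {0..} t * emeasure M {x \<in> space M. t < f x}" .
    qed
    finally show ?thesis .
  qed
  interpret N: sigma_finite_measure N by fact
  interpret NL: pair_sigma_finite N lborel ..
  have [measurable]: "(\<lambda>t. emeasure N {x \<in> space N. t < g x}) \<in> borel_measurable lborel"
  proof -
    have "(\<lambda>t. emeasure N {x \<in> space N. t < g x}) = (\<lambda>t. \<integral>\<^sup>+x. indicator {u. u < g x} t \<partial>N)"
    proof
      fix t
      have "(\<integral>\<^sup>+x. indicator {u. u < g x} t \<partial>N) = (\<integral>\<^sup>+x. indicator {x \<in> space N. t < g x} x \<partial>N)"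
        by (intro nn_integral_cong) (auto simp: indicator_def)
      then show "emeasure N {x \<in> space N. t < g x} = (\<integral>\<^sup>+x. indicator {u. u < g x} t \<partial>N)" by simp
    qed
    then show ?thesis by simp
  qed
  have "(\<integral>\<^sup>+x. ennreal (f x) \<partial>M) \<le> (\<integral>\<^sup>+t. C * (indicator {0..} t * emeasure N {x \<in> space N. t < g x}) \<partial>lborel)"
    unfolding layer[OF assms(1,3) nonneg(1)] using le by (intro nn_integral_mono) (auto simp: indicator_def)
  also have "\<dots> = C * (\<integral>\<^sup>+x. ennreal (g x) \<partial>N)"
    unfolding layer[OF assms(2,4) nonneg(2)] by (rule nn_integral_cmult) measurable
  finally show ?thesis .
qed

text \<open>What the integral estimates retain of a parabolic quasi-distance: the quasi-triangle
  inequality with k \<ge> 1, symmetry, and the volume \<upsilon> t^\<gamma> of {\<rho> < t}. That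
  \<rho> is bounded on balls and vanishes only at 0 are consequences of these volumes being finite
  and positive.\<close>

locale homogeneous_quasi_norm =
  fixes \<rho> :: "'a::euclidean_space \<Rightarrow> real" and k \<gamma> \<upsilon> :: real
  assumes measurable_rho [measurable]: "\<rho> \<in> borel_measurable borel"
    and nonneg [simp]: "0 \<le> \<rho> x" and zero [simp]: "\<rho> 0 = 0" and minus [simp]: "\<rho> (- x) = \<rho> x"
    and add_le: "\<rho> (x + y) \<le> k * (\<rho> x + \<rho> y)"
    and k_ge_1: "1 \<le> k" and gamma_pos: "0 < \<gamma>" and upsilon_pos: "0 < \<upsilon>"
    and emeasure_less: "0 < t \<Longrightarrow> emeasure lborel {x. \<rho> x < t} = ennreal (\<upsilon> * t powr \<gamma>)"
begin

text \<open>The sets {\<rho> < R} increase to the whole space, so their parts in a ball exhaust its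
  volume. The fraction 3/4 suits the packing argument in \<open>bounded_on_balls\<close>: two
  disjoint copies fill more than 3/2 of the volume of the ball.\<close>

lemma exists_large_part:
  assumes "0 < L"
  shows "\<exists>R>0. ennreal (3 / 4) * emeasure lborel (ball (0::'a) L) < emeasure lborel ({x. \<rho> x < R} \<inter> ball 0 L)"
proof -
  let ?A = "\<lambda>i. {x. \<rho> x < real (Suc i)} \<inter> ball 0 L"
  have "(\<Union>i. ?A i) = ball 0 L"
  proof -
    have "\<exists>i. \<rho> x < real (Suc i)" for x using reals_Archimedean2[of "\<rho> x"] by (metis less_Suc_eq of_nat_less_iff order_less_trans)
    then show ?thesis by auto
  qed
  moreover have "(\<lambda>i. emeasure lborel (?A i)) \<longlonglongrightarrow> emeasure lborel (\<Union>i. ?A i)"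
    by (rule Lim_emeasure_incseq) (auto simp: incseq_def)
  ultimately have lim: "(\<lambda>i. emeasure lborel (?A i)) \<longlonglongrightarrow> emeasure lborel (ball (0::'a) L)" by simp
  have pos: "0 < emeasure lborel (ball (0::'a) L)" "emeasure lborel (ball (0::'a) L) < top"
    using content_ball_pos[OF assms, of "0::'a"] emeasure_lborel_ball_finite[of "0::'a" L]
    by (auto simp: measure_def enn2real_positive_iff)
  then obtain b where b: "emeasure lborel (ball (0::'a) L) = ennreal b" "0 < b"
    by (cases "emeasure lborel (ball (0::'a) L)") auto
  have "ennreal (3 / 4) * emeasure lborel (ball (0::'a) L) < emeasure lborel (ball (0::'a) L)"
    using b by (simp add: ennreal_less_iff flip: ennreal_mult)
  then have "eventually (\<lambda>i. ennreal (3 / 4) * emeasure lborel (ball (0::'a) L) < emeasure lborel (?A i)) sequentially"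
    by (rule order_tendstoD(1)[OF lim])
  then obtain i where "ennreal (3 / 4) * emeasure lborel (ball (0::'a) L) < emeasure lborel (?A i)"
    by (auto simp: eventually_sequentially)
  then show ?thesis by (intro exI[of _ "real (Suc i)"]) auto
qed

lemma emeasure_translate:
  assumes [measurable]: "F \<in> sets borel"
  shows "emeasure lborel {y. y - a \<in> F} = emeasure lborel (F :: 'a set)"
proof -
  have "(\<lambda>y. indicator F (y - a)) = (indicator {y. y - a \<in> F} :: 'a \<Rightarrow> ennreal)" by (auto simp: indicator_def)
  then have "emeasure lborel {y. y - a \<in> F} = (\<integral>\<^sup>+y. indicator F (y - a) \<partial>lborel)"
    by simp
  also have "\<dots> = emeasure lborel F" by (subst nn_integral_lborel_diff(1)) auto
  finally show ?thesis .
qed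

text \<open>For large \<open>R\<close> the set \<open>F = {\<rho> < R}\<close> fills most of a big ball, so \<open>F\<close> and \<open>x + F\<close> cannot be disjoint; hence \<open>x \<in> F - F\<close>.\<close>

lemma bounded_on_balls: "\<exists>B. \<forall>x. norm x \<le> M \<longrightarrow> \<rho> x \<le> B"
proof -
  define M' where "M' = max M 1"
  have M': "0 < M'" "M \<le> M'" by (auto simp: M'_def)
  let ?n = "DIM('a)"
  have "((\<lambda>d::real. (1 + d) ^ ?n) \<longlongrightarrow> (1 + 0) ^ ?n) (at_right 0)" by (intro tendsto_intros)
  then have "eventually (\<lambda>d::real. (1 + d) ^ ?n < 3 / 2) (at_right 0)" by (rule order_tendstoD) simp
  then obtain d :: real where "0 < d" "\<And>y. 0 < y \<Longrightarrow> y < d \<Longrightarrow> (1 + y) ^ ?n < 3 / 2"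
    unfolding eventually_at_right_field by auto
  then obtain d :: real where d: "0 < d" "(1 + d) ^ ?n < 3 / 2" by (metis dense)
  \<comment> \<open>The radius is so large that enlarging the ball by M' multiplies its volume by (1
    + d)^n < 3/2, too little room for F and its translate to be disjoint.\<close>
  define L where "L = M' / d"
  have L: "0 < L" "L + M' = (1 + d) * L" using d M' by (auto simp: L_def field_simps)
  obtain R where R: "0 < R" "ennreal (3 / 4) * emeasure lborel (ball (0::'a) L) < emeasure lborel ({x. \<rho> x < R} \<inter> ball 0 L)"
    using exists_large_part[OF L(1)] by blast
  define F where "F = {x. \<rho> x < R} \<inter> ball 0 L"
  have [measurable]: "F \<in> sets borel" unfolding F_def by measurable
  have pos: "0 < emeasure lborel (ball (0::'a) L)" "emeasure lborel (ball (0::'a) L) < top"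
    using content_ball_pos[OF L(1), of "0::'a"] emeasure_lborel_ball_finite[of "0::'a" L]
    by (auto simp: measure_def enn2real_positive_iff)
  have big: "emeasure lborel (ball (0::'a) (L + M')) = ennreal ((1 + d) ^ ?n) * emeasure lborel (ball (0::'a) L)"
    using d L by (simp add: emeasure_ball power_mult_distrib mult_ac flip: ennreal_mult)
  have "\<rho> x \<le> k * (R + R)" if x: "norm x \<le> M" for x
  proof -
    let ?G = "{y. y - x \<in> F}"
    have "F \<inter> ?G \<noteq> {}"
    proof
      assume disj: "F \<inter> ?G = {}"
      have "emeasure lborel F + emeasure lborel ?G = emeasure lborel (F \<union> ?G)"
        using disj by (intro plus_emeasure) auto
      also have "\<dots> \<le> emeasure lborel (ball (0::'a) (L + M'))"
      proof (rule emeasure_mono)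
        have "norm y < L + M'" if "norm (y - x) < L" for y using norm_triangle_sub[of y x] x M' that by linarith
        then show "F \<union> ?G \<subseteq> ball 0 (L + M')" using M' by (auto simp: F_def)
      qed simp
      finally have "2 * emeasure lborel F \<le> ennreal ((1 + d) ^ ?n) * emeasure lborel (ball (0::'a) L)"
        unfolding emeasure_translate[OF \<open>F \<in> sets borel\<close>] big by (simp add: mult_2)
      also have "\<dots> \<le> ennreal (3 / 2) * emeasure lborel (ball (0::'a) L)"
        using d by (intro mult_right_mono ennreal_leI) auto
      also have "\<dots> = 2 * (ennreal (3 / 4) * emeasure lborel (ball (0::'a) L))"
        by (simp add: mult.assoc[symmetric] flip: ennreal_mult ennreal_numeral)
      also have "\<dots> < 2 * emeasure lborel F"
        using R(2) by (intro ennreal_mult_strict_left_mono) (auto simp: F_def)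
      finally show False by simp
    qed
    then obtain y where y: "y \<in> F" "y - x \<in> F" by blast
    have "\<rho> x = \<rho> (y + - (y - x))" by simp
    also have "\<dots> \<le> k * (\<rho> y + \<rho> (y - x))" using add_le[of y "- (y - x)"] minus[of "y - x"] by simp
    also have "\<dots> \<le> k * (R + R)" using y k_ge_1 by (intro mult_left_mono add_mono) (auto simp: F_def)
    finally show ?thesis .
  qed
  then show ?thesis by blast
qed

text \<open>Every further summand costs at most a factor 2 k. The exponential growth is harmless:
  either the number of multiples is fixed before \<rho> x is made small, or \<rho> x is 0.\<close>

lemma of_nat_scaleR_le: "\<rho> (real m *\<^sub>R x) \<le> (2 * k) ^ m * \<rho> x"
proof (induction m)
  case (Suc m)
  have "\<rho> (real (Suc m) *\<^sub>R x) \<le> k * (\<rho> (real m *\<^sub>R x) + \<rho> x)"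
    using add_le[of "real m *\<^sub>R x" x] by (simp add: algebra_simps)
  also have "\<dots> \<le> k * ((2 * k) ^ m * \<rho> x + (2 * k) ^ m * \<rho> x)"
  proof (intro mult_left_mono add_mono Suc)
    have "1 \<le> (2 * k) ^ m" using k_ge_1 by (intro one_le_power) simp
    then show "\<rho> x \<le> (2 * k) ^ m * \<rho> x" using mult_right_mono[of 1 "(2 * k) ^ m" "\<rho> x"] by simp
  qed (use k_ge_1 in auto)
  finally show ?case by (simp add: mult_ac)
qed simp

text \<open>If \<open>\<rho> x\<close> is tiny while \<open>x\<close> is not, then many disjoint translates of a set of positive measure by multiples of \<open>x\<close> fit into
  a set \<open>{\<rho> < t}\<close> of finite measure.\<close>

lemma small_imp_norm_less_1: "\<exists>\<eta>>0. \<forall>x. \<rho> x < \<eta> \<longrightarrow> norm x < 1"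
proof -
  obtain R where R: "0 < R" "ennreal (3 / 4) * emeasure lborel (ball (0::'a) 1) < emeasure lborel ({x. \<rho> x < R} \<inter> ball 0 1)"
    using exists_large_part[of 1] by auto
  define F where "F = {x. \<rho> x < R} \<inter> ball 0 1"
  have [measurable]: "F \<in> sets borel" unfolding F_def by measurable
  have "emeasure lborel F \<le> emeasure lborel (ball (0::'a) 1)" by (rule emeasure_mono) (auto simp: F_def)
  then have "emeasure lborel F < top" using emeasure_lborel_ball_finite[of "0::'a" 1] by auto
  moreover have "0 < emeasure lborel F" using R(2) by (auto simp: F_def intro: le_less_trans)
  ultimately obtain \<mu> where \<mu>: "emeasure lborel F = ennreal \<mu>" "0 < \<mu>" by (cases "emeasure lborel F") auto
  define V where "V = \<upsilon> * (2 * k * R) powr \<gamma>"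
  have V: "emeasure lborel {x. \<rho> x < 2 * k * R} = ennreal V"
    unfolding V_def using R k_ge_1 by (intro emeasure_less) auto
  \<comment> \<open>J disjoint sets of measure \<mu> are more than {\<rho> < 2 k R} can hold; \<eta>
    is then so small that the multiples of x up to 2 J stay in {\<rho> \<le> R}.\<close>
  obtain J :: nat where J: "V < real J * \<mu>" using reals_Archimedean3[OF \<mu>(2)] by blast
  define \<eta> where "\<eta> = R / (2 * k) ^ (2 * J)"
  have \<eta>: "0 < \<eta>" using R k_ge_1 by (simp add: \<eta>_def)
  have "norm x < 1" if x: "\<rho> x < \<eta>" for x
  proof (rule ccontr)
    assume "\<not> norm x < 1"
    then have nx: "1 \<le> norm x" by simp
    \<comment> \<open>Even multiples, because F lies in the unit ball: for x of norm at least 1 the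
      translation vectors 2 j x differ by at least 2, which makes the translates disjoint.\<close>
    let ?G = "\<lambda>j. {y. y - real (2 * j) *\<^sub>R x \<in> F}"
    have disj: "disjoint_family_on ?G {..<J}"
      unfolding disjoint_family_on_def
    proof (intro ballI impI)
      fix i j :: nat assume "i \<noteq> j"
      show "?G i \<inter> ?G j = {}"
      proof (rule ccontr)
        assume "?G i \<inter> ?G j \<noteq> {}"
        then obtain y where y: "norm (y - real (2 * i) *\<^sub>R x) < 1" "norm (y - real (2 * j) *\<^sub>R x) < 1"
          by (auto simp: F_def)
        have "norm ((real (2 * i) - real (2 * j)) *\<^sub>R x) = norm ((y - real (2 * j) *\<^sub>R x) - (y - real (2 * i) *\<^sub>R x))"
          by (simp add: algebra_simps)
        also have "\<dots> < 2" using norm_triangle_ineq4[of "y - real (2 * j) *\<^sub>R x" "y - real (2 * i) *\<^sub>R x"] y by linarith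
        finally have "\<bar>real (2 * i) - real (2 * j)\<bar> * norm x < 2" by simp
        moreover have "2 \<le> \<bar>real (2 * i) - real (2 * j)\<bar>" using \<open>i \<noteq> j\<close> by linarith
        ultimately show False using mult_mono[of 2 "\<bar>real (2 * i) - real (2 * j)\<bar>" 1 "norm x"] nx by simp
      qed
    qed
    have "ennreal (real J * \<mu>) = (\<Sum>j<J. emeasure lborel (?G j))"
      using \<mu> by (simp add: emeasure_translate ennreal_mult ennreal_of_nat_eq_real_of_nat)
    also have "\<dots> = emeasure lborel (\<Union>j<J. ?G j)"
      using disj by (intro sum_emeasure) auto
    also have "\<dots> \<le> emeasure lborel {x. \<rho> x < 2 * k * R}"
    proof (rule emeasure_mono)
      show "(\<Union>j<J. ?G j) \<subseteq> {x. \<rho> x < 2 * k * R}"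
      proof (rule subsetI)
        fix y assume "y \<in> (\<Union>j<J. ?G j)"
        then obtain j where j: "j < J" and y: "y - real (2 * j) *\<^sub>R x \<in> F" by blast
        have "\<rho> (real (2 * j) *\<^sub>R x) \<le> (2 * k) ^ (2 * j) * \<rho> x" by (rule of_nat_scaleR_le)
        also have "\<dots> \<le> (2 * k) ^ (2 * J) * \<eta>"
          using j x k_ge_1 by (intro mult_mono power_increasing) auto
        also have "\<dots> = R" using k_ge_1 by (simp add: \<eta>_def)
        finally have "\<rho> (real (2 * j) *\<^sub>R x) \<le> R" .
        moreover have "\<rho> (y - real (2 * j) *\<^sub>R x) < R" using y by (simp add: F_def)
        ultimately have "k * (\<rho> (y - real (2 * j) *\<^sub>R x) + \<rho> (real (2 * j) *\<^sub>R x)) < k * (R + R)"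
          using k_ge_1 by - (rule mult_strict_left_mono, auto)
        then show "y \<in> {x. \<rho> x < 2 * k * R}"
          using add_le[of "y - real (2 * j) *\<^sub>R x" "real (2 * j) *\<^sub>R x"] by simp
      qed
    qed simp
    also have "\<dots> = ennreal V" by (rule V)
    finally have "real J * \<mu> \<le> V"
      using upsilon_pos by (simp add: ennreal_le_iff V_def)
    then show False using J by simp
  qed
  then show ?thesis using \<eta> by blast
qed

text \<open>If \<rho> x = 0, then all multiples of x by natural numbers have \<rho> = 0 and hence
  norm below 1.\<close>

lemma rho_eq_0_iff [simp]: "\<rho> x = 0 \<longleftrightarrow> x = 0"
proof
  assume x: "\<rho> x = 0"
  obtain \<eta> where \<eta>: "0 < \<eta>" "\<And>x. \<rho> x < \<eta> \<Longrightarrow> norm x < 1" using small_imp_norm_less_1 by blast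
  have *: "real m * norm x < 1" for m
  proof -
    have "\<rho> (real m *\<^sub>R x) \<le> 0" using of_nat_scaleR_le[of m x] x by simp
    then show ?thesis using \<eta>(2)[of "real m *\<^sub>R x"] \<eta>(1) by simp
  qed
  show "x = 0"
  proof (rule ccontr)
    assume "x \<noteq> 0"
    then obtain m where "1 < real m * norm x" using reals_Archimedean3[of "norm x"] by auto
    then show False using *[of m] by simp
  qed
qed simp

lemma rho_pos: "x \<noteq> 0 \<Longrightarrow> 0 < \<rho> x"
  using nonneg[of x] rho_eq_0_iff[of x] by linarith

end

section \<open>Parabolic quasi-distances\<close>

lemma measurable_dilation [measurable]:
  fixes P :: "real^'n^'n"
  assumes [measurable]: "r \<in> borel_measurable M" "w \<in> borel_measurable M"
  shows "(\<lambda>x. dilation P (r x) (w x)) \<in> borel_measurable M"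
proof -
  have *: "(\<lambda>x. matrix_exp (ln (r x) *\<^sub>R P) $ i $ j) \<in> borel_measurable M" for i j
  proof -
    have "continuous_on UNIV (\<lambda>s. matrix_exp (s *\<^sub>R P) $ i $ j)"
      by (rule DERIV_continuous_on) (rule has_field_derivative_at_within[OF matrix_exp_has_field_derivative(1)])
    then have [measurable]: "(\<lambda>s. matrix_exp (s *\<^sub>R P) $ i $ j) \<in> borel_measurable borel"
      by (rule borel_measurable_continuous_onI)
    show ?thesis by (rule measurable_compose[of "\<lambda>x. ln (r x)" M borel "\<lambda>s. matrix_exp (s *\<^sub>R P) $ i $ j"]) measurable
  qed
  have w: "(\<lambda>x. w x $ j) \<in> borel_measurable M" for j
    by (rule measurable_compose[OF assms(2)]) (intro borel_measurable_continuous_onI continuous_intros)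
  have "(\<lambda>x. dilation P (r x) (w x) $ i) \<in> borel_measurable M" for i
    unfolding dilation_def matrix_vector_mult_def by (simp, intro borel_measurable_sum borel_measurable_times * w)
  then show ?thesis
    by (subst borel_measurable_euclidean_space) (auto simp: Basis_vec_def inner_axis)
qed

lemma nn_integral_powr_0:
  assumes "0 < \<gamma>" "0 < t"
  shows "(\<integral>\<^sup>+r. indicator {0<..<t} r * ennreal (r powr (\<gamma> - 1)) \<partial>lborel) = ennreal (t powr \<gamma> / \<gamma>)"
proof -
  have "((\<lambda>x. x powr (\<gamma> - 1)) has_integral (t powr (\<gamma> - 1 + 1) / (\<gamma> - 1 + 1))) {0..t}"
    using assms by (intro has_integral_powr_from_0) auto
  then have "((\<lambda>x. if x \<in> {0..t} then x powr (\<gamma> - 1) else 0) has_integral (t powr \<gamma> / \<gamma>)) UNIV"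
    by (simp only: has_integral_restrict_UNIV) simp
  moreover have "(\<lambda>x. if x \<in> {0..t} then x powr (\<gamma> - 1) else 0) \<in> borel_measurable borel" by measurable
  ultimately have "(\<integral>\<^sup>+x. ennreal (if x \<in> {0..t} then x powr (\<gamma> - 1) else 0) \<partial>lborel) = ennreal (t powr \<gamma> / \<gamma>)"
    using assms by (intro nn_integral_has_integral_lborel) auto
  also have "(\<integral>\<^sup>+x. ennreal (if x \<in> {0..t} then x powr (\<gamma> - 1) else 0) \<partial>lborel) = (\<integral>\<^sup>+r. indicator {0<..<t} r * ennreal (r powr (\<gamma> - 1)) \<partial>lborel)"
  proof (intro nn_integral_cong_AE)
    have "AE x in lborel. x \<noteq> 0 \<and> x \<noteq> t" by (intro AE_conjI AE_lborel_singleton)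
    then show "AE x in lborel. ennreal (if x \<in> {0..t} then x powr (\<gamma> - 1) else 0) = indicator {0<..<t} x * ennreal (x powr (\<gamma> - 1))"
      by eventually_elim (auto simp: indicator_def)
  qed
  finally show ?thesis .
qed

context
  fixes P :: "real^'n^'n" and \<rho> :: "real^'n \<Rightarrow> real"
  assumes qd: "parabolic_quasi_distance P \<rho>" and tr: "0 < trace P"
begin

lemma rho_dilation: "0 < t \<Longrightarrow> \<rho> (dilation P t x) = t * \<rho> x"
  using qd by (simp add: parabolic_quasi_distance_def)

text \<open>The polar formula is applied to the indicator of {\<rho> < t}: for \<rho> w = 1
  homogeneity gives \<rho>(A_r w) = r, so the volume is the mass c of \<sigma> times the integral of
  r^(\<gamma>-1) from 0 to t, and \<upsilon> = c / \<gamma>. The given constant of the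
  quasi-triangle inequality may be below 1 and is replaced by its maximum with 1.\<close>

lemma homogeneous_quasi_norm_rho: "\<exists>k \<upsilon>. homogeneous_quasi_norm \<rho> k (trace P) \<upsilon>"
proof -
  obtain \<sigma> where \<sigma>: "polar_decomposition P \<rho> \<sigma>" using qd by (auto simp: parabolic_quasi_distance_def)
  then have [measurable]: "\<rho> \<in> borel_measurable borel" and sets\<sigma>: "sets \<sigma> = sets (restrict_space borel {w. \<rho> w = 1})"
    and fin: "finite_measure \<sigma>" by (auto simp: polar_decomposition_def)
  interpret \<sigma>: finite_measure \<sigma> by fact
  have space\<sigma>: "space \<sigma> = {w. \<rho> w = 1}" using sets_eq_imp_space_eq[OF sets\<sigma>] by (simp add: space_restrict_space)
  have polar: "(\<integral>\<^sup>+x. h x \<partial>lborel) = (\<integral>\<^sup>+r\<in>{0<..}. (\<integral>\<^sup>+w. h (dilation P r w) * ennreal (r powr (trace P - 1)) \<partial>\<sigma>) \<partial>lborel)"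
    if "h \<in> borel_measurable borel" for h :: "real^'n \<Rightarrow> ennreal"
    using \<sigma> that by (simp add: polar_decomposition_def)
  define c where "c = measure \<sigma> (space \<sigma>)"
  define \<upsilon> where "\<upsilon> = c / trace P"
  have em: "emeasure lborel {x. \<rho> x < t} = ennreal (\<upsilon> * t powr trace P)" if t: "0 < t" for t
  proof -
    have "emeasure lborel {x. \<rho> x < t} = (\<integral>\<^sup>+x. indicator {x. \<rho> x < t} x \<partial>lborel)" by simp
    also have "\<dots> = (\<integral>\<^sup>+r\<in>{0<..}. (\<integral>\<^sup>+w. indicator {x. \<rho> x < t} (dilation P r w) * ennreal (r powr (trace P - 1)) \<partial>\<sigma>) \<partial>lborel)"
      by (rule polar) measurable
    also have "\<dots> = (\<integral>\<^sup>+r. ennreal c * (indicator {0<..<t} r * ennreal (r powr (trace P - 1))) \<partial>lborel)"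
    proof (intro nn_integral_cong)
      fix r :: real
      show "(\<integral>\<^sup>+w. indicator {x. \<rho> x < t} (dilation P r w) * ennreal (r powr (trace P - 1)) \<partial>\<sigma>) * indicator {0<..} r
        = ennreal c * (indicator {0<..<t} r * ennreal (r powr (trace P - 1)))"
      proof (cases "0 < r")
        case True
        have "(\<integral>\<^sup>+w. indicator {x. \<rho> x < t} (dilation P r w) * ennreal (r powr (trace P - 1)) \<partial>\<sigma>)
          = (\<integral>\<^sup>+w. indicator {..<t} r * ennreal (r powr (trace P - 1)) \<partial>\<sigma>)"
          using True by (intro nn_integral_cong) (auto simp: space\<sigma> rho_dilation indicator_def)
        then show ?thesis using True by (simp add: c_def \<sigma>.emeasure_eq_measure mult_ac indicator_def)
      qed auto
    qed
    also have "\<dots> = ennreal c * ennreal (t powr trace P / trace P)"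
      using nn_integral_powr_0[OF tr t] by (subst nn_integral_cmult) auto
    also have "\<dots> = ennreal (\<upsilon> * t powr trace P)"
      using tr by (simp add: \<upsilon>_def c_def flip: ennreal_mult)
    finally show ?thesis .
  qed
  \<comment> \<open>Otherwise the whole space would be a countable union of null sets.\<close>
  have "c \<noteq> 0"
  proof
    assume "c = 0"
    have "UNIV = (\<Union>i::nat. {x. \<rho> x < real (Suc i)})"
      using reals_Archimedean2 by (auto, metis less_Suc_eq of_nat_Suc of_nat_less_iff order_less_trans)
    moreover have "emeasure lborel (\<Union>i::nat. {x. \<rho> x < real (Suc i)}) \<le> (\<Sum>i. emeasure lborel {x. \<rho> x < real (Suc i)})"
      by (rule emeasure_subadditive_countably) auto
    ultimately have "emeasure lborel (UNIV :: (real^'n) set) \<le> (\<Sum>i. emeasure lborel {x. \<rho> x < real (Suc i)})" by simp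
    then have "emeasure lborel (UNIV :: (real^'n) set) \<le> 0" using \<open>c = 0\<close> by (simp add: em \<upsilon>_def)
    then show False by simp
  qed
  then have "0 < \<upsilon>" using tr by (simp add: \<upsilon>_def c_def zero_less_measure_iff)
  obtain k0 where k0: "\<And>x y z. \<rho> (x - y) \<le> k0 * (\<rho> (x - z) + \<rho> (y - z))" using qd by (auto simp: parabolic_quasi_distance_def)
  have sym: "\<rho> (x - y) = \<rho> (y - x)" "0 \<le> \<rho> (x - y)" "\<rho> 0 = 0" for x y using qd by (auto simp: parabolic_quasi_distance_def)
  have nn: "0 \<le> \<rho> x" for x using sym(2)[of x 0] by simp
  have "homogeneous_quasi_norm \<rho> (max k0 1) (trace P) \<upsilon>"
  proof
    fix x y
    show "\<rho> (- x) = \<rho> x" using sym(1)[of 0 x] by simp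
    have "\<rho> (x + y) \<le> k0 * (\<rho> x + \<rho> y)" using k0[of x "- y" 0] sym(1)[of 0 y] by simp
    also have "\<dots> \<le> max k0 1 * (\<rho> x + \<rho> y)" using nn by (intro mult_right_mono) auto
    finally show "\<rho> (x + y) \<le> max k0 1 * (\<rho> x + \<rho> y)" .
  qed (use nn sym tr \<open>0 < \<upsilon>\<close> em in auto)
  then show ?thesis by blast
qed

text \<open>A_t has Jacobian t^(tr P), seen by rescaling the radial variable of the polar formula:
  A_t A_r = A_(tr), and the substitution produces t (t r)^(\<gamma>-1) = t^\<gamma>
  r^(\<gamma>-1).\<close>

lemma nn_integral_dilation:
  fixes h :: "real^'n \<Rightarrow> ennreal"
  assumes [measurable]: "h \<in> borel_measurable borel" and t: "0 < t"
  shows "(\<integral>\<^sup>+x. h x \<partial>lborel) = ennreal (t powr trace P) * (\<integral>\<^sup>+x. h (dilation P t x) \<partial>lborel)"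
proof -
  obtain \<sigma> where \<sigma>: "polar_decomposition P \<rho> \<sigma>" using qd by (auto simp: parabolic_quasi_distance_def)
  then have sets\<sigma>: "sets \<sigma> = sets (restrict_space borel {w. \<rho> w = 1})"
    and fin: "finite_measure \<sigma>" by (auto simp: polar_decomposition_def)
  interpret \<sigma>: finite_measure \<sigma> by fact
  have id: "(\<lambda>w. w) \<in> borel_measurable \<sigma>"
    by (subst measurable_cong_sets[OF sets\<sigma> refl]) (rule measurable_restrict_space1, simp)
  have polar: "(\<integral>\<^sup>+x. h x \<partial>lborel) = (\<integral>\<^sup>+r\<in>{0<..}. (\<integral>\<^sup>+w. h (dilation P r w) * ennreal (r powr (trace P - 1)) \<partial>\<sigma>) \<partial>lborel)"
    if "h \<in> borel_measurable borel" for h :: "real^'n \<Rightarrow> ennreal"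
    using \<sigma> that by (simp add: polar_decomposition_def)
  define G where "G r = (\<integral>\<^sup>+w. h (dilation P r w) * ennreal (r powr (trace P - 1)) \<partial>\<sigma>) * indicator {0<..} r" for r
  have [measurable]: "G \<in> borel_measurable borel"
  proof -
    have [measurable]: "(\<lambda>p. dilation P (fst p) (snd p)) \<in> borel_measurable (borel \<Otimes>\<^sub>M \<sigma>)"
      by (intro measurable_dilation measurable_fst measurable_compose[OF measurable_snd id])
    have "(\<lambda>(r, w). h (dilation P r w) * ennreal (r powr (trace P - 1))) \<in> borel_measurable (borel \<Otimes>\<^sub>M \<sigma>)"
      unfolding split_beta' by measurable
    then have "(\<lambda>r. \<integral>\<^sup>+w. h (dilation P r w) * ennreal (r powr (trace P - 1)) \<partial>\<sigma>) \<in> borel_measurable borel"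
      using \<sigma>.borel_measurable_nn_integral by simp
    then show ?thesis unfolding G_def by measurable
  qed
  have "(\<integral>\<^sup>+x. h x \<partial>lborel) = (\<integral>\<^sup>+r. G r \<partial>lborel)" unfolding G_def by (rule polar) fact
  also have "\<dots> = ennreal \<bar>t\<bar> * (\<integral>\<^sup>+r. G (0 + t * r) \<partial>lborel)"
    using t by (intro nn_integral_real_affine) auto
  also have "\<dots> = (\<integral>\<^sup>+r. ennreal t * G (t * r) \<partial>lborel)" using t by (simp add: nn_integral_cmult)
  also have "\<dots> = (\<integral>\<^sup>+r\<in>{0<..}. (\<integral>\<^sup>+w. (ennreal (t powr trace P) * h (dilation P t (dilation P r w))) * ennreal (r powr (trace P - 1)) \<partial>\<sigma>) \<partial>lborel)"
  proof (intro nn_integral_cong)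
    fix r :: real
    show "ennreal t * G (t * r) = (\<integral>\<^sup>+w. (ennreal (t powr trace P) * h (dilation P t (dilation P r w))) * ennreal (r powr (trace P - 1)) \<partial>\<sigma>) * indicator {0<..} r"
    proof (cases "0 < r")
      case True
      have [measurable]: "(\<lambda>w. dilation P (t * r) w) \<in> borel_measurable \<sigma>"
        by (intro measurable_dilation measurable_const id) simp
      have "ennreal t * G (t * r) = (\<integral>\<^sup>+w. ennreal t * (h (dilation P (t * r) w) * ennreal ((t * r) powr (trace P - 1))) \<partial>\<sigma>)"
        using True t by (simp add: G_def nn_integral_cmult)
      also have "\<dots> = (\<integral>\<^sup>+w. (ennreal (t powr trace P) * h (dilation P t (dilation P r w))) * ennreal (r powr (trace P - 1)) \<partial>\<sigma>)"
      proof (intro nn_integral_cong)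
        fix w
        have "t * (t * r) powr (trace P - 1) = t powr trace P * r powr (trace P - 1)"
          using True t powr_mult_base[of t "trace P - 1"] by (simp add: powr_mult mult.assoc[symmetric])
        then have e: "ennreal t * ennreal ((t * r) powr (trace P - 1)) = ennreal (t powr trace P) * ennreal (r powr (trace P - 1))"
          using t by (simp flip: ennreal_mult)
        have "ennreal t * (h (dilation P (t * r) w) * ennreal ((t * r) powr (trace P - 1))) = h (dilation P (t * r) w) * (ennreal t * ennreal ((t * r) powr (trace P - 1)))"
          by (simp only: mult_ac)
        also have "\<dots> = (ennreal (t powr trace P) * h (dilation P t (dilation P r w))) * ennreal (r powr (trace P - 1))"
          unfolding e using True t by (simp add: dilation_mult mult_ac)
        finally show "ennreal t * (h (dilation P (t * r) w) * ennreal ((t * r) powr (trace P - 1))) = (ennreal (t powr trace P) * h (dilation P t (dilation P r w))) * ennreal (r powr (trace P - 1))" .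
      qed
      finally show ?thesis using True by simp
    qed (use t in \<open>auto simp: G_def indicator_def zero_less_mult_iff\<close>)
  qed
  also have "\<dots> = (\<integral>\<^sup>+x. ennreal (t powr trace P) * h (dilation P t x) \<partial>lborel)"
    by (rule polar[symmetric]) measurable
  also have "\<dots> = ennreal (t powr trace P) * (\<integral>\<^sup>+x. h (dilation P t x) \<partial>lborel)"
    by (rule nn_integral_cmult) measurable
  finally show ?thesis .
qed

text \<open>Null sets are preserved because volumes only scale. This restores homogeneity almost
  everywhere for a Borel version of \<Omega>.\<close>

lemma AE_dilation:
  assumes "AE x in lborel. Q x" and t: "0 < t"
  shows "AE x in lborel. Q (dilation P t x)"
proof -
  obtain N where N: "{x \<in> space lborel. \<not> Q x} \<subseteq> N" "emeasure lborel N = 0" "N \<in> sets lborel"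
    using AE_E[OF assms(1)] by blast
  then have [measurable]: "N \<in> sets borel" by simp
  have "ennreal (t powr trace P) * (\<integral>\<^sup>+x. indicator N (dilation P t x) \<partial>lborel) = 0"
    using nn_integral_dilation[of "indicator N" t] N t by simp
  then have "(\<integral>\<^sup>+x. indicator N (dilation P t x) \<partial>lborel) = 0" using t by simp
  then have "AE x in lborel. indicator N (dilation P t x) = (0::ennreal)"
    by (subst (asm) nn_integral_0_iff_AE) measurable
  then show ?thesis
    by eventually_elim (use N(1) in \<open>auto simp: indicator_def split: if_splits\<close>)
qed

text \<open>Every orbit of the dilations meets the Euclidean unit sphere, so that \<open>\<phi> y = A\<^bsub>c|y|\<^esub> (y / |y|)\<close> maps a Euclidean annulus onto
  a set that contains \<open>{1/2 < \<rho> \<le> 1}\<close>. An orbit may meet the sphere more than once and tangentially,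
  but \<open>\<phi>\<close> is Lipschitz, and this suffices for an upper bound.\<close>

lemma annulus_subset_Lipschitz_image:
  "\<exists>c a L. 0 < c \<and> 0 < a \<and> 0 \<le> L \<and>
     (\<forall>x y. a \<le> norm x \<and> norm x < 1 \<and> a \<le> norm y \<and> norm y < 1 \<longrightarrow>
        norm (dilation P (c * norm x) (sgn x) - dilation P (c * norm y) (sgn y)) \<le> L * norm (x - y)) \<and>
     (\<forall>x. 1 / 2 < \<rho> x \<and> \<rho> x \<le> 1 \<longrightarrow> (\<exists>y. a \<le> norm y \<and> norm y < 1 \<and> x = dilation P (c * norm y) (sgn y)))"
proof -
  obtain k \<upsilon> where "homogeneous_quasi_norm \<rho> k (trace P) \<upsilon>" using homogeneous_quasi_norm_rho by blast
  then interpret homogeneous_quasi_norm \<rho> k "trace P" \<upsilon> .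
  obtain B0 where B0: "\<And>x. norm x \<le> 1 \<Longrightarrow> \<rho> x \<le> B0" using bounded_on_balls[of 1] by blast
  define B where "B = max B0 1"
  have B: "\<And>x. norm x \<le> 1 \<Longrightarrow> \<rho> x \<le> B" "0 < B" using B0 by (force simp: B_def)+
  obtain \<eta>0 where \<eta>0: "0 < \<eta>0" "\<And>x. \<rho> x < \<eta>0 \<Longrightarrow> norm x < 1" using small_imp_norm_less_1 by blast
  define \<eta> where "\<eta> = min \<eta>0 1"
  have \<eta>: "0 < \<eta>" "\<And>x. \<rho> x < \<eta> \<Longrightarrow> norm x < 1" using \<eta>0 by (auto simp: \<eta>_def)
  \<comment> \<open>The time t at which the orbit of x meets the unit sphere will lie in [\<eta>, 2
    B). The preimage of x has norm 1 / (t c) = \<eta> / (2 t), at most 1/2 and above a = \<eta> / (4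
    B).\<close>
  define c where "c = 2 / \<eta>"
  define a where "a = \<eta> / (4 * B)"
  have ca: "0 < c" "0 < a" using \<eta> B by (auto simp: c_def a_def)
  obtain L0 where L0: "0 \<le> L0" "\<And>s t x y. s \<in> {c * a..c} \<Longrightarrow> t \<in> {c * a..c} \<Longrightarrow> norm (dilation P s x - dilation P t y) \<le> L0 * (norm (x - y) + \<bar>s - t\<bar> * norm y)"
    using dilation_Lipschitz[of "c * a" c P] ca by auto
  have lip: "norm (dilation P (c * norm x) (sgn x) - dilation P (c * norm y) (sgn y)) \<le> (L0 * (2 / a + c)) * norm (x - y)"
    if xy: "a \<le> norm x" "norm x < 1" "a \<le> norm y" "norm y < 1" for x y :: "real^'n"
  proof -
    have nz: "0 < norm x" "0 < norm y" using xy ca by linarith+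
    have "norm (dilation P (c * norm x) (sgn x) - dilation P (c * norm y) (sgn y)) \<le> L0 * (norm (sgn x - sgn y) + \<bar>c * norm x - c * norm y\<bar> * norm (sgn y))"
      using xy ca by (intro L0) auto
    also have "\<dots> \<le> L0 * (2 / a * norm (x - y) + c * norm (x - y))"
    proof (intro mult_left_mono add_mono L0)
      have "norm (norm x *\<^sub>R (sgn x - sgn y)) = norm ((x - y) + (norm y - norm x) *\<^sub>R sgn y)"
        using nz by (simp add: sgn_div_norm algebra_simps)
      also have "\<dots> \<le> norm (x - y) + \<bar>norm y - norm x\<bar>"
        using norm_triangle_ineq[of "x - y" "(norm y - norm x) *\<^sub>R sgn y"] nz by (simp add: norm_sgn)
      also have "\<dots> \<le> 2 * norm (x - y)" using norm_triangle_ineq3[of x y] by simp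
      finally have "norm x * norm (sgn x - sgn y) \<le> 2 * norm (x - y)" by simp
      moreover have "a * norm (sgn x - sgn y) \<le> norm x * norm (sgn x - sgn y)" using xy by (intro mult_right_mono) auto
      ultimately show "norm (sgn x - sgn y) \<le> 2 / a * norm (x - y)" using ca by (simp add: field_simps)
      have "\<bar>c * norm x - c * norm y\<bar> = c * \<bar>norm x - norm y\<bar>" using ca by (simp add: abs_mult flip: right_diff_distrib)
      also have "\<dots> \<le> c * norm (x - y)" using ca norm_triangle_ineq3[of x y] by simp
      finally show "\<bar>c * norm x - c * norm y\<bar> * norm (sgn y) \<le> c * norm (x - y)" using nz by (simp add: norm_sgn)
    qed
    finally show ?thesis by (simp add: algebra_simps)
  qed
  have surj: "\<exists>y. a \<le> norm y \<and> norm y < 1 \<and> x = dilation P (c * norm y) (sgn y)" if x: "1 / 2 < \<rho> x" "\<rho> x \<le> 1" for x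
  proof -
    \<comment> \<open>\<rho> is not known to be continuous, but orbits are. The intermediate value
      theorem is applied to their Euclidean norm; the values of \<rho> at the two ends place this
      norm on either side of 1.\<close>
    have cont: "continuous_on {\<eta> / 2..2 * (B + 1)} (\<lambda>t. norm (dilation P t x))"
      using \<eta> by (intro continuous_on_norm continuous_on_subset[OF continuous_on_dilation]) auto
    have "\<rho> (dilation P (\<eta> / 2) x) < \<eta>"
      using mult_left_mono[OF x(2), of "\<eta> / 2"] \<eta>(1) by (simp add: rho_dilation)
    then have low: "norm (dilation P (\<eta> / 2) x) \<le> 1" using \<eta>(2) by (simp add: less_imp_le)
    have "B < \<rho> (dilation P (2 * (B + 1)) x)"
    proof -
      have "2 * (B + 1) * (1 / 2) < 2 * (B + 1) * \<rho> x" using B by (intro mult_strict_left_mono x) simp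
      then have "B + 1 < 2 * (B + 1) * \<rho> x" by simp
      then show ?thesis using B by (simp add: rho_dilation)
    qed
    then have high: "1 \<le> norm (dilation P (2 * (B + 1)) x)" using B(1) by (meson linorder_not_less less_imp_le)
    have "\<eta> / 2 \<le> 2 * (B + 1)" using B by (simp add: \<eta>_def min_def)
    then obtain t where t: "\<eta> / 2 \<le> t" "norm (dilation P t x) = 1"
      using IVT'[of "\<lambda>t. norm (dilation P t x)" "\<eta> / 2" 1 "2 * (B + 1)"] cont low high by blast
    define w where "w = dilation P t x"
    have tpos: "0 < t" using t \<eta> by simp
    have w: "norm w = 1" "x = dilation P (1 / t) w" using t tpos by (auto simp: w_def dilation_inverse)
    define y where "y = (1 / (t * c)) *\<^sub>R w"
    have "sgn w = w" using w by (simp add: sgn_div_norm)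
    then have y: "sgn y = w" "norm y = 1 / (t * c)" using w tpos ca by (auto simp: y_def sgn_scaleR)
    have "t * \<rho> x = \<rho> w" using tpos by (simp add: w_def rho_dilation)
    moreover have "\<eta> \<le> \<rho> w" using \<eta>(2)[of w] w by force
    moreover have "\<rho> w \<le> B" using B w by simp
    ultimately have "\<eta> \<le> t" "t < 2 * B"
      using x tpos mult_left_mono[OF x(2), of t] mult_strict_left_mono[OF x(1), of t] by auto
    then have "a \<le> norm y" "norm y < 1" unfolding y(2) using tpos \<eta>(1) B ca by (auto simp: a_def c_def field_simps)
    moreover have "x = dilation P (c * norm y) (sgn y)" using w y ca by simp
    ultimately show ?thesis by blast
  qed
  show ?thesis
    using ca L0(1) lip surj by (intro exI[of _ c] exI[of _ a] exI[of _ "L0 * (2 / a + c)"]) auto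
qed

end

section \<open>Growth of homogeneous functions\<close>

lemma le_suminf_ennreal: "f j \<le> (\<Sum>j. f j :: ennreal)"
  using sum_le_suminf[of f "{j}"] by simp

lemma sigma_finite_lebesgue: "sigma_finite_measure (lebesgue :: 'a::euclidean_space measure)"
proof -
  obtain A :: "'a set set" where A: "countable A" "A \<subseteq> sets lborel" "\<Union>A = space lborel" "\<forall>a\<in>A. emeasure lborel a \<noteq> \<infinity>"
    using sigma_finite_lborel[where 'a='a] unfolding sigma_finite_measure_def by blast
  have "\<forall>a\<in>A. emeasure lebesgue a \<noteq> \<infinity>" using A(2,4) by auto
  moreover have "A \<subseteq> sets lebesgue" using A(2) by auto
  ultimately show ?thesis unfolding sigma_finite_measure_def using A(1,3) by (intro exI[of _ A]) auto
qed

lemma borel_measurable_lebesgue_AE: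
  fixes f g :: "'a::euclidean_space \<Rightarrow> 'b::topological_space"
  assumes g: "g \<in> borel_measurable lebesgue" and ae: "AE x in lebesgue. f x = g x"
  shows "f \<in> borel_measurable lebesgue"
proof (rule measurableI)
  fix A :: "'b set" assume A: "A \<in> sets borel"
  show "f -` A \<inter> space lebesgue \<in> sets lebesgue"
  proof (rule completion.in_sets_AE)
    show "g -` A \<inter> space lebesgue \<in> sets lebesgue" using g A by (rule measurable_sets)
    show "AE x in lebesgue. x \<in> g -` A \<inter> space lebesgue \<longleftrightarrow> x \<in> f -` A \<inter> space lebesgue"
      using ae by eventually_elim auto
  qed auto
qed simp

lemma finite_measure_sphere_measure: "finite_measure (sphere_measure :: 'a::euclidean_space measure)"
proof -
  have "emeasure lborel (ball (0::'a) 1) \<noteq> 0" "emeasure lborel (ball (0::'a) 1) \<noteq> top"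
    using content_ball_pos[of 1 "0::'a"] emeasure_lborel_ball_finite[of "0::'a" 1]
    by (auto simp: measure_def enn2real_positive_iff)
  then interpret finite_measure "uniform_measure lborel (ball (0::'a) 1)"
    by (intro finite_measureI) (simp add: emeasure_uniform_measure ennreal_divide_eq_top_iff)
  have "finite_measure (distr (uniform_measure lborel (ball (0::'a) 1)) borel sgn)" by (rule finite_measure_distr) simp
  then show ?thesis unfolding sphere_measure_def by (rule finite_measure_restrict_space) simp
qed

text \<open>On a finite measure space it suffices that |f|^t \<le> 1 + |f|^r for t \<le> r; for s =
  \<infinity> an essential bound takes the place of the power.\<close>

lemma in_Lp_exponent_mono:
  assumes f: "in_Lp M s f" and M: "finite_measure M" and t: "0 < t" "ennreal t \<le> s"
  shows "(\<integral>\<^sup>+x. ennreal (\<bar>f x\<bar> powr t) \<partial>M) < \<infinity>"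
proof -
  interpret finite_measure M by fact
  have [measurable]: "f \<in> borel_measurable M" using f by (simp add: in_Lp_def)
  show ?thesis
  proof (cases "s = \<infinity>")
    case True
    then obtain B where B: "AE x in M. \<bar>f x\<bar> \<le> B" using f by (auto simp: in_Lp_def)
    have "(\<integral>\<^sup>+x. ennreal (\<bar>f x\<bar> powr t) \<partial>M) \<le> (\<integral>\<^sup>+x. ennreal (B powr t) \<partial>M)"
    proof (intro nn_integral_mono_AE)
      show "AE x in M. ennreal (\<bar>f x\<bar> powr t) \<le> ennreal (B powr t)"
        using B by eventually_elim (use t in \<open>auto intro!: ennreal_leI powr_mono2\<close>)
    qed
    also have "\<dots> < \<infinity>" using emeasure_finite[of "space M"] by (simp add: ennreal_mult_less_top less_top[symmetric] ennreal_mult_eq_top_iff)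
    finally show ?thesis .
  next
    case False
    then obtain r where r: "s = ennreal r" "0 \<le> r" by (cases s) auto
    then have tr: "t \<le> r" using t by (simp add: ennreal_le_iff2)
    have fin: "(\<integral>\<^sup>+x. ennreal (\<bar>f x\<bar> powr r) \<partial>M) < \<infinity>" using f False r by (simp add: in_Lp_def)
    have "(\<integral>\<^sup>+x. ennreal (\<bar>f x\<bar> powr t) \<partial>M) \<le> (\<integral>\<^sup>+x. 1 + ennreal (\<bar>f x\<bar> powr r) \<partial>M)"
    proof (intro nn_integral_mono)
      fix x
      have "\<bar>f x\<bar> powr t \<le> 1 + \<bar>f x\<bar> powr r"
      proof (cases "\<bar>f x\<bar> \<le> 1")
        case True
        then have "\<bar>f x\<bar> powr t \<le> 1 powr t" using t by (intro powr_mono2) auto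
        then show ?thesis by (simp add: add_increasing2)
      next
        case False
        then have "\<bar>f x\<bar> powr t \<le> \<bar>f x\<bar> powr r" using tr by (intro powr_mono) auto
        then show ?thesis by simp
      qed
      then show "ennreal (\<bar>f x\<bar> powr t) \<le> 1 + ennreal (\<bar>f x\<bar> powr r)"
        by (metis ennreal_1 ennreal_leI ennreal_plus powr_ge_zero zero_le_one)
    qed
    also have "\<dots> = emeasure M (space M) + (\<integral>\<^sup>+x. ennreal (\<bar>f x\<bar> powr r) \<partial>M)" by (subst nn_integral_add) auto
    also have "\<dots> < \<infinity>" using fin by (simp add: less_top[symmetric])
    finally show ?thesis .
  qed
qed

text \<open>By homogeneity \<Omega> takes the same value at A_(c|y|)(y/|y|) and at y/|y|, so
  superlevel sets of |\<Omega>|^s on {1/2 < \<rho> \<le> 1} lie in Lipschitz images of superlevel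
  sets of its radial extension from the sphere to a Euclidean annulus. Layer cake bounds the
  integral over this shell, dilations move it to every dyadic shell, and the sum is geometric.
  \<Omega>0 is a Borel version for the volume and says nothing about the sphere, where
  \<open>\<Omega>2\<close> is taken as a second version.\<close>

lemma homogeneous_Ls_growth:
  fixes P :: "real^'n^'n" and \<rho> \<Omega> \<Omega>0 :: "real^'n \<Rightarrow> real"
  assumes qd: "parabolic_quasi_distance P \<rho>" and tr: "0 < trace P"
    and meas: "\<Omega> \<in> borel_measurable lebesgue" and hom: "\<And>t x. 0 < t \<Longrightarrow> \<Omega> (dilation P t x) = \<Omega> x"
    and s: "0 < s" and \<Omega>S: "\<Omega> \<in> borel_measurable (completion sphere_measure)"
    and fin: "(\<integral>\<^sup>+x. ennreal (\<bar>\<Omega> x\<bar> powr s) \<partial>completion sphere_measure) < \<infinity>"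
    and \<Omega>0[measurable]: "\<Omega>0 \<in> borel_measurable borel" and ae0: "AE x in lborel. \<Omega> x = \<Omega>0 x"
  shows "\<exists>A\<ge>0. \<forall>t>0. (\<integral>\<^sup>+x. ennreal (\<bar>\<Omega>0 x\<bar> powr s) * indicator {x. \<rho> x < t} x \<partial>lborel) \<le> ennreal (A * t powr trace P)"
proof -
  obtain k \<upsilon> where "homogeneous_quasi_norm \<rho> k (trace P) \<upsilon>" using homogeneous_quasi_norm_rho[OF qd tr] by blast
  then interpret homogeneous_quasi_norm \<rho> k "trace P" \<upsilon> .
  note rd = rho_dilation[OF qd tr]
  let ?U = "uniform_measure lborel (ball (0::real^'n) 1)"
  let ?b = "emeasure lborel (ball (0::real^'n) 1)"
  have b: "?b \<noteq> 0" "?b < \<infinity>"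
    using content_ball_pos[of 1 "0::real^'n"] emeasure_lborel_ball_finite[of "0::real^'n" 1]
    by (auto simp: measure_def enn2real_positive_iff)
  obtain \<Omega>1 where \<Omega>1: "\<Omega>1 \<in> borel_measurable sphere_measure" "AE x in sphere_measure. \<Omega> x = \<Omega>1 x"
    using completion_ex_borel_measurable_real[OF \<Omega>S] by blast
  define \<Omega>2 where "\<Omega>2 x = indicator (sphere 0 1) x *\<^sub>R \<Omega>1 x" for x
  have [measurable]: "\<Omega>2 \<in> borel_measurable borel"
    using \<Omega>1(1) unfolding \<Omega>2_def[abs_def] sphere_measure_def
    by (subst (asm) borel_measurable_restrict_space_iff) auto
  \<comment> \<open>The sphere measure is the image under \<open>sgn\<close> of the uniform measure
    on the ball, so a statement about almost every point of the sphere is one about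
    \<open>sgn y\<close> for almost every y in the ball.\<close>
  have ae2: "AE y in lborel. y \<in> ball 0 1 \<and> y \<noteq> 0 \<longrightarrow> \<Omega> (sgn y) = \<Omega>2 (sgn y)"
  proof -
    have "AE x in distr ?U borel sgn. x \<in> sphere 0 1 \<longrightarrow> \<Omega> x = \<Omega>1 x"
      using \<Omega>1(2) unfolding sphere_measure_def by (subst (asm) AE_restrict_space_iff) auto
    then have "AE y in ?U. sgn y \<in> sphere 0 1 \<longrightarrow> \<Omega> (sgn y) = \<Omega>1 (sgn y)"
      by (rule AE_distrD[rotated]) simp
    then have "AE y in lborel. y \<in> ball 0 1 \<longrightarrow> sgn y \<in> sphere 0 1 \<longrightarrow> \<Omega> (sgn y) = \<Omega>1 (sgn y)"
      using b by (subst (asm) AE_uniform_measure) auto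
    then show ?thesis by eventually_elim (auto simp: \<Omega>2_def norm_sgn)
  qed
  have fin2: "(\<integral>\<^sup>+y. ennreal (\<bar>\<Omega>2 (sgn y)\<bar> powr s) * indicator (ball 0 1) y \<partial>lborel) < \<infinity>"
  proof -
    have "(\<integral>\<^sup>+x. ennreal (\<bar>\<Omega> x\<bar> powr s) \<partial>completion sphere_measure) = (\<integral>\<^sup>+x. ennreal (\<bar>\<Omega> x\<bar> powr s) \<partial>sphere_measure)"
      by (rule nn_integral_completion)
    also have "\<dots> = (\<integral>\<^sup>+x. ennreal (\<bar>\<Omega>2 x\<bar> powr s) \<partial>sphere_measure)"
    proof (intro nn_integral_cong_AE)
      have "AE x in sphere_measure. x \<in> sphere (0::real^'n) 1"
        by (rule AE_I2) (simp add: sphere_measure_def space_restrict_space)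
      with \<Omega>1(2) show "AE x in sphere_measure. ennreal (\<bar>\<Omega> x\<bar> powr s) = ennreal (\<bar>\<Omega>2 x\<bar> powr s)"
        by eventually_elim (auto simp: \<Omega>2_def)
    qed
    also have "\<dots> = (\<integral>\<^sup>+x. ennreal (\<bar>\<Omega>2 x\<bar> powr s) * indicator (sphere 0 1) x \<partial>distr ?U borel sgn)"
      unfolding sphere_measure_def by (rule nn_integral_restrict_space) simp
    also have "\<dots> = (\<integral>\<^sup>+x. ennreal (\<bar>\<Omega>2 x\<bar> powr s) \<partial>distr ?U borel sgn)"
      using s by (intro nn_integral_cong) (auto simp: \<Omega>2_def indicator_def)
    also have "\<dots> = (\<integral>\<^sup>+y. ennreal (\<bar>\<Omega>2 (sgn y)\<bar> powr s) \<partial>?U)"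
      by (rule nn_integral_distr) auto
    also have "\<dots> = (\<integral>\<^sup>+y. ennreal (\<bar>\<Omega>2 (sgn y)\<bar> powr s) * indicator (ball 0 1) y \<partial>lborel) / ?b"
      by (rule nn_integral_uniform_measure) auto
    finally show ?thesis using fin b by (auto simp: ennreal_divide_eq_top_iff simp flip: less_top)
  qed
  obtain c a L where ca: "0 < c" "0 < a" "0 \<le> L"
    and lip: "\<And>x y. a \<le> norm x \<Longrightarrow> norm x < 1 \<Longrightarrow> a \<le> norm y \<Longrightarrow> norm y < 1 \<Longrightarrow>
        norm (dilation P (c * norm x) (sgn x) - dilation P (c * norm y) (sgn y)) \<le> L * norm (x - y)"
    and surj: "\<And>x. 1 / 2 < \<rho> x \<Longrightarrow> \<rho> x \<le> 1 \<Longrightarrow> \<exists>y. a \<le> norm y \<and> norm y < 1 \<and> x = dilation P (c * norm y) (sgn y)"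
    using annulus_subset_Lipschitz_image[OF qd tr] by (elim exE conjE) blast
  define D where "D = {y::real^'n. a \<le> norm y \<and> norm y < 1}"
  have D[measurable]: "D \<in> sets borel" unfolding D_def by measurable
  define g where "g y = \<bar>\<Omega> (sgn y)\<bar> powr s * indicator D y" for y
  define g2 where "g2 y = \<bar>\<Omega>2 (sgn y)\<bar> powr s * indicator D y" for y
  have [measurable]: "g2 \<in> borel_measurable borel" unfolding g2_def by measurable
  have gg2: "AE y in lborel. g y = g2 y"
    using ae2 by eventually_elim (use ca in \<open>auto simp: g_def g2_def D_def indicator_def\<close>)
  have g: "g \<in> borel_measurable lebesgue"
    by (rule borel_measurable_lebesgue_AE[OF _ AE_completion[OF gg2]]) (rule measurable_completion, simp)
  define Ann where "Ann = {x. 1 / 2 < \<rho> x \<and> \<rho> x \<le> 1}"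
  have [measurable]: "Ann \<in> sets borel" unfolding Ann_def by measurable
  define f where "f x = \<bar>\<Omega> x\<bar> powr s * indicator Ann x" for x
  have f: "f \<in> borel_measurable lebesgue"
  proof -
    have [measurable]: "Ann \<in> sets lebesgue" by simp
    note meas[measurable]
    show ?thesis unfolding f_def by measurable
  qed
  define C where "C = ennreal ((2 * L * DIM(real^'n)) ^ DIM(real^'n))"
  have "(\<integral>\<^sup>+x. ennreal (f x) \<partial>lebesgue) \<le> C * (\<integral>\<^sup>+x. ennreal (g x) \<partial>lebesgue)"
  proof (rule nn_integral_le_of_distribution_le)
    fix t :: real assume t: "0 \<le> t"
    have St: "{x \<in> space lebesgue. t < g x} \<subseteq> D" using t by (auto simp: g_def indicator_def of_bool_def split: if_splits)
    have "{x \<in> space lebesgue. t < f x} \<subseteq> (\<lambda>y. dilation P (c * norm y) (sgn y)) ` {x \<in> space lebesgue. t < g x}"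
    proof
      fix x assume "x \<in> {x \<in> space lebesgue. t < f x}"
      then have x: "x \<in> Ann" "t < \<bar>\<Omega> x\<bar> powr s" using t by (auto simp: f_def indicator_def of_bool_def split: if_splits)
      then obtain y where y: "a \<le> norm y" "norm y < 1" "x = dilation P (c * norm y) (sgn y)" using surj[of x] by (auto simp: Ann_def)
      have "0 < c * norm y" using ca y by (intro mult_pos_pos) linarith+
      then have "\<Omega> x = \<Omega> (sgn y)" using y hom by simp
      then have "y \<in> {x \<in> space lebesgue. t < g x}" using x y by (auto simp: g_def D_def)
      then show "x \<in> (\<lambda>y. dilation P (c * norm y) (sgn y)) ` {x \<in> space lebesgue. t < g x}" using y(3) by blast
    qed
    moreover have "bounded {x \<in> space lebesgue. t < g x}"
      using bounded_subset[OF _ St] by (auto simp: D_def bounded_iff intro: less_imp_le)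
    moreover have "{x \<in> space lebesgue. t < f x} \<in> sets lebesgue" "{x \<in> space lebesgue. t < g x} \<in> sets lebesgue"
      using f g by measurable
    moreover have "norm (dilation P (c * norm x) (sgn x) - dilation P (c * norm y) (sgn y)) \<le> L * norm (x - y)"
      if "x \<in> {x \<in> space lebesgue. t < g x}" "y \<in> {x \<in> space lebesgue. t < g x}" for x y
      using lip[of x y] subsetD[OF St that(1)] subsetD[OF St that(2)] by (simp add: D_def)
    ultimately show "emeasure lebesgue {x \<in> space lebesgue. t < f x} \<le> C * emeasure lebesgue {x \<in> space lebesgue. t < g x}"
      unfolding C_def using ca(3)
      by (intro emeasure_subset_Lipschitz_image[where \<phi>="\<lambda>y. dilation P (c * norm y) (sgn y)"]) auto
    next
    show "0 \<le> f x" "0 \<le> g x" for x by (simp_all add: f_def g_def)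
  qed (use f g sigma_finite_lebesgue in auto)
  also have "(\<integral>\<^sup>+x. ennreal (g x) \<partial>lebesgue) = (\<integral>\<^sup>+x. ennreal (g2 x) \<partial>lborel)"
    unfolding nn_integral_completion by (intro nn_integral_cong_AE) (use gg2 in \<open>auto elim!: eventually_mono\<close>)
  also have "C * (\<integral>\<^sup>+x. ennreal (g2 x) \<partial>lborel) < \<infinity>"
  proof -
    have "(\<integral>\<^sup>+x. ennreal (g2 x) \<partial>lborel) \<le> (\<integral>\<^sup>+y. ennreal (\<bar>\<Omega>2 (sgn y)\<bar> powr s) * indicator (ball 0 1) y \<partial>lborel)"
      by (intro nn_integral_mono) (auto simp: g2_def D_def indicator_def)
    then have "(\<integral>\<^sup>+x. ennreal (g2 x) \<partial>lborel) < \<infinity>" using fin2 by (rule le_less_trans)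
    then show ?thesis by (simp add: C_def ennreal_mult_less_top)
  qed
  finally have ff: "(\<integral>\<^sup>+x. ennreal (f x) \<partial>lebesgue) < \<infinity>" .
  define f0 where "f0 x = ennreal (\<bar>\<Omega>0 x\<bar> powr s) * indicator Ann x" for x
  have [measurable]: "f0 \<in> borel_measurable borel" unfolding f0_def by measurable
  have "(\<integral>\<^sup>+x. ennreal (f x) \<partial>lebesgue) = (\<integral>\<^sup>+x. f0 x \<partial>lborel)"
    unfolding nn_integral_completion
    by (intro nn_integral_cong_AE) (use ae0 in \<open>auto elim!: eventually_mono simp: f_def f0_def indicator_def\<close>)
  then obtain A0 where A0: "(\<integral>\<^sup>+x. f0 x \<partial>lborel) = ennreal A0" "0 \<le> A0"
    using ff by (cases "\<integral>\<^sup>+x. f0 x \<partial>lborel") auto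
  have ann: "(\<integral>\<^sup>+x. ennreal (\<bar>\<Omega>0 x\<bar> powr s) * indicator {x. t / 2 < \<rho> x \<and> \<rho> x \<le> t} x \<partial>lborel) = ennreal (A0 * t powr trace P)"
    if t: "0 < t" for t
  proof -
    have "(\<integral>\<^sup>+x. ennreal (\<bar>\<Omega>0 x\<bar> powr s) * indicator {x. t / 2 < \<rho> x \<and> \<rho> x \<le> t} x \<partial>lborel)
      = ennreal (t powr trace P) * (\<integral>\<^sup>+x. ennreal (\<bar>\<Omega>0 (dilation P t x)\<bar> powr s) * indicator {x. t / 2 < \<rho> x \<and> \<rho> x \<le> t} (dilation P t x) \<partial>lborel)"
      by (rule nn_integral_dilation[OF qd tr _ t]) measurable
    also have "(\<integral>\<^sup>+x. ennreal (\<bar>\<Omega>0 (dilation P t x)\<bar> powr s) * indicator {x. t / 2 < \<rho> x \<and> \<rho> x \<le> t} (dilation P t x) \<partial>lborel) = (\<integral>\<^sup>+x. f0 x \<partial>lborel)"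
    proof (intro nn_integral_cong_AE)
      \<comment> \<open>The Borel version is homogeneous only off a null set, which depends on
        t.\<close>
      show "AE x in lborel. ennreal (\<bar>\<Omega>0 (dilation P t x)\<bar> powr s) * indicator {x. t / 2 < \<rho> x \<and> \<rho> x \<le> t} (dilation P t x) = f0 x"
        using ae0 AE_dilation[OF qd tr ae0 t]
      proof eventually_elim
        case (elim x)
        then have "\<Omega>0 (dilation P t x) = \<Omega>0 x" using hom[OF t, of x] by simp
        moreover have "dilation P t x \<in> {x. t / 2 < \<rho> x \<and> \<rho> x \<le> t} \<longleftrightarrow> x \<in> Ann"
          using t by (auto simp: rd Ann_def field_simps)
        ultimately show ?case by (simp add: f0_def indicator_def)
      qed
    qed
    finally show ?thesis using A0 by (simp add: mult.commute flip: ennreal_mult)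
  qed
  show ?thesis
  proof (intro exI[of _ "A0 / (1 - (1 / 2) powr trace P)"] conjI allI impI)
    have q: "(1 / 2 :: real) powr trace P < 1" using tr powr_less_mono2[of "trace P" "1 / 2" 1] by simp
    then show "0 \<le> A0 / (1 - (1 / 2) powr trace P)" using A0 by simp
    fix t :: real assume t: "0 < t"
    have "(\<integral>\<^sup>+x. ennreal (\<bar>\<Omega>0 x\<bar> powr s) * indicator {x. \<rho> x < t} x \<partial>lborel)
      \<le> (\<integral>\<^sup>+x. (\<Sum>j. ennreal (\<bar>\<Omega>0 x\<bar> powr s) * indicator {x. (t / 2 ^ j) / 2 < \<rho> x \<and> \<rho> x \<le> t / 2 ^ j} x) \<partial>lborel)"
    proof (intro nn_integral_mono_AE)
      \<comment> \<open>The origin lies in {\<rho> < t} but in none of the shells.\<close>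
      have "AE x in lborel. x \<noteq> (0 :: real^'n)" by (rule AE_lborel_singleton)
      then show "AE x in lborel. ennreal (\<bar>\<Omega>0 x\<bar> powr s) * indicator {x. \<rho> x < t} x
        \<le> (\<Sum>j. ennreal (\<bar>\<Omega>0 x\<bar> powr s) * indicator {x. (t / 2 ^ j) / 2 < \<rho> x \<and> \<rho> x \<le> t / 2 ^ j} x)"
      proof eventually_elim
        case (elim x)
        let ?f = "\<lambda>j. ennreal (\<bar>\<Omega>0 x\<bar> powr s) * indicator {x. (t / 2 ^ j) / 2 < \<rho> x \<and> \<rho> x \<le> t / 2 ^ j} x"
        show ?case
        proof (cases "\<rho> x < t")
          case True
          have rp: "0 < \<rho> x" using elim by (rule rho_pos)
          then obtain j :: nat where j: "2 ^ j \<le> t / \<rho> x" "t / \<rho> x < 2 * 2 ^ j"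
            using ex_dyadic_interval[of "t / \<rho> x"] True by auto
          then have "(t / 2 ^ j) / 2 < \<rho> x" "\<rho> x \<le> t / 2 ^ j" using rp by (auto simp: field_simps)
          then have "ennreal (\<bar>\<Omega>0 x\<bar> powr s) * indicator {x. \<rho> x < t} x \<le> ?f j" using True by simp
          also have "?f j \<le> suminf ?f" by (rule le_suminf_ennreal)
          finally show ?thesis .
        qed auto
      qed
    qed
    also have "\<dots> = (\<Sum>j. (\<integral>\<^sup>+x. ennreal (\<bar>\<Omega>0 x\<bar> powr s) * indicator {x. (t / 2 ^ j) / 2 < \<rho> x \<and> \<rho> x \<le> t / 2 ^ j} x \<partial>lborel))"
      by (rule nn_integral_suminf) measurable
    also have "\<dots> = (\<Sum>j. ennreal (A0 * (t / 2 ^ j) powr trace P))"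
      by (intro arg_cong[where f=suminf] ext ann) (use t in simp)
    also have "\<dots> = (\<Sum>j. ennreal ((A0 * t powr trace P) * ((1 / 2) powr trace P) ^ j))"
      using t by (intro arg_cong[where f=suminf] ext) (simp add: powr_divide power_powr_swap power_divide mult_ac)
    also have "\<dots> = ennreal ((A0 * t powr trace P) / (1 - (1 / 2) powr trace P))"
      using q A0 by (intro suminf_ennreal_geometric) auto
    finally show "(\<integral>\<^sup>+x. ennreal (\<bar>\<Omega>0 x\<bar> powr s) * indicator {x. \<rho> x < t} x \<partial>lborel)
       \<le> ennreal (A0 / (1 - (1 / 2) powr trace P) * t powr trace P)" by simp
  qed
qed

section \<open>Rough fractional integrals\<close>

text \<open>Here \<Omega> is a nonnegative Borel function, later the absolute value of a Borel
  version, and s a finite exponent, later the \<open>\<sigma>\<close> chosen by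
  \<open>exponent_reduction\<close>. Homogeneity is present through the growth of the s-th moment.
  The bound on s means \<gamma> < (\<gamma> - \<alpha>) s, so that the s-th power of the kernel is
  integrable at infinity.\<close>

locale rough_fractional = homogeneous_quasi_norm \<rho> k \<gamma> \<upsilon>
  for \<rho> :: "real^'n \<Rightarrow> real" and k \<gamma> \<upsilon> :: real +
  fixes \<Omega> :: "real^'n \<Rightarrow> real" and s A \<alpha> :: real
  assumes measurable_Omega [measurable]: "\<Omega> \<in> borel_measurable borel" and Omega_nonneg: "0 \<le> \<Omega> x"
    and A_nonneg: "0 \<le> A" and alpha: "0 < \<alpha>" "\<alpha> < \<gamma>" and s_gt: "\<gamma> / (\<gamma> - \<alpha>) < s"
    and Omega_growth: "0 < t \<Longrightarrow> (\<integral>\<^sup>+x. ennreal (\<Omega> x powr s) * indicator {x. \<rho> x < t} x \<partial>lborel) \<le> ennreal (A * t powr \<gamma>)"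
begin

lemma s_gt_1: "1 < s"
proof -
  have "1 < \<gamma> / (\<gamma> - \<alpha>)" using alpha by simp
  then show ?thesis using s_gt by linarith
qed

definition K :: "real^'n \<Rightarrow> real" where
  "K z = \<Omega> z / \<rho> z powr (\<gamma> - \<alpha>)"

lemma K_nonneg: "0 \<le> K z"
  by (simp add: K_def Omega_nonneg)

lemma measurable_K [measurable]: "K \<in> borel_measurable borel"
  unfolding K_def by measurable

text \<open>Let R = \<mu>^(-1/(\<gamma>-\<alpha>)). The set {\<rho> < R} has volume \<upsilon>
  \<mu>^(-\<gamma>/(\<gamma>-\<alpha>)); outside it, Chebyshev's inequality with the s-th moment and
  dyadic summation give the same power of \<mu>.\<close>

lemma K_weak: "\<exists>B\<ge>0. \<forall>\<mu>>0. emeasure lborel {x. \<mu> < K x} \<le> ennreal (B * \<mu> powr - (\<gamma> / (\<gamma> - \<alpha>)))"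
proof -
  define a where "a = (\<gamma> - \<alpha>) * s"
  have a: "\<gamma> < a" using s_gt alpha by (simp add: a_def field_simps)
  define B0 where "B0 = A * 2 powr \<gamma> / (1 - 2 powr (\<gamma> - a))"
  have "2 powr (\<gamma> - a) < (1::real)" using powr_less_mono[of "\<gamma> - a" 0 2] a by simp
  then have B0: "0 \<le> B0" using A_nonneg by (simp add: B0_def)
  show ?thesis
  proof (intro exI[of _ "\<upsilon> + B0"] conjI allI impI)
    show "0 \<le> \<upsilon> + B0" using B0 upsilon_pos by simp
    fix \<mu> :: real assume \<mu>: "0 < \<mu>"
    define R where "R = \<mu> powr (- (1 / (\<gamma> - \<alpha>)))"
    have R: "0 < R" using \<mu> by (simp add: R_def)
    have "emeasure lborel {x. \<mu> < K x} \<le> emeasure lborel ({x. \<rho> x < R} \<union> {x. R \<le> \<rho> x \<and> \<mu> < K x})"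
      by (rule emeasure_mono) (auto simp: not_less)
    also have "\<dots> \<le> emeasure lborel {x. \<rho> x < R} + emeasure lborel {x. R \<le> \<rho> x \<and> \<mu> < K x}"
      by (rule emeasure_subadditive) auto
    also have "emeasure lborel {x. \<rho> x < R} = ennreal (\<upsilon> * \<mu> powr - (\<gamma> / (\<gamma> - \<alpha>)))"
      using R by (simp add: emeasure_less R_def powr_powr)
    also have "emeasure lborel {x. R \<le> \<rho> x \<and> \<mu> < K x} = (\<integral>\<^sup>+x. indicator {x. R \<le> \<rho> x \<and> \<mu> < K x} x \<partial>lborel)" by simp
    also have "\<dots> \<le> (\<integral>\<^sup>+x. ennreal (\<mu> powr - s) * (ennreal (\<Omega> x powr s) * ennreal (\<rho> x powr - a) * indicator {x. R \<le> \<rho> x} x) \<partial>lborel)"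
    proof (intro nn_integral_mono)
      fix x
      show "indicator {x. R \<le> \<rho> x \<and> \<mu> < K x} x \<le> ennreal (\<mu> powr - s) * (ennreal (\<Omega> x powr s) * ennreal (\<rho> x powr - a) * indicator {x. R \<le> \<rho> x} x)"
      proof (cases "R \<le> \<rho> x \<and> \<mu> < K x")
        case True
        then have "\<mu> powr s \<le> (\<Omega> x / \<rho> x powr (\<gamma> - \<alpha>)) powr s"
          using \<mu> s_gt_1 by (intro powr_mono2) (auto simp: K_def)
        also have "\<dots> = \<Omega> x powr s * \<rho> x powr - a"
          by (subst powr_divide) (simp_all add: Omega_nonneg powr_powr a_def powr_minus_divide)
        finally have "\<mu> powr s * \<mu> powr - s \<le> (\<Omega> x powr s * \<rho> x powr - a) * \<mu> powr - s" by (rule mult_right_mono) simp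
        then have "1 \<le> \<mu> powr - s * (\<Omega> x powr s * \<rho> x powr - a)"
          using \<mu> by (simp add: mult.commute flip: powr_add)
        then have "ennreal 1 \<le> ennreal (\<mu> powr - s * (\<Omega> x powr s * \<rho> x powr - a))" by (rule ennreal_leI)
        then show ?thesis using True by (simp add: ennreal_mult)
      qed auto
    qed
    also have "\<dots> = ennreal (\<mu> powr - s) * (\<integral>\<^sup>+x. (ennreal (\<Omega> x powr s) * ennreal (\<rho> x powr - a) * indicator {x. R \<le> \<rho> x} x) \<partial>lborel)"
      by (rule nn_integral_cmult) measurable
    also have "\<dots> \<le> ennreal (\<mu> powr - s) * ennreal (B0 * R powr (\<gamma> - a))"
      unfolding B0_def using a A_nonneg R Omega_growth gamma_pos
      by (intro mult_left_mono nn_integral_dyadic_above) auto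
    also have "\<dots> = ennreal (B0 * \<mu> powr - (\<gamma> / (\<gamma> - \<alpha>)))"
    proof -
      have "- s + - (1 / (\<gamma> - \<alpha>)) * (\<gamma> - a) = - (\<gamma> / (\<gamma> - \<alpha>))" using alpha by (simp add: a_def field_simps)
      then have "\<mu> powr - s * R powr (\<gamma> - a) = \<mu> powr - (\<gamma> / (\<gamma> - \<alpha>))"
        by (simp only: R_def powr_powr powr_add[symmetric])
      then show ?thesis using B0 by (simp add: mult.left_commute flip: ennreal_mult)
    qed
    finally show "emeasure lborel {x. \<mu> < K x} \<le> ennreal ((\<upsilon> + B0) * \<mu> powr - (\<gamma> / (\<gamma> - \<alpha>)))"
      using B0 upsilon_pos by (simp add: distrib_right add_left_mono)
  qed
qed

text \<open>The fractional integral of nonnegative functions; the operator of the size condition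
  bears the same letter but is a different object.\<close>

definition T :: "(real^'n \<Rightarrow> real) \<Rightarrow> real^'n \<Rightarrow> ennreal" where
  "T f x = (\<integral>\<^sup>+y. ennreal (K (x - y)) * ennreal (f y) \<partial>lborel)"

lemma measurable_T [measurable]:
  assumes [measurable]: "f \<in> borel_measurable borel"
  shows "T f \<in> borel_measurable borel"
  unfolding T_def by measurable

text \<open>The weak Young inequality with 1 / \<kappa> = 1 - \<alpha> / \<gamma>, which turns its
  exponent relation into 1 / u = 1 / v - \<alpha> / \<gamma>.\<close>

theorem Hardy_Littlewood_Sobolev:
  assumes "1 < v" "0 < u" "1 / u = 1 / v - \<alpha> / \<gamma>"
  shows "\<exists>C>0. \<forall>f\<in>borel_measurable borel. (\<forall>y. 0 \<le> f y) \<longrightarrow>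
    enn_Lp_norm u lborel (T f) \<le> ennreal C * enn_Lp_norm v lborel (\<lambda>y. ennreal (f y))"
proof -
  obtain B where B: "0 \<le> B" "\<And>\<mu>. 0 < \<mu> \<Longrightarrow> emeasure lborel {x. \<mu> < K x} \<le> ennreal (B * \<mu> powr - (\<gamma> / (\<gamma> - \<alpha>)))"
    using K_weak by blast
  have "1 < \<gamma> / (\<gamma> - \<alpha>)" using alpha by simp
  moreover have "1 / u = 1 / v + 1 / (\<gamma> / (\<gamma> - \<alpha>)) - 1" using assms alpha by (simp add: diff_divide_distrib)
  ultimately have "\<exists>C>0. \<forall>f\<in>borel_measurable borel. (\<forall>y. 0 \<le> f y) \<longrightarrow>
    enn_Lp_norm u lborel (\<lambda>x. \<integral>\<^sup>+y. ennreal (K (x - y)) * ennreal (f y) \<partial>lborel)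
      \<le> ennreal C * enn_Lp_norm v lborel (\<lambda>y. ennreal (f y))"
    using B K_nonneg assms by (intro weak_Young[where \<kappa>="\<gamma> / (\<gamma> - \<alpha>)" and B=B]) auto
  then show ?thesis unfolding T_def[abs_def] .
qed

section \<open>Ellipsoids, shells and local estimates of the fractional integral\<close>

lemma measurable_ellipsoid [measurable]: "ellipsoid \<rho> x r \<in> sets borel"
  unfolding ellipsoid_def by measurable

lemma emeasure_ellipsoid: "0 < r \<Longrightarrow> emeasure lborel (ellipsoid \<rho> x r) = ennreal (\<upsilon> * r powr \<gamma>)"
proof -
  assume r: "0 < r"
  have "(\<lambda>y. indicator {z. \<rho> z < r} (x - y)) = (indicator (ellipsoid \<rho> x r) :: _ \<Rightarrow> ennreal)" by (auto simp: indicator_def ellipsoid_def)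
  then have "emeasure lborel (ellipsoid \<rho> x r) = (\<integral>\<^sup>+y. indicator {z. \<rho> z < r} (x - y) \<partial>lborel)" by simp
  also have "\<dots> = emeasure lborel {z. \<rho> z < r}" by (subst nn_integral_lborel_diff(2)) auto
  finally show ?thesis using r by (simp add: emeasure_less)
qed

text \<open>The index 0 takes the full ellipsoid, so that all shells together cover the space. They
  are used with t = 2 k r, which keeps the shells of index j \<ge> 1 at a distance from E(x0, r)
  comparable with their size.\<close>

definition shell :: "real^'n \<Rightarrow> real \<Rightarrow> nat \<Rightarrow> (real^'n) set" where
  "shell x0 t j = (if j = 0 then ellipsoid \<rho> x0 t else ellipsoid \<rho> x0 (2 ^ j * t) - ellipsoid \<rho> x0 (2 ^ (j - 1) * t))"

lemma measurable_shell [measurable]: "shell x0 t j \<in> sets borel"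
  unfolding shell_def by auto

lemma ex_shell:
  assumes "0 < t" shows "\<exists>j. y \<in> shell x0 t j"
proof (cases "\<rho> (x0 - y) < t")
  case True then show ?thesis by (intro exI[of _ 0]) (simp add: shell_def ellipsoid_def)
next
  case False
  then obtain j :: nat where "2 ^ j \<le> \<rho> (x0 - y) / t" "\<rho> (x0 - y) / t < 2 * 2 ^ j"
    using ex_dyadic_interval[of "\<rho> (x0 - y) / t"] assms by auto
  then show ?thesis using assms by (intro exI[of _ "Suc j"]) (auto simp: shell_def ellipsoid_def field_simps)
qed

lemma shell_subset: "shell x0 t j \<subseteq> ellipsoid \<rho> x0 (2 ^ j * t)"
  by (auto simp: shell_def)

text \<open>Both signs of the argument are recorded: Hoelder's inequality integrates \<Omega>(x - y)
  in y, Minkowski's in x.\<close>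

lemma Omega_norm_le:
  assumes t: "0 < t"
  shows "enn_Lp_norm s lborel (\<lambda>y. ennreal (\<Omega> (x - y) * indicator {z. \<rho> z < t} (x - y))) \<le> ennreal ((A * t powr \<gamma>) powr (1 / s))"
    and "enn_Lp_norm s lborel (\<lambda>y. ennreal (\<Omega> (y - x) * indicator {z. \<rho> z < t} (y - x))) \<le> ennreal ((A * t powr \<gamma>) powr (1 / s))"
proof -
  have e: "ennreal_powr (ennreal (\<Omega> z * indicator {z. \<rho> z < t} z)) s = ennreal (\<Omega> z powr s) * indicator {x. \<rho> x < t} z" for z
    using Omega_nonneg[of z] s_gt_1 by (auto simp: indicator_def ennreal_powr_ennreal)
  have c: "ennreal_powr (ennreal ((A * t powr \<gamma>) powr (1 / s))) s = ennreal (A * t powr \<gamma>)"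
    using A_nonneg s_gt_1 by (simp add: ennreal_powr_ennreal powr_powr)
  show "enn_Lp_norm s lborel (\<lambda>y. ennreal (\<Omega> (x - y) * indicator {z. \<rho> z < t} (x - y))) \<le> ennreal ((A * t powr \<gamma>) powr (1 / s))"
  proof (rule enn_Lp_norm_leI)
    show "(\<integral>\<^sup>+y. ennreal_powr (ennreal (\<Omega> (x - y) * indicator {z. \<rho> z < t} (x - y))) s \<partial>lborel) \<le> ennreal_powr (ennreal ((A * t powr \<gamma>) powr (1 / s))) s"
      unfolding e c using Omega_growth[OF t] by (subst nn_integral_lborel_diff(2)[of "\<lambda>z. ennreal (\<Omega> z powr s) * indicator {x. \<rho> x < t} z"]) auto
  qed (use s_gt_1 in auto)
  show "enn_Lp_norm s lborel (\<lambda>y. ennreal (\<Omega> (y - x) * indicator {z. \<rho> z < t} (y - x))) \<le> ennreal ((A * t powr \<gamma>) powr (1 / s))"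
  proof (rule enn_Lp_norm_leI)
    show "(\<integral>\<^sup>+y. ennreal_powr (ennreal (\<Omega> (y - x) * indicator {z. \<rho> z < t} (y - x))) s \<partial>lborel) \<le> ennreal_powr (ennreal ((A * t powr \<gamma>) powr (1 / s))) s"
      unfolding e c using Omega_growth[OF t] by (subst nn_integral_lborel_diff(1)[of "\<lambda>z. ennreal (\<Omega> z powr s) * indicator {x. \<rho> x < t} z"]) auto
  qed (use s_gt_1 in auto)
qed

text \<open>For y in the shell, \<rho>(x0 - y) lies in [t/2, t), and the quasi-triangle inequality
  puts \<rho>(x - y) between t / (4 k) and 2 k t; the first radius 2 k r is what makes k r \<le> t /
  4 absorbable. Hence the singular factor of the kernel is bounded by a power of t, and \<Omega> is
  left on {\<rho> < 2 k t}.\<close>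

lemma T_shell_le:
  assumes r: "0 < r" and x: "x \<in> ellipsoid \<rho> x0 r" and f: "\<And>y. 0 \<le> f y" and j: "j \<noteq> 0"
  defines "t \<equiv> 2 ^ j * (2 * k * r)"
  shows "T (\<lambda>y. f y * indicator (shell x0 (2 * k * r) j) y) x \<le>
    (\<integral>\<^sup>+y. ennreal ((t / (4 * k)) powr (\<alpha> - \<gamma>)) * (ennreal (\<Omega> (x - y) * indicator {z. \<rho> z < 2 * k * t} (x - y)) * (ennreal (f y) * indicator (shell x0 (2 * k * r) j) y)) \<partial>lborel)"
  unfolding T_def
proof (intro nn_integral_mono)
  fix y
  have t: "0 < t" "2 * k * r \<le> t / 2"
  proof -
    show "0 < t" using r k_ge_1 by (simp add: t_def)
    have "2 * (2 * k * r) \<le> 2 ^ j * (2 * k * r)" using r k_ge_1 j power_increasing[of 1 j "2::real"] by (intro mult_right_mono) auto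
    then show "2 * k * r \<le> t / 2" by (simp add: t_def mult_ac)
  qed
  show "ennreal (K (x - y)) * ennreal (f y * indicator (shell x0 (2 * k * r) j) y)
     \<le> ennreal ((t / (4 * k)) powr (\<alpha> - \<gamma>)) * (ennreal (\<Omega> (x - y) * indicator {z. \<rho> z < 2 * k * t} (x - y)) * (ennreal (f y) * indicator (shell x0 (2 * k * r) j) y))"
  proof (cases "y \<in> shell x0 (2 * k * r) j")
    case True
    have "2 ^ (j - 1) * (2 * k * r) = t / 2" using j by (cases j) (auto simp: t_def)
    moreover have "\<not> \<rho> (x0 - y) < 2 ^ (j - 1) * (2 * k * r)" "\<rho> (x0 - y) < 2 ^ j * (2 * k * r)"
      using True j by (simp_all add: shell_def ellipsoid_def)
    ultimately have y: "t / 2 \<le> \<rho> (x0 - y)" "\<rho> (x0 - y) < t" by (simp_all only: t_def not_less)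
    have xr: "\<rho> (x0 - x) < r" "\<rho> (x - x0) < r" using x minus[of "x0 - x"] by (auto simp: ellipsoid_def)
    have "\<rho> (x0 - y) \<le> k * (\<rho> (x0 - x) + \<rho> (x - y))" using add_le[of "x0 - x" "x - y"] by simp
    also have "\<dots> \<le> k * (r + \<rho> (x - y))" using xr k_ge_1 by (intro mult_left_mono) auto
    also have "\<dots> \<le> t / 4 + k * \<rho> (x - y)" using t by (simp add: distrib_left)
    finally have "t / 4 \<le> k * \<rho> (x - y)" using y by simp
    then have low: "t / (4 * k) \<le> \<rho> (x - y)" using k_ge_1 by (simp add: field_simps)
    have "\<rho> (x - y) \<le> k * (\<rho> (x - x0) + \<rho> (x0 - y))" using add_le[of "x - x0" "x0 - y"] by simp
    also have "\<dots> < k * (t + t)"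
    proof (rule mult_strict_left_mono)
      have "1 * r \<le> k * r" using k_ge_1 r by (intro mult_right_mono) auto
      then have "r \<le> t" using t by linarith
      then show "\<rho> (x - x0) + \<rho> (x0 - y) < t + t" using xr y by simp
    qed (use k_ge_1 in simp)
    finally have up: "\<rho> (x - y) < 2 * k * t" by simp
    have "\<rho> (x - y) powr (\<alpha> - \<gamma>) \<le> (t / (4 * k)) powr (\<alpha> - \<gamma>)"
      using low t k_ge_1 alpha by (intro powr_mono2') auto
    moreover have "K (x - y) = \<rho> (x - y) powr (\<alpha> - \<gamma>) * \<Omega> (x - y)"
      using powr_minus_divide[of "\<rho> (x - y)" "\<gamma> - \<alpha>"] by (simp add: K_def)
    ultimately have "K (x - y) \<le> (t / (4 * k)) powr (\<alpha> - \<gamma>) * \<Omega> (x - y)"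
      using Omega_nonneg by (simp add: mult_right_mono)
    then have "ennreal (K (x - y)) \<le> ennreal ((t / (4 * k)) powr (\<alpha> - \<gamma>)) * ennreal (\<Omega> (x - y))"
      using Omega_nonneg by (simp add: ennreal_leI flip: ennreal_mult)
    then show ?thesis using True up by (simp add: mult.assoc[symmetric] mult_right_mono)
  qed simp
qed

text \<open>Two ways of spending the L_s-norm of \<Omega>. For \<theta> = 0, Hoelder in y with the
  conjugate exponent q \<le> v bounds T on E(x0, r) pointwise by t^(-\<gamma>/u) times the norm of
  f, and the volume of E(x0, r) yields (r / t)^(\<gamma>/u). For \<theta> = 1 / s, the s-norm is
  taken in x by Minkowski's inequality and compared with the u-norm on E(x0, r), where u \<le> s;
  the decay that remains is (r / t)^(\<gamma>/u - \<gamma>/s).\<close>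

lemma shell_estimate_far:
  assumes v: "1 < v" and u: "0 < u" "1 / u = 1 / v - \<alpha> / \<gamma>"
    and \<theta>: "(\<theta> = 0 \<and> (\<exists>q. 1 < q \<and> q \<le> v \<and> 1 / s + 1 / q = 1)) \<or> (\<theta> = 1 / s \<and> u \<le> s)"
  shows "\<exists>C>0. \<forall>x0 r j. \<forall>f\<in>borel_measurable borel. 0 < r \<longrightarrow> j \<noteq> 0 \<longrightarrow> (\<forall>y. 0 \<le> f y) \<longrightarrow>
     enn_Lp_norm u lborel (\<lambda>x. T (\<lambda>y. f y * indicator (shell x0 (2 * k * r) j) y) x * indicator (ellipsoid \<rho> x0 r) x)
      \<le> ennreal (C * (2 ^ j) powr (\<gamma> * (\<theta> - 1 / u))) * enn_Lp_norm v lborel (\<lambda>y. ennreal (f y) * indicator (ellipsoid \<rho> x0 (2 ^ j * (2 * k * r))) y)"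
proof -
  define C1 where "C1 = (1 / (4 * k)) powr (\<alpha> - \<gamma>) * (A * (2 * k) powr \<gamma>) powr (1 / s)"
  have C1: "0 \<le> C1" by (simp add: C1_def)
  have "\<exists>C2\<ge>0. \<forall>x0 r j. \<forall>f\<in>borel_measurable borel. 0 < r \<longrightarrow> j \<noteq> 0 \<longrightarrow> (\<forall>y. 0 \<le> f y) \<longrightarrow>
     enn_Lp_norm u lborel (\<lambda>x. T (\<lambda>y. f y * indicator (shell x0 (2 * k * r) j) y) x * indicator (ellipsoid \<rho> x0 r) x)
      \<le> ennreal (C1 * C2 * (2 ^ j) powr (\<gamma> * (\<theta> - 1 / u))) * enn_Lp_norm v lborel (\<lambda>y. ennreal (f y) * indicator (ellipsoid \<rho> x0 (2 ^ j * (2 * k * r))) y)"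
    using \<theta>
  proof (elim disjE conjE exE)
    fix q assume \<theta>0: "\<theta> = 0" and q: "1 < q" "q \<le> v" "1 / s + 1 / q = 1"
    define C2 where "C2 = \<upsilon> powr (1 / q - 1 / v) * \<upsilon> powr (1 / u) * (2 * k) powr (- \<gamma> / u)"
    have C2: "0 \<le> C2" by (simp add: C2_def)
    show ?thesis
    proof (intro exI[of _ C2] conjI allI ballI impI C2)
      fix x0 :: "real^'n" and r :: real and j :: nat and f :: "real^'n \<Rightarrow> real"
      assume f[measurable]: "f \<in> borel_measurable borel" and r: "0 < r" and j: "j \<noteq> 0" and f0: "\<forall>y. 0 \<le> f y"
      define t where "t = 2 ^ j * (2 * k * r)"
      have t: "0 < t" using r k_ge_1 by (simp add: t_def)
      let ?E = "ellipsoid \<rho> x0 t" and ?g = "\<lambda>y. ennreal (f y) * indicator (shell x0 (2 * k * r) j) y"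
      let ?N = "enn_Lp_norm v lborel (\<lambda>y. ennreal (f y) * indicator ?E y)"
      have sub: "shell x0 (2 * k * r) j \<subseteq> ?E" using shell_subset by (simp add: t_def)
      have pt: "T (\<lambda>y. f y * indicator (shell x0 (2 * k * r) j) y) x * indicator (ellipsoid \<rho> x0 r) x
          \<le> (ennreal (C1 * \<upsilon> powr (1 / q - 1 / v) * t powr (- \<gamma> / u)) * ?N) * indicator (ellipsoid \<rho> x0 r) x" for x
      proof (cases "x \<in> ellipsoid \<rho> x0 r")
        case True
        have "T (\<lambda>y. f y * indicator (shell x0 (2 * k * r) j) y) x
          \<le> (\<integral>\<^sup>+y. ennreal ((t / (4 * k)) powr (\<alpha> - \<gamma>)) * (ennreal (\<Omega> (x - y) * indicator {z. \<rho> z < 2 * k * t} (x - y)) * ?g y) \<partial>lborel)"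
          unfolding t_def using r True f0 j by (intro T_shell_le) auto
        also have "\<dots> = ennreal ((t / (4 * k)) powr (\<alpha> - \<gamma>)) * (\<integral>\<^sup>+y. ennreal (\<Omega> (x - y) * indicator {z. \<rho> z < 2 * k * t} (x - y)) * ?g y \<partial>lborel)"
          by (rule nn_integral_cmult) measurable
        also have "\<dots> \<le> ennreal ((t / (4 * k)) powr (\<alpha> - \<gamma>)) * (enn_Lp_norm s lborel (\<lambda>y. ennreal (\<Omega> (x - y) * indicator {z. \<rho> z < 2 * k * t} (x - y))) * enn_Lp_norm q lborel ?g)"
          using s_gt_1 q by (intro mult_left_mono nn_integral_Holder_norm) auto
        also have "\<dots> \<le> ennreal ((t / (4 * k)) powr (\<alpha> - \<gamma>)) * (ennreal ((A * (2 * k * t) powr \<gamma>) powr (1 / s)) * (?N * ennreal ((\<upsilon> * t powr \<gamma>) powr (1 / q - 1 / v))))"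
        proof (intro mult_left_mono mult_mono Omega_norm_le)
          have "enn_Lp_norm q lborel ?g \<le> enn_Lp_norm q lborel (\<lambda>y. ennreal (f y) * indicator ?E y)"
            using q sub by (intro enn_Lp_norm_mono) (auto simp: indicator_def)
          also have "\<dots> \<le> ?N * ennreal_powr (emeasure lborel ?E) (1 / q - 1 / v)"
            using q v t upsilon_pos by (intro enn_Lp_norm_exponent_mono) (auto simp: emeasure_ellipsoid)
          finally show "enn_Lp_norm q lborel ?g \<le> ?N * ennreal ((\<upsilon> * t powr \<gamma>) powr (1 / q - 1 / v))"
            using t upsilon_pos by (simp add: emeasure_ellipsoid ennreal_powr_ennreal)
        qed (use t k_ge_1 in auto)
        also have "\<dots> = ennreal ((t / (4 * k)) powr (\<alpha> - \<gamma>) * (A * (2 * k * t) powr \<gamma>) powr (1 / s) * (\<upsilon> * t powr \<gamma>) powr (1 / q - 1 / v)) * ?N"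
          by (simp add: ennreal_mult mult_ac)
        also have "(t / (4 * k)) powr (\<alpha> - \<gamma>) * (A * (2 * k * t) powr \<gamma>) powr (1 / s) * (\<upsilon> * t powr \<gamma>) powr (1 / q - 1 / v)
           = C1 * \<upsilon> powr (1 / q - 1 / v) * t powr (- \<gamma> / u)"
        proof -
          \<comment> \<open>Counts the powers of t: the conjugacy 1 / s + 1 / q = 1 removes s and q,
            and the relation of u and v leaves - \<gamma> / u.\<close>
          have "(\<alpha> - \<gamma>) + \<gamma> * (1 / s) + \<gamma> * (1 / q - 1 / v) = \<gamma> * (1 / s + 1 / q) - \<gamma> - \<gamma> * (1 / v - \<alpha> / \<gamma>)"
            using gamma_pos by (simp add: algebra_simps)
          also have "\<dots> = - \<gamma> / u" unfolding q(3) u(2)[symmetric] by simp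
          finally have e: "(\<alpha> - \<gamma>) + \<gamma> * (1 / s) + \<gamma> * (1 / q - 1 / v) = - \<gamma> / u" .
          have "(t / (4 * k)) powr (\<alpha> - \<gamma>) * (A * (2 * k * t) powr \<gamma>) powr (1 / s) * (\<upsilon> * t powr \<gamma>) powr (1 / q - 1 / v)
             = C1 * \<upsilon> powr (1 / q - 1 / v) * (t powr (\<alpha> - \<gamma>) * t powr (\<gamma> * (1 / s)) * t powr (\<gamma> * (1 / q - 1 / v)))"
            using t k_ge_1 A_nonneg upsilon_pos
            by (simp add: C1_def powr_mult powr_divide powr_powr)
          then show ?thesis by (simp only: powr_add[symmetric] e)
        qed
        finally show ?thesis using True by simp
      qed simp
      have "enn_Lp_norm u lborel (\<lambda>x. T (\<lambda>y. f y * indicator (shell x0 (2 * k * r) j) y) x * indicator (ellipsoid \<rho> x0 r) x)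
        \<le> enn_Lp_norm u lborel (\<lambda>x. (ennreal (C1 * \<upsilon> powr (1 / q - 1 / v) * t powr (- \<gamma> / u)) * ?N) * indicator (ellipsoid \<rho> x0 r) x)"
        using pt u by (intro enn_Lp_norm_mono) auto
      also have "\<dots> = (ennreal (C1 * \<upsilon> powr (1 / q - 1 / v) * t powr (- \<gamma> / u)) * ?N) * ennreal ((\<upsilon> * r powr \<gamma>) powr (1 / u))"
        using u r upsilon_pos by (subst enn_Lp_norm_cmult) (auto simp: enn_Lp_norm_indicator emeasure_ellipsoid ennreal_powr_ennreal)
      also have "\<dots> = ennreal (C1 * \<upsilon> powr (1 / q - 1 / v) * t powr (- \<gamma> / u) * (\<upsilon> * r powr \<gamma>) powr (1 / u)) * ?N"
        using C1 by (simp add: ennreal_mult mult_ac)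
      also have "C1 * \<upsilon> powr (1 / q - 1 / v) * t powr (- \<gamma> / u) * (\<upsilon> * r powr \<gamma>) powr (1 / u) = C1 * C2 * (2 ^ j) powr (\<gamma> * (\<theta> - 1 / u))"
      proof -
        have "t powr (- \<gamma> / u) * r powr (\<gamma> / u) = (2 ^ j) powr (- \<gamma> / u) * (2 * k) powr (- \<gamma> / u) * (r powr (- \<gamma> / u) * r powr (\<gamma> / u))"
          using r k_ge_1 by (simp add: t_def powr_mult)
        also have "r powr (- \<gamma> / u) * r powr (\<gamma> / u) = 1" using r by (simp flip: powr_add)
        finally show ?thesis using upsilon_pos r by (simp add: C2_def \<theta>0 powr_mult powr_powr mult_ac)
      qed
      finally show "enn_Lp_norm u lborel (\<lambda>x. T (\<lambda>y. f y * indicator (shell x0 (2 * k * r) j) y) x * indicator (ellipsoid \<rho> x0 r) x)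
         \<le> ennreal (C1 * C2 * (2 ^ j) powr (\<gamma> * (\<theta> - 1 / u))) * enn_Lp_norm v lborel (\<lambda>y. ennreal (f y) * indicator (ellipsoid \<rho> x0 (2 ^ j * (2 * k * r))) y)"
        by (simp add: t_def)
    qed
  next
    assume \<theta>s: "\<theta> = 1 / s" and us: "u \<le> s"
    define C2 where "C2 = \<upsilon> powr (1 - 1 / v) * \<upsilon> powr (1 / u - 1 / s) * (2 * k) powr (\<gamma> / s - \<gamma> / u)"
    have C2: "0 \<le> C2" by (simp add: C2_def)
    show ?thesis
    proof (intro exI[of _ C2] conjI allI ballI impI C2)
      fix x0 :: "real^'n" and r :: real and j :: nat and f :: "real^'n \<Rightarrow> real"
      assume f[measurable]: "f \<in> borel_measurable borel" and r: "0 < r" and j: "j \<noteq> 0" and f0: "\<forall>y. 0 \<le> f y"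
      define t where "t = 2 ^ j * (2 * k * r)"
      have t: "0 < t" using r k_ge_1 by (simp add: t_def)
      let ?E = "ellipsoid \<rho> x0 t" and ?g = "\<lambda>y. ennreal (f y) * indicator (shell x0 (2 * k * r) j) y"
      let ?N = "enn_Lp_norm v lborel (\<lambda>y. ennreal (f y) * indicator ?E y)"
      let ?O = "\<lambda>z. ennreal (\<Omega> z * indicator {z. \<rho> z < 2 * k * t} z)"
      let ?c = "ennreal ((t / (4 * k)) powr (\<alpha> - \<gamma>))"
      let ?H = "\<lambda>x. \<integral>\<^sup>+y. ?O (x - y) * ?g y \<partial>lborel"
      have sub: "shell x0 (2 * k * r) j \<subseteq> ?E" using shell_subset by (simp add: t_def)
      have pt: "T (\<lambda>y. f y * indicator (shell x0 (2 * k * r) j) y) x * indicator (ellipsoid \<rho> x0 r) x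
          \<le> ?c * (?H x * indicator (ellipsoid \<rho> x0 r) x)" for x
      proof (cases "x \<in> ellipsoid \<rho> x0 r")
        case True
        have "T (\<lambda>y. f y * indicator (shell x0 (2 * k * r) j) y) x
          \<le> (\<integral>\<^sup>+y. ?c * (?O (x - y) * ?g y) \<partial>lborel)"
          unfolding t_def using r True f0 j by (intro T_shell_le) auto
        also have "\<dots> = ?c * ?H x" by (rule nn_integral_cmult) measurable
        finally show ?thesis using True by simp
      qed simp
      have "enn_Lp_norm u lborel (\<lambda>x. T (\<lambda>y. f y * indicator (shell x0 (2 * k * r) j) y) x * indicator (ellipsoid \<rho> x0 r) x)
        \<le> enn_Lp_norm u lborel (\<lambda>x. ?c * (?H x * indicator (ellipsoid \<rho> x0 r) x))"
        using pt u by (intro enn_Lp_norm_mono) auto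
      also have "\<dots> = ?c * enn_Lp_norm u lborel (\<lambda>x. ?H x * indicator (ellipsoid \<rho> x0 r) x)"
        using u by (intro enn_Lp_norm_cmult) auto
      also have "\<dots> \<le> ?c * ((ennreal ((A * (2 * k * t) powr \<gamma>) powr (1 / s)) * (?N * ennreal ((\<upsilon> * t powr \<gamma>) powr (1 - 1 / v)))) * ennreal ((\<upsilon> * r powr \<gamma>) powr (1 / u - 1 / s)))"
      proof (rule mult_left_mono)
        have "(\<integral>\<^sup>+y. ?g y \<partial>lborel) \<le> enn_Lp_norm 1 lborel (\<lambda>y. ennreal (f y) * indicator ?E y)"
          unfolding enn_Lp_norm_def using sub by (auto intro!: nn_integral_mono simp: indicator_def)
        also have "\<dots> \<le> ?N * ennreal_powr (emeasure lborel ?E) (1 / 1 - 1 / v)"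
          using v t upsilon_pos by (intro enn_Lp_norm_exponent_mono) (auto simp: emeasure_ellipsoid)
        also have "ennreal_powr (emeasure lborel ?E) (1 / 1 - 1 / v) = ennreal ((\<upsilon> * t powr \<gamma>) powr (1 - 1 / v))"
          using t upsilon_pos by (simp add: emeasure_ellipsoid ennreal_powr_ennreal)
        finally have g: "(\<integral>\<^sup>+y. ?g y \<partial>lborel) \<le> ?N * ennreal ((\<upsilon> * t powr \<gamma>) powr (1 - 1 / v))" .
        have "enn_Lp_norm s lborel (\<lambda>x. ?H x * indicator (ellipsoid \<rho> x0 r) x) \<le> enn_Lp_norm s lborel ?H"
          using s_gt_1 by (intro enn_Lp_norm_mono) (auto simp: indicator_def)
        also have "\<dots> \<le> (\<integral>\<^sup>+y. enn_Lp_norm s lborel (\<lambda>x. ?O (x - y) * ?g y) \<partial>lborel)"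
          using s_gt_1 by (intro enn_Lp_norm_Minkowski sigma_finite_lborel) auto
        also have "\<dots> \<le> (\<integral>\<^sup>+y. ennreal ((A * (2 * k * t) powr \<gamma>) powr (1 / s)) * ?g y \<partial>lborel)"
        proof (intro nn_integral_mono)
          fix y
          have "enn_Lp_norm s lborel (\<lambda>x. ?O (x - y) * ?g y) = ?g y * enn_Lp_norm s lborel (\<lambda>x. ?O (x - y))"
            using s_gt_1 by (subst mult.commute, subst enn_Lp_norm_cmult) auto
          also have "\<dots> \<le> ?g y * ennreal ((A * (2 * k * t) powr \<gamma>) powr (1 / s))"
            using t k_ge_1 by (intro mult_left_mono Omega_norm_le) auto
          finally show "enn_Lp_norm s lborel (\<lambda>x. ?O (x - y) * ?g y) \<le> ennreal ((A * (2 * k * t) powr \<gamma>) powr (1 / s)) * ?g y"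
            by (simp add: mult.commute)
        qed
        also have "\<dots> = ennreal ((A * (2 * k * t) powr \<gamma>) powr (1 / s)) * (\<integral>\<^sup>+y. ?g y \<partial>lborel)"
          by (rule nn_integral_cmult) measurable
        also have "\<dots> \<le> ennreal ((A * (2 * k * t) powr \<gamma>) powr (1 / s)) * (?N * ennreal ((\<upsilon> * t powr \<gamma>) powr (1 - 1 / v)))"
          by (intro mult_left_mono g) simp
        finally have hs: "enn_Lp_norm s lborel (\<lambda>x. ?H x * indicator (ellipsoid \<rho> x0 r) x)
            \<le> ennreal ((A * (2 * k * t) powr \<gamma>) powr (1 / s)) * (?N * ennreal ((\<upsilon> * t powr \<gamma>) powr (1 - 1 / v)))" .
        have "enn_Lp_norm u lborel (\<lambda>x. ?H x * indicator (ellipsoid \<rho> x0 r) x)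
           \<le> enn_Lp_norm s lborel (\<lambda>x. ?H x * indicator (ellipsoid \<rho> x0 r) x) * ennreal_powr (emeasure lborel (ellipsoid \<rho> x0 r)) (1 / u - 1 / s)"
          using u us r upsilon_pos by (intro enn_Lp_norm_exponent_mono) (auto simp: emeasure_ellipsoid)
        also have "ennreal_powr (emeasure lborel (ellipsoid \<rho> x0 r)) (1 / u - 1 / s) = ennreal ((\<upsilon> * r powr \<gamma>) powr (1 / u - 1 / s))"
          using r upsilon_pos by (simp add: emeasure_ellipsoid ennreal_powr_ennreal)
        also have "enn_Lp_norm s lborel (\<lambda>x. ?H x * indicator (ellipsoid \<rho> x0 r) x) * ennreal ((\<upsilon> * r powr \<gamma>) powr (1 / u - 1 / s))
           \<le> (ennreal ((A * (2 * k * t) powr \<gamma>) powr (1 / s)) * (?N * ennreal ((\<upsilon> * t powr \<gamma>) powr (1 - 1 / v)))) * ennreal ((\<upsilon> * r powr \<gamma>) powr (1 / u - 1 / s))"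
          by (intro mult_right_mono hs) simp
        finally show "enn_Lp_norm u lborel (\<lambda>x. ?H x * indicator (ellipsoid \<rho> x0 r) x) \<le>
           (ennreal ((A * (2 * k * t) powr \<gamma>) powr (1 / s)) * (?N * ennreal ((\<upsilon> * t powr \<gamma>) powr (1 - 1 / v)))) * ennreal ((\<upsilon> * r powr \<gamma>) powr (1 / u - 1 / s))" .
      qed simp
      also have "\<dots> = ennreal ((t / (4 * k)) powr (\<alpha> - \<gamma>) * (A * (2 * k * t) powr \<gamma>) powr (1 / s) * (\<upsilon> * t powr \<gamma>) powr (1 - 1 / v) * (\<upsilon> * r powr \<gamma>) powr (1 / u - 1 / s)) * ?N"
        by (simp add: ennreal_mult mult_ac)
      also have "(t / (4 * k)) powr (\<alpha> - \<gamma>) * (A * (2 * k * t) powr \<gamma>) powr (1 / s) * (\<upsilon> * t powr \<gamma>) powr (1 - 1 / v) * (\<upsilon> * r powr \<gamma>) powr (1 / u - 1 / s)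
         = C1 * C2 * (2 ^ j) powr (\<gamma> * (\<theta> - 1 / u))"
      proof -
        have "(\<alpha> - \<gamma>) + \<gamma> * (1 / s) + \<gamma> * (1 - 1 / v) = \<gamma> / s - \<gamma> * (1 / v - \<alpha> / \<gamma>)"
          using gamma_pos by (simp add: algebra_simps)
        also have "\<dots> = \<gamma> / s - \<gamma> / u" unfolding u(2)[symmetric] by simp
        finally have e: "(\<alpha> - \<gamma>) + \<gamma> * (1 / s) + \<gamma> * (1 - 1 / v) = \<gamma> / s - \<gamma> / u" .
        have "(t / (4 * k)) powr (\<alpha> - \<gamma>) * (A * (2 * k * t) powr \<gamma>) powr (1 / s) * (\<upsilon> * t powr \<gamma>) powr (1 - 1 / v) * (\<upsilon> * r powr \<gamma>) powr (1 / u - 1 / s)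
           = C1 * \<upsilon> powr (1 - 1 / v) * \<upsilon> powr (1 / u - 1 / s) * (t powr (\<alpha> - \<gamma>) * t powr (\<gamma> * (1 / s)) * t powr (\<gamma> * (1 - 1 / v))) * r powr (\<gamma> * (1 / u - 1 / s))"
          using t k_ge_1 A_nonneg upsilon_pos r
          by (simp add: C1_def powr_mult powr_divide powr_powr)
        also have "t powr (\<alpha> - \<gamma>) * t powr (\<gamma> * (1 / s)) * t powr (\<gamma> * (1 - 1 / v)) = t powr (\<gamma> / s - \<gamma> / u)"
          by (simp only: powr_add[symmetric] e)
        also have "t powr (\<gamma> / s - \<gamma> / u) = (2 ^ j) powr (\<gamma> * (\<theta> - 1 / u)) * (2 * k) powr (\<gamma> / s - \<gamma> / u) * r powr (\<gamma> / s - \<gamma> / u)"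
          using r k_ge_1 by (simp add: t_def powr_mult \<theta>s right_diff_distrib)
        finally have "(t / (4 * k)) powr (\<alpha> - \<gamma>) * (A * (2 * k * t) powr \<gamma>) powr (1 / s) * (\<upsilon> * t powr \<gamma>) powr (1 - 1 / v) * (\<upsilon> * r powr \<gamma>) powr (1 / u - 1 / s)
          = C1 * C2 * (2 ^ j) powr (\<gamma> * (\<theta> - 1 / u)) * (r powr (\<gamma> / s - \<gamma> / u) * r powr (\<gamma> * (1 / u - 1 / s)))"
          by (simp add: C2_def mult_ac)
        moreover have "r powr (\<gamma> / s - \<gamma> / u) * r powr (\<gamma> * (1 / u - 1 / s)) = 1"
          using r by (simp add: right_diff_distrib flip: powr_add)
        ultimately show ?thesis by simp
      qed
      finally show "enn_Lp_norm u lborel (\<lambda>x. T (\<lambda>y. f y * indicator (shell x0 (2 * k * r) j) y) x * indicator (ellipsoid \<rho> x0 r) x)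
         \<le> ennreal (C1 * C2 * (2 ^ j) powr (\<gamma> * (\<theta> - 1 / u))) * enn_Lp_norm v lborel (\<lambda>y. ennreal (f y) * indicator (ellipsoid \<rho> x0 (2 ^ j * (2 * k * r))) y)"
        by (simp add: t_def)
    qed
  qed
  then obtain C2 where C2: "0 \<le> C2" "\<And>x0 r j f. f \<in> borel_measurable borel \<Longrightarrow> 0 < r \<Longrightarrow> j \<noteq> 0 \<Longrightarrow> (\<forall>y. 0 \<le> f y) \<Longrightarrow>
     enn_Lp_norm u lborel (\<lambda>x. T (\<lambda>y. f y * indicator (shell x0 (2 * k * r) j) y) x * indicator (ellipsoid \<rho> x0 r) x)
      \<le> ennreal (C1 * C2 * (2 ^ j) powr (\<gamma> * (\<theta> - 1 / u))) * enn_Lp_norm v lborel (\<lambda>y. ennreal (f y) * indicator (ellipsoid \<rho> x0 (2 ^ j * (2 * k * r))) y)"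
    by blast
  show ?thesis
  proof (intro exI[of _ "C1 * C2 + 1"] conjI allI ballI impI)
    show "0 < C1 * C2 + 1" using C1 C2 by (simp add: add_nonneg_pos)
    fix x0 :: "real^'n" and r :: real and j :: nat and f :: "real^'n \<Rightarrow> real"
    assume f: "f \<in> borel_measurable borel" "0 < r" "j \<noteq> 0" "\<forall>y. 0 \<le> f y"
    have "ennreal (C1 * C2 * (2 ^ j) powr (\<gamma> * (\<theta> - 1 / u))) \<le> ennreal ((C1 * C2 + 1) * (2 ^ j) powr (\<gamma> * (\<theta> - 1 / u)))"
      by (intro ennreal_leI mult_right_mono) auto
    then show "enn_Lp_norm u lborel (\<lambda>x. T (\<lambda>y. f y * indicator (shell x0 (2 * k * r) j) y) x * indicator (ellipsoid \<rho> x0 r) x)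
      \<le> ennreal ((C1 * C2 + 1) * (2 ^ j) powr (\<gamma> * (\<theta> - 1 / u))) * enn_Lp_norm v lborel (\<lambda>y. ennreal (f y) * indicator (ellipsoid \<rho> x0 (2 ^ j * (2 * k * r))) y)"
      using C2(2)[OF f] by (meson mult_right_mono order_trans zero_le)
  qed
qed

text \<open>The shell of index 0 is the singular one and is covered by the Hardy-Littlewood-Sobolev
  bound. That bound also covers every shell when \<theta> = 1 / s and s < u, for then the factor
  (2^j)^(\<gamma> (\<theta> - 1/u)) is at least 1; in all other cases the far estimate applies for j
  \<ge> 1.\<close>

lemma shell_estimate:
  assumes v: "1 < v" and u: "0 < u" "1 / u = 1 / v - \<alpha> / \<gamma>"
    and \<theta>: "(\<theta> = 0 \<and> (\<exists>q. 1 < q \<and> q \<le> v \<and> 1 / s + 1 / q = 1)) \<or> \<theta> = 1 / s"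
  shows "\<exists>C>0. \<forall>x0 r j. \<forall>f\<in>borel_measurable borel. 0 < r \<longrightarrow> (\<forall>y. 0 \<le> f y) \<longrightarrow>
     enn_Lp_norm u lborel (\<lambda>x. T (\<lambda>y. f y * indicator (shell x0 (2 * k * r) j) y) x * indicator (ellipsoid \<rho> x0 r) x)
      \<le> ennreal (C * (2 ^ j) powr (\<gamma> * (\<theta> - 1 / u))) * enn_Lp_norm v lborel (\<lambda>y. ennreal (f y) * indicator (ellipsoid \<rho> x0 (2 ^ j * (2 * k * r))) y)"
proof -
  obtain C1 where C1: "0 < C1" "\<And>f. f \<in> borel_measurable borel \<Longrightarrow> (\<And>y. 0 \<le> f y) \<Longrightarrow> enn_Lp_norm u lborel (T f) \<le> ennreal C1 * enn_Lp_norm v lborel (\<lambda>y. ennreal (f y))"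
    using Hardy_Littlewood_Sobolev[OF v u] by blast
  have near: "enn_Lp_norm u lborel (\<lambda>x. T (\<lambda>y. f y * indicator (shell x0 (2 * k * r) j) y) x * indicator (ellipsoid \<rho> x0 r) x)
      \<le> ennreal C1 * enn_Lp_norm v lborel (\<lambda>y. ennreal (f y) * indicator (ellipsoid \<rho> x0 (2 ^ j * (2 * k * r))) y)"
    if [measurable]: "f \<in> borel_measurable borel" and f: "\<forall>y. 0 \<le> f y" for f x0 r j
  proof -
    have "enn_Lp_norm u lborel (\<lambda>x. T (\<lambda>y. f y * indicator (shell x0 (2 * k * r) j) y) x * indicator (ellipsoid \<rho> x0 r) x)
      \<le> enn_Lp_norm u lborel (T (\<lambda>y. f y * indicator (shell x0 (2 * k * r) j) y))"
      using u by (intro enn_Lp_norm_mono) (auto simp: indicator_def)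
    also have "\<dots> \<le> ennreal C1 * enn_Lp_norm v lborel (\<lambda>y. ennreal (f y * indicator (shell x0 (2 * k * r) j) y))"
      using f by (intro C1) auto
    also have "\<dots> \<le> ennreal C1 * enn_Lp_norm v lborel (\<lambda>y. ennreal (f y) * indicator (ellipsoid \<rho> x0 (2 ^ j * (2 * k * r))) y)"
    proof (intro mult_left_mono enn_Lp_norm_mono)
      fix y show "ennreal (f y * indicator (shell x0 (2 * k * r) j) y) \<le> ennreal (f y) * indicator (ellipsoid \<rho> x0 (2 ^ j * (2 * k * r))) y"
        using shell_subset[of x0 "2 * k * r" j] by (auto simp: indicator_def)
    qed (use v in auto)
    finally show ?thesis .
  qed
  show ?thesis
  proof (cases "\<theta> = 1 / s \<and> s < u")
    case True
    show ?thesis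
    proof (intro exI[of _ C1] conjI allI ballI impI C1)
      fix x0 :: "real^'n" and r :: real and j :: nat and f :: "real^'n \<Rightarrow> real"
      assume f: "f \<in> borel_measurable borel" "0 < r" "\<forall>y. 0 \<le> f y"
      have "1 / u \<le> 1 / s" using True s_gt_1 by (intro divide_left_mono) auto
      then have "1 \<le> (2 ^ j) powr (\<gamma> * (\<theta> - 1 / u))" using True gamma_pos by (intro ge_one_powr_ge_zero) auto
      then have "ennreal C1 \<le> ennreal (C1 * (2 ^ j) powr (\<gamma> * (\<theta> - 1 / u)))" using C1(1) by (intro ennreal_leI) simp
      then show "enn_Lp_norm u lborel (\<lambda>x. T (\<lambda>y. f y * indicator (shell x0 (2 * k * r) j) y) x * indicator (ellipsoid \<rho> x0 r) x)
        \<le> ennreal (C1 * (2 ^ j) powr (\<gamma> * (\<theta> - 1 / u))) * enn_Lp_norm v lborel (\<lambda>y. ennreal (f y) * indicator (ellipsoid \<rho> x0 (2 ^ j * (2 * k * r))) y)"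
        using near[OF f(1,3)] by (meson mult_right_mono order_trans zero_le)
    qed
  next
    case False
    then have "(\<theta> = 0 \<and> (\<exists>q. 1 < q \<and> q \<le> v \<and> 1 / s + 1 / q = 1)) \<or> (\<theta> = 1 / s \<and> u \<le> s)" using \<theta> by auto
    from shell_estimate_far[OF v u this] obtain C2 where C2: "0 < C2" "\<And>x0 r j f. f \<in> borel_measurable borel \<Longrightarrow> 0 < r \<Longrightarrow> j \<noteq> 0 \<Longrightarrow> (\<forall>y. 0 \<le> f y) \<Longrightarrow>
     enn_Lp_norm u lborel (\<lambda>x. T (\<lambda>y. f y * indicator (shell x0 (2 * k * r) j) y) x * indicator (ellipsoid \<rho> x0 r) x)
      \<le> ennreal (C2 * (2 ^ j) powr (\<gamma> * (\<theta> - 1 / u))) * enn_Lp_norm v lborel (\<lambda>y. ennreal (f y) * indicator (ellipsoid \<rho> x0 (2 ^ j * (2 * k * r))) y)"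
      by blast
    show ?thesis
    proof (intro exI[of _ "C1 + C2"] conjI allI ballI impI)
      show "0 < C1 + C2" using C1 C2 by simp
      fix x0 :: "real^'n" and r :: real and j :: nat and f :: "real^'n \<Rightarrow> real"
      assume f: "f \<in> borel_measurable borel" "0 < r" "\<forall>y. 0 \<le> f y"
      let ?p = "(2 ^ j) powr (\<gamma> * (\<theta> - 1 / u))"
      have le: "ennreal (C2 * ?p) \<le> ennreal ((C1 + C2) * ?p)" "j = 0 \<Longrightarrow> ennreal C1 \<le> ennreal ((C1 + C2) * ?p)"
        using C1(1) C2(1) by (auto intro!: ennreal_leI mult_right_mono)
      show "enn_Lp_norm u lborel (\<lambda>x. T (\<lambda>y. f y * indicator (shell x0 (2 * k * r) j) y) x * indicator (ellipsoid \<rho> x0 r) x)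
        \<le> ennreal ((C1 + C2) * ?p) * enn_Lp_norm v lborel (\<lambda>y. ennreal (f y) * indicator (ellipsoid \<rho> x0 (2 ^ j * (2 * k * r))) y)"
      proof (cases "j = 0")
        case True
        then show ?thesis using near[OF f(1,3), of x0 r j] le(2) by (meson mult_right_mono order_trans zero_le)
      next
        case False
        then show ?thesis using C2(2)[OF f(1,2) False f(3), of x0] le(1) by (meson mult_right_mono order_trans zero_le)
      qed
    qed
  qed
qed

end

section \<open>The Campanato and weight hypotheses\<close>

lemma enn_Lp_norm_add:
  assumes "sigma_finite_measure M" and [measurable]: "F \<in> borel_measurable M" "G \<in> borel_measurable M" and "1 \<le> q"
  shows "enn_Lp_norm q M (\<lambda>x. F x + G x) \<le> enn_Lp_norm q M F + enn_Lp_norm q M G"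
proof -
  have "enn_Lp_norm q M (\<lambda>x. \<Sum>i\<in>{0, 1::nat}. (if i = 0 then F else G) x) \<le> (\<Sum>i\<in>{0, 1::nat}. enn_Lp_norm q M (if i = 0 then F else G))"
    using assms by (intro enn_Lp_norm_sum) auto
  then show ?thesis by simp
qed

text \<open>With \<tau>_j = 2^j \<kappa> r, the j-th term is compared with the integral over
  [\<tau>_j, 2 \<tau>_j); these intervals are disjoint and lie beyond r. There 1 + j \<le> 2 (1 +
  ln(t / r)), powers of t vary by a bounded factor, and the length \<tau>_j supplies the power that
  separates d from d - 1.\<close>

lemma sum_le_weight_integral:
  fixes F :: "nat \<Rightarrow> ennreal" and W :: "real \<Rightarrow> ennreal"
  assumes r: "0 < r" and \<kappa>: "1 < \<kappa>" and L: "0 < L"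
    and FW: "\<And>j t. 2 ^ j * (\<kappa> * r) \<le> t \<Longrightarrow> F j \<le> ennreal L * W t"
  shows "(\<Sum>j. ennreal ((1 + real j) ^ m * (2 ^ j * (\<kappa> * r)) powr d) * F j)
    \<le> ennreal (2 ^ m * 2 powr \<bar>d - 1\<bar> * L) * (\<integral>\<^sup>+t\<in>{r<..}. ennreal ((1 + ln (t / r)) ^ m) * (W t / ennreal (t powr (1 - d))) \<partial>lebesgue)"
proof -
  define \<tau> where "\<tau> j = 2 ^ j * (\<kappa> * r)" for j :: nat
  have \<tau>: "0 < \<tau> j" "r < \<tau> j" for j
  proof -
    show "0 < \<tau> j" using r \<kappa> by (simp add: \<tau>_def)
    have "1 * r < \<kappa> * r" using \<kappa> r by (intro mult_strict_right_mono) auto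
    moreover have "1 * (\<kappa> * r) \<le> \<tau> j" unfolding \<tau>_def using r \<kappa> by (intro mult_right_mono) auto
    ultimately show "r < \<tau> j" by simp
  qed
  define C where "C = 2 ^ m * 2 powr \<bar>d - 1\<bar> * L"
  have C: "0 < C" using L by (simp add: C_def)
  define w where "w t = ennreal ((1 + ln (t / r)) ^ m) * (W t / ennreal (t powr (1 - d))) * indicator {r<..} t" for t
  \<comment> \<open>The factor 1 / C is placed here, so that the comparison with the integrand w is
    free of constants.\<close>
  define h where "h j t = ennreal (1 / C) * (ennreal ((1 + real j) ^ m * \<tau> j powr (d - 1)) * F j * indicator {\<tau> j..<2 * \<tau> j} t)" for j t
  have hw: "h j t \<le> w t" if t: "t \<in> {\<tau> j..<2 * \<tau> j}" for j t
  proof -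
    have tp: "0 < t" "r < t" "\<tau> j \<le> t" "t < 2 * \<tau> j" using t \<tau>[of j] by auto
    have "(2::real) ^ j \<le> t / r"
    proof -
      have "2 ^ j * (1 * r) \<le> \<tau> j" unfolding \<tau>_def using \<kappa> r by (intro mult_left_mono mult_right_mono) auto
      then show ?thesis using tp r by (simp add: field_simps)
    qed
    then have "ln (2 ^ j) \<le> ln (t / r)" using tp r by (subst ln_le_cancel_iff) auto
    then have "real j * ln 2 \<le> ln (t / r)" by (simp add: ln_realpow)
    \<comment> \<open>ln 2 \<ge> 1/2 is where the factor 2 in 1 + j \<le> 2 (1 + ln(t / r)) comes
      from.\<close>
    moreover have "real j * (1 / 2) \<le> real j * ln 2" using ln2_ge_two_thirds by (intro mult_left_mono) auto
    ultimately have "1 + real j \<le> 2 * (1 + ln (t / r))" by simp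
    then have "(1 + real j) ^ m \<le> (2 * (1 + ln (t / r))) ^ m" by (intro power_mono) auto
    then have 1: "(1 + real j) ^ m \<le> 2 ^ m * (1 + ln (t / r)) ^ m" by (simp only: power_mult_distrib)
    have 2: "\<tau> j powr (d - 1) \<le> 2 powr \<bar>d - 1\<bar> * t powr (d - 1)"
    proof (cases "0 \<le> d - 1")
      case True
      then have "\<tau> j powr (d - 1) \<le> t powr (d - 1)" using tp \<tau>[of j] by (intro powr_mono2) auto
      moreover have "1 \<le> (2::real) powr \<bar>d - 1\<bar>" by (intro ge_one_powr_ge_zero) auto
      ultimately show ?thesis using mult_right_mono[of 1 "2 powr \<bar>d - 1\<bar>" "t powr (d - 1)"] by simp
    next
      case False
      then have "\<tau> j powr (d - 1) \<le> (t / 2) powr (d - 1)" using tp by (intro powr_mono2') auto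
      also have "\<dots> = 2 powr \<bar>d - 1\<bar> * t powr (d - 1)" using tp False powr_minus_divide[of 2 "d - 1"] by (simp add: powr_divide abs_if)
      finally show ?thesis .
    qed
    have lnp: "0 \<le> (1 + ln (t / r)) ^ m" using tp r by (intro zero_le_power) (simp add: ln_div)
    have "(1 + real j) ^ m * \<tau> j powr (d - 1) \<le> (2 ^ m * (1 + ln (t / r)) ^ m) * (2 powr \<bar>d - 1\<bar> * t powr (d - 1))"
      using 1 2 lnp by (intro mult_mono) auto
    then have "h j t \<le> ennreal (1 / C) * (ennreal ((2 ^ m * (1 + ln (t / r)) ^ m) * (2 powr \<bar>d - 1\<bar> * t powr (d - 1))) * (ennreal L * W t))"
      unfolding h_def using t FW[of j t] by (auto simp: \<tau>_def intro!: mult_left_mono mult_mono ennreal_leI)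
    also have "\<dots> = ennreal (1 / C * ((2 ^ m * (1 + ln (t / r)) ^ m) * (2 powr \<bar>d - 1\<bar> * t powr (d - 1))) * L) * W t"
    proof -
      have "ennreal a * (ennreal x * (ennreal l * z)) = ennreal (a * x * l) * z" if "0 \<le> a" "0 \<le> x" "0 \<le> l" for a x l z
        using that by (simp add: ennreal_mult mult_ac)
      then show ?thesis using C L lnp by simp
    qed
    also have "1 / C * ((2 ^ m * (1 + ln (t / r)) ^ m) * (2 powr \<bar>d - 1\<bar> * t powr (d - 1))) * L = (1 + ln (t / r)) ^ m * (1 / t powr (1 - d))"
      using L tp powr_minus_divide[of t "1 - d"] by (simp add: C_def field_simps)
    also have "ennreal ((1 + ln (t / r)) ^ m * (1 / t powr (1 - d))) * W t = w t"
    proof -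
      have "ennreal (1 / t powr (1 - d)) = inverse (ennreal (t powr (1 - d)))"
        using tp by (simp add: inverse_ennreal divide_inverse)
      moreover have "ennreal ((1 + ln (t / r)) ^ m * (1 / t powr (1 - d))) = ennreal ((1 + ln (t / r)) ^ m) * ennreal (1 / t powr (1 - d))"
        using lnp by (intro ennreal_mult) auto
      ultimately show ?thesis using tp by (simp only: w_def divide_ennreal_def) (simp add: mult_ac)
    qed
    finally show ?thesis .
  qed
  have sum_h: "(\<Sum>j. h j t) \<le> w t" for t
  proof (cases "\<exists>j. t \<in> {\<tau> j..<2 * \<tau> j}")
    case True
    then obtain j where j: "t \<in> {\<tau> j..<2 * \<tau> j}" by blast
    have "h i t = 0" if "i \<noteq> j" for i
    proof -
      have "t \<notin> {\<tau> i..<2 * \<tau> i}"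
      proof
        assume i: "t \<in> {\<tau> i..<2 * \<tau> i}"
        have *: "2 * \<tau> a \<le> \<tau> b" if "a < b" for a b
        proof -
          have "2 ^ Suc a * (\<kappa> * r) \<le> 2 ^ b * (\<kappa> * r)" using that r \<kappa> by (intro mult_right_mono power_increasing) auto
          then show ?thesis by (simp add: \<tau>_def)
        qed
        show False using *[of i j] *[of j i] i j that by (cases "i < j") auto
      qed
      then show ?thesis by (simp add: h_def)
    qed
    then have "(\<Sum>j. h j t) = h j t" by (subst suminf_finite[where N="{j}"]) auto
    then show ?thesis using hw[OF j] by simp
  next
    case False
    then show ?thesis by (simp add: h_def)
  qed
  have "(\<Sum>j. ennreal ((1 + real j) ^ m * \<tau> j powr d) * F j) = ennreal C * (\<Sum>j. \<integral>\<^sup>+t. h j t \<partial>lborel)"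
  proof -
    have "(\<integral>\<^sup>+t. h j t \<partial>lborel) = ennreal (1 / C) * (ennreal ((1 + real j) ^ m * \<tau> j powr d) * F j)" for j
    proof -
      have "(\<integral>\<^sup>+t. h j t \<partial>lborel) = ennreal (1 / C) * (ennreal ((1 + real j) ^ m * \<tau> j powr (d - 1)) * F j * ennreal (\<tau> j))"
        unfolding h_def using \<tau>[of j] by (simp add: nn_integral_cmult)
      also have "\<dots> = ennreal (1 / C) * (ennreal ((1 + real j) ^ m * (\<tau> j * \<tau> j powr (d - 1))) * F j)"
        using \<tau>[of j] by (simp add: ennreal_mult mult_ac)
      also have "\<tau> j * \<tau> j powr (d - 1) = \<tau> j powr d" using powr_mult_base[of "\<tau> j" "d - 1"] \<tau>[of j] by simp
      finally show ?thesis .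
    qed
    moreover have "ennreal C * (ennreal (1 / C) * z) = z" for z using C by (simp add: mult.assoc[symmetric] flip: ennreal_mult)
    ultimately show ?thesis by (simp flip: ennreal_suminf_cmult)
  qed
  also have "(\<Sum>j. \<integral>\<^sup>+t. h j t \<partial>lborel) = (\<integral>\<^sup>+t. (\<Sum>j. h j t) \<partial>lborel)"
    unfolding h_def by (rule nn_integral_suminf[symmetric]) measurable
  also have "\<dots> \<le> (\<integral>\<^sup>+t. w t \<partial>lborel)" by (intro nn_integral_mono sum_h)
  finally show ?thesis
    by (simp add: \<tau>_def C_def w_def nn_integral_completion mult_left_mono)
qed

context rough_fractional
begin

text \<open>Consecutive averages are compared on the smaller ellipsoid, where both deviations are
  controlled; since l \<ge> 0, each of the n steps is bounded by the last power \<mu>_n^l, whence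
  the linear factor 1 + n. The radii form a general chain with ratios at most 2 k, because in the
  application one goes from r to 2 k r first and doubles afterwards.\<close>

lemma Campanato_growth:
  fixes b :: "real^'n \<Rightarrow> real" and c :: "real \<Rightarrow> real" and R :: "nat \<Rightarrow> real"
  assumes [measurable]: "b \<in> borel_measurable borel" and p: "1 \<le> p" and N: "0 \<le> N" and l: "0 \<le> l"
    and b: "\<And>t. 0 < t \<Longrightarrow> enn_Lp_norm p lborel (\<lambda>y. ennreal \<bar>b y - c t\<bar> * indicator (ellipsoid \<rho> x0 t) y) \<le> ennreal (N * (\<upsilon> * t powr \<gamma>) powr (1 / p + l))"
    and R: "0 < R 0" "\<And>n. R n \<le> R (Suc n)" "\<And>n. R (Suc n) \<le> 2 * k * R n"
  shows "enn_Lp_norm p lborel (\<lambda>y. ennreal \<bar>b y - c (R 0)\<bar> * indicator (ellipsoid \<rho> x0 (R n)) y)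
    \<le> ennreal (2 * (2 * k) powr (\<gamma> / p) * N * (1 + real n) * (\<upsilon> * R n powr \<gamma>) powr (1 / p + l))"
proof -
  have Rmono: "R i \<le> R j" if "i \<le> j" for i j using lift_Suc_mono_le[of R, OF R(2) that] .
  then have Rpos: "0 < R n" for n using R(1) by (meson less_le_trans zero_le)
  define \<mu> where "\<mu> n = \<upsilon> * R n powr \<gamma>" for n
  have \<mu>: "0 < \<mu> n" for n using upsilon_pos Rpos[of n] by (simp add: \<mu>_def)
  have \<mu>mono: "\<mu> i \<le> \<mu> j" if "i \<le> j" for i j
    unfolding \<mu>_def using Rmono[OF that] Rpos[of i] upsilon_pos gamma_pos by (intro mult_left_mono powr_mono2) auto
  \<comment> \<open>Bounds the growth of \<mu>^(1/p) along one step of the chain.\<close>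
  define D where "D = (2 * k) powr (\<gamma> / p)"
  have D: "1 \<le> D" unfolding D_def using k_ge_1 gamma_pos p by (intro ge_one_powr_ge_zero) auto
  have const: "enn_Lp_norm p lborel (\<lambda>y. ennreal a * indicator (ellipsoid \<rho> x0 (R n)) y) = ennreal (a * \<mu> n powr (1 / p))" if "0 \<le> a" for a n
    using that p Rpos[of n] \<mu>[of n] by (subst enn_Lp_norm_cmult) (auto simp: enn_Lp_norm_indicator emeasure_ellipsoid \<mu>_def ennreal_powr_ennreal ennreal_mult)
  have step: "\<bar>c (R i) - c (R (Suc i))\<bar> \<le> 2 * N * D * \<mu> n powr l" if "i < n" for i n
  proof -
    have "ennreal (\<bar>c (R i) - c (R (Suc i))\<bar> * \<mu> i powr (1 / p)) = enn_Lp_norm p lborel (\<lambda>y. ennreal \<bar>c (R i) - c (R (Suc i))\<bar> * indicator (ellipsoid \<rho> x0 (R i)) y)"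
      by (simp add: const)
    also have "\<dots> \<le> enn_Lp_norm p lborel (\<lambda>y. ennreal \<bar>b y - c (R i)\<bar> * indicator (ellipsoid \<rho> x0 (R i)) y + ennreal \<bar>b y - c (R (Suc i))\<bar> * indicator (ellipsoid \<rho> x0 (R (Suc i))) y)"
    proof (rule enn_Lp_norm_mono)
      fix y
      show "ennreal \<bar>c (R i) - c (R (Suc i))\<bar> * indicator (ellipsoid \<rho> x0 (R i)) y \<le> ennreal \<bar>b y - c (R i)\<bar> * indicator (ellipsoid \<rho> x0 (R i)) y + ennreal \<bar>b y - c (R (Suc i))\<bar> * indicator (ellipsoid \<rho> x0 (R (Suc i))) y"
      proof (cases "y \<in> ellipsoid \<rho> x0 (R i)")
        case True
        then have "y \<in> ellipsoid \<rho> x0 (R (Suc i))" using R(2)[of i] by (simp add: ellipsoid_def)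
        then show ?thesis using True by (simp add: ennreal_leI flip: ennreal_plus)
      qed simp
    qed (use p in simp)
    also have "\<dots> \<le> enn_Lp_norm p lborel (\<lambda>y. ennreal \<bar>b y - c (R i)\<bar> * indicator (ellipsoid \<rho> x0 (R i)) y) + enn_Lp_norm p lborel (\<lambda>y. ennreal \<bar>b y - c (R (Suc i))\<bar> * indicator (ellipsoid \<rho> x0 (R (Suc i))) y)"
      using p by (intro enn_Lp_norm_add sigma_finite_lborel) auto
    also have "\<dots> \<le> ennreal (N * \<mu> i powr (1 / p + l)) + ennreal (N * \<mu> (Suc i) powr (1 / p + l))"
      unfolding \<mu>_def by (intro add_mono b Rpos)
    also have "\<dots> = ennreal (N * \<mu> i powr (1 / p + l) + N * \<mu> (Suc i) powr (1 / p + l))" using N by simp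
    finally have "\<bar>c (R i) - c (R (Suc i))\<bar> * \<mu> i powr (1 / p) \<le> N * \<mu> i powr (1 / p + l) + N * \<mu> (Suc i) powr (1 / p + l)"
      using N by (subst (asm) ennreal_le_iff) auto
    also have "\<dots> \<le> N * \<mu> (Suc i) powr (1 / p + l) + N * \<mu> (Suc i) powr (1 / p + l)"
      using N \<mu>mono[of i "Suc i"] \<mu>[of i] p l by (intro add_right_mono mult_left_mono powr_mono2) auto
    also have "\<dots> = 2 * N * (\<mu> (Suc i) powr (1 / p) * \<mu> (Suc i) powr l)" by (simp add: powr_add)
    also have "\<dots> \<le> 2 * N * ((D * \<mu> i powr (1 / p)) * \<mu> n powr l)"
    proof (intro mult_left_mono mult_mono)
      have "\<mu> (Suc i) \<le> \<upsilon> * (2 * k * R i) powr \<gamma>"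
        unfolding \<mu>_def using R(3)[of i] Rpos[of "Suc i"] upsilon_pos gamma_pos by (intro mult_left_mono powr_mono2) auto
      also have "\<dots> = (2 * k) powr \<gamma> * \<mu> i" using k_ge_1 Rpos[of i] by (simp add: \<mu>_def powr_mult)
      finally have "\<mu> (Suc i) powr (1 / p) \<le> ((2 * k) powr \<gamma> * \<mu> i) powr (1 / p)" using p \<mu>[of "Suc i"] by (intro powr_mono2) auto
      also have "\<dots> = D * \<mu> i powr (1 / p)" using \<mu>[of i] k_ge_1 by (simp add: D_def powr_mult powr_powr)
      finally show "\<mu> (Suc i) powr (1 / p) \<le> D * \<mu> i powr (1 / p)" .
      show "\<mu> (Suc i) powr l \<le> \<mu> n powr l" using that l \<mu>[of "Suc i"] by (intro powr_mono2 \<mu>mono) auto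
    qed (use N D in auto)
    finally have "\<bar>c (R i) - c (R (Suc i))\<bar> * \<mu> i powr (1 / p) \<le> (2 * N * D * \<mu> n powr l) * \<mu> i powr (1 / p)" by (simp add: mult_ac)
    then show ?thesis using \<mu>[of i] by (simp add: mult_le_cancel_right)
  qed
  have tel: "\<bar>c (R 0) - c (R j)\<bar> \<le> real j * (2 * N * D * \<mu> n powr l)" if "j \<le> n" for j
    using that
  proof (induction j)
    case (Suc j)
    have "\<bar>c (R 0) - c (R (Suc j))\<bar> \<le> \<bar>c (R 0) - c (R j)\<bar> + \<bar>c (R j) - c (R (Suc j))\<bar>" by linarith
    also have "\<dots> \<le> real j * (2 * N * D * \<mu> n powr l) + 2 * N * D * \<mu> n powr l"
      using Suc step[of j n] by (intro add_mono) auto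
    finally show ?case by (simp add: algebra_simps)
  qed simp
  have "enn_Lp_norm p lborel (\<lambda>y. ennreal \<bar>b y - c (R 0)\<bar> * indicator (ellipsoid \<rho> x0 (R n)) y)
    \<le> enn_Lp_norm p lborel (\<lambda>y. ennreal \<bar>b y - c (R n)\<bar> * indicator (ellipsoid \<rho> x0 (R n)) y + ennreal (real n * (2 * N * D * \<mu> n powr l)) * indicator (ellipsoid \<rho> x0 (R n)) y)"
  proof (rule enn_Lp_norm_mono)
    fix y
    have "\<bar>b y - c (R 0)\<bar> \<le> \<bar>b y - c (R n)\<bar> + real n * (2 * N * D * \<mu> n powr l)" using tel[of n] by simp
    then have "ennreal \<bar>b y - c (R 0)\<bar> \<le> ennreal \<bar>b y - c (R n)\<bar> + ennreal (real n * (2 * N * D * \<mu> n powr l))"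
      using N D by (simp add: ennreal_leI flip: ennreal_plus)
    then show "ennreal \<bar>b y - c (R 0)\<bar> * indicator (ellipsoid \<rho> x0 (R n)) y \<le> ennreal \<bar>b y - c (R n)\<bar> * indicator (ellipsoid \<rho> x0 (R n)) y + ennreal (real n * (2 * N * D * \<mu> n powr l)) * indicator (ellipsoid \<rho> x0 (R n)) y"
      by (simp add: indicator_def)
  qed (use p in simp)
  also have "\<dots> \<le> enn_Lp_norm p lborel (\<lambda>y. ennreal \<bar>b y - c (R n)\<bar> * indicator (ellipsoid \<rho> x0 (R n)) y) + enn_Lp_norm p lborel (\<lambda>y. ennreal (real n * (2 * N * D * \<mu> n powr l)) * indicator (ellipsoid \<rho> x0 (R n)) y)"
    using p by (intro enn_Lp_norm_add sigma_finite_lborel) auto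
  also have "\<dots> \<le> ennreal (N * \<mu> n powr (1 / p + l)) + ennreal (real n * (2 * N * D * \<mu> n powr l) * \<mu> n powr (1 / p))"
  proof (rule add_mono)
    show "enn_Lp_norm p lborel (\<lambda>y. ennreal \<bar>b y - c (R n)\<bar> * indicator (ellipsoid \<rho> x0 (R n)) y) \<le> ennreal (N * \<mu> n powr (1 / p + l))"
      unfolding \<mu>_def by (rule b[OF Rpos])
    show "enn_Lp_norm p lborel (\<lambda>y. ennreal (real n * (2 * N * D * \<mu> n powr l)) * indicator (ellipsoid \<rho> x0 (R n)) y) \<le> ennreal (real n * (2 * N * D * \<mu> n powr l) * \<mu> n powr (1 / p))"
      using N D by (subst const) auto
  qed
  also have "\<dots> = ennreal (N * \<mu> n powr (1 / p + l) + real n * (2 * N * D) * \<mu> n powr (1 / p + l))"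
    using N D by (simp add: powr_add mult_ac flip: ennreal_plus)
  also have "\<dots> \<le> ennreal (2 * D * N * (1 + real n) * \<mu> n powr (1 / p + l))"
  proof (rule ennreal_leI)
    have "1 * (N * \<mu> n powr (1 / p + l)) \<le> (2 * D) * (N * \<mu> n powr (1 / p + l))" using D N by (intro mult_right_mono) auto
    then show "N * \<mu> n powr (1 / p + l) + real n * (2 * N * D) * \<mu> n powr (1 / p + l) \<le> 2 * D * N * (1 + real n) * \<mu> n powr (1 / p + l)"
      by (simp add: algebra_simps)
  qed
  finally show ?thesis unfolding D_def \<mu>_def .
qed

end

section \<open>Commutators with absolute values\<close>

lemma prod_mono_ennreal: "(\<And>i. i \<in> A \<Longrightarrow> f i \<le> g i) \<Longrightarrow> prod f A \<le> (prod g A :: ennreal)"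
  by (induction A rule: infinite_finite_induct) (auto intro!: mult_mono)

context rough_fractional
begin

definition abs_commutator :: "nat set \<Rightarrow> (nat \<Rightarrow> real^'n \<Rightarrow> real) \<Rightarrow> (real^'n \<Rightarrow> real) \<Rightarrow> real^'n \<Rightarrow> ennreal" where
  "abs_commutator I b f x = (\<integral>\<^sup>+y. ennreal ((\<Prod>i\<in>I. \<bar>b i x - b i y\<bar>) * K (x - y) * f y) \<partial>lborel)"

lemma measurable_abs_commutator:
  assumes [measurable]: "\<And>i. i \<in> I \<Longrightarrow> b i \<in> borel_measurable borel" "f \<in> borel_measurable borel"
  shows "abs_commutator I b f \<in> borel_measurable borel"
proof -
  have [measurable]: "(\<lambda>z. \<Prod>i\<in>I. \<bar>b i (fst z) - b i (snd z)\<bar>) \<in> borel_measurable (borel \<Otimes>\<^sub>M (borel :: (real^'n) measure))"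
    by (intro borel_measurable_prod) measurable
  have "(\<lambda>(x, y). ennreal ((\<Prod>i\<in>I. \<bar>b i x - b i y\<bar>) * K (x - y) * f y)) \<in> borel_measurable (borel \<Otimes>\<^sub>M lborel)"
    unfolding split_beta' by measurable
  then show ?thesis unfolding abs_commutator_def using lborel.borel_measurable_nn_integral by simp
qed

text \<open>The product is expanded over the set \<open>S\<close> of those factors that keep the variable \<open>x\<close>.\<close>

lemma abs_commutator_le:
  assumes I: "finite I" and [measurable]: "\<And>i. i \<in> I \<Longrightarrow> b i \<in> borel_measurable borel" "f \<in> borel_measurable borel"
    and f: "\<And>y. 0 \<le> f y" and r: "0 < r"
  shows "abs_commutator I b f x \<le> (\<Sum>S\<in>Pow I. \<Sum>j. (\<Prod>i\<in>S. ennreal \<bar>b i x - c i\<bar>) *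
     T (\<lambda>y. ((\<Prod>i\<in>I - S. \<bar>b i y - c i\<bar>) * f y) * indicator (shell x0 (2 * k * r) j) y) x)"
proof -
  define g where "g S y = (\<Prod>i\<in>I - S. \<bar>b i y - c i\<bar>) * f y" for S y
  have [measurable]: "g S \<in> borel_measurable borel" for S
    unfolding g_def by (intro borel_measurable_times borel_measurable_prod) auto
  have g0: "0 \<le> g S y" for S y unfolding g_def using f by (intro mult_nonneg_nonneg prod_nonneg) auto
  have "abs_commutator I b f x \<le> (\<integral>\<^sup>+y. (\<Sum>S\<in>Pow I. (\<Prod>i\<in>S. ennreal \<bar>b i x - c i\<bar>) * (ennreal (K (x - y)) * ennreal (g S y))) \<partial>lborel)"
    unfolding abs_commutator_def
  proof (intro nn_integral_mono)
    fix y
    have "(\<Prod>i\<in>I. \<bar>b i x - b i y\<bar>) \<le> (\<Prod>i\<in>I. \<bar>b i x - c i\<bar> + \<bar>b i y - c i\<bar>)"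
      by (intro prod_mono) auto
    also have "\<dots> = (\<Sum>S\<in>Pow I. (\<Prod>i\<in>S. \<bar>b i x - c i\<bar>) * (\<Prod>i\<in>I - S. \<bar>b i y - c i\<bar>))"
      by (rule prod_add[OF I])
    finally have "(\<Prod>i\<in>I. \<bar>b i x - b i y\<bar>) * (K (x - y) * f y) \<le> (\<Sum>S\<in>Pow I. (\<Prod>i\<in>S. \<bar>b i x - c i\<bar>) * (\<Prod>i\<in>I - S. \<bar>b i y - c i\<bar>)) * (K (x - y) * f y)"
      using f K_nonneg by (intro mult_right_mono) auto
    also have "\<dots> = (\<Sum>S\<in>Pow I. (\<Prod>i\<in>S. \<bar>b i x - c i\<bar>) * (K (x - y) * g S y))"
      by (simp add: sum_distrib_left sum_distrib_right g_def mult_ac)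
    finally have "ennreal ((\<Prod>i\<in>I. \<bar>b i x - b i y\<bar>) * K (x - y) * f y) \<le> ennreal (\<Sum>S\<in>Pow I. (\<Prod>i\<in>S. \<bar>b i x - c i\<bar>) * (K (x - y) * g S y))"
      by (simp add: ennreal_leI mult.assoc)
    also have "\<dots> = (\<Sum>S\<in>Pow I. ennreal ((\<Prod>i\<in>S. \<bar>b i x - c i\<bar>) * (K (x - y) * g S y)))"
      using K_nonneg g0 by (intro sum_ennreal[symmetric] mult_nonneg_nonneg prod_nonneg) auto
    also have "\<dots> = (\<Sum>S\<in>Pow I. (\<Prod>i\<in>S. ennreal \<bar>b i x - c i\<bar>) * (ennreal (K (x - y)) * ennreal (g S y)))"
      using K_nonneg g0 by (intro sum.cong refl) (simp add: ennreal_mult prod_nonneg prod_ennreal)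
    finally show "ennreal ((\<Prod>i\<in>I. \<bar>b i x - b i y\<bar>) * K (x - y) * f y) \<le> (\<Sum>S\<in>Pow I. (\<Prod>i\<in>S. ennreal \<bar>b i x - c i\<bar>) * (ennreal (K (x - y)) * ennreal (g S y)))" .
  qed
  also have "\<dots> = (\<Sum>S\<in>Pow I. (\<Prod>i\<in>S. ennreal \<bar>b i x - c i\<bar>) * T (g S) x)"
    unfolding T_def by (subst nn_integral_sum) (auto simp: nn_integral_cmult)
  also have "\<dots> \<le> (\<Sum>S\<in>Pow I. (\<Prod>i\<in>S. ennreal \<bar>b i x - c i\<bar>) * (\<Sum>j. T (\<lambda>y. g S y * indicator (shell x0 (2 * k * r) j) y) x))"
  proof (intro sum_mono mult_left_mono)
    fix S
    have "T (g S) x \<le> (\<integral>\<^sup>+y. (\<Sum>j. ennreal (K (x - y)) * ennreal (g S y * indicator (shell x0 (2 * k * r) j) y)) \<partial>lborel)"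
      unfolding T_def
    proof (intro nn_integral_mono)
      fix y
      obtain j where j: "y \<in> shell x0 (2 * k * r) j" using ex_shell[of "2 * k * r" y x0] r k_ge_1 by auto
      let ?h = "\<lambda>j. ennreal (K (x - y)) * ennreal (g S y * indicator (shell x0 (2 * k * r) j) y)"
      have "ennreal (K (x - y)) * ennreal (g S y) = ?h j" using j by simp
      also have "\<dots> \<le> (\<Sum>j. ?h j)" by (rule le_suminf_ennreal)
      finally show "ennreal (K (x - y)) * ennreal (g S y) \<le> (\<Sum>j. ?h j)" .
    qed
    also have "\<dots> = (\<Sum>j. T (\<lambda>y. g S y * indicator (shell x0 (2 * k * r) j) y) x)"
      unfolding T_def by (rule nn_integral_suminf) measurable
    finally show "T (g S) x \<le> (\<Sum>j. T (\<lambda>y. g S y * indicator (shell x0 (2 * k * r) j) y) x)" .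
  qed simp
  finally show ?thesis by (simp add: g_def)
qed

text \<open>Collects the powers of r, t and 2^j = t / (2 k r). The deviations kept in x give a
  factor r^(\<gamma> \<lambda>_i) where the claim has t^(\<gamma> \<lambda>_i); as r \<le> t and
  \<lambda>_i is nonnegative, r may be raised to t. Afterwards the bound depends on S only through
  the leading constant.\<close>

lemma commutator_exponent_bound:
  fixes j :: nat and I S :: "nat set"
  assumes I: "finite I" "S \<subseteq> I" and lam: "\<And>i. i \<in> I \<Longrightarrow> 0 \<le> lam i" and N: "\<And>i. i \<in> I \<Longrightarrow> 0 \<le> N i"
    and r: "0 < r" and C: "0 \<le> C"
    and u: "1 / q1 = (\<Sum>i\<in>S. 1 / ps i) + 1 / u"
  defines "t \<equiv> 2 ^ j * (2 * k * r)"
  shows "(\<Prod>i\<in>S. N i * r powr (\<gamma> * (1 / ps i + lam i))) * (C * (2 ^ j) powr (\<gamma> * (\<theta> - 1 / u))) *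
      (\<Prod>i\<in>I - S. N i * (1 + real j) * t powr (\<gamma> * (1 / ps i + lam i)))
    \<le> (C * (2 * k) powr (\<gamma> / u)) * ((\<Prod>i\<in>I. N i) * (1 + real j) ^ card I * r powr (\<gamma> / q1) *
        t powr (\<gamma> * ((\<Sum>i\<in>I. lam i) + (\<Sum>i\<in>I. 1 / ps i) - 1 / q1)) * (2 ^ j) powr (\<gamma> * \<theta>))"
proof -
  have fin: "finite S" "finite (I - S)" using I finite_subset by auto
  have t: "0 < t" "r \<le> t"
  proof -
    show "0 < t" using r k_ge_1 by (simp add: t_def)
    have "1 * (1 * r) \<le> 2 ^ j * ((2 * k) * r)" using r k_ge_1 by (intro mult_mono mult_right_mono) auto
    then show "r \<le> t" by (simp add: t_def mult.assoc)
  qed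
  have split: "(\<Sum>i\<in>I. h i) = (\<Sum>i\<in>S. h i) + (\<Sum>i\<in>I - S. h i)" for h :: "nat \<Rightarrow> real"
    using I by (metis add.commute sum.subset_diff)
  have Nsplit: "(\<Prod>i\<in>I. N i) = (\<Prod>i\<in>S. N i) * (\<Prod>i\<in>I - S. N i)"
    using I by (metis mult.commute prod.subset_diff)
  have psum: "(\<Prod>i\<in>A. x powr (h i)) = x powr (\<Sum>i\<in>A. h i)" if "finite A" "0 < x" for A x and h :: "nat \<Rightarrow> real"
    using powr_sum[of x h A] that by simp
  let ?a = "\<lambda>i. \<gamma> * (1 / ps i + lam i)"
  have asum: "(\<Sum>i\<in>A. ?a i) = \<gamma> * (\<Sum>i\<in>A. 1 / ps i) + \<gamma> * (\<Sum>i\<in>A. lam i)" for A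
    by (simp only: distrib_left sum.distrib sum_distrib_left)
  define LS where "LS = (\<Sum>i\<in>S. lam i)"
  have LS: "0 \<le> LS" unfolding LS_def using lam I by (intro sum_nonneg) auto
  have 2: "(2 ^ j :: real) = t / (2 * k * r)" using r k_ge_1 by (simp add: t_def)
  have pw: "(2 ^ j :: real) powr (\<gamma> * (\<theta> - 1 / u)) = (2 ^ j) powr (\<gamma> * \<theta>) * (t powr (- (\<gamma> / u)) * (2 * k) powr (\<gamma> / u) * r powr (\<gamma> / u))"
  proof -
    have "(2 ^ j :: real) powr (\<gamma> * (\<theta> - 1 / u)) = (2 ^ j) powr (\<gamma> * \<theta>) * (2 ^ j) powr (- (\<gamma> / u))"
      by (simp add: right_diff_distrib flip: powr_add)
    also have "(2 ^ j :: real) powr (- (\<gamma> / u)) = t powr (- (\<gamma> / u)) * (2 * k) powr (\<gamma> / u) * r powr (\<gamma> / u)"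
      unfolding 2 using r t k_ge_1 by (simp add: powr_divide powr_mult powr_minus field_simps)
    finally show ?thesis .
  qed
  have er: "(\<Sum>i\<in>S. ?a i) + \<gamma> / u = \<gamma> / q1 + \<gamma> * LS"
  proof -
    have "(\<Sum>i\<in>S. ?a i) + \<gamma> / u = \<gamma> * ((\<Sum>i\<in>S. 1 / ps i) + 1 / u) + \<gamma> * LS"
      unfolding asum LS_def by (simp add: distrib_left)
    then show ?thesis unfolding u[symmetric] by simp
  qed
  have et: "(\<Sum>i\<in>I - S. ?a i) - \<gamma> / u = \<gamma> * ((\<Sum>i\<in>I. lam i) + (\<Sum>i\<in>I. 1 / ps i) - 1 / q1) - \<gamma> * LS"
  proof -
    have "(\<Sum>i\<in>I - S. ?a i) = \<gamma> * (\<Sum>i\<in>I - S. 1 / ps i) + \<gamma> * (\<Sum>i\<in>I - S. lam i)"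
      by (rule asum)
    moreover have "\<gamma> / u = \<gamma> * (1 / q1 - (\<Sum>i\<in>S. 1 / ps i))" using u by simp
    ultimately show ?thesis unfolding LS_def split[of lam] split[of "\<lambda>i. 1 / ps i"] by (simp add: algebra_simps)
  qed
  let ?e = "\<gamma> * ((\<Sum>i\<in>I. lam i) + (\<Sum>i\<in>I. 1 / ps i) - 1 / q1)"
  have "(\<Prod>i\<in>S. N i * r powr ?a i) * (C * (2 ^ j) powr (\<gamma> * (\<theta> - 1 / u))) * (\<Prod>i\<in>I - S. N i * (1 + real j) * t powr ?a i)
    = (C * (2 * k) powr (\<gamma> / u)) * ((\<Prod>i\<in>I. N i) * (1 + real j) ^ card (I - S) * (2 ^ j) powr (\<gamma> * \<theta>)) *
      ((r powr (\<Sum>i\<in>S. ?a i) * r powr (\<gamma> / u)) * (t powr (\<Sum>i\<in>I - S. ?a i) * t powr (- (\<gamma> / u))))"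
    unfolding pw Nsplit prod.distrib psum[OF fin(1) r] psum[OF fin(2) t(1)] by (simp add: mult_ac)
  also have "(r powr (\<Sum>i\<in>S. ?a i) * r powr (\<gamma> / u)) * (t powr (\<Sum>i\<in>I - S. ?a i) * t powr (- (\<gamma> / u)))
    = r powr (\<gamma> / q1) * t powr ?e * (r powr (\<gamma> * LS) * t powr (- (\<gamma> * LS)))"
  proof -
    have "r powr (\<Sum>i\<in>S. ?a i) * r powr (\<gamma> / u) = r powr (\<gamma> / q1) * r powr (\<gamma> * LS)"
      unfolding powr_add[symmetric] er ..
    moreover have "t powr (\<Sum>i\<in>I - S. ?a i) * t powr (- (\<gamma> / u)) = t powr ?e * t powr (- (\<gamma> * LS))"
      unfolding powr_add[symmetric] using et by simp
    ultimately show ?thesis by simp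
  qed
  also have "(C * (2 * k) powr (\<gamma> / u)) * ((\<Prod>i\<in>I. N i) * (1 + real j) ^ card (I - S) * (2 ^ j) powr (\<gamma> * \<theta>)) *
      (r powr (\<gamma> / q1) * t powr ?e * (r powr (\<gamma> * LS) * t powr (- (\<gamma> * LS))))
    \<le> (C * (2 * k) powr (\<gamma> / u)) * ((\<Prod>i\<in>I. N i) * (1 + real j) ^ card I * (2 ^ j) powr (\<gamma> * \<theta>)) *
      (r powr (\<gamma> / q1) * t powr ?e * 1)"
  proof -
    have 1: "(1 + real j) ^ card (I - S) \<le> (1 + real j) ^ card I"
      using I by (intro power_increasing card_mono) auto
    have "r powr (\<gamma> * LS) \<le> t powr (\<gamma> * LS)" using r t LS gamma_pos by (intro powr_mono2) auto
    then have "r powr (\<gamma> * LS) * t powr (- (\<gamma> * LS)) \<le> t powr (\<gamma> * LS) * t powr (- (\<gamma> * LS))" by (rule mult_right_mono) simp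
    also have "\<dots> = 1" using t by (simp flip: powr_add)
    finally have "(1 + real j) ^ card (I - S) * (r powr (\<gamma> * LS) * t powr (- (\<gamma> * LS))) \<le> (1 + real j) ^ card I * 1"
      using 1 by (intro mult_mono) auto
    moreover have "0 \<le> (C * (2 * k) powr (\<gamma> / u)) * (\<Prod>i\<in>I. N i) * (2 ^ j) powr (\<gamma> * \<theta>) * (r powr (\<gamma> / q1) * t powr ?e)"
      using C N by (intro mult_nonneg_nonneg prod_nonneg) auto
    ultimately have "((C * (2 * k) powr (\<gamma> / u)) * (\<Prod>i\<in>I. N i) * (2 ^ j) powr (\<gamma> * \<theta>) * (r powr (\<gamma> / q1) * t powr ?e)) *
        ((1 + real j) ^ card (I - S) * (r powr (\<gamma> * LS) * t powr (- (\<gamma> * LS))))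
      \<le> ((C * (2 * k) powr (\<gamma> / u)) * (\<Prod>i\<in>I. N i) * (2 ^ j) powr (\<gamma> * \<theta>) * (r powr (\<gamma> / q1) * t powr ?e)) * ((1 + real j) ^ card I * 1)"
      by (rule mult_left_mono)
    then show ?thesis by (simp only: mult_ac)
  qed
  finally show ?thesis by (simp add: mult_ac)
qed

text \<open>For every S three inequalities are chained: Hoelder in x, where 1 / q1 is 1 / u_S plus
  the sum of 1 / p_i over S; the shell estimate from L_v to L_u with v = v_S and u = u_S; and
  Hoelder in y, where 1 / v_S is 1 / p plus the sum over I - S. The constant is chosen before the
  functions, the center and the radius.\<close>

theorem abs_commutator_estimate:
  assumes I: "finite I" and ps: "\<And>i. i \<in> I \<Longrightarrow> 1 < ps i" and lam: "\<And>i. i \<in> I \<Longrightarrow> 0 \<le> lam i"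
    and p: "1 < p" "p < \<gamma> / \<alpha>" and q: "1 < q" "1 / q = (\<Sum>i\<in>I. 1 / ps i) + 1 / p"
    and q1: "1 < q1" "1 / q1 = 1 / q - \<alpha> / \<gamma>"
    and \<theta>: "(\<theta> = 0 \<and> 1 / s + 1 / q = 1) \<or> \<theta> = 1 / s"
  shows "\<exists>C>0. \<forall>b f c N x0 r. (\<forall>i\<in>I. b i \<in> borel_measurable borel) \<longrightarrow> f \<in> borel_measurable borel \<longrightarrow> (\<forall>y. 0 \<le> f y) \<longrightarrow>
     0 < r \<longrightarrow> (\<forall>i\<in>I. 0 \<le> N i) \<longrightarrow>
     (\<forall>i\<in>I. enn_Lp_norm (ps i) lborel (\<lambda>y. ennreal \<bar>b i y - c i\<bar> * indicator (ellipsoid \<rho> x0 r) y) \<le> ennreal (N i * r powr (\<gamma> * (1 / ps i + lam i)))) \<longrightarrow>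
     (\<forall>i\<in>I. \<forall>j. enn_Lp_norm (ps i) lborel (\<lambda>y. ennreal \<bar>b i y - c i\<bar> * indicator (ellipsoid \<rho> x0 (2 ^ j * (2 * k * r))) y)
        \<le> ennreal (N i * (1 + real j) * (2 ^ j * (2 * k * r)) powr (\<gamma> * (1 / ps i + lam i)))) \<longrightarrow>
     enn_Lp_norm q1 lborel (\<lambda>x. abs_commutator I b f x * indicator (ellipsoid \<rho> x0 r) x) \<le>
       ennreal C * (\<Sum>j. ennreal ((\<Prod>i\<in>I. N i) * (1 + real j) ^ card I * r powr (\<gamma> / q1) *
         (2 ^ j * (2 * k * r)) powr (\<gamma> * ((\<Sum>i\<in>I. lam i) + (\<Sum>i\<in>I. 1 / ps i) - 1 / q1)) * (2 ^ j) powr (\<gamma> * \<theta>)) *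
         enn_Lp_norm p lborel (\<lambda>y. ennreal (f y) * indicator (ellipsoid \<rho> x0 (2 ^ j * (2 * k * r))) y))"
proof -
  \<comment> \<open>The exponent q belongs to the empty S, hence q \<le> v S for all S, as the case
    \<theta> = 0 of the shell estimate asks; p < \<gamma> / \<alpha> makes every 1 / u S
    positive.\<close>
  define v where "v S = 1 / ((\<Sum>i\<in>I - S. 1 / ps i) + 1 / p)" for S
  define u where "u S = 1 / (1 / v S - \<alpha> / \<gamma>)" for S
  have psp: "0 < 1 / ps i" if "i \<in> I" for i using ps[OF that] by simp
  have v: "1 < v S" "q \<le> v S" "1 / v S = (\<Sum>i\<in>I - S. 1 / ps i) + 1 / p" and u: "0 < u S" "1 / u S = 1 / v S - \<alpha> / \<gamma>"
    and u1: "1 / q1 = (\<Sum>i\<in>S. 1 / ps i) + 1 / u S" if S: "S \<subseteq> I" for S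
  proof -
    have nn: "0 \<le> (\<Sum>i\<in>I - S. 1 / ps i)" "0 \<le> (\<Sum>i\<in>S. 1 / ps i)"
      using psp S by (auto intro!: sum_nonneg simp: less_imp_le subset_iff)
    have split: "(\<Sum>i\<in>I. 1 / ps i) = (\<Sum>i\<in>S. 1 / ps i) + (\<Sum>i\<in>I - S. 1 / ps i)"
      using I S by (metis add.commute sum.subset_diff)
    show v3: "1 / v S = (\<Sum>i\<in>I - S. 1 / ps i) + 1 / p" by (simp add: v_def)
    have vpos: "0 < 1 / v S" unfolding v3 using nn p by (simp add: add_nonneg_pos)
    have "1 / v S \<le> 1 / q" unfolding v3 q(2) using split nn by simp
    then show "q \<le> v S" using vpos q(1) by (simp add: field_simps zero_less_divide_iff)
    then show "1 < v S" using q by simp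
    show u2: "1 / u S = 1 / v S - \<alpha> / \<gamma>" by (simp add: u_def)
    have "\<alpha> / \<gamma> < 1 / p" using p alpha gamma_pos by (simp add: field_simps)
    then have "0 < 1 / u S" unfolding u2 v3 using nn by simp
    then show "0 < u S" by (simp add: zero_less_divide_iff)
    show "1 / q1 = (\<Sum>i\<in>S. 1 / ps i) + 1 / u S" unfolding u2 v3 q1(2) q(2) using split by simp
  qed
  define Q where "Q S C \<longleftrightarrow> (\<forall>x0 r j. \<forall>f\<in>borel_measurable borel. 0 < r \<longrightarrow> (\<forall>y. 0 \<le> f y) \<longrightarrow>
     enn_Lp_norm (u S) lborel (\<lambda>x. T (\<lambda>y. f y * indicator (shell x0 (2 * k * r) j) y) x * indicator (ellipsoid \<rho> x0 r) x)
      \<le> ennreal (C * (2 ^ j) powr (\<gamma> * (\<theta> - 1 / u S))) * enn_Lp_norm (v S) lborel (\<lambda>y. ennreal (f y) * indicator (ellipsoid \<rho> x0 (2 ^ j * (2 * k * r))) y))"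
    for S C
  have exQ: "\<forall>S\<in>Pow I. \<exists>C. 0 < C \<and> Q S C"
  proof
    fix S assume "S \<in> Pow I"
    then have S: "S \<subseteq> I" by simp
    have "(\<theta> = 0 \<and> (\<exists>q. 1 < q \<and> q \<le> v S \<and> 1 / s + 1 / q = 1)) \<or> \<theta> = 1 / s"
      using \<theta> q(1) v(2)[OF S] by blast
    then show "\<exists>C. 0 < C \<and> Q S C"
      unfolding Q_def by (rule shell_estimate[OF v(1)[OF S] u[OF S]])
  qed
  \<comment> \<open>There are finitely many S, so one constant for each is chosen and these are
    summed up in C.\<close>
  obtain Cs where CQ: "\<forall>S\<in>Pow I. 0 < Cs S \<and> Q S (Cs S)" using bchoice[OF exQ] by (elim exE)
  have Cs1: "0 < Cs S" if "S \<in> Pow I" for S using CQ that by blast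
  have Cs2: "enn_Lp_norm (u S) lborel (\<lambda>x. T (\<lambda>y. f y * indicator (shell x0 (2 * k * r) j) y) x * indicator (ellipsoid \<rho> x0 r) x)
      \<le> ennreal (Cs S * (2 ^ j) powr (\<gamma> * (\<theta> - 1 / u S))) * enn_Lp_norm (v S) lborel (\<lambda>y. ennreal (f y) * indicator (ellipsoid \<rho> x0 (2 ^ j * (2 * k * r))) y)"
    if S: "S \<in> Pow I" and f: "f \<in> borel_measurable borel" "0 < r" "\<forall>y. 0 \<le> f y" for S x0 r j f
  proof -
    have QS: "Q S (Cs S)" using bspec[OF CQ S] by blast
    show ?thesis by (rule QS[unfolded Q_def, rule_format, OF f(1,2)]) (use f(3) in blast)
  qed
  note Cs = Cs1 Cs2
  define C where "C = (\<Sum>S\<in>Pow I. Cs S * (2 * k) powr (\<gamma> / u S))"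
  have Cpos: "0 < C" unfolding C_def using I Cs(1) k_ge_1 by (intro sum_pos) auto
  show ?thesis
  proof (intro exI[of _ C] conjI allI impI Cpos)
    fix b :: "nat \<Rightarrow> real^'n \<Rightarrow> real" and f :: "real^'n \<Rightarrow> real" and c N and x0 :: "real^'n" and r :: real
    assume b: "\<forall>i\<in>I. b i \<in> borel_measurable borel" and f[measurable]: "f \<in> borel_measurable borel" and f0: "\<forall>y. 0 \<le> f y"
      and r: "0 < r" and N: "\<forall>i\<in>I. 0 \<le> N i"
      and br: "\<forall>i\<in>I. enn_Lp_norm (ps i) lborel (\<lambda>y. ennreal \<bar>b i y - c i\<bar> * indicator (ellipsoid \<rho> x0 r) y) \<le> ennreal (N i * r powr (\<gamma> * (1 / ps i + lam i)))"
      and bt: "\<forall>i\<in>I. \<forall>j. enn_Lp_norm (ps i) lborel (\<lambda>y. ennreal \<bar>b i y - c i\<bar> * indicator (ellipsoid \<rho> x0 (2 ^ j * (2 * k * r))) y)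
        \<le> ennreal (N i * (1 + real j) * (2 ^ j * (2 * k * r)) powr (\<gamma> * (1 / ps i + lam i)))"
    have bm[measurable]: "b i \<in> borel_measurable borel" if "i \<in> I" for i using b that by blast
    define t where "t j = 2 ^ j * (2 * k * r)" for j :: nat
    define F where "F j = enn_Lp_norm p lborel (\<lambda>y. ennreal (f y) * indicator (ellipsoid \<rho> x0 (t j)) y)" for j
    define Y where "Y j = (\<Prod>i\<in>I. N i) * (1 + real j) ^ card I * r powr (\<gamma> / q1) *
         t j powr (\<gamma> * ((\<Sum>i\<in>I. lam i) + (\<Sum>i\<in>I. 1 / ps i) - 1 / q1)) * (2 ^ j) powr (\<gamma> * \<theta>)" for j
    have Y0: "0 \<le> Y j" for j unfolding Y_def using N by (intro mult_nonneg_nonneg prod_nonneg) auto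
    define g where "g S y = (\<Prod>i\<in>I - S. \<bar>b i y - c i\<bar>) * f y" for S y
    have gm[measurable]: "g S \<in> borel_measurable borel" for S
      unfolding g_def by (intro borel_measurable_times borel_measurable_prod) auto
    have g0: "0 \<le> g S y" for S y unfolding g_def using f0 by (intro mult_nonneg_nonneg prod_nonneg) auto
    let ?E = "ellipsoid \<rho> x0 r"
    define H where "H S j x = (\<Prod>i\<in>S. ennreal \<bar>b i x - c i\<bar> * indicator ?E x) * (T (\<lambda>y. g S y * indicator (shell x0 (2 * k * r) j) y) x * indicator ?E x)" for S j x
    have Hm: "H S j \<in> borel_measurable lborel" if "S \<in> Pow I" for S j
    proof -
      have "(\<lambda>x. ennreal \<bar>b i x - c i\<bar> * indicator ?E x) \<in> borel_measurable lborel" if "i \<in> S" for i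
        using bm[of i] that \<open>S \<in> Pow I\<close> by auto
      then have "(\<lambda>x. \<Prod>i\<in>S. ennreal \<bar>b i x - c i\<bar> * indicator ?E x) \<in> borel_measurable lborel" by (rule borel_measurable_prod_ennreal)
      moreover have "(\<lambda>x. T (\<lambda>y. g S y * indicator (shell x0 (2 * k * r) j) y) x * indicator ?E x) \<in> borel_measurable lborel" by measurable
      ultimately show ?thesis unfolding H_def by (rule borel_measurable_times_ennreal)
    qed
    have HSj: "enn_Lp_norm q1 lborel (H S j) \<le> ennreal (Cs S * (2 * k) powr (\<gamma> / u S)) * (ennreal (Y j) * F j)" if S: "S \<in> Pow I" for S j
    proof -
      have SI: "S \<subseteq> I" "finite S" "finite (I - S)" using S I finite_subset by auto
      have bS: "(\<lambda>x. ennreal \<bar>b i x - c i\<bar> * indicator A x) \<in> borel_measurable lborel" if "i \<in> I" "A \<in> sets borel" for i A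
        using bm[OF that(1)] that(2) by measurable
      have "enn_Lp_norm q1 lborel (H S j) \<le> (\<Prod>i\<in>S. enn_Lp_norm (ps i) lborel (\<lambda>x. ennreal \<bar>b i x - c i\<bar> * indicator ?E x)) *
          enn_Lp_norm (u S) lborel (\<lambda>x. T (\<lambda>y. g S y * indicator (shell x0 (2 * k * r) j) y) x * indicator ?E x)"
        unfolding H_def
      proof (rule enn_Lp_norm_Holder_prod[OF SI(2)])
        show "(\<lambda>x. ennreal \<bar>b i x - c i\<bar> * indicator ?E x) \<in> borel_measurable lborel" "0 < ps i" if "i \<in> S" for i
          using that SI(1) bS[of i ?E] ps[of i] by auto
        show "0 < u S" "1 / q1 = (\<Sum>i\<in>S. 1 / ps i) + 1 / u S" using u[OF SI(1)] u1[OF SI(1)] by auto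
      qed (use q1 in auto)
      also have "\<dots> \<le> (\<Prod>i\<in>S. ennreal (N i * r powr (\<gamma> * (1 / ps i + lam i)))) *
          (ennreal (Cs S * (2 ^ j) powr (\<gamma> * (\<theta> - 1 / u S))) * ((\<Prod>i\<in>I - S. ennreal (N i * (1 + real j) * t j powr (\<gamma> * (1 / ps i + lam i)))) * F j))"
      proof (intro mult_mono prod_mono_ennreal)
        show "enn_Lp_norm (ps i) lborel (\<lambda>x. ennreal \<bar>b i x - c i\<bar> * indicator ?E x) \<le> ennreal (N i * r powr (\<gamma> * (1 / ps i + lam i)))" if "i \<in> S" for i
          using br that SI(1) by blast
        have "enn_Lp_norm (u S) lborel (\<lambda>x. T (\<lambda>y. g S y * indicator (shell x0 (2 * k * r) j) y) x * indicator ?E x)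
          \<le> ennreal (Cs S * (2 ^ j) powr (\<gamma> * (\<theta> - 1 / u S))) * enn_Lp_norm (v S) lborel (\<lambda>y. ennreal (g S y) * indicator (ellipsoid \<rho> x0 (t j)) y)"
          unfolding t_def using S r g0 by (intro Cs(2)) auto
        also have "enn_Lp_norm (v S) lborel (\<lambda>y. ennreal (g S y) * indicator (ellipsoid \<rho> x0 (t j)) y)
          \<le> (\<Prod>i\<in>I - S. ennreal (N i * (1 + real j) * t j powr (\<gamma> * (1 / ps i + lam i)))) * F j"
        proof -
          have "enn_Lp_norm (v S) lborel (\<lambda>y. ennreal (g S y) * indicator (ellipsoid \<rho> x0 (t j)) y)
            \<le> enn_Lp_norm (v S) lborel (\<lambda>y. (\<Prod>i\<in>I - S. ennreal \<bar>b i y - c i\<bar> * indicator (ellipsoid \<rho> x0 (t j)) y) * (ennreal (f y) * indicator (ellipsoid \<rho> x0 (t j)) y))"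
          proof (rule enn_Lp_norm_mono)
            fix y
            show "ennreal (g S y) * indicator (ellipsoid \<rho> x0 (t j)) y \<le> (\<Prod>i\<in>I - S. ennreal \<bar>b i y - c i\<bar> * indicator (ellipsoid \<rho> x0 (t j)) y) * (ennreal (f y) * indicator (ellipsoid \<rho> x0 (t j)) y)"
              using f0 by (cases "y \<in> ellipsoid \<rho> x0 (t j)") (simp_all add: g_def ennreal_mult prod_nonneg prod_ennreal)
          qed (use v[OF SI(1)] in simp)
          also have "\<dots> \<le> (\<Prod>i\<in>I - S. enn_Lp_norm (ps i) lborel (\<lambda>y. ennreal \<bar>b i y - c i\<bar> * indicator (ellipsoid \<rho> x0 (t j)) y)) * F j"
            unfolding F_def
          proof (rule enn_Lp_norm_Holder_prod[OF SI(3)])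
            show "(\<lambda>x. ennreal \<bar>b i x - c i\<bar> * indicator (ellipsoid \<rho> x0 (t j)) x) \<in> borel_measurable lborel" "0 < ps i" if "i \<in> I - S" for i
              using that bS[of i "ellipsoid \<rho> x0 (t j)"] ps[of i] by auto
            show "0 < v S" "1 / v S = (\<Sum>i\<in>I - S. 1 / ps i) + 1 / p" using v[OF SI(1)] by auto
          qed (use p in auto)
          also have "\<dots> \<le> (\<Prod>i\<in>I - S. ennreal (N i * (1 + real j) * t j powr (\<gamma> * (1 / ps i + lam i)))) * F j"
            using bt unfolding t_def by (intro mult_right_mono prod_mono_ennreal) auto
          finally show ?thesis .
        qed
        finally show "enn_Lp_norm (u S) lborel (\<lambda>x. T (\<lambda>y. g S y * indicator (shell x0 (2 * k * r) j) y) x * indicator ?E x)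
          \<le> ennreal (Cs S * (2 ^ j) powr (\<gamma> * (\<theta> - 1 / u S))) * ((\<Prod>i\<in>I - S. ennreal (N i * (1 + real j) * t j powr (\<gamma> * (1 / ps i + lam i)))) * F j)"
          by (simp add: mult_left_mono)
      qed auto
      also have "\<dots> = ennreal ((\<Prod>i\<in>S. N i * r powr (\<gamma> * (1 / ps i + lam i))) * (Cs S * (2 ^ j) powr (\<gamma> * (\<theta> - 1 / u S))) *
          (\<Prod>i\<in>I - S. N i * (1 + real j) * t j powr (\<gamma> * (1 / ps i + lam i)))) * F j"
      proof -
        have "0 \<le> (\<Prod>i\<in>S. N i * r powr (\<gamma> * (1 / ps i + lam i)))" "0 \<le> (\<Prod>i\<in>I - S. N i * (1 + real j) * t j powr (\<gamma> * (1 / ps i + lam i)))"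
          using N SI(1) by (auto intro!: prod_nonneg)
        moreover have "(\<Prod>i\<in>S. ennreal (N i * r powr (\<gamma> * (1 / ps i + lam i)))) = ennreal (\<Prod>i\<in>S. N i * r powr (\<gamma> * (1 / ps i + lam i)))"
          "(\<Prod>i\<in>I - S. ennreal (N i * (1 + real j) * t j powr (\<gamma> * (1 / ps i + lam i)))) = ennreal (\<Prod>i\<in>I - S. N i * (1 + real j) * t j powr (\<gamma> * (1 / ps i + lam i)))"
          using N SI(1) by (auto intro!: prod_ennreal)
        ultimately show ?thesis using Cs(1)[OF S] by (simp add: ennreal_mult mult.assoc)
      qed
      also have "\<dots> \<le> ennreal ((Cs S * (2 * k) powr (\<gamma> / u S)) * Y j) * F j"
        unfolding Y_def t_def using I SI lam N r Cs(1)[OF S] u1[OF SI(1)]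
        by (intro mult_right_mono ennreal_leI commutator_exponent_bound) auto
      also have "\<dots> = ennreal (Cs S * (2 * k) powr (\<gamma> / u S)) * (ennreal (Y j) * F j)"
        using Cs(1)[OF S] Y0 by (simp add: ennreal_mult mult.assoc)
      finally show ?thesis .
    qed
    have "enn_Lp_norm q1 lborel (\<lambda>x. abs_commutator I b f x * indicator ?E x) \<le> enn_Lp_norm q1 lborel (\<lambda>x. \<Sum>S\<in>Pow I. \<Sum>j. H S j x)"
    proof (rule enn_Lp_norm_mono)
      fix x
      show "abs_commutator I b f x * indicator ?E x \<le> (\<Sum>S\<in>Pow I. \<Sum>j. H S j x)"
      proof (cases "x \<in> ?E")
        case True
        have "abs_commutator I b f x \<le> (\<Sum>S\<in>Pow I. \<Sum>j. (\<Prod>i\<in>S. ennreal \<bar>b i x - c i\<bar>) *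
           T (\<lambda>y. ((\<Prod>i\<in>I - S. \<bar>b i y - c i\<bar>) * f y) * indicator (shell x0 (2 * k * r) j) y) x)"
          using I bm f0 r by (intro abs_commutator_le) auto
        then show ?thesis using True by (simp add: H_def g_def)
      qed simp
    qed (use q1 in simp)
    also have "\<dots> \<le> (\<Sum>S\<in>Pow I. enn_Lp_norm q1 lborel (\<lambda>x. \<Sum>j. H S j x))"
    proof (rule enn_Lp_norm_sum)
      show "(\<lambda>x. \<Sum>j. H S j x) \<in> borel_measurable lborel" if "S \<in> Pow I" for S
        by (rule borel_measurable_suminf_order) (rule Hm[OF that])
    qed (use I q1 sigma_finite_lborel in auto)
    also have "\<dots> \<le> (\<Sum>S\<in>Pow I. \<Sum>j. enn_Lp_norm q1 lborel (H S j))"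
      using q1 by (intro sum_mono enn_Lp_norm_suminf sigma_finite_lborel Hm) auto
    also have "\<dots> \<le> (\<Sum>S\<in>Pow I. \<Sum>j. ennreal (Cs S * (2 * k) powr (\<gamma> / u S)) * (ennreal (Y j) * F j))"
      by (intro sum_mono suminf_le HSj) auto
    also have "\<dots> = (\<Sum>S\<in>Pow I. ennreal (Cs S * (2 * k) powr (\<gamma> / u S)) * (\<Sum>j. ennreal (Y j) * F j))"
      by simp
    also have "\<dots> = ennreal C * (\<Sum>j. ennreal (Y j) * F j)"
    proof -
      have "0 \<le> Cs S * (2 * k) powr (\<gamma> / u S)" if "S \<in> Pow I" for S
        using Cs1[OF that] by simp
      then have "(\<Sum>S\<in>Pow I. ennreal (Cs S * (2 * k) powr (\<gamma> / u S))) = ennreal C"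
        unfolding C_def by (rule sum_ennreal)
      then show ?thesis by (simp only: sum_distrib_right[symmetric])
    qed
    finally show "enn_Lp_norm q1 lborel (\<lambda>x. abs_commutator I b f x * indicator ?E x) \<le>
       ennreal C * (\<Sum>j. ennreal ((\<Prod>i\<in>I. N i) * (1 + real j) ^ card I * r powr (\<gamma> / q1) *
         (2 ^ j * (2 * k * r)) powr (\<gamma> * ((\<Sum>i\<in>I. lam i) + (\<Sum>i\<in>I. 1 / ps i) - 1 / q1)) * (2 ^ j) powr (\<gamma> * \<theta>)) *
         enn_Lp_norm p lborel (\<lambda>y. ennreal (f y) * indicator (ellipsoid \<rho> x0 (2 ^ j * (2 * k * r))) y))"
      unfolding Y_def F_def t_def .
  qed
qed

text \<open>The parameter \<theta> covers both weight hypotheses. In the application c i t is the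
  average of b_i over E(x0, t); the expansion on E(x0, r) uses c i r on all shells, and
  \<open>Campanato_growth\<close> bounds the deviations from it. N and L are arbitrary bounds, so
  that the constant is independent of the functions.\<close>

theorem local_Morrey_estimate:
  fixes \<phi>1 \<phi>2 :: "real \<Rightarrow> real" and x0 :: "real^'n"
  assumes I: "finite I" and ps: "\<And>i. i \<in> I \<Longrightarrow> 1 < ps i" and lam: "\<And>i. i \<in> I \<Longrightarrow> 0 \<le> lam i"
    and p: "1 < p" "p < \<gamma> / \<alpha>" and q: "1 < q" "1 / q = (\<Sum>i\<in>I. 1 / ps i) + 1 / p"
    and q1: "1 < q1" "1 / q1 = 1 / q - \<alpha> / \<gamma>"
    and \<theta>: "(\<theta> = 0 \<and> 1 / s + 1 / q = 1) \<or> \<theta> = 1 / s"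
    and \<phi>1: "\<And>t. 0 < t \<Longrightarrow> 0 < \<phi>1 t" and \<phi>2: "\<And>t. 0 < t \<Longrightarrow> 0 < \<phi>2 t" and Cw: "0 < Cw"
    and weight: "\<And>r. 0 < r \<Longrightarrow> (\<integral>\<^sup>+t\<in>{r<..}. ennreal ((1 + ln (t / r)) ^ card I) *
        (ess_inf (lebesgue_on {t<..}) (\<lambda>\<tau>. ennreal (\<phi>1 \<tau> * \<tau> powr (\<gamma> / p))) /
          ennreal (t powr (\<gamma> * (1 / q1 - (\<theta> + (\<Sum>i\<in>I. lam i) + (\<Sum>i\<in>I. 1 / ps i))) + 1))) \<partial>lebesgue)
        \<le> ennreal (Cw * \<phi>2 r * r powr (\<gamma> * \<theta>))"
  shows "\<exists>C>0. \<forall>b f c N L. (\<forall>i\<in>I. b i \<in> borel_measurable borel) \<longrightarrow> f \<in> borel_measurable borel \<longrightarrow> (\<forall>y. 0 \<le> f y) \<longrightarrow>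
     (\<forall>i\<in>I. 0 \<le> N i) \<longrightarrow> 0 \<le> L \<longrightarrow>
     (\<forall>i\<in>I. \<forall>t>0. enn_Lp_norm (ps i) lborel (\<lambda>y. ennreal \<bar>b i y - c i t\<bar> * indicator (ellipsoid \<rho> x0 t) y) \<le> ennreal (N i * (\<upsilon> * t powr \<gamma>) powr (1 / ps i + lam i))) \<longrightarrow>
     (\<forall>t>0. enn_Lp_norm p lborel (\<lambda>y. ennreal (f y) * indicator (ellipsoid \<rho> x0 t) y) \<le> ennreal (L * \<phi>1 t * (\<upsilon> * t powr \<gamma>) powr (1 / p))) \<longrightarrow>
     (\<forall>r>0. enn_Lp_norm q1 lborel (\<lambda>x. abs_commutator I b f x * indicator (ellipsoid \<rho> x0 r) x)
        \<le> ennreal (C * (\<Prod>i\<in>I. N i) * L * \<phi>2 r * (\<upsilon> * r powr \<gamma>) powr (1 / q1)))"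
proof -
  obtain C0 where C0: "0 < C0" and est: "\<forall>b f c N x0 r. (\<forall>i\<in>I. b i \<in> borel_measurable borel) \<longrightarrow> f \<in> borel_measurable borel \<longrightarrow> (\<forall>y. 0 \<le> f y) \<longrightarrow>
     0 < r \<longrightarrow> (\<forall>i\<in>I. 0 \<le> N i) \<longrightarrow>
     (\<forall>i\<in>I. enn_Lp_norm (ps i) lborel (\<lambda>y. ennreal \<bar>b i y - c i\<bar> * indicator (ellipsoid \<rho> x0 r) y) \<le> ennreal (N i * r powr (\<gamma> * (1 / ps i + lam i)))) \<longrightarrow>
     (\<forall>i\<in>I. \<forall>j. enn_Lp_norm (ps i) lborel (\<lambda>y. ennreal \<bar>b i y - c i\<bar> * indicator (ellipsoid \<rho> x0 (2 ^ j * (2 * k * r))) y)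
        \<le> ennreal (N i * (1 + real j) * (2 ^ j * (2 * k * r)) powr (\<gamma> * (1 / ps i + lam i)))) \<longrightarrow>
     enn_Lp_norm q1 lborel (\<lambda>x. abs_commutator I b f x * indicator (ellipsoid \<rho> x0 r) x) \<le>
       ennreal C0 * (\<Sum>j. ennreal ((\<Prod>i\<in>I. N i) * (1 + real j) ^ card I * r powr (\<gamma> / q1) *
         (2 ^ j * (2 * k * r)) powr (\<gamma> * ((\<Sum>i\<in>I. lam i) + (\<Sum>i\<in>I. 1 / ps i) - 1 / q1)) * (2 ^ j) powr (\<gamma> * \<theta>)) *
         enn_Lp_norm p lborel (\<lambda>y. ennreal (f y) * indicator (ellipsoid \<rho> x0 (2 ^ j * (2 * k * r))) y))"
    by (rule exE[OF abs_commutator_estimate[of I ps lam p q q1 \<theta>, OF I _ _ p q q1 \<theta>]],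
        erule ps, erule lam, erule conjE, rule that)
  \<comment> \<open>Of the factor 4, one 2 comes from \<open>Campanato_growth\<close> and the other
    from 2 + j \<le> 2 (1 + j), as the shell j is step j + 1 of the chain of radii.\<close>
  define D where "D i = 4 * (2 * k) powr (\<gamma> / ps i) * \<upsilon> powr (1 / ps i + lam i)" for i
  have D: "0 < D i" for i using k_ge_1 upsilon_pos by (simp add: D_def)
  define d where "d = \<gamma> * ((\<Sum>i\<in>I. lam i) + (\<Sum>i\<in>I. 1 / ps i) - 1 / q1) + \<gamma> * \<theta>"
  have d: "1 - d = \<gamma> * (1 / q1 - (\<theta> + (\<Sum>i\<in>I. lam i) + (\<Sum>i\<in>I. 1 / ps i))) + 1"
    by (simp add: d_def algebra_simps)
  define C where "C = C0 * (\<Prod>i\<in>I. D i) * (2 * k) powr (- (\<gamma> * \<theta>)) * (2 ^ card I * 2 powr \<bar>d - 1\<bar> * \<upsilon> powr (1 / p)) * Cw * \<upsilon> powr (- (1 / q1))"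
  have C: "0 < C" unfolding C_def using C0 D Cw k_ge_1 upsilon_pos by (intro mult_pos_pos prod_pos) auto
  show ?thesis
  proof (intro exI[of _ C] conjI allI impI C)
    fix b :: "nat \<Rightarrow> real^'n \<Rightarrow> real" and f :: "real^'n \<Rightarrow> real" and c :: "nat \<Rightarrow> real \<Rightarrow> real" and N :: "nat \<Rightarrow> real" and L r :: real
    assume b: "\<forall>i\<in>I. b i \<in> borel_measurable borel" and f[measurable]: "f \<in> borel_measurable borel" and f0: "\<forall>y. 0 \<le> f y"
      and N: "\<forall>i\<in>I. 0 \<le> N i" and L: "0 \<le> L"
      and bN: "\<forall>i\<in>I. \<forall>t>0. enn_Lp_norm (ps i) lborel (\<lambda>y. ennreal \<bar>b i y - c i t\<bar> * indicator (ellipsoid \<rho> x0 t) y) \<le> ennreal (N i * (\<upsilon> * t powr \<gamma>) powr (1 / ps i + lam i))"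
      and fL: "\<forall>t>0. enn_Lp_norm p lborel (\<lambda>y. ennreal (f y) * indicator (ellipsoid \<rho> x0 t) y) \<le> ennreal (L * \<phi>1 t * (\<upsilon> * t powr \<gamma>) powr (1 / p))"
      and r: "0 < r"
    define R where "R n = (if n = 0 then r else 2 ^ (n - 1) * (2 * k * r))" for n :: nat
    have Rpos: "0 < R n" for n using r k_ge_1 by (simp add: R_def)
    have kr: "r \<le> 2 * k * r" using mult_right_mono[of 1 "2 * k" r] r k_ge_1 by simp
    have R1: "R n \<le> R (Suc n)" for n
      using kr r k_ge_1 by (cases n) (auto simp: R_def)
    have R2: "R (Suc n) \<le> 2 * k * R n" for n
    proof (cases n)
      case (Suc i)
      have "1 * (2 ^ Suc i * (2 * k * r)) \<le> k * (2 ^ Suc i * (2 * k * r))" using r k_ge_1 by (intro mult_right_mono) auto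
      then show ?thesis using Suc by (simp add: R_def mult_ac)
    qed (simp add: R_def)
    have growth: "enn_Lp_norm (ps i) lborel (\<lambda>y. ennreal \<bar>b i y - c i r\<bar> * indicator (ellipsoid \<rho> x0 (R n)) y)
       \<le> ennreal (2 * (2 * k) powr (\<gamma> / ps i) * N i * (1 + real n) * (\<upsilon> * R n powr \<gamma>) powr (1 / ps i + lam i))" if i: "i \<in> I" for i n
    proof -
      have "enn_Lp_norm (ps i) lborel (\<lambda>y. ennreal \<bar>b i y - c i (R 0)\<bar> * indicator (ellipsoid \<rho> x0 (R n)) y)
       \<le> ennreal (2 * (2 * k) powr (\<gamma> / ps i) * N i * (1 + real n) * (\<upsilon> * R n powr \<gamma>) powr (1 / ps i + lam i))"
        by (rule Campanato_growth) (use b bN N i ps[OF i] lam[OF i] Rpos R1 R2 in auto)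
      then show ?thesis by (simp add: R_def)
    qed
    have mass: "(\<upsilon> * t powr \<gamma>) powr a = \<upsilon> powr a * t powr (\<gamma> * a)" for t a
      using upsilon_pos by (simp add: powr_mult powr_powr)
    define t where "t j = 2 ^ j * (2 * k * r)" for j :: nat
    have tpos: "0 < t j" for j using r k_ge_1 by (simp add: t_def)
    have est1: "enn_Lp_norm (ps i) lborel (\<lambda>y. ennreal \<bar>b i y - c i r\<bar> * indicator (ellipsoid \<rho> x0 r) y) \<le> ennreal (N i * D i * r powr (\<gamma> * (1 / ps i + lam i)))" if i: "i \<in> I" for i
    proof -
      have "enn_Lp_norm (ps i) lborel (\<lambda>y. ennreal \<bar>b i y - c i r\<bar> * indicator (ellipsoid \<rho> x0 r) y)
         \<le> ennreal (2 * (2 * k) powr (\<gamma> / ps i) * N i * (\<upsilon> powr (1 / ps i + lam i) * r powr (\<gamma> * (1 / ps i + lam i))))"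
        using growth[OF i, of 0] by (simp add: R_def mass)
      also have "\<dots> \<le> ennreal (N i * D i * r powr (\<gamma> * (1 / ps i + lam i)))"
      proof (rule ennreal_leI)
        have "0 \<le> 2 * (2 * k) powr (\<gamma> / ps i) * N i * (\<upsilon> powr (1 / ps i + lam i) * r powr (\<gamma> * (1 / ps i + lam i)))"
          using N i by simp
        then show "2 * (2 * k) powr (\<gamma> / ps i) * N i * (\<upsilon> powr (1 / ps i + lam i) * r powr (\<gamma> * (1 / ps i + lam i))) \<le> N i * D i * r powr (\<gamma> * (1 / ps i + lam i))"
          by (simp add: D_def mult_ac)
      qed
      finally show ?thesis .
    qed
    have est2: "enn_Lp_norm (ps i) lborel (\<lambda>y. ennreal \<bar>b i y - c i r\<bar> * indicator (ellipsoid \<rho> x0 (t j)) y) \<le> ennreal (N i * D i * (1 + real j) * t j powr (\<gamma> * (1 / ps i + lam i)))" if i: "i \<in> I" for i j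
    proof -
      let ?X = "2 * (2 * k) powr (\<gamma> / ps i) * N i * (\<upsilon> powr (1 / ps i + lam i) * t j powr (\<gamma> * (1 / ps i + lam i)))"
      have "R (Suc j) = t j" by (simp add: R_def t_def)
      then have "enn_Lp_norm (ps i) lborel (\<lambda>y. ennreal \<bar>b i y - c i r\<bar> * indicator (ellipsoid \<rho> x0 (t j)) y) \<le> ennreal (?X * (2 + real j))"
        using growth[OF i, of "Suc j"] by (simp add: mass mult_ac)
      also have "\<dots> \<le> ennreal (?X * (2 * (1 + real j)))"
        using N i by (intro ennreal_leI mult_left_mono) auto
      also have "?X * (2 * (1 + real j)) = N i * D i * (1 + real j) * t j powr (\<gamma> * (1 / ps i + lam i))"
        by (simp add: D_def mult_ac)
      finally show ?thesis .
    qed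
    define F where "F j = enn_Lp_norm p lborel (\<lambda>y. ennreal (f y) * indicator (ellipsoid \<rho> x0 (t j)) y)" for j
    define PN where "PN = (\<Prod>i\<in>I. N i * D i)"
    have PN: "0 \<le> PN" "PN = (\<Prod>i\<in>I. N i) * (\<Prod>i\<in>I. D i)"
    proof -
      have "0 \<le> N i * D i" if "i \<in> I" for i using N D[of i] that by simp
      then show "0 \<le> PN" unfolding PN_def by (intro prod_nonneg) auto
    qed (simp add: PN_def prod.distrib)
    \<comment> \<open>Since (2^j)^(\<gamma>\<theta>) = (t_j / (2 k r))^(\<gamma>\<theta>), the
      exponent \<theta> moves into the power d of t_j, and the r^(-\<gamma>\<theta>) kept in Z
      cancels the r^(\<gamma>\<theta>) of the weight hypothesis.\<close>
    define Z where "Z = PN * r powr (\<gamma> / q1) * (2 * k) powr (- (\<gamma> * \<theta>)) * r powr (- (\<gamma> * \<theta>))"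
    have Z: "0 \<le> Z" using PN by (simp add: Z_def)
    have "enn_Lp_norm q1 lborel (\<lambda>x. abs_commutator I b f x * indicator (ellipsoid \<rho> x0 r) x) \<le>
       ennreal C0 * (\<Sum>j. ennreal ((\<Prod>i\<in>I. N i * D i) * (1 + real j) ^ card I * r powr (\<gamma> / q1) *
         (2 ^ j * (2 * k * r)) powr (\<gamma> * ((\<Sum>i\<in>I. lam i) + (\<Sum>i\<in>I. 1 / ps i) - 1 / q1)) * (2 ^ j) powr (\<gamma> * \<theta>)) *
         enn_Lp_norm p lborel (\<lambda>y. ennreal (f y) * indicator (ellipsoid \<rho> x0 (2 ^ j * (2 * k * r))) y))"
    proof (rule est[rule_format, where c="\<lambda>i. c i r"])
      show "0 \<le> N i * D i" if "i \<in> I" for i using N D[of i] that by simp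
    qed (use b f0 r est1 est2 in \<open>auto simp: t_def\<close>)
    also have "\<dots> = ennreal C0 * (\<Sum>j. ennreal Z * (ennreal ((1 + real j) ^ card I * t j powr d) * F j))"
    proof (intro arg_cong[where f="\<lambda>x. ennreal C0 * x"] arg_cong[where f=suminf] ext)
      fix j :: nat
      let ?e = "\<gamma> * \<theta>"
      have "t j powr ?e * ((2 * k) powr (- ?e) * r powr (- ?e)) = (2 ^ j) powr ?e * (((2 * k) powr ?e * (2 * k) powr (- ?e)) * (r powr ?e * r powr (- ?e)))"
        using r k_ge_1 by (simp add: t_def powr_mult)
      moreover have "(2 * k) powr ?e * (2 * k) powr (- ?e) = 1" "r powr ?e * r powr (- ?e) = 1"
        using r k_ge_1 by (simp_all flip: powr_add)
      ultimately have "(2 ^ j :: real) powr ?e = t j powr ?e * ((2 * k) powr (- ?e) * r powr (- ?e))" by simp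
      then have e: "(\<Prod>i\<in>I. N i * D i) * (1 + real j) ^ card I * r powr (\<gamma> / q1) *
         t j powr (\<gamma> * ((\<Sum>i\<in>I. lam i) + (\<Sum>i\<in>I. 1 / ps i) - 1 / q1)) * (2 ^ j) powr (\<gamma> * \<theta>) = Z * ((1 + real j) ^ card I * t j powr d)"
        by (simp add: Z_def PN_def d_def powr_add mult_ac)
      have "ennreal (Z * ((1 + real j) ^ card I * t j powr d)) * F j = ennreal Z * (ennreal ((1 + real j) ^ card I * t j powr d) * F j)"
        by (subst ennreal_mult) (use Z in \<open>simp_all add: mult.assoc\<close>)
      then show "ennreal ((\<Prod>i\<in>I. N i * D i) * (1 + real j) ^ card I * r powr (\<gamma> / q1) *
         (2 ^ j * (2 * k * r)) powr (\<gamma> * ((\<Sum>i\<in>I. lam i) + (\<Sum>i\<in>I. 1 / ps i) - 1 / q1)) * (2 ^ j) powr (\<gamma> * \<theta>)) *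
         enn_Lp_norm p lborel (\<lambda>y. ennreal (f y) * indicator (ellipsoid \<rho> x0 (2 ^ j * (2 * k * r))) y) = ennreal Z * (ennreal ((1 + real j) ^ card I * t j powr d) * F j)"
        unfolding e[symmetric] by (simp only: t_def F_def)
    qed
    also have "\<dots> = ennreal C0 * (ennreal Z * (\<Sum>j. ennreal ((1 + real j) ^ card I * t j powr d) * F j))" by simp
    also have "(\<Sum>j. ennreal ((1 + real j) ^ card I * t j powr d) * F j) \<le> ennreal ((2 ^ card I * 2 powr \<bar>d - 1\<bar> * (L * \<upsilon> powr (1 / p))) * (Cw * \<phi>2 r * r powr (\<gamma> * \<theta>)))"
    \<comment> \<open>The comparison with the essential infimum divides by L.\<close>
    proof (cases "L = 0")
      case True
      have "F j = 0" for j
      proof -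
        have "F j \<le> ennreal (L * \<phi>1 (t j) * (\<upsilon> * t j powr \<gamma>) powr (1 / p))" unfolding F_def using fL tpos by blast
        then show ?thesis using True by simp
      qed
      then show ?thesis by simp
    next
      case False
      then have Lp: "0 < L * \<upsilon> powr (1 / p)" using L upsilon_pos by simp
      define W where "W t = ess_inf (lebesgue_on {t<..}) (\<lambda>\<tau>. ennreal (\<phi>1 \<tau> * \<tau> powr (\<gamma> / p)))" for t
      have FW: "F j \<le> ennreal (L * \<upsilon> powr (1 / p)) * W \<tau>0" if \<tau>0: "2 ^ j * (2 * k * r) \<le> \<tau>0" for j \<tau>0
      proof -
        define z where "z = ennreal (1 / (L * \<upsilon> powr (1 / p))) * F j"
        have inv: "ennreal (1 / (L * \<upsilon> powr (1 / p))) * ennreal (L * \<upsilon> powr (1 / p)) = 1" using Lp L upsilon_pos False by (simp flip: ennreal_mult)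
        \<comment> \<open>Local norms of f increase with the radius, so the norm on the j-th
          ellipsoid is bounded by the Morrey bound at every larger \<tau>, and therefore by the
          essential infimum of these bounds.\<close>
        have "z \<le> ennreal (\<phi>1 \<tau> * \<tau> powr (\<gamma> / p))" if \<tau>: "\<tau>0 < \<tau>" for \<tau>
        proof -
          have tt: "t j \<le> \<tau>" "0 < \<tau>" using \<tau> \<tau>0[folded t_def] tpos[of j] by linarith+
          have "F j \<le> enn_Lp_norm p lborel (\<lambda>y. ennreal (f y) * indicator (ellipsoid \<rho> x0 \<tau>) y)"
            unfolding F_def using tt p by (intro enn_Lp_norm_mono) (auto simp: indicator_def ellipsoid_def)
          also have "\<dots> \<le> ennreal (L * \<phi>1 \<tau> * (\<upsilon> * \<tau> powr \<gamma>) powr (1 / p))" using fL tt by blast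
          also have "L * \<phi>1 \<tau> * (\<upsilon> * \<tau> powr \<gamma>) powr (1 / p) = (L * \<upsilon> powr (1 / p)) * (\<phi>1 \<tau> * \<tau> powr (\<gamma> / p))"
            by (simp add: mass mult_ac)
          also have "ennreal ((L * \<upsilon> powr (1 / p)) * (\<phi>1 \<tau> * \<tau> powr (\<gamma> / p))) = ennreal (L * \<upsilon> powr (1 / p)) * ennreal (\<phi>1 \<tau> * \<tau> powr (\<gamma> / p))"
            using Lp \<phi>1[OF tt(2)] by (intro ennreal_mult) auto
          finally have "z \<le> ennreal (1 / (L * \<upsilon> powr (1 / p))) * (ennreal (L * \<upsilon> powr (1 / p)) * ennreal (\<phi>1 \<tau> * \<tau> powr (\<gamma> / p)))"
            unfolding z_def by (rule mult_left_mono) simp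
          then show ?thesis using inv by (simp add: mult.assoc[symmetric])
        qed
        then have "AE \<tau> in lebesgue_on {\<tau>0<..}. z \<le> ennreal (\<phi>1 \<tau> * \<tau> powr (\<gamma> / p))"
          by (intro AE_I2) (simp add: space_restrict_space)
        then have "z \<le> W \<tau>0" unfolding W_def ess_inf_def by (intro Sup_upper) simp
        then have "ennreal (L * \<upsilon> powr (1 / p)) * z \<le> ennreal (L * \<upsilon> powr (1 / p)) * W \<tau>0" by (rule mult_left_mono) simp
        moreover have "ennreal (L * \<upsilon> powr (1 / p)) * z = (ennreal (1 / (L * \<upsilon> powr (1 / p))) * ennreal (L * \<upsilon> powr (1 / p))) * F j"
          unfolding z_def by (simp only: mult_ac)
        moreover have "\<dots> = F j" unfolding inv by simp
        ultimately show ?thesis by simp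
      qed
      have "(\<Sum>j. ennreal ((1 + real j) ^ card I * t j powr d) * F j)
        \<le> ennreal (2 ^ card I * 2 powr \<bar>d - 1\<bar> * (L * \<upsilon> powr (1 / p))) *
          (\<integral>\<^sup>+t\<in>{r<..}. ennreal ((1 + ln (t / r)) ^ card I) * (W t / ennreal (t powr (1 - d))) \<partial>lebesgue)"
        unfolding t_def using r k_ge_1 Lp FW by (intro sum_le_weight_integral) auto
      also have "\<dots> \<le> ennreal (2 ^ card I * 2 powr \<bar>d - 1\<bar> * (L * \<upsilon> powr (1 / p))) * ennreal (Cw * \<phi>2 r * r powr (\<gamma> * \<theta>))"
        unfolding W_def d by (intro mult_left_mono weight r) simp
      also have "\<dots> = ennreal ((2 ^ card I * 2 powr \<bar>d - 1\<bar> * (L * \<upsilon> powr (1 / p))) * (Cw * \<phi>2 r * r powr (\<gamma> * \<theta>)))"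
        using Lp Cw \<phi>2[OF r] by (intro ennreal_mult[symmetric]) auto
      finally show ?thesis .
    qed
    also have "ennreal C0 * (ennreal Z * ennreal ((2 ^ card I * 2 powr \<bar>d - 1\<bar> * (L * \<upsilon> powr (1 / p))) * (Cw * \<phi>2 r * r powr (\<gamma> * \<theta>))))
      = ennreal (C0 * (Z * ((2 ^ card I * 2 powr \<bar>d - 1\<bar> * (L * \<upsilon> powr (1 / p))) * (Cw * \<phi>2 r * r powr (\<gamma> * \<theta>)))))"
      using C0 Z Cw L \<phi>2[OF r] by (simp add: ennreal_mult)
    also have "C0 * (Z * ((2 ^ card I * 2 powr \<bar>d - 1\<bar> * (L * \<upsilon> powr (1 / p))) * (Cw * \<phi>2 r * r powr (\<gamma> * \<theta>))))
      = C * (\<Prod>i\<in>I. N i) * L * \<phi>2 r * (\<upsilon> * r powr \<gamma>) powr (1 / q1)"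
    proof -
      have 1: "r powr (- (\<gamma> * \<theta>)) * r powr (\<gamma> * \<theta>) = 1" "\<upsilon> powr (- (1 / q1)) * \<upsilon> powr (1 / q1) = 1"
        using r upsilon_pos by (simp_all flip: powr_add)
      have e1: "C0 * (Z * ((2 ^ card I * 2 powr \<bar>d - 1\<bar> * (L * \<upsilon> powr (1 / p))) * (Cw * \<phi>2 r * r powr (\<gamma> * \<theta>))))
        = (C0 * (\<Prod>i\<in>I. D i) * (2 * k) powr (- (\<gamma> * \<theta>)) * (2 ^ card I * 2 powr \<bar>d - 1\<bar> * \<upsilon> powr (1 / p)) * Cw) * (\<Prod>i\<in>I. N i) * L * \<phi>2 r * r powr (\<gamma> / q1) *
          (r powr (- (\<gamma> * \<theta>)) * r powr (\<gamma> * \<theta>))"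
        by (simp only: Z_def PN(2) mult_ac)
      have e2: "C * (\<Prod>i\<in>I. N i) * L * \<phi>2 r * (\<upsilon> * r powr \<gamma>) powr (1 / q1)
        = (C0 * (\<Prod>i\<in>I. D i) * (2 * k) powr (- (\<gamma> * \<theta>)) * (2 ^ card I * 2 powr \<bar>d - 1\<bar> * \<upsilon> powr (1 / p)) * Cw) * (\<Prod>i\<in>I. N i) * L * \<phi>2 r * r powr (\<gamma> / q1) *
          (\<upsilon> powr (- (1 / q1)) * \<upsilon> powr (1 / q1))"
        unfolding mass by (simp add: C_def mult_ac)
      show ?thesis unfolding e1 e2 1 ..
    qed
    finally show "enn_Lp_norm q1 lborel (\<lambda>x. abs_commutator I b f x * indicator (ellipsoid \<rho> x0 r) x)
        \<le> ennreal (C * (\<Prod>i\<in>I. N i) * L * \<phi>2 r * (\<upsilon> * r powr \<gamma>) powr (1 / q1))"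
      by (simp add: mult_left_mono)
  qed
qed

end

section \<open>Local Morrey spaces\<close>

lemma AE_lborel_diff:
  assumes "AE z in lborel. Q (z :: 'a::euclidean_space)"
  shows "AE y in lborel. Q (x - y)"
proof -
  obtain N where N: "{z \<in> space lborel. \<not> Q z} \<subseteq> N" "emeasure lborel N = 0" "N \<in> sets lborel"
    using AE_E[OF assms] by blast
  then have [measurable]: "N \<in> sets borel" by simp
  have "(\<integral>\<^sup>+y. indicator N (x - y) \<partial>lborel) = 0"
    using N by (subst nn_integral_lborel_diff(2)) auto
  then have "AE y in lborel. indicator N (x - y) = (0::ennreal)"
    by (subst (asm) nn_integral_0_iff_AE) measurable
  then show ?thesis
    by eventually_elim (use N(1) in \<open>auto simp: indicator_def split: if_splits\<close>)
qed

text \<open>Links the norms of the statement, taken over \<open>lebesgue\<close>, with those of the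
  estimates, taken of a Borel version f0.\<close>

lemma Lp_norm_on_eq:
  assumes ae: "AE x in lborel. f x = f0 x" and p: "0 < p"
  shows "Lp_norm_on p A f = enn_Lp_norm p lborel (\<lambda>x. ennreal \<bar>f0 x\<bar> * indicator A x)"
proof -
  have "(\<integral>\<^sup>+x. ennreal (\<bar>f x\<bar> powr p) * indicator A x \<partial>lborel) = (\<integral>\<^sup>+x. ennreal_powr (ennreal \<bar>f0 x\<bar> * indicator A x) p \<partial>lborel)"
  proof (intro nn_integral_cong_AE)
    show "AE x in lborel. ennreal (\<bar>f x\<bar> powr p) * indicator A x = ennreal_powr (ennreal \<bar>f0 x\<bar> * indicator A x) p"
      using ae by eventually_elim (auto simp: indicator_def ennreal_powr_ennreal)
  qed
  then show ?thesis by (simp add: Lp_norm_on_def enn_Lp_norm_def nn_integral_completion)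
qed

text \<open>Each \<open>{y. R y < t}\<close> is the increasing union of the sets \<open>{y. R y < t'}\<close> with rational \<open>t' < t\<close>, and \<open>w\<close> decreases.\<close>

lemma SUP_rational:
  fixes R :: "'a \<Rightarrow> real" and w :: "real \<Rightarrow> ennreal"
  assumes [measurable]: "R \<in> borel_measurable M" "F \<in> borel_measurable M"
    and w: "\<And>s t. 0 < s \<Longrightarrow> s \<le> t \<Longrightarrow> w t \<le> w s"
  shows "(SUP t\<in>{0<..}. w t * (\<integral>\<^sup>+y. F y * indicator {y. R y < t} y \<partial>M)) = (SUP t\<in>{0<..} \<inter> \<rat>. w t * (\<integral>\<^sup>+y. F y * indicator {y. R y < t} y \<partial>M))"
    (is "?L = ?R")
proof (rule antisym)
  show "?R \<le> ?L" by (rule SUP_subset_mono) auto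
  show "?L \<le> ?R"
  proof (rule SUP_least)
    fix t :: real assume "t \<in> {0<..}"
    then have t: "0 < t" by simp
    have "\<exists>q\<in>\<rat>. max 0 (t - 1 / real (Suc n)) < q \<and> q < t" for n
      using t by (intro Rats_dense_in_real) simp
    then obtain q where q: "\<And>n. q n \<in> \<rat>" "\<And>n. max 0 (t - 1 / real (Suc n)) < q n" "\<And>n. q n < t" by metis
    have "w t * (\<integral>\<^sup>+y. F y * indicator {y. R y < t} y \<partial>M) = (\<integral>\<^sup>+y. w t * (F y * indicator {y. R y < t} y) \<partial>M)"
      by (rule nn_integral_cmult[symmetric]) measurable
    also have "\<dots> \<le> (\<integral>\<^sup>+y. liminf (\<lambda>n. w t * (F y * indicator {y. R y < q n} y)) \<partial>M)"
    proof (intro nn_integral_mono)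
      fix y
      show "w t * (F y * indicator {y. R y < t} y) \<le> liminf (\<lambda>n. w t * (F y * indicator {y. R y < q n} y))"
      proof (cases "R y < t")
        case True
        then obtain n0 where n0: "1 / real (Suc n0) < t - R y" using nat_approx_posE[of "t - R y"] by auto
        have "R y < q n" if "n0 \<le> n" for n
        proof -
          have "1 / real (Suc n) \<le> 1 / real (Suc n0)" using that by (intro divide_left_mono) auto
          then show ?thesis using n0 q(2)[of n] by linarith
        qed
        then have "eventually (\<lambda>n. w t * (F y * indicator {y. R y < t} y) \<le> w t * (F y * indicator {y. R y < q n} y)) sequentially"
          unfolding eventually_sequentially using True by (intro exI[of _ n0]) simp
        then show ?thesis by (rule Liminf_bounded)
      qed simp
    qed
    also have "\<dots> \<le> liminf (\<lambda>n. \<integral>\<^sup>+y. w t * (F y * indicator {y. R y < q n} y) \<partial>M)"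
      by (rule nn_integral_liminf) measurable
    also have "\<dots> \<le> ?R"
    proof (rule Liminf_le)
      show "eventually (\<lambda>n. (\<integral>\<^sup>+y. w t * (F y * indicator {y. R y < q n} y) \<partial>M) \<le> ?R) sequentially"
      proof (intro always_eventually allI)
        fix n
        have qn: "0 < q n" "q n \<le> t" using q(2)[of n] q(3)[of n] by simp_all
        have "(\<integral>\<^sup>+y. w t * (F y * indicator {y. R y < q n} y) \<partial>M) = w t * (\<integral>\<^sup>+y. F y * indicator {y. R y < q n} y \<partial>M)"
          by (rule nn_integral_cmult) measurable
        also have "\<dots> \<le> w (q n) * (\<integral>\<^sup>+y. F y * indicator {y. R y < q n} y \<partial>M)"
          using qn by (intro mult_right_mono w) auto
        also have "\<dots> \<le> ?R" using qn q(1) by (intro SUP_upper) auto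
        finally show "(\<integral>\<^sup>+y. w t * (F y * indicator {y. R y < q n} y) \<partial>M) \<le> ?R" .
      qed
    qed simp
    finally show "w t * (\<integral>\<^sup>+y. F y * indicator {y. R y < t} y \<partial>M) \<le> ?R" .
  qed
qed

context rough_fractional
begin

lemma measure_ellipsoid: "0 < t \<Longrightarrow> measure lebesgue (ellipsoid \<rho> x t) = \<upsilon> * t powr \<gamma>"
  using emeasure_ellipsoid[of t x] upsilon_pos by (simp add: measure_def)

text \<open>One radius of the supremum, rewritten; the exponent arises as (1 + l p) / p = 1 / p + l.
  The average is that of b, the deviation that of its Borel version.\<close>

lemma LC_estimate:
  assumes b: "b \<in> LC \<rho> x0 p l" and ae: "AE x in lborel. b x = b0 x" and p: "1 < p" and t: "0 < t"
  shows "enn_Lp_norm p lborel (\<lambda>y. ennreal \<bar>b0 y - average (ellipsoid \<rho> x0 t) b\<bar> * indicator (ellipsoid \<rho> x0 t) y)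
    \<le> ennreal (enn2real (LC_norm \<rho> x0 p l b) * (\<upsilon> * t powr \<gamma>) powr (1 / p + l))"
proof -
  let ?E = "ellipsoid \<rho> x0 t" and ?m = "\<upsilon> * t powr \<gamma>"
  define c where "c = average ?E b"
  define J where "J = enn_Lp_norm p lborel (\<lambda>y. ennreal \<bar>b0 y - c\<bar> * indicator ?E y)"
  have m: "0 < ?m" using upsilon_pos t by simp
  have fin: "LC_norm \<rho> x0 p l b < \<infinity>" using b by (simp add: LC_def)
  have ae': "AE y in lborel. b y - c = b0 y - c" using ae by eventually_elim simp
  have J: "ennreal_powr (\<integral>\<^sup>+y\<in>?E. ennreal (\<bar>b y - c\<bar> powr p) \<partial>lebesgue) (1 / p) = J"
    using Lp_norm_on_eq[OF ae', of p ?E] p by (simp add: Lp_norm_on_def J_def)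
  have "ennreal (1 / ?m powr (1 / p + l)) * J = ennreal_powr (ennreal (1 / ?m powr (1 + l * p)) * (\<integral>\<^sup>+y\<in>?E. ennreal (\<bar>b y - c\<bar> powr p) \<partial>lebesgue)) (1 / p)"
  proof -
    have "(1 + l * p) * (1 / p) = 1 / p + l" using p by (simp add: field_simps)
    then have "(1 / ?m powr (1 + l * p)) powr (1 / p) = 1 / ?m powr (1 / p + l)"
      using m by (simp add: powr_divide powr_powr)
    then show ?thesis by (simp add: ennreal_powr_mult J ennreal_powr_ennreal)
  qed
  also have "\<dots> \<le> LC_norm \<rho> x0 p l b"
    unfolding LC_norm_def c_def measure_ellipsoid[OF t, of x0, symmetric] using t
    by (intro SUP_upper2[of t]) auto
  also have "\<dots> = ennreal (enn2real (LC_norm \<rho> x0 p l b))" using fin by simp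
  finally have le: "ennreal (1 / ?m powr (1 / p + l)) * J \<le> ennreal (enn2real (LC_norm \<rho> x0 p l b))" .
  have "J = ennreal (?m powr (1 / p + l)) * (ennreal (1 / ?m powr (1 / p + l)) * J)"
    using m t upsilon_pos by (simp add: mult.assoc[symmetric] flip: ennreal_mult)
  also have "\<dots> \<le> ennreal (?m powr (1 / p + l)) * ennreal (enn2real (LC_norm \<rho> x0 p l b))"
    by (intro mult_left_mono le) simp
  also have "\<dots> = ennreal (enn2real (LC_norm \<rho> x0 p l b) * ?m powr (1 / p + l))"
    by (simp add: ennreal_mult mult.commute)
  finally show ?thesis by (simp add: J_def c_def)
qed

lemma LM_estimate:
  assumes f: "f \<in> LM \<rho> x0 p \<phi>" and ae: "AE x in lborel. f x = f0 x" and p: "1 < p" and t: "0 < t" and \<phi>: "0 < \<phi> x0 t"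
  shows "enn_Lp_norm p lborel (\<lambda>y. ennreal \<bar>f0 y\<bar> * indicator (ellipsoid \<rho> x0 t) y)
    \<le> ennreal (enn2real (LM_norm \<rho> x0 p \<phi> f) * \<phi> x0 t * (\<upsilon> * t powr \<gamma>) powr (1 / p))"
proof -
  let ?m = "\<upsilon> * t powr \<gamma>"
  define J where "J = enn_Lp_norm p lborel (\<lambda>y. ennreal \<bar>f0 y\<bar> * indicator (ellipsoid \<rho> x0 t) y)"
  have m: "0 < ?m" using upsilon_pos t by simp
  have fin: "LM_norm \<rho> x0 p \<phi> f < \<infinity>" using f by (simp add: LM_def)
  let ?w = "inverse (\<phi> x0 t) * ?m powr (- 1 / p)"
  have "ennreal ?w * J \<le> LM_norm \<rho> x0 p \<phi> f"
    unfolding LM_norm_def J_def measure_ellipsoid[OF t, of x0, symmetric] using t p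
    by (intro SUP_upper2[of t]) (auto simp: Lp_norm_on_eq[OF ae])
  also have "\<dots> = ennreal (enn2real (LM_norm \<rho> x0 p \<phi> f))" using fin by simp
  finally have le: "ennreal ?w * J \<le> ennreal (enn2real (LM_norm \<rho> x0 p \<phi> f))" .
  have "(\<phi> x0 t * ?m powr (1 / p)) * ?w = (\<phi> x0 t * inverse (\<phi> x0 t)) * (?m powr (1 / p) * ?m powr (- 1 / p))"
    by (simp only: mult_ac)
  also have "?m powr (1 / p) * ?m powr (- 1 / p) = 1" using upsilon_pos t by (simp add: powr_add[symmetric])
  finally have w: "(\<phi> x0 t * ?m powr (1 / p)) * ?w = 1" using \<phi> by simp
  have "ennreal (\<phi> x0 t * ?m powr (1 / p)) * ennreal ?w = ennreal ((\<phi> x0 t * ?m powr (1 / p)) * ?w)"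
    using \<phi> by (intro ennreal_mult[symmetric]) auto
  then have "J = ennreal (\<phi> x0 t * ?m powr (1 / p)) * (ennreal ?w * J)"
    unfolding w by (simp add: mult.assoc[symmetric])
  also have "\<dots> \<le> ennreal (\<phi> x0 t * ?m powr (1 / p)) * ennreal (enn2real (LM_norm \<rho> x0 p \<phi> f))"
    by (intro mult_left_mono le) simp
  also have "\<dots> = ennreal (\<phi> x0 t * ?m powr (1 / p) * enn2real (LM_norm \<rho> x0 p \<phi> f))"
    using \<phi> by (intro ennreal_mult[symmetric]) auto
  also have "\<phi> x0 t * ?m powr (1 / p) * enn2real (LM_norm \<rho> x0 p \<phi> f) = enn2real (LM_norm \<rho> x0 p \<phi> f) * \<phi> x0 t * ?m powr (1 / p)"
    by (simp only: mult_ac)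
  finally show ?thesis by (simp add: J_def)
qed

text \<open>The dominating g carries the estimates, while h is only measurable and below g. Local
  integrability of the q-th power holds since a compact set lies in some ellipsoid about x0, \<rho>
  being bounded on balls.\<close>

lemma LM_norm_leI:
  assumes h: "h \<in> borel_measurable lebesgue" and hg: "AE x in lborel. ennreal \<bar>h x\<bar> \<le> g x" and q: "1 < q" and B: "0 \<le> B"
    and \<phi>: "\<And>r. 0 < r \<Longrightarrow> 0 < \<phi> x0 r"
    and g: "\<And>r. 0 < r \<Longrightarrow> enn_Lp_norm q lborel (\<lambda>x. g x * indicator (ellipsoid \<rho> x0 r) x) \<le> ennreal (B * \<phi> x0 r * (\<upsilon> * r powr \<gamma>) powr (1 / q))"
  shows "h \<in> LM \<rho> x0 q \<phi>" and "LM_norm \<rho> x0 q \<phi> h \<le> ennreal B"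
proof -
  have norm_le: "Lp_norm_on q (ellipsoid \<rho> x0 r) h \<le> ennreal (B * \<phi> x0 r * (\<upsilon> * r powr \<gamma>) powr (1 / q))" if r: "0 < r" for r
  proof -
    have "Lp_norm_on q (ellipsoid \<rho> x0 r) h = enn_Lp_norm q lborel (\<lambda>x. ennreal \<bar>h x\<bar> * indicator (ellipsoid \<rho> x0 r) x)"
      using q by (intro Lp_norm_on_eq) auto
    also have "\<dots> \<le> enn_Lp_norm q lborel (\<lambda>x. g x * indicator (ellipsoid \<rho> x0 r) x)"
      using hg q by (intro enn_Lp_norm_mono_AE) (auto elim!: eventually_mono simp: indicator_def)
    finally show ?thesis using g[OF r] by simp
  qed
  show N: "LM_norm \<rho> x0 q \<phi> h \<le> ennreal B"
    unfolding LM_norm_def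
  proof (rule SUP_least)
    fix r :: real assume "r \<in> {0<..}"
    then have r: "0 < r" by simp
    let ?m = "\<upsilon> * r powr \<gamma>"
    have m: "0 < ?m" using upsilon_pos r by simp
    have "ennreal (inverse (\<phi> x0 r) * measure lebesgue (ellipsoid \<rho> x0 r) powr (- 1 / q)) * Lp_norm_on q (ellipsoid \<rho> x0 r) h
      \<le> ennreal (inverse (\<phi> x0 r) * ?m powr (- 1 / q)) * ennreal (B * \<phi> x0 r * ?m powr (1 / q))"
      unfolding measure_ellipsoid[OF r] by (intro mult_left_mono norm_le r) simp
    also have "\<dots> = ennreal ((inverse (\<phi> x0 r) * ?m powr (- 1 / q)) * (B * \<phi> x0 r * ?m powr (1 / q)))"
      using \<phi>[OF r] B by (intro ennreal_mult[symmetric]) auto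
    also have "(inverse (\<phi> x0 r) * ?m powr (- 1 / q)) * (B * \<phi> x0 r * ?m powr (1 / q)) = B * (inverse (\<phi> x0 r) * \<phi> x0 r) * (?m powr (- 1 / q) * ?m powr (1 / q))"
      by (simp only: mult_ac)
    also have "?m powr (- 1 / q) * ?m powr (1 / q) = 1" using upsilon_pos r by (simp add: powr_add[symmetric])
    also have "inverse (\<phi> x0 r) * \<phi> x0 r = 1" using \<phi>[OF r] by simp
    finally show "ennreal (inverse (\<phi> x0 r) * measure lebesgue (ellipsoid \<rho> x0 r) powr (- 1 / q)) * Lp_norm_on q (ellipsoid \<rho> x0 r) h \<le> ennreal B"
      by simp
  qed
  have "h \<in> Lp_loc q"
    unfolding Lp_loc_def
  proof (intro CollectI conjI allI impI h)
    fix Q :: "(real^'n) set" assume "compact Q"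
    then obtain M where M: "\<And>x. x \<in> Q \<Longrightarrow> norm x \<le> M" using compact_imp_bounded bounded_iff by metis
    obtain B' where B': "\<And>x. norm x \<le> norm x0 + M \<Longrightarrow> \<rho> x \<le> B'" using bounded_on_balls by blast
    define r where "r = max B' 0 + 1"
    have r: "0 < r" by (simp add: r_def)
    have "Q \<subseteq> ellipsoid \<rho> x0 r"
    proof
      fix x assume "x \<in> Q"
      then have "norm (x0 - x) \<le> norm x0 + M" using M[of x] norm_triangle_ineq4[of x0 x] by linarith
      then show "x \<in> ellipsoid \<rho> x0 r" using B'[of "x0 - x"] by (simp add: ellipsoid_def r_def)
    qed
    then have "(\<integral>\<^sup>+x\<in>Q. ennreal (\<bar>h x\<bar> powr q) \<partial>lebesgue) \<le> (\<integral>\<^sup>+x\<in>ellipsoid \<rho> x0 r. ennreal (\<bar>h x\<bar> powr q) \<partial>lebesgue)"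
      by (intro nn_integral_mono) (auto simp: indicator_def)
    also have "\<dots> < \<infinity>"
    proof -
      have "Lp_norm_on q (ellipsoid \<rho> x0 r) h < \<infinity>" using norm_le[OF r] by (rule le_less_trans) simp
      then show ?thesis by (simp add: Lp_norm_on_def less_top[symmetric])
    qed
    finally show "(\<integral>\<^sup>+x\<in>Q. ennreal (\<bar>h x\<bar> powr q) \<partial>lebesgue) < \<infinity>" .
  qed
  then show "h \<in> LM \<rho> x0 q \<phi>"
    using N by (simp add: LM_def) (meson ennreal_less_top le_less_trans)
qed

text \<open>The ellipsoids of integer radius about x0 exhaust the space, and on each a finite norm
  forces finite values almost everywhere.\<close>

lemma AE_finite_of_local_norm:
  assumes [measurable]: "g \<in> borel_measurable borel" and q: "0 < q"
    and fin: "\<And>r. 0 < r \<Longrightarrow> enn_Lp_norm q lborel (\<lambda>x. g x * indicator (ellipsoid \<rho> x0 r) x) < top"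
  shows "AE x in lborel. g x < top"
proof -
  have "AE x in lborel. x \<in> ellipsoid \<rho> x0 (real (Suc n)) \<longrightarrow> g x < top" for n
  proof -
    have "(\<integral>\<^sup>+x. ennreal_powr (g x * indicator (ellipsoid \<rho> x0 (real (Suc n))) x) q \<partial>lborel) \<noteq> top"
      using fin[of "real (Suc n)"] by (simp add: enn_Lp_norm_def less_top[symmetric])
    then have "AE x in lborel. ennreal_powr (g x * indicator (ellipsoid \<rho> x0 (real (Suc n))) x) q \<noteq> \<infinity>"
      by (intro nn_integral_PInf_AE) auto
    then show ?thesis by eventually_elim (auto simp: less_top indicator_def split: if_splits)
  qed
  then have "AE x in lborel. \<forall>n. x \<in> ellipsoid \<rho> x0 (real (Suc n)) \<longrightarrow> g x < top" by (subst AE_all_countable) (rule allI)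
  then show ?thesis
  proof eventually_elim
    case (elim x)
    obtain n where "\<rho> (x0 - x) < real n" using reals_Archimedean2 by blast
    then have "x \<in> ellipsoid \<rho> x0 (real (Suc n))" by (simp add: ellipsoid_def)
    then show ?case using elim by blast
  qed
qed

section \<open>The maximal operator\<close>

definition abs_maximal :: "nat set \<Rightarrow> (nat \<Rightarrow> real^'n \<Rightarrow> real) \<Rightarrow> (real^'n \<Rightarrow> real) \<Rightarrow> real^'n \<Rightarrow> ennreal" where
  "abs_maximal I b f x = (SUP t\<in>{0<..}. ennreal ((\<upsilon> * t powr \<gamma>) powr (- 1 + \<alpha> / \<gamma>)) *
     (\<integral>\<^sup>+y. ennreal ((\<Prod>i\<in>I. \<bar>b i x - b i y\<bar>) * \<Omega> (x - y) * f y) * indicator {y. \<rho> (x - y) < t} y \<partial>lborel))"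

text \<open>The supremum runs over uncountably many radii; \<open>SUP_rational\<close> makes it
  countable, as the weight decreases in t by \<alpha> < \<gamma>.\<close>

lemma measurable_abs_maximal:
  assumes [measurable]: "\<And>i. i \<in> I \<Longrightarrow> b i \<in> borel_measurable borel" "f \<in> borel_measurable borel"
  shows "abs_maximal I b f \<in> borel_measurable borel"
proof -
  have [measurable]: "(\<lambda>y. \<Prod>i\<in>I. \<bar>b i x - b i y\<bar>) \<in> borel_measurable borel" for x
    by (intro borel_measurable_prod) measurable
  have eq: "abs_maximal I b f x = (SUP t\<in>{0<..} \<inter> \<rat>. ennreal ((\<upsilon> * t powr \<gamma>) powr (- 1 + \<alpha> / \<gamma>)) *
     (\<integral>\<^sup>+y. ennreal ((\<Prod>i\<in>I. \<bar>b i x - b i y\<bar>) * \<Omega> (x - y) * f y) * indicator {y. \<rho> (x - y) < t} y \<partial>lborel))" for x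
    unfolding abs_maximal_def
  proof (rule SUP_rational)
    fix s t :: real assume "0 < s" "s \<le> t"
    then show "ennreal ((\<upsilon> * t powr \<gamma>) powr (- 1 + \<alpha> / \<gamma>)) \<le> ennreal ((\<upsilon> * s powr \<gamma>) powr (- 1 + \<alpha> / \<gamma>))"
      using upsilon_pos gamma_pos alpha by (intro ennreal_leI powr_mono2' mult_left_mono powr_mono2) (auto simp: field_simps)
  qed measurable
  have "(\<lambda>x. \<integral>\<^sup>+y. ennreal ((\<Prod>i\<in>I. \<bar>b i x - b i y\<bar>) * \<Omega> (x - y) * f y) * indicator {y. \<rho> (x - y) < t} y \<partial>lborel) \<in> borel_measurable borel" for t
  proof -
    have [measurable]: "(\<lambda>z. \<Prod>i\<in>I. \<bar>b i (fst z) - b i (snd z)\<bar>) \<in> borel_measurable (borel \<Otimes>\<^sub>M (borel :: (real^'n) measure))"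
      by (intro borel_measurable_prod) measurable
    have "(\<lambda>(x, y). ennreal ((\<Prod>i\<in>I. \<bar>b i x - b i y\<bar>) * \<Omega> (x - y) * f y) * indicator {y. \<rho> (x - y) < t} y) \<in> borel_measurable (borel \<Otimes>\<^sub>M lborel)"
      unfolding split_beta' by measurable
    then show ?thesis using lborel.borel_measurable_nn_integral by simp
  qed
  then show ?thesis unfolding eq[abs_def]
    by (intro borel_measurable_SUP countable_Int2 countable_rat borel_measurable_times_ennreal) auto
qed

text \<open>On {\<rho>(x - y) < t} the factor (\<upsilon> t^\<gamma>)^(-1+\<alpha>/\<gamma>) equals
  a constant times t^(\<alpha>-\<gamma>), hence is at most the same constant times \<rho>(x -
  y)^(\<alpha>-\<gamma>).\<close>

lemma abs_maximal_le:
  assumes [measurable]: "\<And>i. i \<in> I \<Longrightarrow> b i \<in> borel_measurable borel" "f \<in> borel_measurable borel" and f: "\<And>y. 0 \<le> f y"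
  shows "abs_maximal I b f x \<le> ennreal (\<upsilon> powr (- 1 + \<alpha> / \<gamma>)) * abs_commutator I b f x"
  unfolding abs_maximal_def
proof (rule SUP_least)
  fix t :: real assume "t \<in> {0<..}"
  then have t: "0 < t" by simp
  have [measurable]: "(\<lambda>y. \<Prod>i\<in>I. \<bar>b i x - b i y\<bar>) \<in> borel_measurable borel"
    by (intro borel_measurable_prod) measurable
  let ?c = "(\<upsilon> * t powr \<gamma>) powr (- 1 + \<alpha> / \<gamma>)"
  have c: "?c = \<upsilon> powr (- 1 + \<alpha> / \<gamma>) * t powr (\<alpha> - \<gamma>)"
  proof -
    have "\<gamma> * (- 1 + \<alpha> / \<gamma>) = \<alpha> - \<gamma>" using gamma_pos by (simp add: algebra_simps)
    then show ?thesis using upsilon_pos by (simp add: powr_mult powr_powr)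
  qed
  have "ennreal ?c * (\<integral>\<^sup>+y. ennreal ((\<Prod>i\<in>I. \<bar>b i x - b i y\<bar>) * \<Omega> (x - y) * f y) * indicator {y. \<rho> (x - y) < t} y \<partial>lborel)
    = (\<integral>\<^sup>+y. ennreal ?c * (ennreal ((\<Prod>i\<in>I. \<bar>b i x - b i y\<bar>) * \<Omega> (x - y) * f y) * indicator {y. \<rho> (x - y) < t} y) \<partial>lborel)"
    by (rule nn_integral_cmult[symmetric]) measurable
  also have "\<dots> \<le> (\<integral>\<^sup>+y. ennreal (\<upsilon> powr (- 1 + \<alpha> / \<gamma>)) * ennreal ((\<Prod>i\<in>I. \<bar>b i x - b i y\<bar>) * K (x - y) * f y) \<partial>lborel)"
  proof (intro nn_integral_mono_AE)
    \<comment> \<open>At y = x the kernel takes the default value 0, and the pointwise bound can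
      fail there.\<close>
    have "AE y in lborel. y \<noteq> x" by (rule AE_lborel_singleton)
    then show "AE y in lborel. ennreal ?c * (ennreal ((\<Prod>i\<in>I. \<bar>b i x - b i y\<bar>) * \<Omega> (x - y) * f y) * indicator {y. \<rho> (x - y) < t} y)
       \<le> ennreal (\<upsilon> powr (- 1 + \<alpha> / \<gamma>)) * ennreal ((\<Prod>i\<in>I. \<bar>b i x - b i y\<bar>) * K (x - y) * f y)"
    proof eventually_elim
      case (elim y)
      show ?case
      proof (cases "\<rho> (x - y) < t")
        case True
        have rp: "0 < \<rho> (x - y)" using elim by (intro rho_pos) auto
        have pf: "0 \<le> (\<Prod>i\<in>I. \<bar>b i x - b i y\<bar>)" by (intro prod_nonneg) auto
        have "t powr (\<alpha> - \<gamma>) \<le> \<rho> (x - y) powr (\<alpha> - \<gamma>)" using True rp alpha by (intro powr_mono2') auto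
        then have "t powr (\<alpha> - \<gamma>) * \<Omega> (x - y) \<le> \<rho> (x - y) powr (\<alpha> - \<gamma>) * \<Omega> (x - y)" using Omega_nonneg by (rule mult_right_mono)
        also have "\<dots> = K (x - y)" using powr_minus_divide[of "\<rho> (x - y)" "\<gamma> - \<alpha>"] by (simp add: K_def)
        finally have "(\<upsilon> powr (- 1 + \<alpha> / \<gamma>) * (\<Prod>i\<in>I. \<bar>b i x - b i y\<bar>) * f y) * (t powr (\<alpha> - \<gamma>) * \<Omega> (x - y)) \<le> (\<upsilon> powr (- 1 + \<alpha> / \<gamma>) * (\<Prod>i\<in>I. \<bar>b i x - b i y\<bar>) * f y) * K (x - y)"
          using f pf by (intro mult_left_mono) auto
        then have "?c * ((\<Prod>i\<in>I. \<bar>b i x - b i y\<bar>) * \<Omega> (x - y) * f y) \<le> \<upsilon> powr (- 1 + \<alpha> / \<gamma>) * ((\<Prod>i\<in>I. \<bar>b i x - b i y\<bar>) * K (x - y) * f y)"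
          unfolding c by (simp only: mult_ac)
        then have "ennreal (?c * ((\<Prod>i\<in>I. \<bar>b i x - b i y\<bar>) * \<Omega> (x - y) * f y)) \<le> ennreal (\<upsilon> powr (- 1 + \<alpha> / \<gamma>) * ((\<Prod>i\<in>I. \<bar>b i x - b i y\<bar>) * K (x - y) * f y))"
          by (rule ennreal_leI)
        moreover have "0 \<le> (\<Prod>i\<in>I. \<bar>b i x - b i y\<bar>) * \<Omega> (x - y) * f y" "0 \<le> (\<Prod>i\<in>I. \<bar>b i x - b i y\<bar>) * K (x - y) * f y"
          using pf f Omega_nonneg K_nonneg by (auto intro!: mult_nonneg_nonneg)
        ultimately show ?thesis using True by (simp add: ennreal_mult)
      qed simp
    qed
  qed
  also have "\<dots> = ennreal (\<upsilon> powr (- 1 + \<alpha> / \<gamma>)) * abs_commutator I b f x"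
    unfolding abs_commutator_def by (rule nn_integral_cmult) measurable
  finally show "ennreal ?c * (\<integral>\<^sup>+y. ennreal ((\<Prod>i\<in>I. \<bar>b i x - b i y\<bar>) * \<Omega> (x - y) * f y) * indicator {y. \<rho> (x - y) < t} y \<partial>lborel)
    \<le> ennreal (\<upsilon> powr (- 1 + \<alpha> / \<gamma>)) * abs_commutator I b f x" .
qed

end

section \<open>Passage to Borel versions of \<Omega>, b and f\<close>

lemma AE_borel_representatives:
  fixes b b0 :: "nat \<Rightarrow> 'a::euclidean_space \<Rightarrow> real" and \<Omega> \<Omega>0 f f0 :: "'a \<Rightarrow> real"
  assumes I: "finite I" and b: "\<And>i. i \<in> I \<Longrightarrow> AE x in lborel. b i x = b0 i x"
    and \<Omega>: "AE x in lborel. \<Omega> x = \<Omega>0 x" and f: "AE x in lborel. f x = f0 x"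
  shows "AE x in lborel. AE y in lborel. (\<forall>i\<in>I. b i x = b0 i x \<and> b i y = b0 i y) \<and> \<Omega> (x - y) = \<Omega>0 (x - y) \<and> f y = f0 y"
proof -
  have bb: "AE x in lborel. \<forall>i\<in>I. b i x = b0 i x"
    using I b by (intro AE_finite_allI)
  show ?thesis
    using bb
  proof eventually_elim
    case (elim x)
    show ?case
      using bb AE_lborel_diff[OF \<Omega>, of x] f by eventually_elim (use elim in auto)
  qed
qed

context rough_fractional
begin

context
  fixes P :: "real^'n^'n" and \<Omega>' \<Omega>1 f f1 :: "real^'n \<Rightarrow> real" and b b0 :: "nat \<Rightarrow> real^'n \<Rightarrow> real" and m :: nat
  assumes tr: "\<gamma> = trace P" and \<Omega>1[measurable]: "\<Omega>1 \<in> borel_measurable borel" and \<Omega>_abs: "\<Omega> = (\<lambda>x. \<bar>\<Omega>1 x\<bar>)"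
    and ae\<Omega>: "AE x in lborel. \<Omega>' x = \<Omega>1 x"
    and b0[measurable]: "\<And>i. i \<in> {1..m} \<Longrightarrow> b0 i \<in> borel_measurable borel" and aeb: "\<And>i. i \<in> {1..m} \<Longrightarrow> AE x in lborel. b i x = b0 i x"
    and f1[measurable]: "f1 \<in> borel_measurable borel" and aef: "AE x in lborel. f x = f1 x"
begin

text \<open>\<open>\<Omega>'\<close> is the given function, \<open>\<Omega>1\<close> a Borel version
  of it, and the \<Omega> of the locale is the absolute value of \<open>\<Omega>1\<close>. The signs
  are kept here because the commutator integrates a signed product.\<close>

abbreviation "borel_integrand x y \<equiv> (\<Prod>i\<in>{1..m}. b0 i x - b0 i y) * (\<Omega>1 (x - y) / \<rho> (x - y) powr (\<gamma> - \<alpha>)) * f1 y"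

lemma measurable_borel_integrand: "(\<lambda>(x, y). borel_integrand x y) \<in> borel_measurable (borel \<Otimes>\<^sub>M borel)"
proof -
  have [measurable]: "(\<lambda>z. \<Prod>i\<in>{1..m}. b0 i (fst z) - b0 i (snd z)) \<in> borel_measurable (borel \<Otimes>\<^sub>M (borel :: (real^'n) measure))"
    by (intro borel_measurable_prod) measurable
  show ?thesis unfolding split_beta' by measurable
qed

lemma K_eq: "K z = \<bar>\<Omega>1 z\<bar> / \<rho> z powr (\<gamma> - \<alpha>)"
  unfolding K_def by (simp add: \<Omega>_abs)

lemma nn_integral_borel_integrand: "(\<integral>\<^sup>+y. ennreal \<bar>borel_integrand x y\<bar> \<partial>lborel) = abs_commutator {1..m} b0 (\<lambda>y. \<bar>f1 y\<bar>) x"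
  unfolding abs_commutator_def by (intro nn_integral_cong) (simp add: K_eq abs_mult abs_prod)

text \<open>The exceptional sets are nested, almost every y for almost every x, which matches
  operators that integrate in y for fixed x.\<close>

lemma AE_representatives:
  "AE x in lborel. AE y in lborel. (\<forall>i\<in>{1..m}. b i x = b0 i x \<and> b i y = b0 i y) \<and> \<Omega>' (x - y) = \<Omega>1 (x - y) \<and> f y = f1 y"
  using aeb ae\<Omega> aef by (intro AE_borel_representatives) auto

lemma AE_commutator_integrand:
  "AE x in lborel. AE y in lborel. commutator_integrand P \<rho> \<Omega>' \<alpha> m b f x y = borel_integrand x y"
  using AE_representatives
proof eventually_elim
  case (elim x)
  then show ?case
  proof eventually_elim
    case (elim y)
    have "(\<Prod>i\<in>{1..m}. b i x - b i y) = (\<Prod>i\<in>{1..m}. b0 i x - b0 i y)" using elim by (intro prod.cong) auto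
    then show ?case using elim by (simp add: commutator_integrand_def kernel_def tr)
  qed
qed

text \<open>The first equation holds also where the integrand is not integrable, both sides then
  being the default value 0; measurability of the commutator rests on it. In the other two claims
  the dominating function at x is the integral of the absolute value of the integrand, so its
  finiteness is integrability.\<close>

lemma commutator_eq:
  assumes ae: "AE y in lborel. commutator_integrand P \<rho> \<Omega>' \<alpha> m b f x y = borel_integrand x y"
  shows "commutator P \<rho> \<Omega>' \<alpha> m b f x = (LINT y|lborel. borel_integrand x y)"
    and "abs_commutator {1..m} b0 (\<lambda>y. \<bar>f1 y\<bar>) x < \<infinity> \<Longrightarrow> integrable lebesgue (commutator_integrand P \<rho> \<Omega>' \<alpha> m b f x)"
    and "abs_commutator {1..m} b0 (\<lambda>y. \<bar>f1 y\<bar>) x < \<infinity> \<Longrightarrow> ennreal \<bar>commutator P \<rho> \<Omega>' \<alpha> m b f x\<bar> \<le> abs_commutator {1..m} b0 (\<lambda>y. \<bar>f1 y\<bar>) x"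
proof -
  let ?c = "commutator_integrand P \<rho> \<Omega>' \<alpha> m b f x"
  have [measurable]: "borel_integrand x \<in> borel_measurable borel"
    using measurable_Pair2[OF measurable_borel_integrand, of x] by simp
  have hl: "borel_integrand x \<in> borel_measurable lebesgue" by (rule measurable_completion) simp
  have c: "?c \<in> borel_measurable lebesgue" by (rule borel_measurable_lebesgue_AE[OF hl AE_completion[OF ae]])
  show eq: "commutator P \<rho> \<Omega>' \<alpha> m b f x = (LINT y|lborel. borel_integrand x y)"
  proof -
    have "commutator P \<rho> \<Omega>' \<alpha> m b f x = (LINT y|lebesgue. borel_integrand x y)"
      unfolding commutator_def by (rule integral_cong_AE[OF c hl AE_completion[OF ae]])
    also have "\<dots> = (LINT y|lborel. borel_integrand x y)" by (rule integral_completion) simp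
    finally show ?thesis .
  qed
  assume fin: "abs_commutator {1..m} b0 (\<lambda>y. \<bar>f1 y\<bar>) x < \<infinity>"
  have "(\<integral>\<^sup>+y. ennreal \<bar>?c y\<bar> \<partial>lborel) = (\<integral>\<^sup>+y. ennreal \<bar>borel_integrand x y\<bar> \<partial>lborel)"
    by (intro nn_integral_cong_AE) (use ae in \<open>auto elim!: eventually_mono\<close>)
  then have "(\<integral>\<^sup>+y. ennreal (norm (?c y)) \<partial>lebesgue) < \<infinity>"
    using fin unfolding nn_integral_completion real_norm_def nn_integral_borel_integrand by (simp only:)
  then show "integrable lebesgue ?c" by (rule integrableI_bounded[OF c])
  have "(\<integral>\<^sup>+y. ennreal (norm (borel_integrand x y)) \<partial>lborel) < \<infinity>"
    using fin unfolding real_norm_def nn_integral_borel_integrand .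
  then have "integrable lborel (borel_integrand x)" by (intro integrableI_bounded) simp_all
  from integral_norm_bound_ennreal[OF this] show "ennreal \<bar>commutator P \<rho> \<Omega>' \<alpha> m b f x\<bar> \<le> abs_commutator {1..m} b0 (\<lambda>y. \<bar>f1 y\<bar>) x"
    unfolding real_norm_def nn_integral_borel_integrand eq .
qed

lemma measurable_commutator: "commutator P \<rho> \<Omega>' \<alpha> m b f \<in> borel_measurable lebesgue"
proof (rule borel_measurable_lebesgue_AE)
  have "(\<lambda>(x, y). borel_integrand x y) \<in> borel_measurable (borel \<Otimes>\<^sub>M lborel)" using measurable_borel_integrand by simp
  then have "(\<lambda>x. LINT y|lborel. borel_integrand x y) \<in> borel_measurable borel"
    by (rule lborel.borel_measurable_lebesgue_integral)
  then show "(\<lambda>x. LINT y|lborel. borel_integrand x y) \<in> borel_measurable lebesgue" by (intro measurable_completion) simp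
  show "AE x in lebesgue. commutator P \<rho> \<Omega>' \<alpha> m b f x = (LINT y|lborel. borel_integrand x y)"
  proof (rule AE_completion)
    show "AE x in lborel. commutator P \<rho> \<Omega>' \<alpha> m b f x = (LINT y|lborel. borel_integrand x y)"
      using AE_commutator_integrand by eventually_elim (rule commutator_eq(1))
  qed
qed

text \<open>For fixed x the exceptional set of y does not depend on t, so no union over uncountably
  many radii arises and the suprema agree term by term.\<close>

lemma AE_maximal_commutator:
  "AE x in lborel. maximal_commutator P \<rho> \<Omega>' \<alpha> m b f x = abs_maximal {1..m} b0 (\<lambda>y. \<bar>f1 y\<bar>) x"
  using AE_representatives
proof eventually_elim
  case (elim x)
  show ?case
    unfolding maximal_commutator_def abs_maximal_def
  proof (rule SUP_cong[OF refl])
    fix t :: real assume "t \<in> {0<..}"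
    then have t: "0 < t" by simp
    have "(\<integral>\<^sup>+y. ennreal ((\<Prod>i\<in>{1..m}. \<bar>b i x - b i y\<bar>) * \<bar>\<Omega>' (x - y)\<bar> * \<bar>f y\<bar>) * indicator (ellipsoid \<rho> x t) y \<partial>lborel)
      = (\<integral>\<^sup>+y. ennreal ((\<Prod>i\<in>{1..m}. \<bar>b0 i x - b0 i y\<bar>) * \<Omega> (x - y) * \<bar>f1 y\<bar>) * indicator {y. \<rho> (x - y) < t} y \<partial>lborel)"
    proof (intro nn_integral_cong_AE)
      show "AE y in lborel. ennreal ((\<Prod>i\<in>{1..m}. \<bar>b i x - b i y\<bar>) * \<bar>\<Omega>' (x - y)\<bar> * \<bar>f y\<bar>) * indicator (ellipsoid \<rho> x t) y
        = ennreal ((\<Prod>i\<in>{1..m}. \<bar>b0 i x - b0 i y\<bar>) * \<Omega> (x - y) * \<bar>f1 y\<bar>) * indicator {y. \<rho> (x - y) < t} y"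
        using elim
      proof eventually_elim
        case (elim y)
        have "(\<Prod>i\<in>{1..m}. \<bar>b i x - b i y\<bar>) = (\<Prod>i\<in>{1..m}. \<bar>b0 i x - b0 i y\<bar>)" using elim by (intro prod.cong) auto
        then show ?case using elim by (simp add: \<Omega>_abs ellipsoid_def)
      qed
    qed
    then show "ennreal (measure lebesgue (ellipsoid \<rho> x t) powr (- 1 + \<alpha> / trace P)) *
        (\<integral>\<^sup>+y\<in>ellipsoid \<rho> x t. ennreal ((\<Prod>i\<in>{1..m}. \<bar>b i x - b i y\<bar>) * \<bar>\<Omega>' (x - y)\<bar> * \<bar>f y\<bar>) \<partial>lebesgue)
      = ennreal ((\<upsilon> * t powr \<gamma>) powr (- 1 + \<alpha> / \<gamma>)) *
        (\<integral>\<^sup>+y. ennreal ((\<Prod>i\<in>{1..m}. \<bar>b0 i x - b0 i y\<bar>) * \<Omega> (x - y) * \<bar>f1 y\<bar>) * indicator {y. \<rho> (x - y) < t} y \<partial>lborel)"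
      by (simp only: measure_ellipsoid[OF t] nn_integral_completion tr[symmetric])
  qed
qed

end

end

text \<open>Hypothesis (i) with finite s: \<sigma> = q' is at most s because s' \<le> q, and it
  exceeds \<gamma> / (\<gamma> - \<alpha>) because q < \<gamma> / \<alpha>. Hypothesis (ii) with
  finite s: \<sigma> = s, and 1 / s < 1 / q1 = 1 / q - \<alpha> / \<gamma> < 1 - \<alpha> /
  \<gamma>. If s is infinite, then 1 / s = 0, both hypotheses take the form with \<theta> = 0, and
  \<sigma> = q' is available again.\<close>

lemma exponent_reduction:
  fixes s :: ennreal and W :: "real \<Rightarrow> real \<Rightarrow> ennreal" and \<phi> :: "real \<Rightarrow> real"
  assumes s: "1 < s" and \<alpha>: "0 < \<alpha>" "\<alpha> < \<gamma>" and q: "1 < q" "q < \<gamma> / \<alpha>" and q1: "1 < q1" "1 / q1 = 1 / q - \<alpha> / \<gamma>"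
    and \<phi>: "\<And>r. 0 < r \<Longrightarrow> 0 < \<phi> r"
    and cond: "(conj_exponent s \<le> q \<and> (\<exists>C. \<forall>r>0. W 0 r \<le> ennreal (C * \<phi> r))) \<or>
      (ennreal q1 < s \<and> (\<exists>C. \<forall>r>0. W (enn2real (1 / s)) r \<le> ennreal (C * \<phi> r * r powr (\<gamma> * enn2real (1 / s)))))"
  shows "\<exists>\<sigma> \<theta> C. 0 < \<sigma> \<and> ennreal \<sigma> \<le> s \<and> \<gamma> / (\<gamma> - \<alpha>) < \<sigma> \<and> ((\<theta> = 0 \<and> 1 / \<sigma> + 1 / q = 1) \<or> \<theta> = 1 / \<sigma>) \<and>
    0 < C \<and> (\<forall>r>0. W \<theta> r \<le> ennreal (C * \<phi> r * r powr (\<gamma> * \<theta>)))"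
proof -
  \<comment> \<open>The constants in the hypotheses carry no sign; they are enlarged to positive
    ones.\<close>
  have pos: "\<exists>C'>0. \<forall>r>0. W \<theta> r \<le> ennreal (C' * \<phi> r * r powr (\<gamma> * \<theta>))"
    if "\<And>r. 0 < r \<Longrightarrow> W \<theta> r \<le> ennreal (C * \<phi> r * r powr (\<gamma> * \<theta>))" for \<theta> C
  proof (intro exI[of _ "max C 1"] conjI allI impI)
    fix r :: real assume r: "0 < r"
    have "C * \<phi> r * r powr (\<gamma> * \<theta>) \<le> max C 1 * \<phi> r * r powr (\<gamma> * \<theta>)"
      using \<phi>[OF r] by (intro mult_right_mono) auto
    then show "W \<theta> r \<le> ennreal (max C 1 * \<phi> r * r powr (\<gamma> * \<theta>))" using that[OF r] by (meson ennreal_leI order_trans)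
  qed simp
  define \<sigma> where "\<sigma> = q / (q - 1)"
  have \<sigma>: "1 < \<sigma>" "1 / \<sigma> + 1 / q = 1" using q by (auto simp: \<sigma>_def field_simps)
  have \<sigma>_gt: "\<gamma> / (\<gamma> - \<alpha>) < \<sigma>"
  proof -
    have "q * \<alpha> < \<gamma>" using q \<alpha> by (simp add: field_simps)
    then show ?thesis using q \<alpha> by (simp add: \<sigma>_def field_simps)
  qed
  have first: ?thesis if "ennreal \<sigma> \<le> s" and C: "\<And>r. 0 < r \<Longrightarrow> W 0 r \<le> ennreal (C * \<phi> r)" for C
  proof -
    have "\<And>r. 0 < r \<Longrightarrow> W 0 r \<le> ennreal (C * \<phi> r * r powr (\<gamma> * 0))" using C by simp
    then obtain C' where "0 < C'" "\<forall>r>0. W 0 r \<le> ennreal (C' * \<phi> r * r powr (\<gamma> * 0))" using pos by blast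
    then show ?thesis using \<sigma> \<sigma>_gt that(1) by (intro exI[of _ \<sigma>] exI[of _ 0] exI[of _ C']) auto
  qed
  show ?thesis
  proof (cases "s = \<infinity>")
    case True
    have "\<exists>C. \<forall>r>0. W 0 r \<le> ennreal (C * \<phi> r)"
    proof -
      have "\<exists>C. \<forall>r>0. W 0 r \<le> ennreal (C * \<phi> r * r powr 0)"
        if "\<exists>C. \<forall>r>0. W (enn2real (1 / s)) r \<le> ennreal (C * \<phi> r * r powr (\<gamma> * enn2real (1 / s)))"
        using that True by simp
      then show ?thesis using cond by (metis mult_1_right powr_zero_eq_one less_irrefl)
    qed
    then obtain C where "\<And>r. 0 < r \<Longrightarrow> W 0 r \<le> ennreal (C * \<phi> r)" by blast
    moreover have "ennreal \<sigma> \<le> s" using True by simp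
    ultimately show ?thesis using first by blast
  next
    case False
    then obtain \<tau> where \<tau>: "s = ennreal \<tau>" "0 \<le> \<tau>" by (cases s) auto
    then have \<tau>1: "1 < \<tau>" using s by (metis ennreal_1 ennreal_less_iff zero_le_one)
    from cond show ?thesis
    proof (elim disjE conjE exE)
      fix C assume c: "conj_exponent s \<le> q" and C: "\<forall>r>0. W 0 r \<le> ennreal (C * \<phi> r)"
      have "\<tau> / (\<tau> - 1) \<le> q" using c \<tau> by (simp add: conj_exponent_def)
      then have "\<sigma> \<le> \<tau>" using \<tau>1 q by (simp add: \<sigma>_def field_simps)
      then have "ennreal \<sigma> \<le> s" by (simp add: \<tau>(1) ennreal_leI)
      then show ?thesis using first C by blast
    next
      fix C assume c: "ennreal q1 < s" and C: "\<forall>r>0. W (enn2real (1 / s)) r \<le> ennreal (C * \<phi> r * r powr (\<gamma> * enn2real (1 / s)))"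
      have e: "enn2real (1 / s) = 1 / \<tau>" using \<tau> \<tau>1 divide_ennreal[of 1 \<tau>] by simp
      have "q1 < \<tau>" using c \<tau> q1 by (simp add: ennreal_less_iff)
      then have "1 / \<tau> < 1 / q1" using q1 by (intro divide_strict_left_mono) auto
      moreover have "1 / q < 1" using q by simp
      ultimately have "1 / \<tau> < 1 - \<alpha> / \<gamma>" using q1(2) by linarith
      then have "\<gamma> / (\<gamma> - \<alpha>) < \<tau>" using \<tau>1 \<alpha> by (simp add: field_simps)
      moreover obtain C' where "0 < C'" "\<forall>r>0. W (1 / \<tau>) r \<le> ennreal (C' * \<phi> r * r powr (\<gamma> * (1 / \<tau>)))"
        using pos[of "1 / \<tau>" C] C unfolding e by blast
      ultimately show ?thesis using \<tau> \<tau>1 by (intro exI[of _ \<tau>] exI[of _ "1 / \<tau>"] exI[of _ C']) auto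
    qed
  qed
qed

theorem theorem2:
  fixes P :: "real^'n^'n"
    and \<rho> \<Omega> :: "real^'n \<Rightarrow> real"
    and T :: "(real^'n \<Rightarrow> real) \<Rightarrow> real^'n \<Rightarrow> real"
    and x0 :: "real^'n"
    and s :: ennreal
    and \<alpha> \<gamma> q q1 p :: real
    and m :: nat
    and ps lam :: "nat \<Rightarrow> real"
    and \<phi>1 \<phi>2 :: "real^'n \<Rightarrow> real \<Rightarrow> real"
  assumes n: "CARD('n) \<ge> 2"
    and P: "eigenvalues_pos_Re P"
    and \<gamma>: "\<gamma> = trace P"
    and \<rho>: "parabolic_quasi_distance P \<rho>"
    and s: "1 < s"
    and \<Omega>_meas: "\<Omega> \<in> borel_measurable lebesgue"
    and \<Omega>_Ls: "in_Lp (completion sphere_measure) s \<Omega>"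
    and \<Omega>_hom: "\<And>t x. t > 0 \<Longrightarrow> \<Omega> (dilation P t x) = \<Omega> x"
    and \<alpha>: "0 < \<alpha>" "\<alpha> < \<gamma>"
    and T_linear: "linear_operator T"
    and T_size: "size_condition P \<rho> \<Omega> \<alpha> T"
    and m: "1 \<le> m"
    and q: "1 < q" "q < \<gamma> / \<alpha>"
    and q1: "1 < q1" "q1 < \<gamma> / \<alpha>"
    and p: "1 < p" "p < \<gamma> / \<alpha>"
    and ps: "\<And>i. i \<in> {1..m} \<Longrightarrow> 1 < ps i \<and> ps i < \<gamma> / \<alpha>"
    and q_eq: "1 / q = (\<Sum>i\<in>{1..m}. 1 / ps i) + 1 / p"
    and q1_eq: "1 / q1 = 1 / q - \<alpha> / \<gamma>"
    and lam: "\<And>i. i \<in> {1..m} \<Longrightarrow> 0 \<le> lam i \<and> lam i < 1 / \<gamma>"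
    and \<phi>1: "positive_weight \<phi>1"
    and \<phi>2: "positive_weight \<phi>2"
    and cond:
      "(conj_exponent s \<le> q \<and>
         (\<exists>C. \<forall>r>0. weight_integral P x0 m p \<phi>1
             (\<gamma> * (1 / q1 - ((\<Sum>i\<in>{1..m}. lam i) + (\<Sum>i\<in>{1..m}. 1 / ps i))) + 1) r
           \<le> ennreal (C * \<phi>2 x0 r)))
       \<or>
       (ennreal q1 < s \<and>
         (\<exists>C. \<forall>r>0. weight_integral P x0 m p \<phi>1
             (\<gamma> * (1 / q1 - (enn2real (1 / s) + (\<Sum>i\<in>{1..m}. lam i) + (\<Sum>i\<in>{1..m}. 1 / ps i))) + 1) r
           \<le> ennreal (C * \<phi>2 x0 r * r powr (\<gamma> * enn2real (1 / s)))))"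
  shows "\<exists>C>0. \<forall>b f.
      (\<forall>i\<in>{1..m}. b i \<in> LC \<rho> x0 (ps i) (lam i)) \<longrightarrow> f \<in> LM \<rho> x0 p \<phi>1 \<longrightarrow>
        (AE x in lebesgue. integrable lebesgue (commutator_integrand P \<rho> \<Omega> \<alpha> m b f x)) \<and>
        commutator P \<rho> \<Omega> \<alpha> m b f \<in> LM \<rho> x0 q1 \<phi>2 \<and>
        LM_norm \<rho> x0 q1 \<phi>2 (commutator P \<rho> \<Omega> \<alpha> m b f)
          \<le> ennreal C * (\<Prod>i\<in>{1..m}. LC_norm \<rho> x0 (ps i) (lam i) (b i)) * LM_norm \<rho> x0 p \<phi>1 f \<and>
        (AE x in lebesgue. maximal_commutator P \<rho> \<Omega> \<alpha> m b f x < \<infinity>) \<and>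
        (\<lambda>x. enn2real (maximal_commutator P \<rho> \<Omega> \<alpha> m b f x)) \<in> LM \<rho> x0 q1 \<phi>2 \<and>
        LM_norm \<rho> x0 q1 \<phi>2 (\<lambda>x. enn2real (maximal_commutator P \<rho> \<Omega> \<alpha> m b f x))
          \<le> ennreal C * (\<Prod>i\<in>{1..m}. LC_norm \<rho> x0 (ps i) (lam i) (b i)) * LM_norm \<rho> x0 p \<phi>1 f"
proof -
  have tr: "0 < trace P" using \<alpha> \<gamma> by simp
  have p\<phi>1: "0 < \<phi>1 x0 r" and p\<phi>2: "0 < \<phi>2 x0 r" if "0 < r" for r
    using \<phi>1 \<phi>2 that by (auto simp: positive_weight_def)
  let ?W = "\<lambda>\<theta>. weight_integral P x0 m p \<phi>1 (\<gamma> * (1 / q1 - (\<theta> + (\<Sum>i\<in>{1..m}. lam i) + (\<Sum>i\<in>{1..m}. 1 / ps i))) + 1)"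
  have "\<exists>\<sigma> \<theta> C. 0 < \<sigma> \<and> ennreal \<sigma> \<le> s \<and> \<gamma> / (\<gamma> - \<alpha>) < \<sigma> \<and> ((\<theta> = 0 \<and> 1 / \<sigma> + 1 / q = 1) \<or> \<theta> = 1 / \<sigma>) \<and>
    0 < C \<and> (\<forall>r>0. ?W \<theta> r \<le> ennreal (C * \<phi>2 x0 r * r powr (\<gamma> * \<theta>)))"
    by (rule exponent_reduction[OF s \<alpha> q q1(1) q1_eq p\<phi>2]) (use cond in simp_all)
  then obtain \<sigma> \<theta> Cw where \<sigma>: "0 < \<sigma>" "ennreal \<sigma> \<le> s" "\<gamma> / (\<gamma> - \<alpha>) < \<sigma>" "(\<theta> = 0 \<and> 1 / \<sigma> + 1 / q = 1) \<or> \<theta> = 1 / \<sigma>"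
    and Cw: "0 < Cw" "\<And>r. 0 < r \<Longrightarrow> ?W \<theta> r \<le> ennreal (Cw * \<phi>2 x0 r * r powr (\<gamma> * \<theta>))" by blast
  have fin: "(\<integral>\<^sup>+x. ennreal (\<bar>\<Omega> x\<bar> powr \<sigma>) \<partial>completion sphere_measure) < \<infinity>"
  proof (rule in_Lp_exponent_mono[OF \<Omega>_Ls _ \<sigma>(1,2)])
    show "finite_measure (completion (sphere_measure :: (real^'n) measure))"
      using finite_measure.emeasure_finite[OF finite_measure_sphere_measure, of "space sphere_measure"]
      by (intro finite_measureI) simp
  qed
  obtain \<Omega>1 where \<Omega>1[measurable]: "\<Omega>1 \<in> borel_measurable borel" and ae\<Omega>: "AE x in lborel. \<Omega> x = \<Omega>1 x"
    using completion_ex_borel_measurable_real[OF \<Omega>_meas] by auto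
  have "\<Omega> \<in> borel_measurable (completion sphere_measure)" using \<Omega>_Ls by (simp add: in_Lp_def)
  from homogeneous_Ls_growth[OF \<rho> tr \<Omega>_meas \<Omega>_hom \<sigma>(1) this fin \<Omega>1 ae\<Omega>]
  obtain A where A: "0 \<le> A" "\<And>t. 0 < t \<Longrightarrow> (\<integral>\<^sup>+x. ennreal (\<bar>\<Omega>1 x\<bar> powr \<sigma>) * indicator {x. \<rho> x < t} x \<partial>lborel) \<le> ennreal (A * t powr trace P)"
    by blast
  obtain k \<upsilon> where hq: "homogeneous_quasi_norm \<rho> k (trace P) \<upsilon>" using homogeneous_quasi_norm_rho[OF \<rho> tr] by blast
  \<comment> \<open>The locale is entered with the finite exponent \<open>\<sigma>\<close> in place
    of s, and with the absolute value of the Borel version, whose growth has just been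
    established.\<close>
  interpret R: rough_fractional \<rho> k \<gamma> \<upsilon> "\<lambda>x. \<bar>\<Omega>1 x\<bar>" \<sigma> A \<alpha>
  proof -
    have "homogeneous_quasi_norm \<rho> k \<gamma> \<upsilon>" using hq by (simp add: \<gamma>)
    then show "rough_fractional \<rho> k \<gamma> \<upsilon> (\<lambda>x. \<bar>\<Omega>1 x\<bar>) \<sigma> A \<alpha>"
      using A \<alpha> \<sigma>(3) by (intro rough_fractional.intro rough_fractional_axioms.intro) (simp_all add: \<gamma>)
  qed
  define Q where "Q C \<longleftrightarrow> (\<forall>b f c N L. (\<forall>i\<in>{1..m}. b i \<in> borel_measurable borel) \<longrightarrow> f \<in> borel_measurable borel \<longrightarrow> (\<forall>y. 0 \<le> f y) \<longrightarrow>
     (\<forall>i\<in>{1..m}. 0 \<le> N i) \<longrightarrow> 0 \<le> L \<longrightarrow>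
     (\<forall>i\<in>{1..m}. \<forall>t>0. enn_Lp_norm (ps i) lborel (\<lambda>y. ennreal \<bar>b i y - c i t\<bar> * indicator (ellipsoid \<rho> x0 t) y) \<le> ennreal (N i * (\<upsilon> * t powr \<gamma>) powr (1 / ps i + lam i))) \<longrightarrow>
     (\<forall>t>0. enn_Lp_norm p lborel (\<lambda>y. ennreal (f y) * indicator (ellipsoid \<rho> x0 t) y) \<le> ennreal (L * \<phi>1 x0 t * (\<upsilon> * t powr \<gamma>) powr (1 / p))) \<longrightarrow>
     (\<forall>r>0. enn_Lp_norm q1 lborel (\<lambda>x. R.abs_commutator {1..m} b f x * indicator (ellipsoid \<rho> x0 r) x)
        \<le> ennreal (C * (\<Prod>i\<in>{1..m}. N i) * L * \<phi>2 x0 r * (\<upsilon> * r powr \<gamma>) powr (1 / q1))))" for C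
  have "\<exists>C>0. Q C"
    unfolding Q_def
  proof (rule R.local_Morrey_estimate[where ?\<phi>1.0="\<phi>1 x0" and ?\<phi>2.0="\<phi>2 x0" and \<theta>=\<theta> and Cw=Cw and q=q and I="{1..m}" and ps=ps and lam=lam and p=p and ?q1.0=q1 and ?x0.0=x0])
    fix r :: real assume "0 < r"
    from Cw(2)[OF this] show "(\<integral>\<^sup>+t\<in>{r<..}. ennreal ((1 + ln (t / r)) ^ card {1..m}) *
        (ess_inf (lebesgue_on {t<..}) (\<lambda>\<tau>. ennreal (\<phi>1 x0 \<tau> * \<tau> powr (\<gamma> / p))) /
          ennreal (t powr (\<gamma> * (1 / q1 - (\<theta> + (\<Sum>i\<in>{1..m}. lam i) + (\<Sum>i\<in>{1..m}. 1 / ps i))) + 1))) \<partial>lebesgue)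
        \<le> ennreal (Cw * \<phi>2 x0 r * r powr (\<gamma> * \<theta>))"
      by (simp only: weight_integral_def \<gamma>[symmetric] card_atLeastAtMost diff_Suc_1 Suc_eq_plus1 add_diff_cancel_right')
  qed (use ps lam p q q1 q_eq q1_eq \<sigma> Cw p\<phi>1 p\<phi>2 in auto)
  then obtain C1 where C1: "0 < C1" "Q C1" by blast
  define V where "V = \<upsilon> powr (- 1 + \<alpha> / \<gamma>)"
  have V: "0 \<le> V" by (simp add: V_def)
  show ?thesis
  \<comment> \<open>One constant for both operators: the 1 serves the commutator, and V the maximal
    operator, which is at most V times the dominating function.\<close>
  proof (intro exI[of _ "C1 * (1 + V)"] conjI[of "0 < C1 * (1 + V)"] allI impI)
    show "0 < C1 * (1 + V)" using C1 V by (simp add: add_pos_nonneg)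
    fix b :: "nat \<Rightarrow> real^'n \<Rightarrow> real" and f :: "real^'n \<Rightarrow> real"
    assume b: "\<forall>i\<in>{1..m}. b i \<in> LC \<rho> x0 (ps i) (lam i)" and f: "f \<in> LM \<rho> x0 p \<phi>1"
    have "\<forall>i\<in>{1..m}. \<exists>g\<in>borel_measurable borel. AE x in lborel. b i x = g x"
    proof
      fix i assume "i \<in> {1..m}"
      then have "b i \<in> borel_measurable lebesgue" using b by (auto simp: LC_def Lp_loc_def)
      then show "\<exists>g\<in>borel_measurable borel. AE x in lborel. b i x = g x" using completion_ex_borel_measurable_real by force
    qed
    then obtain b0 where b0: "\<And>i. i \<in> {1..m} \<Longrightarrow> b0 i \<in> borel_measurable borel" "\<And>i. i \<in> {1..m} \<Longrightarrow> AE x in lborel. b i x = b0 i x"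
      by metis
    have "f \<in> borel_measurable lebesgue" using f by (simp add: LM_def Lp_loc_def)
    then obtain f1 where f1[measurable]: "f1 \<in> borel_measurable borel" and aef: "AE x in lborel. f x = f1 x"
      using completion_ex_borel_measurable_real by force
    \<comment> \<open>Membership in the two kinds of spaces makes the norms finite, so
      \<open>enn2real\<close> loses nothing.\<close>
    define N where "N i = enn2real (LC_norm \<rho> x0 (ps i) (lam i) (b i))" for i
    define L where "L = enn2real (LM_norm \<rho> x0 p \<phi>1 f)"
    define B where "B = C1 * (\<Prod>i\<in>{1..m}. N i) * L"
    have B: "0 \<le> B" using C1 by (simp add: B_def N_def L_def prod_nonneg)
    have rhs: "ennreal (C1 * (1 + V)) * (\<Prod>i\<in>{1..m}. LC_norm \<rho> x0 (ps i) (lam i) (b i)) * LM_norm \<rho> x0 p \<phi>1 f = ennreal ((1 + V) * B)"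
    proof -
      have "(\<Prod>i\<in>{1..m}. LC_norm \<rho> x0 (ps i) (lam i) (b i)) = (\<Prod>i\<in>{1..m}. ennreal (N i))"
        using b by (intro prod.cong) (auto simp: N_def LC_def)
      also have "\<dots> = ennreal (\<Prod>i\<in>{1..m}. N i)" by (intro prod_ennreal) (simp add: N_def)
      finally have 1: "(\<Prod>i\<in>{1..m}. LC_norm \<rho> x0 (ps i) (lam i) (b i)) = ennreal (\<Prod>i\<in>{1..m}. N i)" .
      have 2: "LM_norm \<rho> x0 p \<phi>1 f = ennreal L" using f by (simp add: L_def LM_def)
      have "(1 + V) * B = C1 * (1 + V) * (\<Prod>i\<in>{1..m}. N i) * L" by (simp add: B_def mult_ac)
      moreover have "ennreal (C1 * (1 + V) * (\<Prod>i\<in>{1..m}. N i) * L) = ennreal (C1 * (1 + V)) * ennreal (\<Prod>i\<in>{1..m}. N i) * ennreal L"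
        using C1 V by (subst ennreal_mult) (auto simp: N_def L_def prod_nonneg ennreal_mult)
      ultimately show ?thesis unfolding 1 2 by (simp only:)
    qed
    define G where "G = R.abs_commutator {1..m} b0 (\<lambda>y. \<bar>f1 y\<bar>)"
    have [measurable]: "G \<in> borel_measurable borel" unfolding G_def by (intro R.measurable_abs_commutator b0) measurable
    have Gnorm: "enn_Lp_norm q1 lborel (\<lambda>x. G x * indicator (ellipsoid \<rho> x0 r) x) \<le> ennreal (B * \<phi>2 x0 r * (\<upsilon> * r powr \<gamma>) powr (1 / q1))" if r: "0 < r" for r
      unfolding G_def B_def
    proof (rule C1(2)[unfolded Q_def, rule_format, where c="\<lambda>i t. average (ellipsoid \<rho> x0 t) (b i)"])
      fix t :: real assume t: "0 < t"
      show "enn_Lp_norm p lborel (\<lambda>y. ennreal \<bar>f1 y\<bar> * indicator (ellipsoid \<rho> x0 t) y) \<le> ennreal (L * \<phi>1 x0 t * (\<upsilon> * t powr \<gamma>) powr (1 / p))"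
        unfolding L_def by (rule R.LM_estimate[OF f aef p(1) t p\<phi>1[OF t]])
      show "enn_Lp_norm (ps i) lborel (\<lambda>y. ennreal \<bar>b0 i y - average (ellipsoid \<rho> x0 t) (b i)\<bar> * indicator (ellipsoid \<rho> x0 t) y) \<le> ennreal (N i * (\<upsilon> * t powr \<gamma>) powr (1 / ps i + lam i))"
        if i: "i \<in> {1..m}" for i
        unfolding N_def using b i ps[OF i] t by (intro R.LC_estimate b0(2)) auto
    qed (use r b0(1) in \<open>auto simp: N_def L_def\<close>)
    \<comment> \<open>Finiteness of G almost everywhere yields the existence of the commutator
      integral and makes \<open>enn2real\<close> faithful on the maximal function.\<close>
    have Gfin: "AE x in lborel. G x < top"
    proof (rule R.AE_finite_of_local_norm[of G q1 x0])
      fix r :: real assume "0 < r"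
      from Gnorm[OF this] show "enn_Lp_norm q1 lborel (\<lambda>x. G x * indicator (ellipsoid \<rho> x0 r) x) < top"
        by (rule le_less_trans) simp
    qed (use q1 in simp_all)
    note ctx = \<gamma> \<Omega>1 refl ae\<Omega> b0 f1 aef
    have aec: "AE x in lborel. AE y in lborel. commutator_integrand P \<rho> \<Omega> \<alpha> m b f x y = (\<Prod>i\<in>{1..m}. b0 i x - b0 i y) * (\<Omega>1 (x - y) / \<rho> (x - y) powr (\<gamma> - \<alpha>)) * f1 y"
      by (rule R.AE_commutator_integrand[OF ctx])
    have c1: "AE x in lborel. integrable lebesgue (commutator_integrand P \<rho> \<Omega> \<alpha> m b f x)"
      using aec Gfin
    proof eventually_elim
      case (elim x)
      have "R.abs_commutator {1..m} b0 (\<lambda>y. \<bar>f1 y\<bar>) x < \<infinity>" using elim(2) unfolding G_def infinity_ennreal_def .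
      then show ?case by - (rule R.commutator_eq(2)[OF ctx elim(1)])
    qed
    have c2: "AE x in lborel. ennreal \<bar>commutator P \<rho> \<Omega> \<alpha> m b f x\<bar> \<le> G x"
      using aec Gfin
    proof eventually_elim
      case (elim x)
      have "R.abs_commutator {1..m} b0 (\<lambda>y. \<bar>f1 y\<bar>) x < \<infinity>" using elim(2) unfolding G_def infinity_ennreal_def .
      then show ?case unfolding G_def by - (rule R.commutator_eq(3)[OF ctx elim(1)])
    qed
    have c3: "commutator P \<rho> \<Omega> \<alpha> m b f \<in> borel_measurable lebesgue" by (rule R.measurable_commutator[OF ctx])
    note comm = R.LM_norm_leI[where \<phi>=\<phi>2, OF c3 c2 q1(1) B p\<phi>2 Gnorm]
    define M where "M = R.abs_maximal {1..m} b0 (\<lambda>y. \<bar>f1 y\<bar>)"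
    have Mm: "M \<in> borel_measurable borel" unfolding M_def by (intro R.measurable_abs_maximal b0) measurable
    have aem: "AE x in lborel. maximal_commutator P \<rho> \<Omega> \<alpha> m b f x = M x"
      unfolding M_def by (rule R.AE_maximal_commutator[OF ctx])
    have MG: "M x \<le> ennreal V * G x" for x
      unfolding M_def G_def V_def by (intro R.abs_maximal_le b0) auto
    have m1: "AE x in lborel. maximal_commutator P \<rho> \<Omega> \<alpha> m b f x < \<infinity> \<and> ennreal \<bar>enn2real (maximal_commutator P \<rho> \<Omega> \<alpha> m b f x)\<bar> \<le> ennreal V * G x"
      using aem Gfin
    proof eventually_elim
      case (elim x)
      have "M x \<le> ennreal V * G x" by (rule MG)
      moreover have "ennreal V * G x < top" using elim(2) by (simp add: ennreal_mult_less_top)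
      ultimately have "M x < top" by (rule le_less_trans)
      then show ?case using MG[of x] elim(1) by simp
    qed
    have m2: "(\<lambda>x. enn2real (maximal_commutator P \<rho> \<Omega> \<alpha> m b f x)) \<in> borel_measurable lebesgue"
    proof (rule borel_measurable_lebesgue_AE)
      show "(\<lambda>x. enn2real (M x)) \<in> borel_measurable lebesgue" using Mm by (intro measurable_completion) measurable
      show "AE x in lebesgue. enn2real (maximal_commutator P \<rho> \<Omega> \<alpha> m b f x) = enn2real (M x)"
        by (rule AE_completion) (use aem in \<open>auto elim!: eventually_mono\<close>)
    qed
    have m3: "AE x in lborel. ennreal \<bar>enn2real (maximal_commutator P \<rho> \<Omega> \<alpha> m b f x)\<bar> \<le> ennreal V * G x"
      using m1 by eventually_elim blast
    have Mnorm: "enn_Lp_norm q1 lborel (\<lambda>x. ennreal V * G x * indicator (ellipsoid \<rho> x0 r) x) \<le> ennreal (V * B * \<phi>2 x0 r * (\<upsilon> * r powr \<gamma>) powr (1 / q1))" if r: "0 < r" for r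
    proof -
      have "enn_Lp_norm q1 lborel (\<lambda>x. ennreal V * G x * indicator (ellipsoid \<rho> x0 r) x) = ennreal V * enn_Lp_norm q1 lborel (\<lambda>x. G x * indicator (ellipsoid \<rho> x0 r) x)"
        unfolding mult.assoc using q1 by (intro enn_Lp_norm_cmult) auto
      also have "\<dots> \<le> ennreal V * ennreal (B * \<phi>2 x0 r * (\<upsilon> * r powr \<gamma>) powr (1 / q1))" by (intro mult_left_mono Gnorm r) simp
      also have "\<dots> = ennreal (V * B * \<phi>2 x0 r * (\<upsilon> * r powr \<gamma>) powr (1 / q1))"
        using V B p\<phi>2[OF r] by (simp add: mult.assoc flip: ennreal_mult)
      finally show ?thesis .
    qed
    have VB: "0 \<le> V * B" using V B by simp
    note maxi = R.LM_norm_leI[where \<phi>=\<phi>2, OF m2 m3 q1(1) VB p\<phi>2 Mnorm]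
    have le: "ennreal B \<le> ennreal ((1 + V) * B)" "ennreal (V * B) \<le> ennreal ((1 + V) * B)"
      using V B by (auto intro!: ennreal_leI simp: distrib_right)
    show "(AE x in lebesgue. integrable lebesgue (commutator_integrand P \<rho> \<Omega> \<alpha> m b f x)) \<and>
        commutator P \<rho> \<Omega> \<alpha> m b f \<in> LM \<rho> x0 q1 \<phi>2 \<and>
        LM_norm \<rho> x0 q1 \<phi>2 (commutator P \<rho> \<Omega> \<alpha> m b f)
          \<le> ennreal (C1 * (1 + V)) * (\<Prod>i\<in>{1..m}. LC_norm \<rho> x0 (ps i) (lam i) (b i)) * LM_norm \<rho> x0 p \<phi>1 f \<and>
        (AE x in lebesgue. maximal_commutator P \<rho> \<Omega> \<alpha> m b f x < \<infinity>) \<and>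
        (\<lambda>x. enn2real (maximal_commutator P \<rho> \<Omega> \<alpha> m b f x)) \<in> LM \<rho> x0 q1 \<phi>2 \<and>
        LM_norm \<rho> x0 q1 \<phi>2 (\<lambda>x. enn2real (maximal_commutator P \<rho> \<Omega> \<alpha> m b f x))
          \<le> ennreal (C1 * (1 + V)) * (\<Prod>i\<in>{1..m}. LC_norm \<rho> x0 (ps i) (lam i) (b i)) * LM_norm \<rho> x0 p \<phi>1 f"
    proof (intro conjI)
      show "AE x in lebesgue. maximal_commutator P \<rho> \<Omega> \<alpha> m b f x < \<infinity>"
        by (rule AE_completion) (use m1 in \<open>auto elim!: eventually_mono\<close>)
    qed (use AE_completion[OF c1] comm maxi order_trans[OF comm(2) le(1)] order_trans[OF maxi(2) le(2)] in \<open>simp_all only: rhs\<close>)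
  qed
qed

end
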